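(* Let $\mu>0$, $\tau_s\ge 0$, $\varepsilon>0$, $\mathbf f\in \mathbf H^{-1}(\Omega)$, and let $G:\mathbf V_h\to\mathbf V_h$ be the Picard solution operator for the regularized Bingham equations defined in the context. Put $F(\mathbf u):=G(\mathbf u)-\mathbf u$ and equip $\mathbf V_h$ with the norm $\|\mathbf v\|_Y:=\|D\mathbf v\|$. Let $(x_k)_{k\ge 0}$, $(w_k)_{k\ge1}$ be generated by the Anderson acceleration algorithm of the context, with depth $m$ and damping factors $0<\beta_k\le 1$, applied to $g=G$ on $Y=\mathbf V_h$; let $F_k$ and $\theta_k$ be the associated residual-difference matrices and optimization gains. Suppose: (i) there is a constant $\sigma>0$ such that $\|F(\mathbf u)-F(\mathbf s)\|_Y\ge \sigma\|\mathbf u-\mathbf s\|_Y$ for all $\mathbf u,\mathbf s\in\mathbf V_h$; (ii) there is $c_s>0$ such that, for each step $k>m$, the direction sines between each column $f_{j,i}$ of $F_j$ and the subspace spanned by the preceding columns satisfy $|\sin(f_{j,i},\operatorname{span}\{f_{j,1},\dots,f_{j,i-1}\})|\ge c_s$ for $j=k-m_k,\dots,k-1$. Then there are a positive constant $C_*$ independent of $h$, a constant $C$ (depending on $c_s$ and the implied upper bound on the direction cosines), and numbers $h(\theta_j)$ with $h(\theta_j)\le C\sqrt{1-\theta_j^2}+\beta_j\theta_j$, such that, with $$C_G=\Big(\tfrac{\tau_s\varepsilon^{-3}C_*(1+|\ln h|)h^{-2}\mu^{-3}\|\mathbf f\|_{-1}^2}{8}\Big)^{1/2},\qquad \hat C_G=C_*\mu^{-1}\tau_s\varepsilon^{-2}(1+|\ln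 h|)^{1/2}h^{-1}\Big(C_G+\varepsilon^{-1}(1+|\ln h|)^{1/2}h^{-1}\mu^{-1}\|\mathbf f\|_{-1}\Big)$$ if $d=2$, and $$C_G=\Big(\tfrac{\tau_s\varepsilon^{-3}C_*h^{-3}\mu^{-3}\|\mathbf f\|_{-1}^2}{8}\Big)^{1/2},\qquad \hat C_G=C_*\mu^{-1}\tau_s\varepsilon^{-2}h^{-3/2}\Big(C_G+\varepsilon^{-1}h^{-3/2}\mu^{-1}\|\mathbf f\|_{-1}\Big)$$ if $d=3$, for any step $k>m$ the residual satisfies $$\|w_{k+1}\|_Y\le\|w_k\|_Y\Bigg(\theta_k(1-\beta_k+C_G\beta_k)+\frac{C\hat C_G\sqrt{1-\theta_k^2}}{2}\bigg(\|w_k\|_Y h(\theta_k)+2\sum_{n=k-m_k+1}^{k-1}(k-n)\|w_n\|_Y h(\theta_n)+m_k\|w_{k-m_k}\|_Y h(\theta_{k-m_k})\bigg)\Bigg).$$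
   Context: **Spaces.** $\Omega\subset\mathbb R^d$, $d\in\{2,3\}$, is a bounded connected polygonal/polyhedral (or Lipschitz) domain; $\|\cdot\|$, $(\cdot,\cdot)$ are the $L^2(\Omega)$ norm and inner product (or duality pairing for $\mathbf f$). $D\mathbf v=\frac12(\nabla\mathbf v+\nabla\mathbf v^T)$, $|D\mathbf v|_\varepsilon=\sqrt{D\mathbf v:D\mathbf v+\varepsilon^2}$. $\mathbf X=H_0^1(\Omega)^d$, $Q=L^2_0(\Omega)$. For a regular conforming triangulation $\tau_h$ of $\Omega$ with maximum element diameter $h$ (from a family of such, quasi-uniform for $d=3$, for which the inverse inequality $\|\nabla\mathbf v_h\|\le Ch^{-1}\|\mathbf v_h\|$ holds on $\mathbf X_h$ with $C$ independent of $h$), $\mathbf X_h=\mathbf X\cap P_s(\tau_h)$ and $Q_h=Q\cap P_r(\tau_h)$ are piecewise polynomial spaces satisfying the discrete inf-sup (LBB) condition with constant independent of $h$, and $\mathbf V_h=\{\mathbf v_h\in\mathbf X_h:(\nabla\cdot\mathbf v_h,q_h)=0\ \forall q_h\in Q_h\}$. $\|\mathbf f\|_{-1}$ is the dual norm on $\mathbf V_h$ with respect to $\|\nabla\cdot\|$. The discrete Sobolev inequalities $\|\mathbf v_h\|_{L^\infty}\le C(1+|\ln h|)^{1/2}\|\nabla\mathbf v_h\|$ ($d=2$) and $\|\mathbf v_h\|_{L^\infty}\le Ch^{-1/2}\|\nabla\mathbf v_h\|$ ($d=3$) hold on $\mathbf X_h$ with $C$ independent of $h$. **Picard operator.** For $\mathbf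 u\in\mathbf V_h$, $G(\mathbf u)=\tilde{\mathbf u}\in\mathbf V_h$ is the unique solution of $2\mu(D\tilde{\mathbf u},D\mathbf v)+\tau_s\big(\frac{D\tilde{\mathbf u}}{|D\mathbf u|_\varepsilon},D\mathbf v\big)=(\mathbf f,\mathbf v)$ for all $\mathbf v\in\mathbf V_h$. **Anderson acceleration (depth $m$) for $g:Y\to Y$.** Choose $x_0\in Y$; set $w_1=g(x_0)-x_0$, $x_1=x_0+w_1$ (so $\beta_1=1$). For $k=2,3,\dots$ set $m_k=\min\{k-1,m\}$ and: (a) $w_k=g(x_{k-1})-x_{k-1}$; (b) choose $\{\alpha_j^k\}_{j=k-m_k}^{k-1}$ minimizing $\big\|\big(1-\sum_j\alpha_j^k\big)w_k+\sum_j\alpha_j^kw_j\big\|_Y$, sums over $j=k-m_k,\dots,k-1$; (c) set $x_k=\big(1-\sum_j\alpha_j^k\big)x_{k-1}+\sum_j\alpha_j^kx_{j-1}+\beta_k\big(\big(1-\sum_j\alpha_j^k\big)w_k+\sum_j\alpha_j^kw_j\big)$. (For $k=1$, $m_1=0$.) Let $F_k=\big((w_k-w_{k-1})\ (w_{k-1}-w_{k-2})\ \cdots\ (w_{k-m_k+1}-w_{k-m_k})\big)$, with $i$-th column $f_{k,i}$. Let $w_k^\alpha=w_k-F_k\gamma^k$ with $\gamma^k\in\operatorname{argmin}_{\gamma\in\mathbb R^{m_k}}\|w_k-F_k\gamma\|_Y$ (the minimizing combination in (b)). The gain $\theta_k$ is defined by $\|w_k^\alpha\|_Y=\theta_k\|w_k\|_Y$.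 The sine between a vector $f\neq0$ and a subspace $S$ is that of the angle in the inner product $(D\cdot,D\cdot)$, i.e. $\operatorname{dist}_Y(f,S)/\|f\|_Y$. *)

theory Defs
  imports
    "HOL-Analysis.Analysis"
    "HOL-Probability.Essential_Supremum"
    "HOL-Library.Function_Algebras"
begin

section \<open>Functions as vectors\<close>

instantiation "fun" :: (type, scaleR) scaleR
begin

definition "c *\<^sub>R f = (\<lambda>x. c *\<^sub>R f x)"

instance ..

end

instance "fun" :: (type, real_vector) real_vector
  by standard (auto simp: scaleR_fun_def fun_eq_iff scaleR_add_left scaleR_add_right)

section \<open>Lebesgue and Sobolev spaces\<close>

text \<open>
  Elements of the Lebesgue and Sobolev spaces are represented by functions on the whole space;
  functions that agree almost everywhere on \<open>\<Omega>\<close> represent the same element.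
\<close>

definition L2 :: "'a::euclidean_space set \<Rightarrow> ('a \<Rightarrow> 'b::euclidean_space) set" where
  "L2 \<Omega> = {u. u \<in> borel_measurable (lebesgue_on \<Omega>) \<and>
               integrable (lebesgue_on \<Omega>) (\<lambda>x. (norm (u x))\<^sup>2)}"

text \<open>For matrix-valued fields the inner product of the type \<open>real^'n^'n\<close> is the Frobenius product.\<close>

definition L2_inner ::
  "'a::euclidean_space set \<Rightarrow> ('a \<Rightarrow> 'b::euclidean_space) \<Rightarrow> ('a \<Rightarrow> 'b) \<Rightarrow> real" where
  "L2_inner \<Omega> u v = integral\<^sup>L (lebesgue_on \<Omega>) (\<lambda>x. u x \<bullet> v x)"

definition L2_norm :: "'a::euclidean_space set \<Rightarrow> ('a \<Rightarrow> 'b::euclidean_space) \<Rightarrow> real" where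
  "L2_norm \<Omega> u = sqrt (L2_inner \<Omega> u u)"

text \<open>
  Differentiability of all iterated directional derivatives makes them all continuous, so
  \<open>smooth\<close> means infinitely often differentiable on the whole space.
\<close>

fun iter_deriv ::
  "'a list \<Rightarrow> ('a::euclidean_space \<Rightarrow> 'b::real_normed_vector) \<Rightarrow> 'a \<Rightarrow> 'b" where
  "iter_deriv [] f = f"
| "iter_deriv (a # as) f = (\<lambda>x. frechet_derivative (iter_deriv as f) (at x) a)"

definition smooth :: "('a::euclidean_space \<Rightarrow> 'b::real_normed_vector) \<Rightarrow> bool" where
  "smooth f \<longleftrightarrow> (\<forall>as x. iter_deriv as f differentiable (at x))"

definition test_functions ::
  "'a::euclidean_space set \<Rightarrow> ('a \<Rightarrow> 'b::real_normed_vector) set" where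
  "test_functions \<Omega> =
     {\<phi>. smooth \<phi> \<and> compact (closure {x. \<phi> x \<noteq> 0}) \<and> closure {x. \<phi> x \<noteq> 0} \<subseteq> \<Omega>}"

definition is_weak_grad ::
  "(real^'n) set \<Rightarrow> (real^'n \<Rightarrow> real^'n) \<Rightarrow> (real^'n \<Rightarrow> real^'n^'n) \<Rightarrow> bool" where
  "is_weak_grad \<Omega> v M \<longleftrightarrow> M \<in> L2 \<Omega> \<and>
     (\<forall>\<phi>\<in>test_functions \<Omega>. \<forall>i j.
        integral\<^sup>L (lebesgue_on \<Omega>)
          (\<lambda>x. v x $ i * frechet_derivative (\<phi> :: real^'n \<Rightarrow> real) (at x) (axis j 1)) =
        - integral\<^sup>L (lebesgue_on \<Omega>) (\<lambda>x. M x $ i $ j * \<phi> x))"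

text \<open>
  The weak gradient is determined only up to null sets; \<open>grad\<close> picks one representative.
  It is used only inside Lebesgue integrals over \<open>\<Omega>\<close>.
\<close>

definition grad :: "(real^'n) set \<Rightarrow> (real^'n \<Rightarrow> real^'n) \<Rightarrow> real^'n \<Rightarrow> real^'n^'n" where
  "grad \<Omega> v = (SOME M. is_weak_grad \<Omega> v M)"

definition divg :: "(real^'n) set \<Rightarrow> (real^'n \<Rightarrow> real^'n) \<Rightarrow> real^'n \<Rightarrow> real" where
  "divg \<Omega> v = (\<lambda>x. trace (grad \<Omega> v x))"

definition symgrad :: "(real^'n) set \<Rightarrow> (real^'n \<Rightarrow> real^'n) \<Rightarrow> real^'n \<Rightarrow> real^'n^'n" where
  "symgrad \<Omega> v = (\<lambda>x. (1/2) *\<^sub>R (grad \<Omega> v x + transpose (grad \<Omega> v x)))"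

definition H1 :: "(real^'n) set \<Rightarrow> (real^'n \<Rightarrow> real^'n) set" where
  "H1 \<Omega> = {v \<in> L2 \<Omega>. \<exists>M. is_weak_grad \<Omega> v M}"

definition H1_norm :: "(real^'n) set \<Rightarrow> (real^'n \<Rightarrow> real^'n) \<Rightarrow> real" where
  "H1_norm \<Omega> v = sqrt ((L2_norm \<Omega> v)\<^sup>2 + (L2_norm \<Omega> (grad \<Omega> v))\<^sup>2)"

definition H10 :: "(real^'n) set \<Rightarrow> (real^'n \<Rightarrow> real^'n) set" where
  "H10 \<Omega> = {v \<in> H1 \<Omega>. \<exists>\<Phi> :: nat \<Rightarrow> real^'n \<Rightarrow> real^'n.
      (\<forall>n. \<Phi> n \<in> test_functions \<Omega>) \<and> (\<lambda>n. H1_norm \<Omega> (\<Phi> n - v)) \<longlonglongrightarrow> 0}"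

definition L20 :: "(real^'n) set \<Rightarrow> (real^'n \<Rightarrow> real) set" where
  "L20 \<Omega> = {q \<in> L2 \<Omega>. integral\<^sup>L (lebesgue_on \<Omega>) q = 0}"

text \<open>
  \<open>H\<^sup>-\<^sup>1\<close>: continuous linear functionals on \<open>H10 \<Omega>\<close>, normed by \<open>\<parallel>\<nabla>v\<parallel>\<close>;
  \<open>f v\<close> is the duality pairing.
\<close>

definition Hminus1 :: "(real^'n) set \<Rightarrow> ((real^'n \<Rightarrow> real^'n) \<Rightarrow> real) \<Rightarrow> bool" where
  "Hminus1 \<Omega> f \<longleftrightarrow>
     (\<forall>u\<in>H10 \<Omega>. \<forall>v\<in>H10 \<Omega>. f (u + v) = f u + f v) \<and>
     (\<forall>c. \<forall>v\<in>H10 \<Omega>. f (c *\<^sub>R v) = c * f v) \<and>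
     (\<exists>M. \<forall>v\<in>H10 \<Omega>. \<bar>f v\<bar> \<le> M * L2_norm \<Omega> (grad \<Omega> v))"

section \<open>Domains, meshes and finite element spaces\<close>

text \<open>The condition \<open>interior (closure \<Omega>) = \<Omega>\<close> excludes slits and punctures.\<close>

definition polyhedral_domain :: "'a::euclidean_space set \<Rightarrow> bool" where
  "polyhedral_domain \<Omega> \<longleftrightarrow> \<Omega> \<noteq> {} \<and> open \<Omega> \<and> connected \<Omega> \<and> bounded \<Omega> \<and>
     interior (closure \<Omega>) = \<Omega> \<and>
     (\<exists>\<P>. finite \<P> \<and> (\<forall>P\<in>\<P>. polytope P) \<and> closure \<Omega> = \<Union>\<P>)"

text \<open>
  The predicate \<open>triangulation\<close> of the library includes conformity: two cells meet in a common face.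
\<close>

definition mesh_of :: "'a::euclidean_space set \<Rightarrow> 'a set set \<Rightarrow> bool" where
  "mesh_of \<Omega> \<tau> \<longleftrightarrow> triangulation \<tau> \<and> (\<forall>K\<in>\<tau>. int DIM('a) simplex K) \<and> \<Union>\<tau> = closure \<Omega>"

definition mesh_size :: "'a::euclidean_space set set \<Rightarrow> real" where
  "mesh_size \<tau> = Max (diameter ` \<tau>)"

definition regular_family :: "'a::euclidean_space set set set \<Rightarrow> bool" where
  "regular_family \<T> \<longleftrightarrow>
     (\<exists>\<rho>>0. \<forall>\<tau>\<in>\<T>. \<forall>K\<in>\<tau>. \<exists>c. cball c (\<rho> * diameter K) \<subseteq> K)"

definition quasi_uniform_family :: "'a::euclidean_space set set set \<Rightarrow> bool" where
  "quasi_uniform_family \<T> \<longleftrightarrow>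
     (\<exists>\<rho>>0. \<forall>\<tau>\<in>\<T>. \<forall>K\<in>\<tau>. \<rho> * mesh_size \<tau> \<le> diameter K)"

text \<open>Real polynomial functions of total degree at most \<open>k\<close>.\<close>

definition polys :: "nat \<Rightarrow> (real^'n \<Rightarrow> real) set" where
  "polys k = span {\<lambda>x. \<Prod>i\<in>UNIV. (x $ i) ^ e i | e. (\<Sum>i\<in>UNIV. e i) \<le> k}"

text \<open>
  Piecewise polynomials, without continuity across cells. Each class of almost everywhere
  equal functions is represented by its member that vanishes outside the open cells, so that the
  finite element spaces below are vector spaces of functions on which the norms are definite.
\<close>

definition pw_polys :: "nat \<Rightarrow> (real^'n) set set \<Rightarrow> (real^'n \<Rightarrow> 'b::euclidean_space) set" where
  "pw_polys k \<tau> = {v.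
     (\<forall>K\<in>\<tau>. \<exists>p. (\<forall>b\<in>Basis. (\<lambda>x. p x \<bullet> b) \<in> polys k) \<and> (\<forall>x\<in>interior K. v x = p x)) \<and>
     (\<forall>x. x \<notin> (\<Union>K\<in>\<tau>. interior K) \<longrightarrow> v x = 0)}"

definition Xh :: "(real^'n) set \<Rightarrow> nat \<Rightarrow> (real^'n) set set \<Rightarrow> (real^'n \<Rightarrow> real^'n) set" where
  "Xh \<Omega> s \<tau> = H10 \<Omega> \<inter> pw_polys s \<tau>"

definition Qh :: "(real^'n) set \<Rightarrow> nat \<Rightarrow> (real^'n) set set \<Rightarrow> (real^'n \<Rightarrow> real) set" where
  "Qh \<Omega> r \<tau> = L20 \<Omega> \<inter> pw_polys r \<tau>"

definition Vh ::
  "(real^'n) set \<Rightarrow> nat \<Rightarrow> nat \<Rightarrow> (real^'n) set set \<Rightarrow> (real^'n \<Rightarrow> real^'n) set" where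
  "Vh \<Omega> s r \<tau> = {v \<in> Xh \<Omega> s \<tau>. \<forall>q\<in>Qh \<Omega> r \<tau>. L2_inner \<Omega> (divg \<Omega> v) q = 0}"

text \<open>
  In the next definition and in \<open>dual_norm\<close> the supremum includes \<open>v = 0\<close>, which contributes
  \<open>0 / 0 = 0\<close>.
\<close>

definition inf_sup_family ::
  "(real^'n) set \<Rightarrow> nat \<Rightarrow> nat \<Rightarrow> (real^'n) set set set \<Rightarrow> bool" where
  "inf_sup_family \<Omega> s r \<T> \<longleftrightarrow> (\<exists>b>0. \<forall>\<tau>\<in>\<T>. \<forall>q\<in>Qh \<Omega> r \<tau>.
     b * L2_norm \<Omega> q \<le>
       (SUP v\<in>Xh \<Omega> s \<tau>. L2_inner \<Omega> (divg \<Omega> v) q / L2_norm \<Omega> (grad \<Omega> v)))"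

definition inverse_ineq_family ::
  "(real^'n) set \<Rightarrow> nat \<Rightarrow> (real^'n) set set set \<Rightarrow> bool" where
  "inverse_ineq_family \<Omega> s \<T> \<longleftrightarrow> (\<exists>C. \<forall>\<tau>\<in>\<T>. \<forall>v\<in>Xh \<Omega> s \<tau>.
     L2_norm \<Omega> (grad \<Omega> v) \<le> C * mesh_size \<tau> powi (-1) * L2_norm \<Omega> v)"

definition discrete_sobolev_family ::
  "(real^'n) set \<Rightarrow> nat \<Rightarrow> (real^'n) set set set \<Rightarrow> bool" where
  "discrete_sobolev_family \<Omega> s \<T> \<longleftrightarrow> (\<exists>C. \<forall>\<tau>\<in>\<T>. \<forall>v\<in>Xh \<Omega> s \<tau>.
     esssup (lebesgue_on \<Omega>) (\<lambda>x. ereal (norm (v x))) \<le>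
       ereal (C * (if CARD('n) = 2 then sqrt (1 + \<bar>ln (mesh_size \<tau>)\<bar>)
                   else mesh_size \<tau> powr (-1/2)) * L2_norm \<Omega> (grad \<Omega> v)))"

definition dual_norm ::
  "(real^'n) set \<Rightarrow> (real^'n \<Rightarrow> real^'n) set \<Rightarrow> ((real^'n \<Rightarrow> real^'n) \<Rightarrow> real) \<Rightarrow> real" where
  "dual_norm \<Omega> V f = (SUP v\<in>V. \<bar>f v\<bar> / L2_norm \<Omega> (grad \<Omega> v))"

section \<open>The Picard operator\<close>

definition Ynorm :: "(real^'n) set \<Rightarrow> (real^'n \<Rightarrow> real^'n) \<Rightarrow> real" where
  "Ynorm \<Omega> v = L2_norm \<Omega> (symgrad \<Omega> v)"

definition reg_abs :: "real \<Rightarrow> real^'n^'n \<Rightarrow> real" where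
  "reg_abs \<epsilon> A = sqrt (A \<bullet> A + \<epsilon>\<^sup>2)"

definition is_picard_solution ::
  "(real^'n) set \<Rightarrow> (real^'n \<Rightarrow> real^'n) set \<Rightarrow> real \<Rightarrow> real \<Rightarrow> real \<Rightarrow> ((real^'n \<Rightarrow> real^'n) \<Rightarrow> real)
     \<Rightarrow> (real^'n \<Rightarrow> real^'n) \<Rightarrow> (real^'n \<Rightarrow> real^'n) \<Rightarrow> bool" where
  "is_picard_solution \<Omega> V \<mu> \<tau>\<^sub>s \<epsilon> f u ut \<longleftrightarrow> ut \<in> V \<and>
     (\<forall>v\<in>V. 2 * \<mu> * L2_inner \<Omega> (symgrad \<Omega> ut) (symgrad \<Omega> v) +
            \<tau>\<^sub>s * L2_inner \<Omega> (\<lambda>x. inverse (reg_abs \<epsilon> (symgrad \<Omega> u x)) *\<^sub>R symgrad \<Omega> ut x)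
                           (symgrad \<Omega> v) = f v)"

definition picard ::
  "(real^'n) set \<Rightarrow> (real^'n \<Rightarrow> real^'n) set \<Rightarrow> real \<Rightarrow> real \<Rightarrow> real \<Rightarrow> ((real^'n \<Rightarrow> real^'n) \<Rightarrow> real)
     \<Rightarrow> (real^'n \<Rightarrow> real^'n) \<Rightarrow> (real^'n \<Rightarrow> real^'n)" where
  "picard \<Omega> V \<mu> \<tau>\<^sub>s \<epsilon> f u = (THE ut. is_picard_solution \<Omega> V \<mu> \<tau>\<^sub>s \<epsilon> f u ut)"

section \<open>Anderson acceleration\<close>

definition aa_depth :: "nat \<Rightarrow> nat \<Rightarrow> nat" where
  "aa_depth m k = min (k - 1) m"

definition aa_comb ::
  "nat \<Rightarrow> nat \<Rightarrow> (nat \<Rightarrow> real) \<Rightarrow> (nat \<Rightarrow> 'a::real_vector) \<Rightarrow> 'a" where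
  "aa_comb m k \<alpha> y = (1 - (\<Sum>j\<in>{k - aa_depth m k..k-1}. \<alpha> j)) *\<^sub>R y k
                     + (\<Sum>j\<in>{k - aa_depth m k..k-1}. \<alpha> j *\<^sub>R y j)"

text \<open>
  \<open>x\<close> and \<open>w\<close> are the iterates and residuals of a run of the algorithm of depth \<open>m\<close> for
  \<open>g : Y \<rightarrow> Y\<close>, where \<open>N\<close> is the norm of \<open>Y\<close>. The minimising coefficients need not be unique;
  \<open>\<alpha>\<close> is any choice of them. The value \<open>w 0\<close> is irrelevant. For \<open>k = 1\<close> the update degenerates to
  \<open>x 1 = x 0 + w 1\<close>, and so is listed separately.
\<close>

definition anderson ::
  "('a::real_vector \<Rightarrow> real) \<Rightarrow> 'a set \<Rightarrow> ('a \<Rightarrow> 'a) \<Rightarrow> nat \<Rightarrow> (nat \<Rightarrow> real)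
     \<Rightarrow> (nat \<Rightarrow> 'a) \<Rightarrow> (nat \<Rightarrow> 'a) \<Rightarrow> bool" where
  "anderson N Y g m \<beta> x w \<longleftrightarrow>
     x 0 \<in> Y \<and> w 1 = g (x 0) - x 0 \<and> \<beta> 1 = 1 \<and> x 1 = x 0 + w 1 \<and>
     (\<exists>\<alpha> :: nat \<Rightarrow> nat \<Rightarrow> real. \<forall>k\<ge>2.
        w k = g (x (k-1)) - x (k-1) \<and>
        (\<forall>a. N (aa_comb m k (\<alpha> k) w) \<le> N (aa_comb m k a w)) \<and>
        x k = aa_comb m k (\<alpha> k) (\<lambda>j. x (j-1)) + \<beta> k *\<^sub>R aa_comb m k (\<alpha> k) w)"

text \<open>
  The \<open>i\<close>-th column of the residual-difference matrix of step \<open>j\<close>, for \<open>1 \<le> i \<le> aa_depth m j\<close>;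
  columns run from the newest difference to the oldest.
\<close>

definition aa_col :: "(nat \<Rightarrow> 'a::real_vector) \<Rightarrow> nat \<Rightarrow> nat \<Rightarrow> 'a" where
  "aa_col w j i = w (j - i + 1) - w (j - i)"

definition aa_resid ::
  "nat \<Rightarrow> (nat \<Rightarrow> 'a::real_vector) \<Rightarrow> nat \<Rightarrow> (nat \<Rightarrow> real) \<Rightarrow> 'a" where
  "aa_resid m w k \<gamma> = w k - (\<Sum>i\<in>{1..aa_depth m k}. \<gamma> i *\<^sub>R aa_col w k i)"

definition aa_gains ::
  "('a::real_vector \<Rightarrow> real) \<Rightarrow> nat \<Rightarrow> (nat \<Rightarrow> 'a) \<Rightarrow> (nat \<Rightarrow> real) \<Rightarrow> bool" where
  "aa_gains N m w \<theta> \<longleftrightarrow> (\<forall>k\<ge>1. \<exists>\<gamma>.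
     (\<forall>\<gamma>'. N (aa_resid m w k \<gamma>) \<le> N (aa_resid m w k \<gamma>')) \<and>
     N (aa_resid m w k \<gamma>) = \<theta> k * N (w k))"

text \<open>For \<open>N f = 0\<close> this sine is \<open>0\<close>, so a positive lower bound on it entails \<open>f \<noteq> 0\<close>.\<close>

definition direction_sine :: "('a::real_vector \<Rightarrow> real) \<Rightarrow> 'a \<Rightarrow> 'a set \<Rightarrow> real" where
  "direction_sine N f S = (INF v\<in>S. N (f - v)) / N f"

section \<open>The constants of the Picard operator\<close>

text \<open>\<open>d\<close> is the space dimension, \<open>2\<close> or \<open>3\<close>, and \<open>F\<close> stands for the dual norm of the forcing.\<close>

definition C_G :: "nat \<Rightarrow> real \<Rightarrow> real \<Rightarrow> real \<Rightarrow> real \<Rightarrow> real \<Rightarrow> real \<Rightarrow> real" where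
  "C_G d Cst \<mu> \<tau>\<^sub>s \<epsilon> h F =
     (if d = 2
      then sqrt (\<tau>\<^sub>s * \<epsilon> powi (-3) * Cst * (1 + \<bar>ln h\<bar>) * h powi (-2) * \<mu> powi (-3) * F\<^sup>2 / 8)
      else sqrt (\<tau>\<^sub>s * \<epsilon> powi (-3) * Cst * h powi (-3) * \<mu> powi (-3) * F\<^sup>2 / 8))"

definition C_hat_G :: "nat \<Rightarrow> real \<Rightarrow> real \<Rightarrow> real \<Rightarrow> real \<Rightarrow> real \<Rightarrow> real \<Rightarrow> real" where
  "C_hat_G d Cst \<mu> \<tau>\<^sub>s \<epsilon> h F =
     (if d = 2
      then Cst * \<mu> powi (-1) * \<tau>\<^sub>s * \<epsilon> powi (-2) * sqrt (1 + \<bar>ln h\<bar>) * h powi (-1) *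
           (C_G d Cst \<mu> \<tau>\<^sub>s \<epsilon> h F + \<epsilon> powi (-1) * sqrt (1 + \<bar>ln h\<bar>) * h powi (-1) * \<mu> powi (-1) * F)
      else Cst * \<mu> powi (-1) * \<tau>\<^sub>s * \<epsilon> powi (-2) * h powr (-3/2) *
           (C_G d Cst \<mu> \<tau>\<^sub>s \<epsilon> h F + \<epsilon> powi (-1) * h powr (-3/2) * \<mu> powi (-1) * F))"

end

theory Submission
  imports Defs
begin

text \<open>
  The proof does not differentiate \<open>G\<close>. Divided differences of the coefficient \<open>1/|Du|\<close> give the exact identity
  \<open>G u - G v = B u v (u - v)\<close> with operators \<open>B u v\<close> that are linear in their last argument, bounded by \<open>C_G\<close>, and
  Lipschitz in \<open>(u, v)\<close> with constant \<open>C_hat_G\<close>. Substituted into the Anderson update this expands the next residual,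
  and the sines bound the optimisation coefficients.

  Both constants only need a bound of the maximum norm of \<open>Dv\<close> by its \<open>L\<^sup>2\<close> norm. On a cell \<open>K\<close> this is an inverse estimate
  for polynomials of order \<open>diameter K ^ (-d/2)\<close>. For \<open>d = 2\<close> the meshes need not be quasi-uniform; however, a cell on which some
  finite element function does not vanish carries a bubble function, a product of hat functions that is supported in
  neighbours of comparable size, and the inverse inequality for this bubble bounds the diameter of the cell below by a multiple of \<open>h\<close>.
  Korn's inequality on \<open>H10\<close> relates the dual norm of \<open>f\<close> to \<open>Dv\<close>.
\<close>

section \<open>Positive definite forms on subspaces\<close>

text \<open>In \<open>B u v\<close> the first argument fixes the linear form and the second the
  function \<open>G v\<close>: this is what remains when the equations of \<open>G u\<close> and
  \<open>G v\<close> are subtracted. The shape of \<open>C_G\<close> comes from Young's inequality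
  with the weight \<open>1/|Du|\<close>: the yield-stress term on the left absorbs the part that
  contains the unknown, whence the square root and the factor 8. \<open>Cst\<close> is chosen before
  the mesh and the data, so the maximum-norm bound needs one constant for the whole family, and a
  nonzero function on a cell much smaller than \<open>h\<close> would destroy it. The inverse
  inequality speaks of functions in \<open>Xh\<close> only, so a contradiction to it must come from
  a localized member of \<open>Xh\<close>. The degree \<open>s\<close> may be too small for a bubble
  inside one cell. Therefore bubbles belong to faces: a face with at most \<open>s\<close> vertices
  has a bubble of degree at most \<open>s\<close>, and if a point of the face lies in the open
  domain, this bubble vanishes on the boundary. In the plane, a cell without such a face carries
  only the zero function, because the boundary condition then holds at all its vertices
  (\<open>s = 1\<close>) or on all its edges (\<open>s = 2\<close>).\<close>

locale pos_form =
fixes V :: "'a::real_vector set" and ip :: "'a \<Rightarrow> 'a \<Rightarrow> real"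
assumes subspace_V: "subspace V"
 and ip_add: "\<lbrakk>u \<in> V; v \<in> V; w \<in> V\<rbrakk> \<Longrightarrow> ip (u + v) w = ip u w + ip v w"
 and ip_scale: "\<lbrakk>u \<in> V; w \<in> V\<rbrakk> \<Longrightarrow> ip (c *\<^sub>R u) w = c * ip u w"
 and ip_sym: "\<lbrakk>u \<in> V; v \<in> V\<rbrakk> \<Longrightarrow> ip u v = ip v u"
 and ip_nonneg: "u \<in> V \<Longrightarrow> 0 \<le> ip u u"
 and ip_definite: "\<lbrakk>u \<in> V; ip u u = 0\<rbrakk> \<Longrightarrow> u = 0"
begin

definition nm :: "'a \<Rightarrow> real" where "nm u = sqrt (ip u u)"

lemmas V_simps [simp] = subspace_0[OF subspace_V] subspace_add[OF subspace_V]
subspace_diff[OF subspace_V] subspace_scale[OF subspace_V] subspace_sum[OF subspace_V]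

lemma ip_add_right: "\<lbrakk>u \<in> V; v \<in> V; w \<in> V\<rbrakk> \<Longrightarrow> ip w (u + v) = ip w u + ip w v"
by (metis ip_add ip_sym V_simps(2))

lemma ip_scale_right: "\<lbrakk>u \<in> V; w \<in> V\<rbrakk> \<Longrightarrow> ip w (c *\<^sub>R u) = c * ip w u"
by (metis ip_scale ip_sym V_simps(4))

lemma ip_diff: "\<lbrakk>u \<in> V; v \<in> V; w \<in> V\<rbrakk> \<Longrightarrow> ip (u - v) w = ip u w - ip v w"
using ip_add[of u "(-1) *\<^sub>R v" w] ip_scale[of v w "-1"] V_simps(4)[of v "-1"] by simp

lemma ip_zero [simp]: "w \<in> V \<Longrightarrow> ip 0 w = 0" "w \<in> V \<Longrightarrow> ip w 0 = 0"
using ip_scale[of 0 w 0] ip_sym[of w 0] by auto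

lemma nm_sq: "u \<in> V \<Longrightarrow> (nm u)\<^sup>2 = ip u u"
by (simp add: nm_def ip_nonneg)

lemma nm_nonneg [simp]: "u \<in> V \<Longrightarrow> 0 \<le> nm u"
by (simp add: nm_def ip_nonneg)

lemma nm_zero [simp]: "nm 0 = 0"
using subspace_0[OF subspace_V] by (simp add: nm_def)

lemma nm_eq_0: "\<lbrakk>u \<in> V; nm u = 0\<rbrakk> \<Longrightarrow> u = 0"
by (simp add: ip_definite nm_def)

lemma nm_scale: "u \<in> V \<Longrightarrow> nm (c *\<^sub>R u) = \<bar>c\<bar> * nm u"
by (simp add: nm_def ip_scale ip_scale_right real_sqrt_mult flip: mult.assoc)

lemma sq_expand:
assumes "u \<in> V" "v \<in> V"
shows "ip (u + t *\<^sub>R v) (u + t *\<^sub>R v) = ip u u + 2 * t * ip u v + t\<^sup>2 * ip v v"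
using assms by (simp add: ip_add ip_add_right ip_scale ip_scale_right ip_sym[of v u]
  power2_eq_square algebra_simps)

lemma cauchy_schwarz:
assumes "u \<in> V" "v \<in> V"
shows "\<bar>ip u v\<bar> \<le> nm u * nm v"
proof (cases "v = 0")
case False
hence pos: "ip v v > 0"
 using ip_nonneg ip_definite assms by (metis order_less_le)
have "0 \<le> ip (u + (- ip u v / ip v v) *\<^sub>R v) (u + (- ip u v / ip v v) *\<^sub>R v)"
 using assms by (intro ip_nonneg) simp
also have "\<dots> = ip u u - (ip u v)\<^sup>2 / ip v v"
 using pos by (subst sq_expand[OF assms]) (simp add: field_simps power2_eq_square)
finally have "(ip u v)\<^sup>2 \<le> ip u u * ip v v"
 using pos by (simp add: field_simps)
hence "sqrt ((ip u v)\<^sup>2) \<le> sqrt (ip u u * ip v v)"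
 by (rule real_sqrt_le_mono)
thus ?thesis
 by (simp add: nm_def real_sqrt_mult)
qed (use assms in simp)

lemma nm_triangle:
assumes "u \<in> V" "v \<in> V"
shows "nm (u + v) \<le> nm u + nm v"
proof (rule power2_le_imp_le)
have "(nm (u + v))\<^sup>2 = ip u u + 2 * ip u v + ip v v"
 using sq_expand[OF assms, of 1] assms by (simp add: nm_sq)
also have "\<dots> \<le> (nm u + nm v)\<^sup>2"
 using cauchy_schwarz[OF assms] assms
 by (simp add: nm_sq[symmetric] power2_sum)
finally show "(nm (u + v))\<^sup>2 \<le> (nm u + nm v)\<^sup>2" .
qed (use assms in simp)

lemma nm_minus_commute: "\<lbrakk>u \<in> V; v \<in> V\<rbrakk> \<Longrightarrow> nm (u - v) = nm (v - u)"
using nm_scale[of "v - u" "-1"] by simp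

lemma nm_triangle_diff:
assumes "u \<in> V" "v \<in> V" shows "nm (u - v) \<le> nm u + nm v"
using nm_triangle[of u "(-1) *\<^sub>R v"] nm_scale[of v "-1"] V_simps(4)[of v "-1"] assms by simp

lemma nm_sum:
assumes "finite I" "\<And>i. i \<in> I \<Longrightarrow> y i \<in> V"
shows "nm (\<Sum>i\<in>I. y i) \<le> (\<Sum>i\<in>I. nm (y i))"
using assms
proof (induction I)
case (insert i I)
hence "nm (y i + (\<Sum>i\<in>I. y i)) \<le> nm (y i) + nm (\<Sum>i\<in>I. y i)"
 by (intro nm_triangle) auto
with insert show ?case by auto
qed simp

text \<open>At the minimiser \<open>t = - ip a b / ip b b\<close> of the quadratic polynomial in
  \<open>t\<close>, the square drops by \<open>(ip a b)^2 / ip b b\<close>. It is applied to the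
  optimal Anderson residual and the combination of columns that was subtracted.\<close>

lemma minimal_imp_orthogonal:
assumes "a \<in> V" "b \<in> V" and min: "\<And>t. nm a \<le> nm (a + t *\<^sub>R b)"
shows "ip a b = 0"
proof (rule ccontr)
assume ne: "ip a b \<noteq> 0"
hence "b \<noteq> 0" using assms by auto
hence pos: "ip b b > 0"
 using ip_nonneg ip_definite assms by (metis order_less_le)
define t where "t = - ip a b / ip b b"
have "(nm a)\<^sup>2 \<le> (nm (a + t *\<^sub>R b))\<^sup>2"
 using min[of t] assms by (intro power_mono) auto
hence "ip a a \<le> ip a a + 2 * t * ip a b + t\<^sup>2 * ip b b"
 using assms by (simp add: nm_sq sq_expand)
also have "\<dots> = ip a a - (ip a b)\<^sup>2 / ip b b"
 using pos by (simp add: t_def field_simps power2_eq_square)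
finally have "(ip a b)\<^sup>2 / ip b b \<le> 0" by simp
moreover have "(ip a b)\<^sup>2 / ip b b > 0" using pos ne by simp
ultimately show False by simp
qed

text \<open>The vector \<open>p\<close> is the orthogonal projection of \<open>b\<close> onto
  \<open>span B\<close>, so \<open>b - p\<close> is the new orthogonal direction. Both inductions
  over a spanning set below decompose along it.\<close>

lemma gram_schmidt_step:
assumes B: "span B \<subseteq> V" and b: "b \<in> V" and p: "p \<in> span B" "\<And>v. v \<in> span B \<Longrightarrow> ip p v = ip b v"
 and u: "u \<in> span (insert b B)"
obtains v c where "v \<in> span B" "u = v + c *\<^sub>R (b - p)" "\<And>x. x \<in> span B \<Longrightarrow> ip (b - p) x = 0"
proof -
from u obtain c where c: "u - c *\<^sub>R b \<in> span B"
 by (auto simp: span_insert)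
have "u - c *\<^sub>R b + c *\<^sub>R p \<in> span B"
 using c p by (intro span_add span_scale)
moreover have "u = (u - c *\<^sub>R b + c *\<^sub>R p) + c *\<^sub>R (b - p)"
 by (simp add: algebra_simps)
moreover have "ip (b - p) x = 0" if "x \<in> span B" for x
 using p b B that by (simp add: ip_diff subset_iff)
ultimately show thesis by (rule that)
qed

text \<open>Induction over the finite spanning set. Applied to \<open>ip b\<close>, the induction
  hypothesis yields the projection of the new vector, and the representer gains a component along
  the new orthogonal direction. This is the solver for all linear problems of the Picard
  operator.\<close>

lemma riesz:
assumes "finite B" "span B \<subseteq> V"
 and "\<And>u v. \<lbrakk>u \<in> span B; v \<in> span B\<rbrakk> \<Longrightarrow> L (u + v) = L u + L v"
 and "\<And>u c. u \<in> span B \<Longrightarrow> L (c *\<^sub>R u) = c * (L u :: real)"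
shows "\<exists>p\<in>span B. \<forall>v\<in>span B. ip p v = L v"
using assms
proof (induction B arbitrary: L)
case empty
thus ?case using empty(3)[of 0] subspace_0[OF subspace_V] by auto
next
case (insert b B)
have sub: "span B \<subseteq> span (insert b B)" by (rule span_mono) auto
have b: "b \<in> span (insert b B)" "b \<in> V" using insert.prems(1) by (auto simp: span_base)
have BV: "span B \<subseteq> V" using sub insert.prems(1) by auto
obtain p where p: "p \<in> span B" "\<And>v. v \<in> span B \<Longrightarrow> ip p v = ip b v"
 using insert.IH[of "ip b"] BV b(2) by (auto simp: ip_add_right ip_scale_right subset_iff)
obtain q where q: "q \<in> span B" "\<And>v. v \<in> span B \<Longrightarrow> ip q v = L v"
 using insert.IH[of L] BV insert.prems sub by (auto simp: subset_iff)
define d where "d = b - p"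
have dV: "d \<in> V" and dspan: "d \<in> span (insert b B)"
 using b p BV sub by (auto simp: d_def subset_iff intro: span_diff)
have orth: "ip d x = 0" if "x \<in> span B" for x
 using p b BV that by (simp add: ip_diff subset_iff d_def)
\<comment> \<open>If \<open>d = 0\<close>, the quotient is zero by convention, which is consistent
  because then \<open>L d = 0\<close>.\<close>
define r where "r = q + (L d / ip d d) *\<^sub>R d"
have "r \<in> span (insert b B)"
 unfolding r_def using q sub dspan by (intro span_add span_scale) auto
moreover have "ip r v = L v" if v: "v \<in> span (insert b B)" for v
proof -
 obtain x c where x: "x \<in> span B" "v = x + c *\<^sub>R d"
  using gram_schmidt_step[OF BV b(2) p v] unfolding d_def by metis
 have xV: "x \<in> V" "q \<in> V" using x q BV by auto
 have Lv: "L v = L x + c * L d"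
  using insert.prems(2)[of x "c *\<^sub>R d"] insert.prems(3)[of d c] x sub dspan
  by (auto intro: span_scale)
 have "L d = 0" if "ip d d = 0"
 proof -
  have "d = 0" using ip_definite dV that by blast
  thus ?thesis using insert.prems(3)[of 0 0] span_0[of "insert b B"] by simp
 qed
 hence "ip r v = ip q x + c * L d"
  using xV dV x orth[OF x(1)] orth[OF q(1)] ip_sym[of d q]
  by (auto simp: r_def ip_add ip_add_right ip_scale ip_scale_right)
 thus ?thesis using q x Lv by simp
qed
ultimately show ?case by blast
qed

text \<open>Any seminorm is controlled by the norm in finite dimension: each new orthogonal
  direction \<open>d\<close> adds \<open>S d / nm d\<close> to the constant, because both orthogonal
  components of \<open>v\<close> are bounded by \<open>nm v\<close>. The inverse estimate for
  polynomials rests on this.\<close>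

lemma seminorm_bounded:
assumes "finite B" "span B \<subseteq> V"
 and "\<And>u v. \<lbrakk>u \<in> span B; v \<in> span B\<rbrakk> \<Longrightarrow> S (u + v) \<le> S u + S v"
 and "\<And>u c. u \<in> span B \<Longrightarrow> S (c *\<^sub>R u) = \<bar>c\<bar> * (S u :: real)"
 and "\<And>u. u \<in> span B \<Longrightarrow> 0 \<le> S u"
shows "\<exists>C\<ge>0. \<forall>v\<in>span B. S v \<le> C * nm v"
using assms
proof (induction B)
case empty
thus ?case using empty(3)[of 0 0] by auto
next
case (insert b B)
have sub: "span B \<subseteq> span (insert b B)" by (rule span_mono) auto
have b: "b \<in> V" using insert.prems(1) by (auto simp: span_base)
have BV: "span B \<subseteq> V" using sub insert.prems(1) by auto
obtain p where p: "p \<in> span B" "\<And>v. v \<in> span B \<Longrightarrow> ip p v = ip b v"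
 using riesz[of B "ip b"] insert.hyps BV b by (auto simp: ip_add_right ip_scale_right subset_iff)
define d where "d = b - p"
have dV: "d \<in> V" and dspan: "d \<in> span (insert b B)"
 using b p BV sub by (auto simp: d_def subset_iff intro: span_diff span_base)
obtain C where C: "C \<ge> 0" "\<And>v. v \<in> span B \<Longrightarrow> S v \<le> C * nm v"
 using insert.IH BV insert.prems sub by (auto simp: subset_iff)
have "S v \<le> (C + S d / nm d) * nm v" if v: "v \<in> span (insert b B)" for v
proof -
 obtain x c where x: "x \<in> span B" "v = x + c *\<^sub>R d" "ip d x = 0"
  using gram_schmidt_step[OF BV b(1) p v] unfolding d_def by metis
 have xV: "x \<in> V" using x BV by auto
 have "ip v v = ip x x + c\<^sup>2 * ip d d"
  using sq_expand[OF xV dV, of c] x xV dV ip_sym[of d x] by simp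
 hence *: "ip x x \<le> ip v v" "c\<^sup>2 * ip d d \<le> ip v v"
  using ip_nonneg xV dV by auto
 have 1: "nm x \<le> nm v" using *(1) by (simp add: nm_def)
 have 2: "\<bar>c\<bar> * nm d \<le> nm v"
  using real_sqrt_le_mono[OF *(2)] by (simp add: nm_def real_sqrt_mult)
 have Sd: "S d = 0" if "nm d = 0"
  using nm_eq_0[OF dV that] insert.prems(3)[of 0 0] span_0[of "insert b B"] by simp
 have "\<bar>c\<bar> * S d \<le> S d / nm d * nm v"
 proof (cases "nm d = 0")
  case False
  hence "\<bar>c\<bar> * S d = S d / nm d * (\<bar>c\<bar> * nm d)" by simp
  also have "\<dots> \<le> S d / nm d * nm v"
  using 2 insert.prems(4)[OF dspan] dV by (intro mult_left_mono) auto
  finally show ?thesis .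
 qed (simp add: Sd)
 moreover have "S v \<le> S x + \<bar>c\<bar> * S d"
  using insert.prems(2)[of x "c *\<^sub>R d"] insert.prems(3)[OF dspan, of c] x sub dspan
  by (auto intro: span_scale)
 moreover have "S x \<le> C * nm v"
  using C(2)[OF x(1)] mult_left_mono[OF 1 C(1)] by linarith
 ultimately show ?thesis by (simp add: algebra_simps)
qed
thus ?case
 using C(1) insert.prems(4)[OF dspan] dV
 by (intro exI[of _ "C + S d / nm d"]) auto
qed

end

section \<open>Residual expansion of Anderson acceleration\<close>

text \<open>Summation by parts: each \<open>y k - y j\<close> is a sum of consecutive differences,
  so the coefficient of the \<open>i\<close>-th column is the sum of all \<open>\<alpha> j\<close>
  with \<open>j \<le> k - i\<close>. It does not depend on \<open>y\<close>, so iterates and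
  residuals receive the same coefficients.\<close>

lemma aa_comb_telescope:
fixes y :: "nat \<Rightarrow> 'b::real_vector"
assumes "k \<ge> 1"
shows "aa_comb m k \<alpha> y = y k - (\<Sum>i\<in>{1..aa_depth m k}.
  (\<Sum>j\<in>{k - aa_depth m k..k - i}. \<alpha> j) *\<^sub>R aa_col y k i)"
proof -
define M where "M = aa_depth m k"
have M: "M \<le> k - 1" by (simp add: M_def aa_depth_def)
\<comment> \<open>The window length is generalised from the depth to any \<open>p\<close>, since the
  depth itself cannot be varied in an induction.\<close>
have "p \<le> k - 1 \<Longrightarrow> (\<Sum>j\<in>{k - p..k - 1}. \<alpha> j *\<^sub>R (y k - y j))
  = (\<Sum>i\<in>{1..p}. (\<Sum>j\<in>{k - p..k - i}. \<alpha> j) *\<^sub>R aa_col y k i)" for p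
proof (induction p)
 case 0
 thus ?case using assms by simp
next
 case (Suc p)
 have ivl: "{k - Suc p..k - i} = insert (k - Suc p) {k - p..k - i}" if "i \<le> Suc p" for i
  using Suc.prems that by auto
 have tele: "(\<Sum>i\<in>{1..q}. aa_col y k i) = y k - y (k - q)" if "q \<le> k - 1" for q
  using that by (induction q) (auto simp: aa_col_def Suc_diff_Suc)
 have "(\<Sum>i\<in>{1..Suc p}. (\<Sum>j\<in>{k - Suc p..k - i}. \<alpha> j) *\<^sub>R aa_col y k i)
  = (\<Sum>i\<in>{1..Suc p}. \<alpha> (k - Suc p) *\<^sub>R aa_col y k i + (\<Sum>j\<in>{k - p..k - i}. \<alpha> j) *\<^sub>R aa_col y k i)"
  using Suc.prems by (intro sum.cong refl) (subst ivl, auto simp: algebra_simps)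
 also have "\<dots> = \<alpha> (k - Suc p) *\<^sub>R (y k - y (k - Suc p))
  + (\<Sum>i\<in>{1..p}. (\<Sum>j\<in>{k - p..k - i}. \<alpha> j) *\<^sub>R aa_col y k i)"
  using Suc.prems tele[of "Suc p"]
  by (simp add: sum.distrib flip: scaleR_sum_right)
 also have "\<dots> = (\<Sum>j\<in>{k - Suc p..k - 1}. \<alpha> j *\<^sub>R (y k - y j))"
  using Suc.prems Suc.IH ivl[of 1] by simp
 finally show ?case by simp
qed
from this[OF M] show ?thesis
 by (simp add: aa_comb_def M_def[symmetric] scaleR_diff_right sum_subtractf scaleR_left_diff_distrib
  scaleR_sum_left) (simp add: algebra_simps)
qed

text \<open>The substitution from \<open>\<alpha>\<close> to \<open>\<gamma>\<close> is inverted by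
  consecutive differences. Hence a minimiser over \<open>\<alpha>\<close> is also one over
  \<open>\<gamma>\<close>, which is how the gains are defined.\<close>

lemma aa_resid_in_comb:
fixes w :: "nat \<Rightarrow> 'b::real_vector"
assumes "k \<ge> 1"
shows "\<exists>\<alpha>. aa_comb m k \<alpha> w = aa_resid m w k \<gamma>"
proof -
define M where "M = aa_depth m k"
have M: "M \<le> k - 1" by (simp add: M_def aa_depth_def)
\<comment> \<open>Extension by zero beyond the depth makes the telescoping sum end with no boundary
  term.\<close>
define \<gamma>' where "\<gamma>' i = (if i \<le> M then \<gamma> i else 0)" for i
define \<alpha> where "\<alpha> j = \<gamma>' (k - j) - \<gamma>' (Suc (k - j))" for j
have "(\<Sum>j\<in>{k - M..k - i}. \<alpha> j) = \<gamma> i" if i: "1 \<le> i" "i \<le> M" for i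
proof -
 have "(\<Sum>j\<in>{k - M..k - i}. \<alpha> j) = (\<Sum>l\<in>{i..M}. \<gamma>' l - \<gamma>' (Suc l))"
  using i M assms
  by (intro sum.reindex_bij_witness[of _ "\<lambda>l. k - l" "\<lambda>j. k - j"]) (auto simp: \<alpha>_def)
 also have "\<dots> = - (\<Sum>l\<in>{i..M}. \<gamma>' (Suc l) - \<gamma>' l)"
  by (simp add: sum_subtractf)
 also have "\<dots> = \<gamma> i"
  using i by (subst sum_Suc_diff) (auto simp: \<gamma>'_def)
 finally show ?thesis .
qed
hence "aa_comb m k \<alpha> w = aa_resid m w k \<gamma>"
 unfolding aa_comb_telescope[OF assms] aa_resid_def M_def[symmetric] by simp
thus ?thesis by blast
qed

section \<open>Coefficients of a linear combination, estimated by the sines between its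
  vectors\<close>

context pos_form
begin

text \<open>Back substitution: the last vector keeps at least the fraction \<open>c\<close> of its
  length orthogonally to its predecessors, so its term is at most \<open>1/c\<close> times the sum,
  and removing it multiplies the norm by at most \<open>1 + 1/c\<close>.\<close>

lemma coefficient_bound:
assumes V: "\<And>i. i \<in> {1..l} \<Longrightarrow> f i \<in> V" and c: "c > 0"
 and sine: "\<And>i v. \<lbrakk>i \<in> {1..l}; v \<in> span (f ` {1..<i})\<rbrakk> \<Longrightarrow> c * nm (f i) \<le> nm (f i - v)"
 and i: "i \<in> {1..l}"
shows "\<bar>\<gamma> i\<bar> * nm (f i) \<le> (1 / c) * (1 + 1/c) ^ l * nm (\<Sum>j\<in>{1..l}. \<gamma> j *\<^sub>R f j)"
proof -
define S where "S i = (\<Sum>j\<in>{1..i}. \<gamma> j *\<^sub>R f j)" for i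
have SV: "S i \<in> V" if "i \<le> l" for i
 unfolding S_def using that V by (intro V_simps) auto
have last: "c * (\<bar>\<gamma> i\<bar> * nm (f i)) \<le> nm (S i)" if i: "i \<in> {1..l}" for i
proof (cases "\<gamma> i = 0")
 case False
 have "S i = \<gamma> i *\<^sub>R f i + S (i - 1)"
  using i by (cases i) (auto simp: S_def)
 \<comment> \<open>The partial sum is a multiple of \<open>f i\<close> minus a vector of the
   preceding span, the form to which the sine condition applies.\<close>
 hence S: "S i = \<gamma> i *\<^sub>R (f i - (- 1 / \<gamma> i) *\<^sub>R S (i - 1))"
  using False by (simp add: algebra_simps)
 have "(- 1 / \<gamma> i) *\<^sub>R S (i - 1) \<in> span (f ` {1..<i})"
  unfolding S_def by (intro span_scale span_sum span_base) auto
 from sine[OF i this] have "\<bar>\<gamma> i\<bar> * (c * nm (f i)) \<le> nm (S i)"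
  using SV[of "i - 1"] V i by (subst S, subst nm_scale) (auto intro!: mult_left_mono V_simps)
 thus ?thesis by (simp add: algebra_simps)
qed (use SV i in auto)
have step: "nm (S i) \<le> (1 + 1/c) * nm (S (Suc i))" if "Suc i \<le> l" for i
proof -
 have "S i = S (Suc i) - \<gamma> (Suc i) *\<^sub>R f (Suc i)" by (simp add: S_def)
 hence "nm (S i) \<le> nm (S (Suc i)) + \<bar>\<gamma> (Suc i)\<bar> * nm (f (Suc i))"
  using nm_triangle_diff[of "S (Suc i)" "\<gamma> (Suc i) *\<^sub>R f (Suc i)"] SV V that
  by (simp add: nm_scale)
 also have "\<bar>\<gamma> (Suc i)\<bar> * nm (f (Suc i)) \<le> 1/c * nm (S (Suc i))"
  using last[of "Suc i"] that c by (simp add: field_simps)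
 finally show ?thesis by (simp add: algebra_simps)
qed
\<comment> \<open>Descending from the full sum, each removed term costs one factor
  \<open>1 + 1/c\<close>.\<close>
have "nm (S (l - p)) \<le> (1 + 1/c) ^ p * nm (S l)" if "p \<le> l" for p
 using that
proof (induction p)
 case (Suc p)
 have "nm (S (l - Suc p)) \<le> (1 + 1/c) * nm (S (l - p))"
  using step[of "l - Suc p"] Suc.prems by (simp add: Suc_diff_Suc)
 also have "\<dots> \<le> (1 + 1/c) * ((1 + 1/c) ^ p * nm (S l))"
  using Suc c by (intro mult_left_mono) auto
 finally show ?case by simp
qed simp
from this[of "l - i"] have "nm (S i) \<le> (1 + 1/c) ^ (l - i) * nm (S l)"
 using i by simp
also have "\<dots> \<le> (1 + 1/c) ^ l * nm (S l)"
 using c SV by (intro mult_right_mono power_increasing) auto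
finally have "c * (\<bar>\<gamma> i\<bar> * nm (f i)) \<le> (1 + 1/c) ^ l * nm (S l)"
 using last[OF i] by linarith
thus ?thesis using c by (simp add: S_def field_simps)
qed

lemma sine_bound:
assumes "direction_sine nm f S \<ge> c" "c > 0" "f \<in> V" "S \<subseteq> V" "v \<in> S"
shows "c * nm f \<le> nm (f - v)"
proof -
have "nm f \<noteq> 0" using assms by (auto simp: direction_sine_def)
hence pos: "nm f > 0" using assms nm_nonneg[of f] by linarith
have "(INF v\<in>S. nm (f - v)) \<le> nm (f - v)"
 using assms by (intro cINF_lower bdd_belowI2[of _ 0]) auto
thus ?thesis
 using assms(1) pos by (simp add: direction_sine_def field_simps)
qed

end

text \<open>
\<open>B u v\<close> is a linear operator with \<open>g u - g v = B u v (u - v)\<close>; it plays the part of the derivative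
of \<open>g\<close> and makes the Taylor expansion of the residual an exact algebraic identity.
\<close>

locale anderson_run = pos_form V ip
for V :: "'a::real_vector set" and ip +
fixes g :: "'a \<Rightarrow> 'a" and B :: "'a \<Rightarrow> 'a \<Rightarrow> 'a \<Rightarrow> 'a" and CG CH \<sigma> c :: real
 and m :: nat and \<beta> \<theta> :: "nat \<Rightarrow> real" and x w :: "nat \<Rightarrow> 'a"
assumes g_V: "u \<in> V \<Longrightarrow> g u \<in> V"
 and B_V: "\<lbrakk>u \<in> V; v \<in> V; y \<in> V\<rbrakk> \<Longrightarrow> B u v y \<in> V"
 and B_add: "\<lbrakk>u \<in> V; v \<in> V; y \<in> V; z \<in> V\<rbrakk> \<Longrightarrow> B u v (y + z) = B u v y + B u v z"
 and B_scale: "\<lbrakk>u \<in> V; v \<in> V; y \<in> V\<rbrakk> \<Longrightarrow> B u v (t *\<^sub>R y) = t *\<^sub>R B u v y"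
 and g_diff: "\<lbrakk>u \<in> V; v \<in> V\<rbrakk> \<Longrightarrow> g u - g v = B u v (u - v)"
 and B_bound: "\<lbrakk>u \<in> V; v \<in> V; y \<in> V\<rbrakk> \<Longrightarrow> nm (B u v y) \<le> CG * nm y"
 and B_lip: "\<lbrakk>u \<in> V; v \<in> V; u' \<in> V; v' \<in> V; y \<in> V\<rbrakk> \<Longrightarrow>
  nm (B u v y - B u' v' y) \<le> CH * (nm (u - u') + nm (v - v')) * nm y"
 and CG: "CG \<ge> 0" and CH: "CH \<ge> 0"
 and \<sigma>: "\<sigma> > 0" "\<lbrakk>u \<in> V; v \<in> V\<rbrakk> \<Longrightarrow> \<sigma> * nm (u - v) \<le> nm ((g u - u) - (g v - v))"
 and run: "anderson nm V g m \<beta> x w"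
 and damping: "\<And>k. k \<ge> 1 \<Longrightarrow> 0 < \<beta> k \<and> \<beta> k \<le> 1"
 and gains: "aa_gains nm m w \<theta>"
 and c: "c > 0" and sines: "\<And>k j i. \<lbrakk>k > m; j \<in> {k - aa_depth m k..k-1}; i \<in> {1..aa_depth m j}\<rbrakk>
  \<Longrightarrow> direction_sine nm (aa_col w j i) (span (aa_col w j ` {1..<i})) \<ge> c"
begin

text \<open>The factor of \<open>coefficient_bound\<close> for the largest possible number of
  columns; every depth is at most \<open>m\<close>.\<close>

definition C1 :: real where "C1 = (1 / c) * (1 + 1/c) ^ m"

lemma C1_pos: "C1 > 0" using c by (simp add: C1_def add_pos_pos)

lemma depth: "aa_depth m k \<le> m" "k \<ge> 1 \<Longrightarrow> aa_depth m k < k"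
by (auto simp: aa_depth_def)

lemma comb_V:
assumes "k \<ge> 1" "\<And>j. j \<in> {k - aa_depth m k..k} \<Longrightarrow> y j \<in> V"
shows "aa_comb m k \<alpha> y \<in> V"
unfolding aa_comb_def using assms
by (intro V_simps(2,4,5)) (auto intro!: V_simps(4))

lemma x_w_V: "x k \<in> V" "k \<ge> 1 \<Longrightarrow> w k \<in> V"
proof -
obtain \<alpha> where \<alpha>: "\<And>k. k \<ge> 2 \<Longrightarrow> w k = g (x (k-1)) - x (k-1)"
  "\<And>k. k \<ge> 2 \<Longrightarrow> x k = aa_comb m k (\<alpha> k) (\<lambda>j. x (j-1)) + \<beta> k *\<^sub>R aa_comb m k (\<alpha> k) w"
 and 0: "x 0 \<in> V" "w 1 = g (x 0) - x 0" "x 1 = x 0 + w 1"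
 using run by (auto simp: anderson_def)
have "x k \<in> V \<and> (k \<ge> 1 \<longrightarrow> w k \<in> V)" for k
proof (induction k rule: less_induct)
 case (less k)
 consider "k = 0" | "k = 1" | "k \<ge> 2" by linarith
 thus ?case
 proof cases
  case 3
  hence w: "w k \<in> V" using less[of "k - 1"] \<alpha>(1) g_V by simp
  have "x k \<in> V"
  unfolding \<alpha>(2)[OF 3]
  proof (intro V_simps comb_V)
  fix j assume "j \<in> {k - aa_depth m k..k}"
  hence j: "1 \<le> j" "j \<le> k" using depth(2)[of k] 3 by auto
  thus "x (j - 1) \<in> V" using less[of "j - 1"] by auto
  show "w j \<in> V" using less[of j] w j by (cases "j = k") auto
  qed (use 3 in auto)
  with w show ?thesis by simp
 qed (use 0 g_V in auto)
qed
thus "x k \<in> V" "k \<ge> 1 \<Longrightarrow> w k \<in> V" by auto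
qed

lemma w_eq: "k \<ge> 1 \<Longrightarrow> w k = g (x (k - 1)) - x (k - 1)"
using run by (cases "k = 1") (auto simp: anderson_def)

abbreviation "e n \<equiv> x n - x (n - 1)"

text \<open>The step in terms of column coefficients. Column \<open>i\<close> of the shifted
  sequence \<open>j \<mapsto> x (j-1)\<close> is \<open>e (k - i)\<close>, so the same
  \<open>\<gamma>\<close> multiplies steps of the iterates and columns of the residuals.\<close>

lemma update:
assumes "k \<ge> 1"
obtains \<gamma> where "x k = x (k-1) - (\<Sum>i\<in>{1..aa_depth m k}. \<gamma> i *\<^sub>R e (k - i)) + \<beta> k *\<^sub>R aa_resid m w k \<gamma>"
 "\<And>\<gamma>'. nm (aa_resid m w k \<gamma>) \<le> nm (aa_resid m w k \<gamma>')"
proof (cases "k = 1")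
case True
\<comment> \<open>For \<open>k = 1\<close> the depth is zero, any \<open>\<gamma>\<close> gives the
  residual \<open>w 1\<close>, and \<open>\<beta> 1 = 1\<close> turns the first step into this
  form.\<close>
thus thesis using run that
 by (auto simp: anderson_def aa_resid_def aa_depth_def)
next
case False
hence k: "k \<ge> 2" using assms by simp
then obtain \<alpha> where \<alpha>: "\<And>a. nm (aa_comb m k \<alpha> w) \<le> nm (aa_comb m k a w)"
  "x k = aa_comb m k \<alpha> (\<lambda>j. x (j-1)) + \<beta> k *\<^sub>R aa_comb m k \<alpha> w"
 using run unfolding anderson_def by blast
define \<gamma> where "\<gamma> i = (\<Sum>j\<in>{k - aa_depth m k..k - i}. \<alpha> j)" for i
have w: "aa_comb m k \<alpha> w = aa_resid m w k \<gamma>"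
 unfolding aa_comb_telescope[OF assms] aa_resid_def \<gamma>_def ..
have "aa_col (\<lambda>j. x (j - 1)) k i = e (k - i)" for i
 by (simp add: aa_col_def)
hence "aa_comb m k \<alpha> (\<lambda>j. x (j-1)) = x (k-1) - (\<Sum>i\<in>{1..aa_depth m k}. \<gamma> i *\<^sub>R e (k - i))"
 unfolding aa_comb_telescope[OF assms] \<gamma>_def by simp
with \<alpha> w show thesis
 using aa_resid_in_comb[OF assms, of m w] by (intro that[of \<gamma>]) metis+
qed

lemma col_V: "\<lbrakk>k \<ge> 1; i \<in> {1..aa_depth m k}\<rbrakk> \<Longrightarrow> aa_col w k i \<in> V"
using depth(2)[of k] by (auto simp: aa_col_def intro!: x_w_V V_simps)

text \<open>The sine condition of a step \<open>k\<close> concerns only matrices with index at most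
  \<open>k - 1\<close>, so the condition for \<open>F_k\<close> itself is read off at a later
  step.\<close>

lemma col_sine:
assumes "k \<ge> 1" "i \<in> {1..aa_depth m k}" "v \<in> span (aa_col w k ` {1..<i})"
shows "c * nm (aa_col w k i) \<le> nm (aa_col w k i - v)"
proof (rule sine_bound[OF _ c _ _ assms(3)])
have m: "m \<ge> 1" using assms depth(1)[of k] by auto
show "c \<le> direction_sine nm (aa_col w k i) (span (aa_col w k ` {1..<i}))"
\<comment> \<open>The window of step \<open>Suc m\<close> is \<open>{1..m}\<close> and covers all
  early indices; for larger \<open>k\<close> the window of step \<open>Suc k\<close> ends with
  \<open>k\<close>.\<close>
proof (cases "k \<le> m")
 case True
 thus ?thesis using assms by (intro sines[of "Suc m" k i]) (auto simp: aa_depth_def)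
next
 case False
 thus ?thesis using assms m by (intro sines[of "Suc k" k i]) (auto simp: aa_depth_def)
qed
show "span (aa_col w k ` {1..<i}) \<subseteq> V"
 using assms col_V by (intro span_minimal subspace_V) auto
qed (use assms col_V in auto)

text \<open>A column is a difference of residuals at consecutive iterates, so the expansion
  hypothesis with constant \<open>\<sigma>\<close> bounds the step of the iterates by the
  column.\<close>

lemma e_col: "\<lbrakk>k \<ge> 1; i \<in> {1..aa_depth m k}\<rbrakk> \<Longrightarrow> \<sigma> * nm (e (k - i)) \<le> nm (aa_col w k i)"
using \<sigma>(2)[OF x_w_V(1) x_w_V(1), of "k - i" "k - i - 1"] w_eq[of "k - i + 1"] w_eq[of "k - i"]
 depth(2)[of k] by (auto simp: aa_col_def)

text \<open>The gain refers to some minimiser and the algorithm may use another one, but their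
  residuals have equal norm. The residual is orthogonal to the subtracted combination, and
  Pythagoras gives the factor \<open>sqrt (1 - \<theta>^2)\<close>.\<close>

lemma gain_split:
assumes k: "k \<ge> 1" and min: "\<And>\<gamma>'. nm (aa_resid m w k \<gamma>) \<le> nm (aa_resid m w k \<gamma>')"
shows "nm (aa_resid m w k \<gamma>) = \<theta> k * nm (w k)"
 and "nm (\<Sum>i\<in>{1..aa_depth m k}. \<gamma> i *\<^sub>R aa_col w k i) = sqrt (1 - (\<theta> k)\<^sup>2) * nm (w k)"
 and "nm (w k) * \<theta> k \<ge> 0"
proof -
let ?s = "\<Sum>i\<in>{1..aa_depth m k}. \<gamma> i *\<^sub>R aa_col w k i"
let ?r = "aa_resid m w k \<gamma>"
obtain \<gamma>' where "\<And>\<gamma>''. nm (aa_resid m w k \<gamma>') \<le> nm (aa_resid m w k \<gamma>'')"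
  "nm (aa_resid m w k \<gamma>') = \<theta> k * nm (w k)"
 using gains k unfolding aa_gains_def by blast
with min show 1: "nm ?r = \<theta> k * nm (w k)" by (metis order_antisym)
have sV: "?s \<in> V" using col_V[OF k] by (intro V_simps(5,4)) auto
have rV: "?r \<in> V" using x_w_V(2)[OF k] sV by (auto simp: aa_resid_def)
thus "nm (w k) * \<theta> k \<ge> 0" using nm_nonneg[OF rV] 1 by (simp add: mult.commute)
have "ip ?r ?s = 0"
proof (rule minimal_imp_orthogonal[OF rV sV])
 fix t
 \<comment> \<open>Moving along \<open>?s\<close> only rescales the coefficients, so the moved
   vector still competes in the minimisation.\<close>
 have "?r + t *\<^sub>R ?s = aa_resid m w k (\<lambda>i. (1 - t) * \<gamma> i)"
  by (simp add: aa_resid_def algebra_simps scaleR_sum_right sum_subtractf)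
 thus "nm ?r \<le> nm (?r + t *\<^sub>R ?s)" using min by simp
qed
moreover have "w k = ?r + 1 *\<^sub>R ?s" by (simp add: aa_resid_def)
ultimately have "(nm (w k))\<^sup>2 = (nm ?r)\<^sup>2 + (nm ?s)\<^sup>2"
 using sq_expand[OF rV sV, of 1] rV sV x_w_V(2)[OF k] by (simp add: nm_sq)
hence "(nm ?s)\<^sup>2 = (1 - (\<theta> k)\<^sup>2) * (nm (w k))\<^sup>2"
 unfolding 1 by (simp add: power_mult_distrib algebra_simps)
hence "sqrt ((nm ?s)\<^sup>2) = sqrt ((1 - (\<theta> k)\<^sup>2) * (nm (w k))\<^sup>2)" by simp
thus "nm ?s = sqrt (1 - (\<theta> k)\<^sup>2) * nm (w k)"
 using sV x_w_V(2)[OF k] by (simp add: real_sqrt_mult)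
qed

lemma coef_bound:
assumes "k \<ge> 1" "\<And>\<gamma>'. nm (aa_resid m w k \<gamma>) \<le> nm (aa_resid m w k \<gamma>')" "i \<in> {1..aa_depth m k}"
shows "\<bar>\<gamma> i\<bar> * nm (e (k - i)) \<le> C1 / \<sigma> * (sqrt (1 - (\<theta> k)\<^sup>2) * nm (w k))"
proof -
have "\<bar>\<gamma> i\<bar> * (\<sigma> * nm (e (k - i))) \<le> \<bar>\<gamma> i\<bar> * nm (aa_col w k i)"
 using e_col[OF assms(1,3)] by (intro mult_left_mono) auto
also have "\<dots> \<le> (1 / c) * (1 + 1/c) ^ aa_depth m k * nm (\<Sum>j\<in>{1..aa_depth m k}. \<gamma> j *\<^sub>R aa_col w k j)"
 using coefficient_bound[of "aa_depth m k" "aa_col w k" c i \<gamma>] col_V[OF assms(1)] c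
  col_sine[OF assms(1)] assms(3) by blast
also have "\<dots> \<le> C1 * nm (\<Sum>j\<in>{1..aa_depth m k}. \<gamma> j *\<^sub>R aa_col w k j)"
 unfolding C1_def using c depth(1)[of k] col_V[OF assms(1)]
 by (intro mult_right_mono mult_left_mono power_increasing nm_nonneg V_simps(5,4)) auto
finally show ?thesis
 using \<sigma>(1) unfolding gain_split(2)[OF assms(1,2)] by (simp add: field_simps)
qed

text \<open>The numbers \<open>h(\<theta>_j)\<close> of the theorem, taken equal to their upper
  bound. The constant is the one of the quadratic term in \<open>main\<close>, where the 4 arises;
  the summand 1 keeps it positive for \<open>m = 0\<close>.\<close>

definition H :: "nat \<Rightarrow> real" where
"H j = (4 * m * C1 / \<sigma> + 1) * sqrt (1 - (\<theta> j)\<^sup>2) + \<beta> j * \<theta> j"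

lemma resid_V: "k \<ge> 1 \<Longrightarrow> aa_resid m w k \<gamma> \<in> V"
unfolding aa_resid_def using col_V x_w_V by (intro V_simps(3,4,5)) auto

lemma step_length:
assumes k: "k \<ge> 1" shows "nm (e k) \<le> nm (w k) * H k"
proof -
obtain \<gamma> where up: "x k = x (k-1) - (\<Sum>i\<in>{1..aa_depth m k}. \<gamma> i *\<^sub>R e (k - i)) + \<beta> k *\<^sub>R aa_resid m w k \<gamma>"
 and min: "\<And>\<gamma>'. nm (aa_resid m w k \<gamma>) \<le> nm (aa_resid m w k \<gamma>')"
 using update[OF k] by blast
define q where "q = sqrt (1 - (\<theta> k)\<^sup>2) * nm (w k)"
have q0: "q \<ge> 0" unfolding q_def gain_split(2)[OF k min, symmetric]
 using col_V[OF k] by (intro nm_nonneg V_simps(5,4)) auto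
have sV: "(\<Sum>i\<in>{1..aa_depth m k}. \<gamma> i *\<^sub>R e (k - i)) \<in> V"
 using x_w_V by (intro V_simps(5,4,3)) auto
have "e k = \<beta> k *\<^sub>R aa_resid m w k \<gamma> - (\<Sum>i\<in>{1..aa_depth m k}. \<gamma> i *\<^sub>R e (k - i))"
 by (subst (1) up) simp
hence "nm (e k) \<le> \<beta> k * nm (aa_resid m w k \<gamma>) + nm (\<Sum>i\<in>{1..aa_depth m k}. \<gamma> i *\<^sub>R e (k - i))"
 using nm_triangle_diff[OF V_simps(4)[OF resid_V[OF k]] sV, of "\<beta> k" \<gamma>] damping[OF k] resid_V[OF k]
 by (simp add: nm_scale)
also have "nm (\<Sum>i\<in>{1..aa_depth m k}. \<gamma> i *\<^sub>R e (k - i)) \<le> (\<Sum>i\<in>{1..aa_depth m k}. C1 / \<sigma> * q)"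
 using coef_bound[OF k min] x_w_V(1)
 by (intro order.trans[OF nm_sum] sum_mono) (auto simp: nm_scale q_def)
also have "\<dots> \<le> m * (C1 / \<sigma> * q)"
 using depth(1)[of k] C1_pos \<sigma>(1) q0 by (simp add: mult_right_mono divide_right_mono)
\<comment> \<open>A step length needs only \<open>m * C1 / \<sigma>\<close>; it is enlarged so that
  one constant serves both places of the theorem.\<close>
also have "\<dots> \<le> (4 * m * C1 / \<sigma> + 1) * q"
proof -
 have "0 \<le> m * (C1 / \<sigma> * q)" using C1_pos \<sigma>(1) q0 by simp
 moreover have "X \<le> 4 * X + q" if "0 \<le> X" for X using q0 that by linarith
 ultimately have "m * (C1 / \<sigma> * q) \<le> 4 * (m * (C1 / \<sigma> * q)) + q" by blast
 thus ?thesis by (simp add: algebra_simps)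
qed
finally show ?thesis
 unfolding gain_split(1)[OF k min] by (simp add: q_def H_def algebra_simps)
qed

lemma nm_x_diff:
assumes "a \<le> b" shows "nm (x b - x a) \<le> (\<Sum>n\<in>{a+1..b}. nm (e n))"
proof -
have "x b - x a = (\<Sum>n\<in>{a+1..b}. e n)"
 using assms by (induction b rule: dec_induct) (auto simp: algebra_simps)
thus ?thesis using x_w_V by (auto intro!: nm_sum)
qed

text \<open>All differences of \<open>g\<close> in the new residual are compared with the single
  operator \<open>B (x k) (x (k-1))\<close>. By linearity their leading parts combine to this
  operator applied to \<open>\<beta> k *\<^sub>R r\<close>, which gives the term with
  \<open>CG\<close>. The rest consists of coefficients times changes of \<open>B\<close>, a product
  of two small quantities.\<close>

lemma main:
assumes k: "k \<ge> 1"
shows "nm (w (k+1)) \<le> nm (w k) *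
  (\<theta> k * (1 - \<beta> k + CG * \<beta> k) +
  (4 * m * C1 / \<sigma> + 1) * CH * sqrt (1 - (\<theta> k)\<^sup>2) / 2 *
  (nm (w k) * H k
  + 2 * (\<Sum>n = k - aa_depth m k + 1..k-1. real (k - n) * nm (w n) * H n)
  + real (aa_depth m k) * nm (w (k - aa_depth m k)) * H (k - aa_depth m k)))"
proof -
obtain \<gamma> where up: "x k = x (k-1) - (\<Sum>i\<in>{1..aa_depth m k}. \<gamma> i *\<^sub>R e (k - i)) + \<beta> k *\<^sub>R aa_resid m w k \<gamma>"
 and min: "\<And>\<gamma>'. nm (aa_resid m w k \<gamma>) \<le> nm (aa_resid m w k \<gamma>')"
 using update[OF k] by blast
define M where "M = aa_depth m k"
have M: "M < k" "M \<le> m" using depth k by (auto simp: M_def)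
define r where "r = aa_resid m w k \<gamma>"
define q where "q = sqrt (1 - (\<theta> k)\<^sup>2) * nm (w k)"
note xV = x_w_V(1)
have rV: "r \<in> V" using resid_V[OF k] by (simp add: r_def)
have q0: "q \<ge> 0" unfolding q_def gain_split(2)[OF k min, symmetric]
 using col_V[OF k] by (intro nm_nonneg V_simps(5,4)) auto
\<comment> \<open>The error of replacing the operator of an earlier step by that of the current
  one.\<close>
define D where "D i = B (x (k - i)) (x (k - i - 1)) (e (k - i)) - B (x k) (x (k - 1)) (e (k - i))" for i
have BV: "B (x a) (x b) (e n) \<in> V" for a b n using xV by (intro B_V V_simps)
have DV: "D i \<in> V" for i unfolding D_def using BV by (intro V_simps)
have B_diff_sum: "B (x k) (x (k-1)) (\<Sum>i\<in>I. \<gamma> i *\<^sub>R e (k - i)) = (\<Sum>i\<in>I. \<gamma> i *\<^sub>R B (x k) (x (k-1)) (e (k - i)))"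
 if "finite I" for I
 using that
proof (induction I)
 case empty
 show ?case using B_scale[of "x k" "x (k-1)" 0 0] xV V_simps(1) by simp
next
 case (insert i I)
 have "(\<Sum>i\<in>I. \<gamma> i *\<^sub>R e (k - i)) \<in> V" using xV by (intro V_simps(3,4,5)) auto
 thus ?case
  using insert xV by (simp add: B_add B_scale V_simps)
qed
have wcol: "w (n + 1) = g (x n) - x n" for n using w_eq[of "n+1"] by simp
\<comment> \<open>The update formula rearranged: the argument on which the common operator acts is
  exactly the damped residual.\<close>
have ex: "e k + (\<Sum>i\<in>{1..M}. \<gamma> i *\<^sub>R e (k - i)) = \<beta> k *\<^sub>R r"
 by (subst (1) up) (simp add: r_def M_def)
have colg: "aa_col w k i = g (x (k - i)) - g (x (k - i - 1)) - e (k - i)" if "i \<in> {1..M}" for i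
 using w_eq[of "k - i"] wcol[of "k - i"] that M by (auto simp: aa_col_def)
have "w (k+1) = (1 - \<beta> k) *\<^sub>R r + (g (x k) - g (x (k-1))
  + (\<Sum>i\<in>{1..M}. \<gamma> i *\<^sub>R (g (x (k - i)) - g (x (k - i - 1)))))"
proof -
 have "(\<Sum>i\<in>{1..M}. \<gamma> i *\<^sub>R aa_col w k i) =
  (\<Sum>i\<in>{1..M}. \<gamma> i *\<^sub>R (g (x (k - i)) - g (x (k - i - 1)))) - (\<Sum>i\<in>{1..M}. \<gamma> i *\<^sub>R e (k - i))"
  unfolding sum_subtractf[symmetric] by (intro sum.cong refl) (simp only: colg scaleR_diff_right)
 moreover have "r = g (x (k-1)) - x (k-1) - (\<Sum>i\<in>{1..M}. \<gamma> i *\<^sub>R aa_col w k i)"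
  using w_eq[OF k] by (simp add: r_def aa_resid_def M_def)
 moreover have "(1 - \<beta> k) *\<^sub>R r = r - (e k + (\<Sum>i\<in>{1..M}. \<gamma> i *\<^sub>R e (k - i)))"
  by (simp only: ex scaleR_left_diff_distrib scaleR_one)
 ultimately show ?thesis using wcol[of k] by simp
qed
also have "g (x k) - g (x (k-1)) + (\<Sum>i\<in>{1..M}. \<gamma> i *\<^sub>R (g (x (k - i)) - g (x (k - i - 1))))
  = B (x k) (x (k-1)) (\<beta> k *\<^sub>R r) + (\<Sum>i\<in>{1..M}. \<gamma> i *\<^sub>R D i)"
proof -
 have "(\<Sum>i\<in>{1..M}. \<gamma> i *\<^sub>R e (k - i)) \<in> V" using xV by (intro V_simps(3,4,5)) auto
 hence "B (x k) (x (k-1)) (e k + (\<Sum>i\<in>{1..M}. \<gamma> i *\<^sub>R e (k - i))) =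
  B (x k) (x (k-1)) (e k) + B (x k) (x (k-1)) (\<Sum>i\<in>{1..M}. \<gamma> i *\<^sub>R e (k - i))"
  by (intro B_add xV V_simps(3))
 hence "B (x k) (x (k-1)) (\<beta> k *\<^sub>R r) =
  B (x k) (x (k-1)) (e k) + (\<Sum>i\<in>{1..M}. \<gamma> i *\<^sub>R B (x k) (x (k-1)) (e (k - i)))"
  by (simp only: ex B_diff_sum[OF finite_atLeastAtMost])
 thus ?thesis
  using xV by (simp add: D_def g_diff scaleR_diff_right sum_subtractf)
qed
finally have weq: "w (k+1) = (1 - \<beta> k) *\<^sub>R r + (B (x k) (x (k-1)) (\<beta> k *\<^sub>R r) + (\<Sum>i\<in>{1..M}. \<gamma> i *\<^sub>R D i))" .
have BrV: "B (x k) (x (k-1)) (\<beta> k *\<^sub>R r) \<in> V" using xV rV by (intro B_V V_simps)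
have DsV: "(\<Sum>i\<in>{1..M}. \<gamma> i *\<^sub>R D i) \<in> V" using DV by (intro V_simps) auto
\<comment> \<open>The path length of the iterates over the window. It bounds the displacements of
  both arguments of \<open>B\<close>, hence the factor \<open>2 * T\<close> below.\<close>
define T where "T = (\<Sum>n\<in>{k-M..k}. nm (e n))"
have e0: "0 \<le> nm (e n)" for n by (rule nm_nonneg) (simp add: xV)
have T0: "T \<ge> 0" unfolding T_def by (intro sum_nonneg e0)
have D: "nm (\<gamma> i *\<^sub>R D i) \<le> CH * (2 * T) * (C1 / \<sigma> * q)" if i: "i \<in> {1..M}" for i
proof -
 have TA: "(\<Sum>n\<in>A. nm (e n)) \<le> T" if "A \<subseteq> {k-M..k}" for A
  unfolding T_def using that e0 by (intro sum_mono2) auto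
 have "nm (x (k - i) - x k) \<le> T"
  unfolding nm_minus_commute[OF xV xV, of "k - i" k]
  using i M by (intro order.trans[OF nm_x_diff TA]) auto
 moreover have "nm (x (k - i - 1) - x (k - 1)) \<le> T"
  unfolding nm_minus_commute[OF xV xV, of "k - i - 1" "k - 1"]
  using i M by (intro order.trans[OF nm_x_diff TA]) auto
 ultimately have "CH * (nm (x (k - i) - x k) + nm (x (k - i - 1) - x (k - 1))) * nm (e (k - i))
  \<le> CH * (2 * T) * nm (e (k - i))"
  using CH e0[of "k - i"] by (intro mult_right_mono mult_left_mono) auto
 hence "nm (D i) \<le> CH * (2 * T) * nm (e (k - i))"
  using B_lip[of "x (k - i)" "x (k - i - 1)" "x k" "x (k - 1)" "e (k - i)"] xV
  by (simp add: D_def)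
 hence "\<bar>\<gamma> i\<bar> * nm (D i) \<le> \<bar>\<gamma> i\<bar> * (CH * (2 * T) * nm (e (k - i)))"
  by (intro mult_left_mono) auto
 also have "\<dots> = CH * (2 * T) * (\<bar>\<gamma> i\<bar> * nm (e (k - i)))" by simp
 also have "\<dots> \<le> CH * (2 * T) * (C1 / \<sigma> * q)"
  using coef_bound[OF k min, of i] i CH T0
  by (intro mult_left_mono) (auto simp: q_def M_def)
 finally show ?thesis using DV by (simp add: nm_scale)
qed
have wH: "0 \<le> nm (w n) * H n" "nm (e n) \<le> nm (w n) * H n" if "n \<ge> 1" for n
 using step_length[OF that] e0[of n] by linarith+
define R where "R = nm (w k) * H k
  + 2 * (\<Sum>n = k - M + 1..k-1. real (k - n) * nm (w n) * H n)
  + real M * nm (w (k - M)) * H (k - M)"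
\<comment> \<open>Each weight in \<open>R\<close> is at least 1: \<open>M\<close> at the oldest step
  and \<open>2 * (k - n)\<close> in between. For \<open>M \<ge> 1\<close> the two ends of the window
  are distinct and can be split off.\<close>
have TR: "T \<le> R" if "M \<ge> 1"
proof -
 have ivl: "{k-M..k} = insert k (insert (k-M) {k-M+1..k-1})"
  using that M by auto
 have "T = nm (e k) + (nm (e (k-M)) + (\<Sum>n = k-M+1..k-1. nm (e n)))"
  unfolding T_def ivl using that M by (subst sum.insert) auto
 also have "\<dots> \<le> nm (w k) * H k + (real M * (nm (w (k-M)) * H (k-M)) + 2 * (\<Sum>n = k-M+1..k-1. real (k - n) * nm (w n) * H n))"
 proof (intro add_mono)
  have "1 * (nm (w (k-M)) * H (k-M)) \<le> real M * (nm (w (k-M)) * H (k-M))"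
  using that wH(1)[of "k-M"] M by (intro mult_right_mono) auto
  thus "nm (e (k-M)) \<le> real M * (nm (w (k-M)) * H (k-M))"
  using order.trans[OF wH(2)[of "k-M"]] M by simp
  have "nm (e n) \<le> 2 * (real (k - n) * nm (w n) * H n)" if "n \<in> {k-M+1..k-1}" for n
  proof -
  have "1 * (nm (w n) * H n) \<le> 2 * real (k - n) * (nm (w n) * H n)"
  using that M wH(1)[of n] by (intro mult_right_mono) auto
  thus ?thesis using order.trans[OF wH(2)[of n]] that M by (simp add: mult.assoc)
  qed
  thus "(\<Sum>n = k-M+1..k-1. nm (e n)) \<le> 2 * (\<Sum>n = k-M+1..k-1. real (k - n) * nm (w n) * H n)"
  unfolding sum_distrib_left by (intro sum_mono)
 qed (use wH(2)[OF k] in auto)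
 finally show ?thesis by (simp add: R_def mult.assoc)
qed
have R0: "R \<ge> 0"
proof -
 have "0 \<le> (\<Sum>n = k - M + 1..k-1. real (k - n) * nm (w n) * H n)"
  using wH(1) M by (intro sum_nonneg) (auto simp: mult.assoc)
 moreover have "0 \<le> real M * nm (w (k - M)) * H (k - M)"
  using wH(1)[of "k - M"] M by (simp add: mult.assoc)
 ultimately show ?thesis using wH(1)[OF k] by (simp add: R_def)
qed
have "nm (w (k+1)) \<le> (1 - \<beta> k) * nm r + (CG * (\<beta> k * nm r) + (\<Sum>i\<in>{1..M}. CH * (2 * T) * (C1 / \<sigma> * q)))"
proof -
 have "nm (w (k+1)) \<le> nm ((1 - \<beta> k) *\<^sub>R r) + (nm (B (x k) (x (k-1)) (\<beta> k *\<^sub>R r)) + nm (\<Sum>i\<in>{1..M}. \<gamma> i *\<^sub>R D i))"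
  using nm_triangle[OF V_simps(4)[OF rV] V_simps(2)[OF BrV DsV], of "1 - \<beta> k"] nm_triangle[OF BrV DsV]
  unfolding weq by linarith
 also have "\<dots> \<le> (1 - \<beta> k) * nm r + (CG * (\<beta> k * nm r) + (\<Sum>i\<in>{1..M}. CH * (2 * T) * (C1 / \<sigma> * q)))"
 proof (intro add_mono)
  show "nm ((1 - \<beta> k) *\<^sub>R r) \<le> (1 - \<beta> k) * nm r" using rV damping[OF k] by (simp add: nm_scale)
  show "nm (B (x k) (x (k-1)) (\<beta> k *\<^sub>R r)) \<le> CG * (\<beta> k * nm r)"
  using B_bound[of "x k" "x (k-1)" "\<beta> k *\<^sub>R r"] xV rV damping[OF k] by (simp add: nm_scale)
  show "nm (\<Sum>i\<in>{1..M}. \<gamma> i *\<^sub>R D i) \<le> (\<Sum>i\<in>{1..M}. CH * (2 * T) * (C1 / \<sigma> * q))"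
  using D DV by (intro order.trans[OF nm_sum] sum_mono) auto
 qed
 finally show ?thesis .
qed
\<comment> \<open>The factor 4 collects the 2 from the two arguments of \<open>B\<close> and the 2
  that compensates the division by 2 in the stated bound.\<close>
also have "\<dots> = nm r * (1 - \<beta> k + CG * \<beta> k) + (4 * M * C1 / \<sigma>) * CH * q / 2 * T"
 by (simp add: algebra_simps)
also have "(4 * M * C1 / \<sigma>) * CH * q / 2 * T \<le> (4 * m * C1 / \<sigma> + 1) * CH * q / 2 * R"
proof (cases "M = 0")
 case True
 thus ?thesis using C1_pos \<sigma>(1) CH q0 R0 by simp
next
 case False
 define a where "a = 4 * C1 / \<sigma>"
 have a: "a \<ge> 0" using C1_pos \<sigma>(1) by (simp add: a_def)
 have "M * a \<le> m * a" using M(2) a by (intro mult_right_mono) auto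
 hence "M * a * (CH * q / 2 * T) \<le> (m * a + 1) * (CH * q / 2 * R)"
  using TR False CH q0 T0 a by (intro mult_mono mult_left_mono) auto
 thus ?thesis by (simp add: a_def mult.assoc mult.commute mult.left_commute)
qed
finally show ?thesis
 unfolding r_def gain_split(1)[OF k min] q_def R_def M_def by (simp add: algebra_simps)
qed

end

section \<open>The Picard operator on a finite-dimensional space\<close>

text \<open>As a norm on a product space the regularised modulus is 1-Lipschitz by the triangle
  inequality, so no differentiation of the square root occurs.\<close>

lemma reg_abs_eq_norm: "reg_abs \<epsilon> A = norm (A, \<epsilon>)"
by (simp add: reg_abs_def norm_prod_def dot_square_norm)

lemma reg_abs_bounds: "norm A \<le> reg_abs \<epsilon> A" "\<epsilon> > 0 \<Longrightarrow> \<epsilon> \<le> reg_abs \<epsilon> A" "\<epsilon> > 0 \<Longrightarrow> 0 < reg_abs \<epsilon> A"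
proof -
show "norm A \<le> reg_abs \<epsilon> A" unfolding reg_abs_eq_norm by (metis norm_fst_le fst_conv)
show 1: "\<epsilon> \<le> reg_abs \<epsilon> A" if "\<epsilon> > 0"
 unfolding reg_abs_eq_norm by (rule order.trans[OF _ norm_snd_le]) (use that in auto)
show "0 < reg_abs \<epsilon> A" if "\<epsilon> > 0" using 1[OF that] that by linarith
qed

lemma reg_abs_lipschitz: "\<bar>reg_abs \<epsilon> A - reg_abs \<epsilon> B\<bar> \<le> norm (A - B)"
unfolding reg_abs_eq_norm
by (rule order.trans[OF norm_triangle_ineq3]) (simp add: norm_prod_def)

lemma inverse_reg_abs_bounds:
assumes "\<epsilon> > 0"
shows "0 < inverse (reg_abs \<epsilon> A)" "inverse (reg_abs \<epsilon> A) \<le> inverse \<epsilon>"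
 "\<bar>inverse (reg_abs \<epsilon> A) - inverse (reg_abs \<epsilon> B)\<bar> \<le> inverse \<epsilon> ^ 2 * norm (A - B)"
proof -
note b = reg_abs_bounds(2,3)[OF assms]
show 1: "0 < inverse (reg_abs \<epsilon> A)" "inverse (reg_abs \<epsilon> A) \<le> inverse \<epsilon>" for A
 using b[of A] assms by (auto intro: le_imp_inverse_le)
have "inverse (reg_abs \<epsilon> A) - inverse (reg_abs \<epsilon> B)
  = inverse (reg_abs \<epsilon> A) * inverse (reg_abs \<epsilon> B) * (reg_abs \<epsilon> B - reg_abs \<epsilon> A)"
 using b(2)[of A] b(2)[of B] by (simp add: field_simps)
also have "\<bar>\<dots>\<bar> = inverse (reg_abs \<epsilon> A) * inverse (reg_abs \<epsilon> B) * \<bar>reg_abs \<epsilon> A - reg_abs \<epsilon> B\<bar>"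
 using b(2)[of A] b(2)[of B] by (simp add: abs_mult abs_minus_commute)
also have "\<dots> \<le> (inverse \<epsilon> * inverse \<epsilon>) * norm (A - B)"
 using 1[of A] 1[of B] assms
 by (intro mult_mono reg_abs_lipschitz) (auto intro: less_imp_le)
finally show "\<bar>inverse (reg_abs \<epsilon> A) - inverse (reg_abs \<epsilon> B)\<bar> \<le> inverse \<epsilon> ^ 2 * norm (A - B)"
 by (simp add: power2_eq_square)
qed

section \<open>Divided differences of the coefficient\<close>

text \<open>
The divided difference of the coefficient: \<open>1/|B| - 1/|A| = coef_dd A B \<bullet> (A - B)\<close>, where
\<open>|\<cdot>|\<close> is the regularised norm.
\<close>

definition coef_dd :: "real \<Rightarrow> real^'n^'n \<Rightarrow> real^'n^'n \<Rightarrow> real^'n^'n" where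
"coef_dd \<epsilon> A B = inverse (reg_abs \<epsilon> A * reg_abs \<epsilon> B * (reg_abs \<epsilon> A + reg_abs \<epsilon> B)) *\<^sub>R (A + B)"

text \<open>The squares of the regularised moduli differ by
  \<open>(A + B) \<bullet> (A - B)\<close>, because the \<open>\<epsilon>^2\<close> cancel. Division
  by \<open>a b (a + b)\<close> turns the difference of squares into the difference of
  reciprocals.\<close>

lemma coef_dd:
assumes "\<epsilon> > 0"
shows "coef_dd \<epsilon> A B \<bullet> (A - B) = inverse (reg_abs \<epsilon> B) - inverse (reg_abs \<epsilon> A)"
proof -
define a b where "a = reg_abs \<epsilon> A" and "b = reg_abs \<epsilon> B"
have pos: "a > 0" "b > 0" using reg_abs_bounds(3)[OF assms] by (auto simp: a_def b_def)
have "(A + B) \<bullet> (A - B) = a\<^sup>2 - b\<^sup>2"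
 by (simp add: a_def b_def reg_abs_def inner_add_left inner_diff_right inner_commute[of B A])
also have "\<dots> = (a - b) * (a + b)" by (simp add: power2_eq_square algebra_simps)
finally have "coef_dd \<epsilon> A B \<bullet> (A - B) = inverse (a * b * (a + b)) * ((a - b) * (a + b))"
 by (simp add: coef_dd_def a_def b_def)
also have "\<dots> = (a - b) * (inverse a * inverse b)"
 using pos by (simp add: inverse_eq_divide)
also have "\<dots> = inverse b - inverse a" using pos by (simp add: field_simps)
finally show ?thesis by (simp add: a_def b_def)
qed

text \<open>The sum \<open>A + B\<close> is absorbed by \<open>a + b\<close>. Keeping both
  reciprocals, not just powers of \<open>1/\<epsilon>\<close>, preserves the weight that is needed
  for the absorption in \<open>B_bound\<close>.\<close>

lemma norm_coef_dd:
assumes "\<epsilon> > 0"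
shows "norm (coef_dd \<epsilon> A B) \<le> inverse (reg_abs \<epsilon> A) * inverse (reg_abs \<epsilon> B)"
proof -
define a b where "a = reg_abs \<epsilon> A" and "b = reg_abs \<epsilon> B"
have pos: "a > 0" "b > 0" using reg_abs_bounds(3)[OF assms] by (auto simp: a_def b_def)
have "norm (A + B) \<le> a + b"
 using norm_triangle_ineq[of A B] reg_abs_bounds(1)[of A \<epsilon>] reg_abs_bounds(1)[of B \<epsilon>]
 by (simp add: a_def b_def)
hence "inverse (a * b * (a + b)) * norm (A + B) \<le> inverse (a * b * (a + b)) * (a + b)"
 using pos by (intro mult_left_mono) auto
also have "\<dots> = inverse a * inverse b"
 using pos by (simp add: inverse_eq_divide)
finally show ?thesis
 unfolding coef_dd_def a_def[symmetric] b_def[symmetric] using pos by simp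
qed

lemma coef_dd_commute: "coef_dd \<epsilon> A B = coef_dd \<epsilon> B A"
by (simp add: coef_dd_def ac_simps)

text \<open>Either the vector or the scalar factor changes. These contribute 1/2 and 3/2; in the
  latter the factor \<open>inverse (a' + b)\<close> of \<open>s - s'\<close> absorbs
  \<open>norm (A' + B)\<close>.\<close>

lemma coef_dd_lipschitz_left:
assumes "\<epsilon> > 0"
shows "norm (coef_dd \<epsilon> A B - coef_dd \<epsilon> A' B) \<le> 2 * inverse \<epsilon> ^ 3 * norm (A - A')"
proof -
define a b a' where "a = reg_abs \<epsilon> A" and "b = reg_abs \<epsilon> B" and "a' = reg_abs \<epsilon> A'"
have pos: "a > 0" "b > 0" "a' > 0" "a \<ge> \<epsilon>" "b \<ge> \<epsilon>" "a' \<ge> \<epsilon>"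
 using reg_abs_bounds(2,3)[OF assms] by (auto simp: a_def b_def a'_def)
define s s' where "s = inverse (a * b * (a + b))" and "s' = inverse (a' * b * (a' + b))"
have e3: "inverse (p * q * r) \<le> inverse \<epsilon> ^ 3" if "p \<ge> \<epsilon>" "q \<ge> \<epsilon>" "r \<ge> \<epsilon>" for p q r
proof -
 have "\<epsilon> * \<epsilon> * \<epsilon> \<le> p * q * r" using that assms by (intro mult_mono) auto
 hence "inverse (p * q * r) \<le> inverse (\<epsilon> * \<epsilon> * \<epsilon>)"
  using assms by (intro le_imp_inverse_le) auto
 thus ?thesis by (simp add: power3_eq_cube)
qed
have half: "inverse (a * b * (a + b)) \<le> inverse \<epsilon> ^ 3 / 2"
proof -
 \<comment> \<open>The mean of \<open>a\<close> and \<open>b\<close> is still at least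
   \<open>\<epsilon>\<close>; using it gains the factor 1/2.\<close>
 have "inverse (a * b * ((a + b) / 2)) \<le> inverse \<epsilon> ^ 3" using pos by (intro e3) auto
 thus ?thesis using pos by (simp add: field_simps)
qed
have "coef_dd \<epsilon> A B - coef_dd \<epsilon> A' B = s *\<^sub>R (A - A') + (s - s') *\<^sub>R (A' + B)"
 by (simp add: coef_dd_def a_def b_def a'_def s_def s'_def algebra_simps)
also have "norm \<dots> \<le> s * norm (A - A') + \<bar>s - s'\<bar> * norm (A' + B)"
 using pos by (intro order.trans[OF norm_triangle_ineq]) (simp add: s_def)
also have "s * norm (A - A') \<le> (inverse \<epsilon> ^ 3 / 2) * norm (A - A')"
 using half unfolding s_def by (rule mult_right_mono) simp
also have "\<bar>s - s'\<bar> * norm (A' + B) \<le> (3/2 * inverse \<epsilon> ^ 3) * norm (A - A')"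
proof -
 have "s - s' = (a' - a) * (inverse (a * b * a') + inverse (a * b * (a + b))) * inverse (a' + b)"
  using pos by (simp add: s_def s'_def add_pos_pos divide_simps) (simp add: algebra_simps)
 hence "\<bar>s - s'\<bar> = \<bar>a' - a\<bar> * (inverse (a * b * a') + inverse (a * b * (a + b))) * inverse (a' + b)"
  using pos by (simp add: abs_mult)
 moreover have "norm (A' + B) \<le> a' + b"
  using norm_triangle_ineq[of A' B] reg_abs_bounds(1)[of A' \<epsilon>] reg_abs_bounds(1)[of B \<epsilon>]
  by (simp add: a'_def b_def)
 ultimately have "\<bar>s - s'\<bar> * norm (A' + B) \<le>
  \<bar>a' - a\<bar> * (inverse (a * b * a') + inverse (a * b * (a + b))) * inverse (a' + b) * (a' + b)"
  using pos by (simp only:) (intro mult_left_mono, auto)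
 also have "\<dots> = (inverse (a * b * a') + inverse (a * b * (a + b))) * \<bar>a' - a\<bar>"
  using pos by simp
 also have "\<dots> \<le> (inverse \<epsilon> ^ 3 + inverse \<epsilon> ^ 3 / 2) * norm (A - A')"
  using assms pos half e3[of a b a'] reg_abs_lipschitz[of \<epsilon> A A']
  by (intro mult_mono add_mono) (auto simp: a_def a'_def abs_minus_commute)
 finally show ?thesis by simp
qed
finally show ?thesis by (simp add: algebra_simps)
qed

lemma coef_dd_lipschitz:
assumes "\<epsilon> > 0"
shows "norm (coef_dd \<epsilon> A B - coef_dd \<epsilon> A' B') \<le> 2 * inverse \<epsilon> ^ 3 * (norm (A - A') + norm (B - B'))"
using coef_dd_lipschitz_left[OF assms, of A B A'] coef_dd_lipschitz_left[OF assms, of B A' B']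
 norm_triangle_ineq[of "coef_dd \<epsilon> A B - coef_dd \<epsilon> A' B" "coef_dd \<epsilon> A' B - coef_dd \<epsilon> A' B'"]
by (simp add: coef_dd_commute[of \<epsilon> A'] algebra_simps)

lemma continuous_reg_abs [continuous_intros]:
"continuous_on S f \<Longrightarrow> continuous_on S (\<lambda>x. reg_abs \<epsilon> (f x))"
by (simp add: reg_abs_def continuous_intros)

lemma borel_measurable_reg_abs [measurable]: "reg_abs \<epsilon> \<in> borel_measurable borel"
by (intro borel_measurable_continuous_onI continuous_intros)

text \<open>Here \<open>T\<close> stands for the symmetric gradient, \<open>\<Lambda>\<close> for
  the maximum-norm constant of the mesh and \<open>\<Phi>\<close> for the norm of the forcing dual
  to that of \<open>T u\<close>. Linearity of \<open>T\<close> is required only almost everywhere,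
  since weak gradients are chosen representatives.\<close>

locale picard_space = finite_measure M
for M :: "'x measure" +
fixes V :: "'a::real_vector set" and T :: "'a \<Rightarrow> 'x \<Rightarrow> real^'n^'n" and \<Lambda> \<mu> \<tau> \<epsilon> \<Phi> :: real
 and f :: "'a \<Rightarrow> real" and Bs :: "'a set"
assumes V: "V = span Bs" "finite Bs"
 and T_meas [measurable]: "u \<in> V \<Longrightarrow> T u \<in> borel_measurable M"
 and T_add: "\<lbrakk>u \<in> V; v \<in> V\<rbrakk> \<Longrightarrow> AE x in M. T (u + v) x = T u x + T v x"
 and T_scale: "u \<in> V \<Longrightarrow> AE x in M. T (c *\<^sub>R u) x = c *\<^sub>R T u x"
 and T_bound: "u \<in> V \<Longrightarrow> AE x in M. norm (T u x) \<le> \<Lambda> * sqrt (\<integral>x. T u x \<bullet> T u x \<partial>M)"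
 and T_definite: "\<lbrakk>u \<in> V; (\<integral>x. T u x \<bullet> T u x \<partial>M) = 0\<rbrakk> \<Longrightarrow> u = 0"
 and \<Lambda>: "\<Lambda> \<ge> 0" and \<mu>: "\<mu> > 0" and \<tau>: "\<tau> \<ge> 0" and \<epsilon>: "\<epsilon> > 0"
 and f_add: "\<lbrakk>u \<in> V; v \<in> V\<rbrakk> \<Longrightarrow> f (u + v) = f u + f v"
 and f_scale: "u \<in> V \<Longrightarrow> f (c *\<^sub>R u) = c * f u"
 and f_bound: "u \<in> V \<Longrightarrow> f u \<le> \<Phi> * sqrt (\<integral>x. T u x \<bullet> T u x \<partial>M)"
 and \<Phi>: "\<Phi> \<ge> 0"
begin

abbreviation ie where "ie \<equiv> inverse \<epsilon>"

text \<open>Essentially bounded measurable functions. On a finite measure space they are integrable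
  and closed under products, which settles the integrability of every integrand below.\<close>

definition bm :: "('x \<Rightarrow> real) \<Rightarrow> bool" where
"bm h \<longleftrightarrow> h \<in> borel_measurable M \<and> (\<exists>C. AE x in M. \<bar>h x\<bar> \<le> C)"

lemma bm_integrable: "bm h \<Longrightarrow> integrable M h"
unfolding bm_def using integrable_const_bound[of h] by auto

lemma bm_mult: "\<lbrakk>bm g; bm h\<rbrakk> \<Longrightarrow> bm (\<lambda>x. g x * h x)"
proof -
assume "bm g" "bm h"
then obtain C D where "AE x in M. \<bar>g x\<bar> \<le> C" "AE x in M. \<bar>h x\<bar> \<le> D"
  and [measurable]: "g \<in> borel_measurable M" "h \<in> borel_measurable M" by (auto simp: bm_def)
from this(1,2) have "AE x in M. \<bar>g x * h x\<bar> \<le> C * D"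
 by eventually_elim (auto simp: abs_mult intro!: mult_mono)
thus ?thesis by (auto simp: bm_def)
qed

lemma bm_norm: "u \<in> V \<Longrightarrow> bm (\<lambda>x. norm (T u x))"
using T_bound[of u] by (auto simp: bm_def)

lemma bm_inner: "\<lbrakk>u \<in> V; v \<in> V\<rbrakk> \<Longrightarrow> bm (\<lambda>x. T u x \<bullet> T v x)"
proof -
assume uv: "u \<in> V" "v \<in> V"
then obtain C where C: "AE x in M. \<bar>norm (T u x) * norm (T v x)\<bar> \<le> C"
 using bm_mult[OF bm_norm bm_norm] by (auto simp: bm_def)
have "AE x in M. \<bar>T u x \<bullet> T v x\<bar> \<le> C"
 using C by eventually_elim (use Cauchy_Schwarz_ineq2 in \<open>fastforce intro: order.trans\<close>)
thus ?thesis using uv by (auto simp: bm_def)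
qed

definition ip where "ip u v = (\<integral>x. T u x \<bullet> T v x \<partial>M)"

definition rho where "rho u x = inverse (reg_abs \<epsilon> (T u x))"

lemma rho_bounds: "0 \<le> rho u x" "rho u x \<le> ie"
using inverse_reg_abs_bounds(1,2)[OF \<epsilon>] less_imp_le[OF reg_abs_bounds(3)[OF \<epsilon>]]
by (auto simp: rho_def)

lemma bm_rho: "u \<in> V \<Longrightarrow> bm (rho u)"
proof -
assume "u \<in> V"
hence [measurable]: "T u \<in> borel_measurable M" by simp
have "AE x in M. \<bar>rho u x\<bar> \<le> ie"
 using inverse_reg_abs_bounds(2)[OF \<epsilon>]
 by (auto simp: rho_def abs_of_pos[OF reg_abs_bounds(3)[OF \<epsilon>]])
moreover have "rho u \<in> borel_measurable M"
 unfolding rho_def by measurable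
ultimately show ?thesis by (auto simp: bm_def)
qed

abbreviation wi where "wi h u z \<equiv> \<integral>x. h x * (T u x \<bullet> T z x) \<partial>M"

text \<open>The left-hand side of the Picard equation with \<open>u\<close> frozen in the
  coefficient: for each \<open>u\<close> a positive definite form of its own.\<close>

definition wf where "wf u y z = 2 * \<mu> * ip y z + \<tau> * wi (rho u) y z"

lemma weighted_add:
assumes "bm h" "u \<in> V" "v \<in> V" "z \<in> V"
shows "wi h (u + v) z =
  wi h u z + wi h v z"
proof -
have "u + v \<in> V" using assms V by (auto intro: span_add)
have "wi h (u + v) z = (\<integral>x. h x * (T u x \<bullet> T z x) + h x * (T v x \<bullet> T z x) \<partial>M)"
proof (rule integral_cong_AE)
 show "AE x in M. h x * (T (u + v) x \<bullet> T z x) = h x * (T u x \<bullet> T z x) + h x * (T v x \<bullet> T z x)"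
  using T_add[OF assms(2,3)] by eventually_elim (simp add: inner_add_left algebra_simps)
qed (use assms \<open>u + v \<in> V\<close> in \<open>auto simp: bm_def\<close>)
also have "\<dots> = wi h u z + wi h v z"
 using assms by (intro Bochner_Integration.integral_add bm_integrable bm_mult bm_inner)
finally show ?thesis .
qed

lemma weighted_scale:
assumes "bm h" "u \<in> V" "z \<in> V"
shows "wi h (c *\<^sub>R u) z = c * wi h u z"
proof -
have "c *\<^sub>R u \<in> V" using assms V by (auto intro: span_scale)
have "wi h (c *\<^sub>R u) z = (\<integral>x. c * (h x * (T u x \<bullet> T z x)) \<partial>M)"
proof (rule integral_cong_AE)
 show "AE x in M. h x * (T (c *\<^sub>R u) x \<bullet> T z x) = c * (h x * (T u x \<bullet> T z x))"
  using T_scale[OF assms(2), of c] by eventually_elim simp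
qed (use assms \<open>c *\<^sub>R u \<in> V\<close> in \<open>auto simp: bm_def\<close>)
thus ?thesis by simp
qed

lemma bm_1: "bm (\<lambda>x. 1)" by (auto simp: bm_def)

lemma subV: "subspace V" using V by (simp add: subspace_span)

sublocale pos_form V ip
proof
fix u v w assume uv: "u \<in> V" "v \<in> V" "w \<in> V"
show "ip (u + v) w = ip u w + ip v w"
 using weighted_add[OF bm_1 uv] by (simp add: ip_def)
show "ip u v = ip v u" by (simp add: ip_def inner_commute)
next
fix u w c assume uv: "u \<in> V" "w \<in> V"
show "ip (c *\<^sub>R u) w = c * ip u w"
 using weighted_scale[OF bm_1 uv] by (simp add: ip_def)
next
fix u assume "u \<in> V"
show "0 \<le> ip u u" by (simp add: ip_def)
show "u = 0" if "ip u u = 0" using T_definite \<open>u \<in> V\<close> that by (simp add: ip_def)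
qed (rule subV)

lemma T_bound': "u \<in> V \<Longrightarrow> AE x in M. norm (T u x) \<le> \<Lambda> * nm u"
using T_bound by (simp add: nm_def ip_def)

lemma f_bound': "u \<in> V \<Longrightarrow> f u \<le> \<Phi> * nm u"
using f_bound by (simp add: nm_def ip_def)

text \<open>Cauchy-Schwarz for the product of the pointwise norms, from Young's inequality with the
  optimal ratio \<open>nm v / nm u\<close>. The inequality for \<open>ip\<close> would not suffice,
  since the integrands are estimated pointwise before integration.\<close>

lemma norm_integral:
assumes "u \<in> V" "v \<in> V"
shows "(\<integral>x. norm (T u x) * norm (T v x) \<partial>M) \<le> nm u * nm v"
proof -
define h where "h = (\<lambda>x. norm (T u x) * norm (T v x))"
have sq: "norm (T y x) * norm (T y x) = T y x \<bullet> T y x" for y x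
 by (simp add: norm_eq_sqrt_inner)
have ine: "(\<integral>x. h x \<partial>M) \<le> (ip u u * s + ip v v * inverse s) / 2" if "s > 0" for s
proof -
 have "(\<integral>x. h x \<partial>M) \<le> (\<integral>x. (T u x \<bullet> T u x) * (s/2) + (T v x \<bullet> T v x) * (inverse s / 2) \<partial>M)"
 proof (rule integral_mono)
  show "integrable M h"
  unfolding h_def by (intro bm_integrable bm_mult bm_norm assms)
  show "integrable M (\<lambda>x. (T u x \<bullet> T u x) * (s/2) + (T v x \<bullet> T v x) * (inverse s / 2))"
  by (intro Bochner_Integration.integrable_add integrable_mult_left bm_integrable bm_inner assms)
  fix x
  have "0 \<le> (s * norm (T u x) - norm (T v x))\<^sup>2 * inverse s" using that by simp
  also have "\<dots> = s * (norm (T u x) * norm (T u x)) - 2 * h x + norm (T v x) * norm (T v x) * inverse s"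
  using that by (simp add: h_def power2_eq_square field_simps)
  finally show "h x \<le> (T u x \<bullet> T u x) * (s/2) + (T v x \<bullet> T v x) * (inverse s / 2)"
  unfolding sq by (simp add: field_simps)
 qed
 also have "\<dots> = (ip u u * s + ip v v * inverse s) / 2"
  by (subst Bochner_Integration.integral_add; (intro integrable_mult_left bm_integrable bm_inner assms)?)
  (simp add: ip_def add_divide_distrib)
 finally show ?thesis .
qed
show ?thesis
proof (cases "u = 0 \<or> v = 0")
 case True
 have "AE x in M. h x = 0"
  using True T_scale[OF assms(1), of 0] T_scale[OF assms(2), of 0] by (auto simp: h_def)
 hence "(\<integral>x. h x \<partial>M) = 0" by (rule integral_eq_zero_AE)
 thus ?thesis using assms by (simp add: h_def[abs_def])
next
 case False
 hence pos: "nm u > 0" "nm v > 0" using nm_eq_0 nm_nonneg assms by (metis order_less_le)+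
 have "(\<integral>x. h x \<partial>M) \<le> ((nm u)\<^sup>2 * (nm v / nm u) + (nm v)\<^sup>2 * inverse (nm v / nm u)) / 2"
  using ine[of "nm v / nm u"] pos assms by (simp add: nm_sq)
 also have "\<dots> = nm u * nm v" using pos by (simp add: power2_eq_square field_simps)
 finally show ?thesis by (simp add: h_def[abs_def])
qed
qed

lemma weighted_bound:
assumes "bm h" "y \<in> V" "z \<in> V" "K \<ge> 0"
 and "AE x in M. \<bar>h x\<bar> \<le> K * norm (T y x) * norm (T z x)"
shows "(\<integral>x. h x \<partial>M) \<le> K * nm y * nm z"
proof -
have "(\<integral>x. h x \<partial>M) \<le> (\<integral>x. K * (norm (T y x) * norm (T z x)) \<partial>M)"
 using assms(5) by (intro integral_mono_AE bm_integrable assms bm_mult bm_norm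
  integrable_mult_right) (auto simp: mult.assoc)
also have "\<dots> \<le> K * (nm y * nm z)"
 using norm_integral[OF assms(2,3)] assms(4) by (simp add: mult_left_mono)
finally show ?thesis by simp
qed

section \<open>The linear problems with a frozen coefficient\<close>

lemma pos_form_wf: "u \<in> V \<Longrightarrow> pos_form V (wf u)"
proof
assume u: "u \<in> V"
fix y v w assume uv: "y \<in> V" "v \<in> V" "w \<in> V"
show "wf u (y + v) w = wf u y w + wf u v w"
 using weighted_add[OF bm_rho[OF u] uv] uv by (simp add: wf_def ip_add algebra_simps)
show "wf u y v = wf u v y" using uv by (simp add: wf_def inner_commute ip_sym)
next
assume u: "u \<in> V"
fix y w c assume uv: "y \<in> V" "w \<in> V"
show "wf u (c *\<^sub>R y) w = c * wf u y w"
 using weighted_scale[OF bm_rho[OF u] uv] uv by (simp add: wf_def ip_scale algebra_simps)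
next
assume u: "u \<in> V"
fix y assume y: "y \<in> V"
have "0 \<le> wi (rho u) y y"
 by (intro integral_nonneg_AE AE_I2 mult_nonneg_nonneg rho_bounds) auto
hence *: "2 * \<mu> * ip y y \<le> wf u y y" using \<tau> by (simp add: wf_def)
moreover have "0 \<le> 2 * \<mu> * ip y y" using ip_nonneg[OF y] \<mu> by simp
ultimately show "0 \<le> wf u y y" by linarith
show "y = 0" if "wf u y y = 0"
 using * that ip_nonneg[OF y] \<mu> ip_definite[OF y]
 by (metis mult_pos_pos not_less order_less_le zero_less_numeral)
qed (rule subV)

lemma coercive: "\<lbrakk>u \<in> V; y \<in> V\<rbrakk> \<Longrightarrow> 2 * \<mu> * (nm y)\<^sup>2 + \<tau> * wi (rho u) y y = wf u y y"
by (simp add: wf_def nm_sq)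

lemma coercive_le: "\<lbrakk>u \<in> V; y \<in> V\<rbrakk> \<Longrightarrow> 2 * \<mu> * (nm y)\<^sup>2 \<le> wf u y y"
proof -
assume "u \<in> V" "y \<in> V"
have "0 \<le> wi (rho u) y y"
 by (intro integral_nonneg_AE AE_I2 mult_nonneg_nonneg rho_bounds) auto
thus ?thesis using \<tau> coercive[OF \<open>u \<in> V\<close> \<open>y \<in> V\<close>] by (smt (verit) mult_nonneg_nonneg)
qed

lemma solve:
assumes u: "u \<in> V" and L: "\<And>y z. \<lbrakk>y \<in> V; z \<in> V\<rbrakk> \<Longrightarrow> L (y + z) = L y + L z"
 "\<And>y c. y \<in> V \<Longrightarrow> L (c *\<^sub>R y) = c * (L y :: real)"
shows "\<exists>!p. p \<in> V \<and> (\<forall>v\<in>V. wf u p v = L v)"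
proof -
interpret W: pos_form V "wf u" by (rule pos_form_wf[OF u])
obtain p where p: "p \<in> V" "\<forall>v\<in>V. wf u p v = L v"
 using W.riesz[of Bs L] V L by auto
moreover have "q = p" if q: "q \<in> V" "\<forall>v\<in>V. wf u q v = L v" for q
proof -
 have "wf u (q - p) (q - p) = 0" using p q V_simps(3)[of q p] by (simp add: W.ip_diff)
 thus ?thesis using W.ip_definite[of "q - p"] p q V_simps(3)[of q p] by simp
qed
ultimately show ?thesis by blast
qed

definition G where "G u = (THE p. p \<in> V \<and> (\<forall>v\<in>V. wf u p v = f v))"

lemma G: "u \<in> V \<Longrightarrow> G u \<in> V" "\<lbrakk>u \<in> V; v \<in> V\<rbrakk> \<Longrightarrow> wf u (G u) v = f v"
using theI'[OF solve[of u f, OF _ f_add f_scale]] by (auto simp: G_def)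

lemma G_bound: "u \<in> V \<Longrightarrow> nm (G u) \<le> \<Phi> / (2 * \<mu>)"
proof -
assume u: "u \<in> V"
have "2 * \<mu> * (nm (G u))\<^sup>2 \<le> \<Phi> * nm (G u)"
 using coercive_le[OF u G(1)[OF u]] G(2)[OF u G(1)[OF u]] f_bound'[OF G(1)[OF u]] by linarith
hence "nm (G u) * (2 * \<mu> * nm (G u)) \<le> nm (G u) * \<Phi>"
 by (simp add: power2_eq_square algebra_simps)
hence "nm (G u) = 0 \<or> 2 * \<mu> * nm (G u) \<le> \<Phi>"
 using nm_nonneg[OF G(1)[OF u]] by (smt (verit) mult_left_le_imp_le)
thus ?thesis using \<mu> \<Phi> by (auto simp: field_simps)
qed

section \<open>The difference operator of the Picard map and its bounds\<close>

definition bq where "bq u v y x = coef_dd \<epsilon> (T u x) (T v x) \<bullet> T y x"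

text \<open>Subtracting the equations, \<open>wf u (G u - G v) z\<close> equals
  \<open>\<tau>\<close> times the integral of
  \<open>(rho v - rho u) (T (G v) \<bullet> T z)\<close>. The divided difference makes
  \<open>rho v - rho u\<close> linear in \<open>u - v\<close>; replacing \<open>u - v\<close> by an
  arbitrary \<open>y\<close> defines this operator.\<close>

definition B where "B u v y = (THE p. p \<in> V \<and>
 (\<forall>z\<in>V. wf u p z = \<tau> * wi (bq u v y) (G v) z))"

lemma bq_bound: "\<bar>bq u v y x\<bar> \<le> rho u x * rho v x * norm (T y x)"
unfolding bq_def rho_def
by (rule order.trans[OF Cauchy_Schwarz_ineq2]) (intro mult_right_mono norm_coef_dd \<epsilon> norm_ge_zero)

lemma bq_bound': "\<bar>bq u v y x\<bar> \<le> ie ^ 2 * norm (T y x)"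
proof -
have "rho u x * rho v x \<le> ie * ie"
 using rho_bounds \<epsilon> by (intro mult_mono) auto
hence "rho u x * rho v x * norm (T y x) \<le> ie * ie * norm (T y x)"
 by (rule mult_right_mono) simp
thus ?thesis using bq_bound[of u v y x] by (simp add: power2_eq_square)
qed

lemma bm_bq: "\<lbrakk>u \<in> V; v \<in> V; y \<in> V\<rbrakk> \<Longrightarrow> bm (bq u v y)"
proof -
assume uv: "u \<in> V" "v \<in> V" "y \<in> V"
hence [measurable]: "T u \<in> borel_measurable M" "T v \<in> borel_measurable M" "T y \<in> borel_measurable M" by auto
have "AE x in M. \<bar>bq u v y x\<bar> \<le> ie ^ 2 * (\<Lambda> * nm y)"
 using T_bound'[OF uv(3)]
 by eventually_elim (rule order.trans[OF bq_bound'], intro mult_left_mono, auto)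
moreover have "bq u v y \<in> borel_measurable M"
 unfolding bq_def coef_dd_def by measurable
ultimately show ?thesis by (auto simp: bm_def)
qed

lemma B: assumes "u \<in> V" "v \<in> V" "y \<in> V"
shows "B u v y \<in> V" "\<And>z. z \<in> V \<Longrightarrow> wf u (B u v y) z = \<tau> * wi (bq u v y) (G v) z"
proof -
have "\<exists>!p. p \<in> V \<and> (\<forall>z\<in>V. wf u p z = \<tau> * wi (bq u v y) (G v) z)"
proof (rule solve[OF assms(1)])
 note bm = bm_bq[OF assms]
 show "\<tau> * wi (bq u v y) (G v) (z + z')
  = \<tau> * wi (bq u v y) (G v) z + \<tau> * wi (bq u v y) (G v) z'"
  if "z \<in> V" "z' \<in> V" for z z'
  using weighted_add[OF bm that G(1)[OF assms(2)]] by (simp add: inner_commute algebra_simps)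
 show "\<tau> * wi (bq u v y) (G v) (c *\<^sub>R z)
  = c * (\<tau> * wi (bq u v y) (G v) z)" if "z \<in> V" for z c
  using weighted_scale[OF bm that G(1)[OF assms(2)], of c] by (simp add: inner_commute algebra_simps)
qed
from theI'[OF this] show "B u v y \<in> V" "\<And>z. z \<in> V \<Longrightarrow> wf u (B u v y) z = \<tau> * wi (bq u v y) (G v) z"
 by (auto simp: B_def)
qed

lemma wf_unique: "\<lbrakk>u \<in> V; p \<in> V; q \<in> V; \<And>z. z \<in> V \<Longrightarrow> wf u p z = wf u q z\<rbrakk> \<Longrightarrow> p = q"
proof -
assume a: "u \<in> V" "p \<in> V" "q \<in> V" "\<And>z. z \<in> V \<Longrightarrow> wf u p z = wf u q z"
interpret W: pos_form V "wf u" by (rule pos_form_wf[OF a(1)])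
show ?thesis using a W.ip_definite[of "p - q"] V_simps(3)[of p q] by (simp add: W.ip_diff)
qed

lemma bm_bq_inner: "\<lbrakk>u \<in> V; v \<in> V; y \<in> V; w \<in> V; z \<in> V\<rbrakk> \<Longrightarrow> integrable M (\<lambda>x. bq u v y x * (T w x \<bullet> T z x))"
by (intro bm_integrable bm_mult bm_bq bm_inner)

lemma B_add: assumes "u \<in> V" "v \<in> V" "y \<in> V" "y' \<in> V"
shows "B u v (y + y') = B u v y + B u v y'"
proof (rule wf_unique[OF assms(1)])
interpret W: pos_form V "wf u" by (rule pos_form_wf[OF assms(1)])
fix z assume z: "z \<in> V"
note Gv = G(1)[OF assms(2)]
have yy: "y + y' \<in> V" using assms by simp
have "(\<integral>x. bq u v (y + y') x * (T (G v) x \<bullet> T z x) \<partial>M)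
  = (\<integral>x. bq u v y x * (T (G v) x \<bullet> T z x) + bq u v y' x * (T (G v) x \<bullet> T z x) \<partial>M)"
proof (rule integral_cong_AE)
 show "AE x in M. bq u v (y + y') x * (T (G v) x \<bullet> T z x) = bq u v y x * (T (G v) x \<bullet> T z x) + bq u v y' x * (T (G v) x \<bullet> T z x)"
  using T_add[OF assms(3,4)] by eventually_elim (simp add: bq_def inner_add_right algebra_simps)
qed (use bm_bq_inner[OF assms(1,2) _ Gv z] yy assms(3,4) in \<open>auto intro!: borel_measurable_integrable Bochner_Integration.integrable_add\<close>)
also have "\<dots> = wi (bq u v y) (G v) z + wi (bq u v y') (G v) z"
 by (intro Bochner_Integration.integral_add bm_bq_inner assms Gv z)
finally show "wf u (B u v (y + y')) z = wf u (B u v y + B u v y') z"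
 using assms z yy B by (simp add: W.ip_add algebra_simps)
qed (use assms B in auto)

lemma B_scale: assumes "u \<in> V" "v \<in> V" "y \<in> V"
shows "B u v (c *\<^sub>R y) = c *\<^sub>R B u v y"
proof (rule wf_unique[OF assms(1)])
interpret W: pos_form V "wf u" by (rule pos_form_wf[OF assms(1)])
fix z assume z: "z \<in> V"
note Gv = G(1)[OF assms(2)]
have yy: "c *\<^sub>R y \<in> V" using assms by simp
have "(\<integral>x. bq u v (c *\<^sub>R y) x * (T (G v) x \<bullet> T z x) \<partial>M) = (\<integral>x. c * (bq u v y x * (T (G v) x \<bullet> T z x)) \<partial>M)"
proof (rule integral_cong_AE)
 show "AE x in M. bq u v (c *\<^sub>R y) x * (T (G v) x \<bullet> T z x) = c * (bq u v y x * (T (G v) x \<bullet> T z x))"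
  using T_scale[OF assms(3), of c] by eventually_elim (simp add: bq_def)
qed (use bm_bq_inner[OF assms(1,2) _ Gv z] yy assms(3) in \<open>auto intro!: borel_measurable_integrable integrable_mult_right\<close>)
thus "wf u (B u v (c *\<^sub>R y)) z = wf u (c *\<^sub>R B u v y) z"
 using assms z yy B by (simp add: W.ip_scale)
qed (use assms B in auto)

lemma T_diff: "\<lbrakk>u \<in> V; v \<in> V\<rbrakk> \<Longrightarrow> AE x in M. T (u - v) x = T u x - T v x"
using T_add[of u "(-1) *\<^sub>R v"] T_scale[of v "-1"] V_simps(4)[of v "-1"]
by auto

lemma G_diff: assumes "u \<in> V" "v \<in> V"
shows "G u - G v = B u v (u - v)"
proof (rule wf_unique[OF assms(1)])
interpret W: pos_form V "wf u" by (rule pos_form_wf[OF assms(1)])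
fix z assume z: "z \<in> V"
note Gv = G(1)[OF assms(2)] and Gu = G(1)[OF assms(1)]
have uv: "u - v \<in> V" using assms by simp
have "(\<integral>x. bq u v (u - v) x * (T (G v) x \<bullet> T z x) \<partial>M)
  = (\<integral>x. rho v x * (T (G v) x \<bullet> T z x) - rho u x * (T (G v) x \<bullet> T z x) \<partial>M)"
proof (rule integral_cong_AE)
 show "AE x in M. bq u v (u - v) x * (T (G v) x \<bullet> T z x) = rho v x * (T (G v) x \<bullet> T z x) - rho u x * (T (G v) x \<bullet> T z x)"
  using T_diff[OF assms]
  by eventually_elim (simp add: bq_def coef_dd[OF \<epsilon>] rho_def left_diff_distrib)
next
 show "(\<lambda>x. rho v x * (T (G v) x \<bullet> T z x) - rho u x * (T (G v) x \<bullet> T z x)) \<in> borel_measurable M"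
  by (intro borel_measurable_integrable Bochner_Integration.integrable_diff bm_integrable bm_mult bm_rho bm_inner assms Gv z)
qed (use bm_bq_inner[OF assms uv Gv z] in auto)
also have "\<dots> = wi (rho v) (G v) z - wi (rho u) (G v) z"
 by (intro Bochner_Integration.integral_diff bm_integrable bm_mult bm_rho bm_inner assms Gv z)
finally have "\<tau> * (\<integral>x. bq u v (u - v) x * (T (G v) x \<bullet> T z x) \<partial>M)
  = \<tau> * wi (rho v) (G v) z - \<tau> * wi (rho u) (G v) z"
 by (simp only: right_diff_distrib)
hence "wf u (B u v (u - v)) z = wf v (G v) z - wf u (G v) z"
 using B(2)[OF assms uv z] by (simp add: wf_def)
also have "wf v (G v) z = wf u (G u) z" using G(2) assms z by simp
finally show "wf u (G u - G v) z = wf u (B u v (u - v)) z"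
 using Gu Gv z by (simp add: W.ip_diff)
qed (use assms B G in auto)

text \<open>The square contains the maximum-norm bound
  \<open>\<Lambda> * \<Phi> / (2 * \<mu>)\<close> of \<open>T (G v)\<close>. The 8 is the 4 of
  Young's inequality times the 2 of the coercivity constant \<open>2 * \<mu>\<close>.\<close>

definition CG where "CG = sqrt (\<tau> * ie ^ 3 * (\<Lambda> * \<Phi> / (2 * \<mu>))\<^sup>2 / (8 * \<mu>))"

text \<open>The summand \<open>CG\<close> bounds the changes of \<open>G v\<close> and of the form;
  the other one comes from the Lipschitz constant \<open>2 * ie ^ 3\<close> of the divided
  difference. The prefactor contains the division by \<open>2 * \<mu>\<close>.\<close>

definition CH where "CH = \<tau> * ie ^ 2 * \<Lambda> / (2 * \<mu>) * (CG + 2 * ie * \<Lambda> * \<Phi> / (2 * \<mu>))"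

lemma CG_nonneg: "CG \<ge> 0" and CH_nonneg: "CH \<ge> 0"
using \<tau> \<epsilon> \<mu> \<Lambda> \<Phi> by (simp_all add: CG_def CH_def)

lemma G_sup: "v \<in> V \<Longrightarrow> AE x in M. norm (T (G v) x) \<le> \<Lambda> * \<Phi> / (2 * \<mu>)"
proof -
assume v: "v \<in> V"
show ?thesis
 using T_bound'[OF G(1)[OF v]]
 by eventually_elim (use mult_left_mono[OF G_bound[OF v] \<Lambda>] in simp)
qed

text \<open>The equation is tested with its own solution \<open>b\<close>. Young's inequality is
  applied under the weight \<open>rho u\<close>, so that the quadratic term in \<open>T b\<close> is
  the yield-stress term of the form itself.\<close>

lemma B_bound: assumes "u \<in> V" "v \<in> V" "y \<in> V"
shows "nm (B u v y) \<le> CG * nm y"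
proof -
define K where "K = \<Lambda> * \<Phi> / (2 * \<mu>)"
define b where "b = B u v y"
have bV: "b \<in> V" using B(1)[OF assms] by (simp add: b_def)
have "wi (bq u v y) (G v) b
  \<le> (\<integral>x. rho u x * (T b x \<bullet> T b x) + (ie ^ 3 * K\<^sup>2 / 4) * (T y x \<bullet> T y x) \<partial>M)"
proof (rule integral_mono_AE)
 show "AE x in M. bq u v y x * (T (G v) x \<bullet> T b x) \<le> rho u x * (T b x \<bullet> T b x) + (ie ^ 3 * K\<^sup>2 / 4) * (T y x \<bullet> T y x)"
  using G_sup[OF assms(2)]
 proof eventually_elim
  case (elim x)
  define p r s where "p = norm (T b x)" and "r = rho v x * norm (T (G v) x) * norm (T y x)" and "s = rho u x"
  have s: "0 \<le> s" "s \<le> ie" using rho_bounds by (auto simp: s_def)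
  have r0: "r \<ge> 0" using rho_bounds by (simp add: r_def)
  have "bq u v y x * (T (G v) x \<bullet> T b x) \<le> \<bar>bq u v y x\<bar> * \<bar>T (G v) x \<bullet> T b x\<bar>"
  by (metis abs_ge_self abs_mult)
  also have "\<dots> \<le> (rho u x * rho v x * norm (T y x)) * (norm (T (G v) x) * norm (T b x))"
  using rho_bounds by (intro mult_mono bq_bound Cauchy_Schwarz_ineq2) auto
  also have "\<dots> = s * (p * r)" by (simp add: s_def p_def r_def)
  \<comment> \<open>The split into 1 and 1/4 gives the term in \<open>p\<close> precisely the
    coefficient that can be absorbed.\<close>
  also have "\<dots> \<le> s * (p\<^sup>2 + r\<^sup>2 / 4)"
  proof (rule mult_left_mono[OF _ s(1)])
  have "0 \<le> (p - r/2)\<^sup>2" by simp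
  thus "p * r \<le> p\<^sup>2 + r\<^sup>2 / 4" by (simp add: power2_eq_square algebra_simps)
  qed
  also have "s * (p\<^sup>2 + r\<^sup>2/4) = s * p\<^sup>2 + s * r\<^sup>2 / 4" by (simp add: algebra_simps)
  also have "s * r\<^sup>2 \<le> ie * (ie * K * norm (T y x))\<^sup>2"
  proof (intro mult_mono power_mono s r0)
  have "rho v x * norm (T (G v) x) \<le> ie * K"
  using elim rho_bounds \<epsilon> by (intro mult_mono) (auto simp: K_def)
  thus "r \<le> ie * K * norm (T y x)"
  unfolding r_def by (rule mult_right_mono) simp
  qed (use \<epsilon> in auto)
  also have "ie * (ie * K * norm (T y x))\<^sup>2 = ie ^ 3 * K\<^sup>2 * (norm (T y x))\<^sup>2"
  by (simp add: power_mult_distrib power2_eq_square power3_eq_cube)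
  finally show ?case by (simp add: p_def s_def dot_square_norm)
 qed
 show "integrable M (\<lambda>x. rho u x * (T b x \<bullet> T b x) + ie ^ 3 * K\<^sup>2 / 4 * (T y x \<bullet> T y x))"
  by (intro Bochner_Integration.integrable_add integrable_mult_right bm_integrable bm_mult bm_rho bm_inner assms bV)
qed (intro bm_bq_inner assms bV G)
also have "\<dots> = wi (rho u) b b + (ie ^ 3 * K\<^sup>2 / 4) * ip y y"
 unfolding ip_def integral_mult_right_zero[symmetric]
 by (intro Bochner_Integration.integral_add integrable_mult_right bm_integrable bm_mult bm_rho bm_inner assms bV)
\<comment> \<open>The integral \<open>wi (rho u) b b\<close> occurs with factor
  \<open>\<tau>\<close> on both sides and cancels, leaving the viscous part alone.\<close>
finally have "wf u b b \<le> \<tau> * (wi (rho u) b b + (ie ^ 3 * K\<^sup>2 / 4) * ip y y)"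
 using B(2)[OF assms bV] \<tau> by (simp add: b_def mult_left_mono)
hence "2 * \<mu> * (nm b)\<^sup>2 \<le> \<tau> * ((ie ^ 3 * K\<^sup>2 / 4) * (nm y)\<^sup>2)"
 unfolding coercive[OF assms(1) bV, symmetric] using assms by (simp add: nm_sq algebra_simps)
hence "(2 * \<mu> * (nm b)\<^sup>2) / (2 * \<mu>) \<le> \<tau> * ((ie ^ 3 * K\<^sup>2 / 4) * (nm y)\<^sup>2) / (2 * \<mu>)"
 using \<mu> by (intro divide_right_mono) auto
hence "(nm b)\<^sup>2 \<le> \<tau> * ie ^ 3 * K\<^sup>2 / (8 * \<mu>) * (nm y)\<^sup>2"
 using \<mu> by (simp add: mult.assoc)
hence "sqrt ((nm b)\<^sup>2) \<le> sqrt (\<tau> * ie ^ 3 * K\<^sup>2 / (8 * \<mu>) * (nm y)\<^sup>2)"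
 by (rule real_sqrt_le_mono)
thus ?thesis
 using bV assms by (simp only: real_sqrt_mult CG_def K_def b_def) simp
qed

text \<open>The difference \<open>d\<close> of the two solutions is tested with itself in the form
  of \<open>u\<close>. Three things change: the function \<open>G v\<close>, the divided difference
  and the form; each of \<open>i1\<close>, \<open>i2\<close>, \<open>i3\<close> isolates
  one.\<close>

lemma B_lip: assumes "u \<in> V" "v \<in> V" "u' \<in> V" "v' \<in> V" "y \<in> V"
shows "nm (B u v y - B u' v' y) \<le> CH * (nm (u - u') + nm (v - v')) * nm y"
proof -
interpret W: pos_form V "wf u" by (rule pos_form_wf[OF assms(1)])
define b b' d where "b = B u v y" and "b' = B u' v' y" and "d = b - b'"
have bV: "b \<in> V" "b' \<in> V" "d \<in> V" using B(1) assms by (auto simp: b_def b'_def d_def)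
have GV: "G v \<in> V" "G v' \<in> V" "G v - G v' \<in> V" using G assms by auto
have uV: "u - u' \<in> V" "v - v' \<in> V" using assms by auto
define K where "K = \<Lambda> * \<Phi> / (2 * \<mu>)"
have K0: "K \<ge> 0" using \<Lambda> \<Phi> \<mu> by (simp add: K_def)
define i1 i2 i3 where "i1 x = bq u v y x * (T (G v - G v') x \<bullet> T d x)"
 and "i2 x = (bq u v y x - bq u' v' y x) * (T (G v') x \<bullet> T d x)"
 and "i3 x = (rho u' x - rho u x) * (T b' x \<bullet> T d x)" for x
have bm_diff: "bm (\<lambda>x. g x - h x)" if "bm g" "bm h" for g h
proof -
 obtain C D where "AE x in M. \<bar>g x\<bar> \<le> C" "AE x in M. \<bar>h x\<bar> \<le> D" using \<open>bm g\<close> \<open>bm h\<close> by (auto simp: bm_def)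
 hence "AE x in M. \<bar>g x - h x\<bar> \<le> C + D" by eventually_elim linarith
 thus ?thesis using that by (auto simp: bm_def)
qed
have bm: "bm i1" "bm i2" "bm i3"
 unfolding i1_def i2_def i3_def using assms bV GV
 by (intro bm_mult bm_bq bm_inner bm_diff bm_rho; simp)+
have "wf u d d = wf u b d - wf u' b' d + (wf u' b' d - wf u b' d)"
 using bV by (simp add: d_def W.ip_diff)
also have "\<dots> = \<tau> * (wi (bq u v y) (G v) d - wi (bq u' v' y) (G v') d
  + (wi (rho u') b' d - wi (rho u) b' d))"
 using B(2)[OF assms(1,2,5) bV(3)] B(2)[OF assms(3,4,5) bV(3)]
 by (simp add: b_def b'_def wf_def algebra_simps)
also have "\<dots> = \<tau> * (\<integral>x. i1 x + i2 x + i3 x \<partial>M)"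
proof -
 have "(\<integral>x. i1 x + i2 x + i3 x \<partial>M) = (\<integral>x. (bq u v y x * (T (G v) x \<bullet> T d x) - bq u' v' y x * (T (G v') x \<bullet> T d x))
  + (rho u' x * (T b' x \<bullet> T d x) - rho u x * (T b' x \<bullet> T d x)) \<partial>M)"
 proof (rule integral_cong_AE)
  show "AE x in M. i1 x + i2 x + i3 x = (bq u v y x * (T (G v) x \<bullet> T d x) - bq u' v' y x * (T (G v') x \<bullet> T d x))
  + (rho u' x * (T b' x \<bullet> T d x) - rho u x * (T b' x \<bullet> T d x))"
  using T_diff[OF GV(1,2)]
  by eventually_elim (simp add: i1_def i2_def i3_def inner_diff_left left_diff_distrib right_diff_distrib)
  show "(\<lambda>x. i1 x + i2 x + i3 x) \<in> borel_measurable M" using bm by (auto simp: bm_def)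
 qed (intro borel_measurable_integrable Bochner_Integration.integrable_diff Bochner_Integration.integrable_add
  bm_integrable bm_mult bm_bq bm_rho bm_inner assms bV GV)
 also have "\<dots> = wi (bq u v y) (G v) d - wi (bq u' v' y) (G v') d
  + (wi (rho u') b' d - wi (rho u) b' d)"
  by (simp add: Bochner_Integration.integral_add Bochner_Integration.integral_diff
  bm_integrable bm_mult bm_bq bm_rho bm_inner assms bV GV)
 finally show ?thesis by simp
qed
also have "(\<integral>x. i1 x + i2 x + i3 x \<partial>M) = (\<integral>x. i1 x \<partial>M) + (\<integral>x. i2 x \<partial>M) + (\<integral>x. i3 x \<partial>M)"
 using bm by (simp add: bm_integrable)
finally have eq: "wf u d d = \<tau> * ((\<integral>x. i1 x \<partial>M) + (\<integral>x. i2 x \<partial>M) + (\<integral>x. i3 x \<partial>M))" .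
have y0: "0 \<le> \<Lambda> * nm y" using \<Lambda> assms by simp
have 1: "(\<integral>x. i1 x \<partial>M) \<le> (ie ^ 2 * (\<Lambda> * nm y)) * nm (G v - G v') * nm d"
proof (rule weighted_bound[OF bm(1) GV(3) bV(3)])
 show "AE x in M. \<bar>i1 x\<bar> \<le> ie ^ 2 * (\<Lambda> * nm y) * norm (T (G v - G v') x) * norm (T d x)"
  using T_bound'[OF assms(5)]
 proof eventually_elim
  case (elim x)
  have "\<bar>i1 x\<bar> \<le> (ie ^ 2 * norm (T y x)) * (norm (T (G v - G v') x) * norm (T d x))"
  unfolding i1_def abs_mult using \<epsilon> by (intro mult_mono bq_bound' Cauchy_Schwarz_ineq2) auto
  also have "\<dots> \<le> (ie ^ 2 * (\<Lambda> * nm y)) * (norm (T (G v - G v') x) * norm (T d x))"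
  using elim by (intro mult_right_mono mult_left_mono) auto
  finally show ?case by (simp add: mult.assoc)
 qed
qed (use y0 in auto)
\<comment> \<open>The operator bound also shows that \<open>G\<close> is Lipschitz with constant
  \<open>CG\<close>, via the exact identity.\<close>
have "nm (G v - G v') \<le> CG * nm (v - v')"
 unfolding G_diff[OF assms(2,4)] using assms by (intro B_bound) auto
hence 1: "(\<integral>x. i1 x \<partial>M) \<le> (ie ^ 2 * (\<Lambda> * nm y)) * (CG * nm (v - v')) * nm d"
 using y0 bV by (intro order.trans[OF 1] mult_right_mono mult_left_mono) auto
define L where "L = 2 * ie ^ 3 * (\<Lambda> * nm y) * K"
have L0: "L \<ge> 0" using \<epsilon> y0 K0 by (simp add: L_def)
define h where "h z x = L * (norm (T z x) * norm (T d x))" for z x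
have bmh: "bm (h z)" if "z \<in> V" for z unfolding h_def
 using that bV by (intro bm_mult bm_norm) (auto simp: bm_def)
have "(\<integral>x. i2 x \<partial>M) \<le> (\<integral>x. h (u - u') x + h (v - v') x \<partial>M)"
proof (rule integral_mono_AE)
 show "AE x in M. i2 x \<le> h (u - u') x + h (v - v') x"
  using T_bound'[OF assms(5)] G_sup[OF assms(4)] T_diff[OF assms(1,3)] T_diff[OF assms(2,4)]
 proof eventually_elim
  case (elim x)
  have "\<bar>bq u v y x - bq u' v' y x\<bar> \<le> norm (coef_dd \<epsilon> (T u x) (T v x) - coef_dd \<epsilon> (T u' x) (T v' x)) * norm (T y x)"
  unfolding bq_def inner_diff_left[symmetric] by (rule Cauchy_Schwarz_ineq2)
  also have "\<dots> \<le> (2 * ie ^ 3 * (norm (T (u - u') x) + norm (T (v - v') x))) * (\<Lambda> * nm y)"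
  using elim coef_dd_lipschitz[OF \<epsilon>, of "T u x" "T v x" "T u' x" "T v' x"] \<epsilon>
  by (intro mult_mono) (auto intro!: mult_nonneg_nonneg)
  finally have a: "\<bar>bq u v y x - bq u' v' y x\<bar> \<le> (2 * ie ^ 3 * (norm (T (u - u') x) + norm (T (v - v') x))) * (\<Lambda> * nm y)" .
  have c: "\<bar>T (G v') x \<bullet> T d x\<bar> \<le> K * norm (T d x)"
  using elim by (intro order.trans[OF Cauchy_Schwarz_ineq2] mult_right_mono) (auto simp: K_def)
  have "i2 x \<le> \<bar>bq u v y x - bq u' v' y x\<bar> * \<bar>T (G v') x \<bullet> T d x\<bar>"
  unfolding i2_def by (metis abs_ge_self abs_mult)
  also have "\<dots> \<le> ((2 * ie ^ 3 * (norm (T (u - u') x) + norm (T (v - v') x))) * (\<Lambda> * nm y)) * (K * norm (T d x))"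
  using order.trans[OF abs_ge_zero a] by (intro mult_mono a c) auto
  finally show ?case by (simp add: h_def L_def algebra_simps)
 qed
qed (rule bm_integrable[OF bm(2)], intro Bochner_Integration.integrable_add bm_integrable[OF bmh] uV)
also have "\<dots> = L * (\<integral>x. norm (T (u - u') x) * norm (T d x) \<partial>M) + L * (\<integral>x. norm (T (v - v') x) * norm (T d x) \<partial>M)"
 unfolding Bochner_Integration.integral_add[OF bm_integrable[OF bmh[OF uV(1)]] bm_integrable[OF bmh[OF uV(2)]]]
 by (simp add: h_def[abs_def])
also have "\<dots> \<le> L * (nm (u - u') * nm d) + L * (nm (v - v') * nm d)"
 using norm_integral uV bV L0 by (intro add_mono mult_left_mono) auto
finally have 2: "(\<integral>x. i2 x \<partial>M) \<le> L * (nm (u - u') + nm (v - v')) * nm d" by (simp add: algebra_simps)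
have 3: "(\<integral>x. i3 x \<partial>M) \<le> (ie ^ 2 * (\<Lambda> * nm (u - u'))) * nm b' * nm d"
proof (rule weighted_bound[OF bm(3) bV(2,3)])
 show "AE x in M. \<bar>i3 x\<bar> \<le> ie ^ 2 * (\<Lambda> * nm (u - u')) * norm (T b' x) * norm (T d x)"
  using T_bound'[OF uV(1)] T_diff[OF assms(1,3)]
 proof eventually_elim
  case (elim x)
  have "\<bar>rho u' x - rho u x\<bar> \<le> ie ^ 2 * norm (T (u - u') x)"
  unfolding rho_def elim(2) by (subst norm_minus_commute) (rule inverse_reg_abs_bounds(3)[OF \<epsilon>])
  also have "\<dots> \<le> ie ^ 2 * (\<Lambda> * nm (u - u'))" using elim by (intro mult_left_mono) auto
  finally have "\<bar>i3 x\<bar> \<le> (ie ^ 2 * (\<Lambda> * nm (u - u'))) * (norm (T b' x) * norm (T d x))"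
  unfolding i3_def abs_mult by (intro mult_mono Cauchy_Schwarz_ineq2) auto
  thus ?case by (simp add: mult.assoc)
 qed
qed (use \<Lambda> uV in auto)
have "nm b' \<le> CG * nm y" unfolding b'_def using assms by (intro B_bound)
hence 3: "(\<integral>x. i3 x \<partial>M) \<le> (ie ^ 2 * (\<Lambda> * nm (u - u'))) * (CG * nm y) * nm d"
 using \<Lambda> uV bV by (intro order.trans[OF 3] mult_right_mono mult_left_mono) auto
have "2 * \<mu> * (nm d)\<^sup>2 \<le> \<tau> * ((ie ^ 2 * (\<Lambda> * nm y)) * (CG * nm (v - v')) * nm d
  + L * (nm (u - u') + nm (v - v')) * nm d + (ie ^ 2 * (\<Lambda> * nm (u - u'))) * (CG * nm y) * nm d)"
 unfolding eq[symmetric]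
 by (rule order.trans[OF coercive_le[OF assms(1) bV(3)]], subst eq,
  rule mult_left_mono[OF add_mono[OF add_mono[OF 1 2] 3] \<tau>])
also have "\<dots> = 2 * \<mu> * (CH * (nm (u - u') + nm (v - v')) * nm y) * nm d"
proof -
 define e S where "e = ie" and "S = nm (u - u') + nm (v - v')"
 have CH: "2 * \<mu> * CH = \<tau> * (e * e) * \<Lambda> * (CG + 2 * e * K)"
  using \<mu> by (simp add: CH_def K_def e_def power2_eq_square)
 have "2 * \<mu> * (CH * S * nm y) * nm d = (2 * \<mu> * CH) * S * nm y * nm d" by simp
 also have "\<dots> = \<tau> * ((e * e * (\<Lambda> * nm y)) * (CG * nm (v - v')) * nm d
  + L * S * nm d + (e * e * (\<Lambda> * nm (u - u'))) * (CG * nm y) * nm d)"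
  unfolding CH by (simp add: L_def S_def e_def power3_eq_cube algebra_simps)
 finally show ?thesis by (simp add: e_def S_def power2_eq_square)
qed
finally have "nm d * nm d \<le> (CH * (nm (u - u') + nm (v - v')) * nm y) * nm d"
 using \<mu> by (simp add: power2_eq_square mult.assoc)
hence "nm d = 0 \<or> nm d \<le> CH * (nm (u - u') + nm (v - v')) * nm y"
 using nm_nonneg[OF bV(3)] by (smt (verit) mult_right_le_imp_le)
moreover have "0 \<le> CH * (nm (u - u') + nm (v - v')) * nm y"
 using CH_nonneg uV assms by simp
ultimately show ?thesis by (auto simp: d_def b_def b'_def)
qed

end

section \<open>Smooth functions\<close>

abbreviation pd :: "('a::euclidean_space \<Rightarrow> 'b::real_normed_vector) \<Rightarrow> 'a \<Rightarrow> 'a \<Rightarrow> 'b" where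
"pd f a x \<equiv> frechet_derivative f (at x) a"

text \<open>Smoothness is coinductive: it suffices to exhibit a class of differentiable functions
  that is closed under directional derivatives. All smoothness proofs below only name such a
  class.\<close>

lemma smooth_coinduct:
assumes "f \<in> A" and "\<And>g x. g \<in> A \<Longrightarrow> g differentiable (at x)"
 and "\<And>g a. g \<in> A \<Longrightarrow> (\<lambda>x. pd g a x) \<in> A"
shows "smooth f"
proof -
have "iter_deriv as f \<in> A" for as
 by (induction as) (use assms in auto)
thus ?thesis using assms(2) by (auto simp: smooth_def)
qed

lemma smooth_differentiable: "smooth f \<Longrightarrow> f differentiable (at x)"
unfolding smooth_def by (metis iter_deriv.simps(1))

lemma smooth_pd: "smooth f \<Longrightarrow> smooth (\<lambda>x. pd f a x)"
proof -
have "iter_deriv as (\<lambda>x. pd f a x) = iter_deriv (as @ [a]) f" for as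
 by (induction as) auto
thus "smooth f \<Longrightarrow> smooth (\<lambda>x. pd f a x)"
 unfolding smooth_def by metis
qed

lemma smooth_has_derivative: "smooth f \<Longrightarrow> (f has_derivative frechet_derivative f (at x)) (at x)"
using smooth_differentiable frechet_derivative_works by blast

lemma smooth_continuous_on: "smooth f \<Longrightarrow> continuous_on S f"
by (meson smooth_differentiable differentiable_imp_continuous_within continuous_at_imp_continuous_on)

lemma pd_fun:
assumes "\<And>x. (f has_derivative D x) (at x)"
shows "(\<lambda>x. pd f a x) = (\<lambda>x. D x a)"
using fun_cong[OF frechet_derivative_at[OF assms]] by auto

lemma smooth_const: "smooth (\<lambda>x. c)"
by (rule smooth_coinduct[where A = "range (\<lambda>c x. c)"]) auto

lemma smooth_linear_image:
assumes "bounded_linear L" "smooth f"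
shows "smooth (\<lambda>x. L (f x))"
proof (rule smooth_coinduct[where A = "{\<lambda>x. L (g x) | g. smooth g}"])
fix g a assume "g \<in> {\<lambda>x. L (g x) | g. smooth g}"
then obtain f where f: "smooth f" "g = (\<lambda>x. L (f x))" by auto
have D: "(g has_derivative (\<lambda>h. L (pd f h x))) (at x)" for x
 unfolding f(2) by (intro bounded_linear.has_derivative[OF assms(1)] smooth_has_derivative f)
thus "g differentiable (at x)" for x by (auto simp: differentiable_def)
have "(\<lambda>x. pd g a x) = (\<lambda>x. L (pd f a x))"
 by (rule pd_fun[OF D])
thus "(\<lambda>x. pd g a x) \<in> {\<lambda>x. L (g x) | g. smooth g}"
 using smooth_pd[OF f(1)] by auto
qed (use assms in auto)

lemma smooth_affine_arg:
fixes c :: "'a::euclidean_space" and f :: "'a \<Rightarrow> 'b::real_normed_vector"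
assumes "smooth f"
shows "smooth (\<lambda>x. f (c + s *\<^sub>R x))"
proof (rule smooth_coinduct[where A = "{\<lambda>x. g (c + s *\<^sub>R x) | g. smooth g}"])
fix g :: "'a \<Rightarrow> 'b" and a assume "g \<in> {\<lambda>x. g (c + s *\<^sub>R x) | g. smooth g}"
then obtain f where f: "smooth f" "g = (\<lambda>x. f (c + s *\<^sub>R x))" by auto
have D: "(g has_derivative (\<lambda>h. frechet_derivative f (at (c + s *\<^sub>R x)) (s *\<^sub>R h))) (at x)" for x
 unfolding f(2)
 by (rule has_derivative_compose[of "\<lambda>x. c + s *\<^sub>R x", OF _ smooth_has_derivative[OF f(1)]])
  (auto intro!: derivative_eq_intros)
thus "g differentiable (at x)" for x by (auto simp: differentiable_def)
have "(\<lambda>x. pd g a x) = (\<lambda>x. (\<lambda>y. s *\<^sub>R pd f a y) (c + s *\<^sub>R x))"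
 unfolding pd_fun[OF D]
 by (simp add: linear_scale[OF linear_frechet_derivative[OF smooth_differentiable[OF f(1)]]])
moreover have "smooth (\<lambda>y. s *\<^sub>R pd f a y)"
 by (intro smooth_linear_image[OF bounded_linear_scaleR_right] smooth_pd f)
ultimately show "(\<lambda>x. pd g a x) \<in> {\<lambda>x. g (c + s *\<^sub>R x) | g. smooth g}"
 by (intro CollectI exI[of _ "\<lambda>y. s *\<^sub>R pd f a y"] conjI)
qed (use assms in auto)

lemma smooth_add:
assumes "smooth f" "smooth g"
shows "smooth (\<lambda>x. f x + g x)"
proof (rule smooth_coinduct[where A = "{\<lambda>x. f x + g x | f g. smooth f \<and> smooth g}"])
fix h a assume "h \<in> {\<lambda>x. f x + g x | f g. smooth f \<and> smooth g}"
then obtain f g where f: "smooth f" "smooth g" "h = (\<lambda>x. f x + g x)" by auto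
have D: "(h has_derivative (\<lambda>a. pd f a x + pd g a x)) (at x)" for x
 unfolding f(3) by (intro has_derivative_add smooth_has_derivative f)
thus "h differentiable (at x)" for x by (auto simp: differentiable_def)
have "(\<lambda>x. pd h a x) = (\<lambda>x. pd f a x + pd g a x)"
 by (rule pd_fun[OF D])
thus "(\<lambda>x. pd h a x) \<in> {\<lambda>x. f x + g x | f g. smooth f \<and> smooth g}"
 using f(1,2)
 by (intro CollectI exI[of _ "\<lambda>x. pd f a x"]
  exI[of _ "\<lambda>x. pd g a x"] conjI smooth_pd)
qed (use assms in auto)

text \<open>By the Leibniz rule a derivative of a product is a sum of two products, so products
  alone do not form a closed class but finite sums of them do.\<close>

inductive_set product_sums :: "('a::euclidean_space \<Rightarrow> real) set" where
"\<lbrakk>smooth f; smooth g\<rbrakk> \<Longrightarrow> (\<lambda>x. f x * g x) \<in> product_sums"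
| "\<lbrakk>u \<in> product_sums; v \<in> product_sums\<rbrakk> \<Longrightarrow> (\<lambda>x. u x + v x) \<in> product_sums"

lemma product_sums_derivative:
assumes "u \<in> product_sums"
shows "(\<forall>x. u differentiable (at x)) \<and> (\<forall>a. (\<lambda>x. pd u a x) \<in> product_sums)"
using assms
proof induction
case (1 f g)
have D: "((\<lambda>x. f x * g x) has_derivative (\<lambda>a. f x * pd g a x + pd f a x * g x)) (at x)" for x
 by (intro has_derivative_mult smooth_has_derivative 1)
have "(\<lambda>x. pd (\<lambda>x. f x * g x) a x) = (\<lambda>x. f x * pd g a x + pd f a x * g x)" for a
 by (rule pd_fun[OF D])
moreover have "(\<lambda>x. f x * pd g a x + pd f a x * g x) \<in> product_sums" for a
 using 1 by (intro product_sums.intros smooth_pd)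
ultimately show ?case using D by (auto simp: differentiable_def)
next
case (2 u v)
have D: "((\<lambda>x. u x + v x) has_derivative (\<lambda>a. pd u a x + pd v a x)) (at x)" for x
 using 2 by (intro has_derivative_add) (auto simp: frechet_derivative_works[symmetric])
have "(\<lambda>x. pd (\<lambda>x. u x + v x) a x) = (\<lambda>x. pd u a x + pd v a x)" for a
 by (rule pd_fun[OF D])
moreover have "(\<lambda>x. pd u a x + pd v a x) \<in> product_sums" for a
 using 2 by (intro product_sums.intros) auto
ultimately show ?case using D by (auto simp: differentiable_def)
qed

lemma smooth_mult:
fixes f g :: "'a::euclidean_space \<Rightarrow> real"
shows "smooth f \<Longrightarrow> smooth g \<Longrightarrow> smooth (\<lambda>x. f x * g x)"
by (rule smooth_coinduct[where A = product_sums])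
 (use product_sums_derivative in \<open>auto intro: product_sums.intros\<close>)

lemma smooth_prod:
fixes f :: "'i \<Rightarrow> 'a::euclidean_space \<Rightarrow> real"
assumes "finite I" "\<And>i. i \<in> I \<Longrightarrow> smooth (f i)"
shows "smooth (\<lambda>x. \<Prod>i\<in>I. f i x)"
using assms by (induction I) (auto intro: smooth_const smooth_mult)

section \<open>Flat functions and bumps supported in boxes\<close>

text \<open>The functions \<open>p(1/t) e\<^sup>-\<^sup>1\<^sup>/\<^sup>t\<close>, extended by zero, are closed under differentiation.\<close>

definition flat :: "real poly \<Rightarrow> real \<Rightarrow> real" where
"flat p t = (if t > 0 then poly p (inverse t) * exp (- inverse t) else 0)"

lemma poly_exp_tendsto_0: "((\<lambda>t. poly p t * exp (- t)) \<longlongrightarrow> (0::real)) at_top"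
proof -
have "((\<lambda>t. \<Sum>i\<le>degree p. coeff p i * (t ^ i / exp t)) \<longlongrightarrow> (\<Sum>i\<le>degree p. coeff p i * 0)) at_top"
 by (intro tendsto_sum tendsto_mult tendsto_const tendsto_power_div_exp_0)
moreover have "(\<lambda>t. \<Sum>i\<le>degree p. coeff p i * (t ^ i / exp t)) = (\<lambda>t. poly p t * exp (- t))"
 by (auto simp: poly_altdef sum_distrib_right exp_minus field_simps sum_divide_distrib)
ultimately show ?thesis by simp
qed

text \<open>By the chain rule, differentiation sends the polynomial \<open>p\<close> to
  \<open>X^2 (p - p')\<close>. Only the point \<open>0\<close> requires an argument beyond the usual
  rules.\<close>

lemma flat_has_derivative:
"(flat p has_real_derivative flat ([:0, 0, 1:] * (p - pderiv p)) t) (at t)"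
proof -
consider "t > 0" | "t = 0" | "t < 0" by linarith
thus ?thesis
proof cases
 case 1
 have "((\<lambda>t. poly p (inverse t) * exp (- inverse t)) has_real_derivative
  flat ([:0, 0, 1:] * (p - pderiv p)) t) (at t)"
  using 1 by (auto intro!: derivative_eq_intros simp: flat_def power2_eq_square field_simps)
 moreover have "eventually (\<lambda>t. t > 0) (nhds t)"
  using 1 by (simp add: eventually_nhds_in_open[of "{0<..}", simplified])
 hence "eventually (\<lambda>t. flat p t = poly p (inverse t) * exp (- inverse t)) (nhds t)"
  by eventually_elim (simp add: flat_def)
 ultimately show ?thesis by (subst DERIV_cong_ev[OF refl _ refl]) auto
next
 case 2
 \<comment> \<open>For \<open>h > 0\<close> the quotient is again polynomial times exponential, with
   \<open>p\<close> multiplied by \<open>X\<close>, and hence tends to zero.\<close>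
 have "((\<lambda>h. flat p h / h) \<longlongrightarrow> 0) (at 0)"
 proof (rule filterlim_split_at)
  have "((\<lambda>h. poly (p * [:0,1:]) (inverse h) * exp (- inverse h)) \<longlongrightarrow> 0) (at_right 0)"
  using poly_exp_tendsto_0[of "p * [:0,1:]"] filterlim_inverse_at_top_right
  by (rule filterlim_compose)
  moreover have "eventually (\<lambda>h. poly (p * [:0,1:]) (inverse h) * exp (- inverse h) = flat p h / h) (at_right 0)"
  using eventually_at_right_less[of 0] by eventually_elim (simp add: flat_def field_simps)
  ultimately show "((\<lambda>h. flat p h / h) \<longlongrightarrow> 0) (at_right 0)"
  by (rule Lim_transform_eventually)
  show "((\<lambda>h. flat p h / h) \<longlongrightarrow> 0) (at_left 0)"
  by (rule tendsto_eventually) (auto simp: eventually_at_filter flat_def)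
 qed
 thus ?thesis using 2 by (simp add: has_field_derivative_iff flat_def)
next
 case 3
 have "eventually (\<lambda>t. t < 0) (nhds t)"
  using 3 by (simp add: eventually_nhds_in_open[of "{..<0}", simplified])
 hence "eventually (\<lambda>t. flat p t = 0) (nhds t)"
  by eventually_elim (simp add: flat_def)
 hence "(flat p has_real_derivative 0) (at t)"
  by (subst DERIV_cong_ev[OF refl _ refl]) auto
 thus ?thesis using 3 by (simp add: flat_def)
qed
qed

lemma smooth_flat_affine:
fixes i :: "'a::euclidean_space"
shows "smooth (\<lambda>x. flat p (c + x \<bullet> i))"
proof (rule smooth_coinduct[where A = "{\<lambda>x. k * flat p (c + x \<bullet> i) | k p. True}"])
fix g :: "'a \<Rightarrow> real" and a assume "g \<in> {\<lambda>x. k * flat p (c + x \<bullet> i) | k p. True}"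
then obtain k p where g: "g = (\<lambda>x. k * flat p (c + x \<bullet> i))" by auto
define q where "q = [:0, 0, 1:] * (p - pderiv p)"
have F: "(flat p has_derivative (\<lambda>h. flat q t * h)) (at t)" for t
 unfolding q_def by (rule flat_has_derivative[unfolded has_field_derivative_def])
have D: "(g has_derivative (\<lambda>h. k * (flat q (c + x \<bullet> i) * (h \<bullet> i)))) (at x)" for x
 unfolding g
 by (rule has_derivative_mult_right, rule has_derivative_compose[OF _ F])
  (auto intro!: derivative_eq_intros)
thus "g differentiable (at x)" for x by (auto simp: differentiable_def)
have "(\<lambda>x. pd g a x) = (\<lambda>x. (k * (a \<bullet> i)) * flat q (c + x \<bullet> i))"
 unfolding pd_fun[OF D] by (simp add: ac_simps)
thus "(\<lambda>x. pd g a x) \<in> {\<lambda>x. k * flat p (c + x \<bullet> i) | k p. True}"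
 by blast
qed (auto intro!: exI[of _ "1::real"])

text \<open>The shift by 1 keeps the support at distance \<open>1/n\<close> from the faces of the
  box; the factor \<open>n\<close> pushes the arguments to infinity inside. Thus the bumps have
  compact support in the open box and converge to its indicator.\<close>

definition bump :: "'a::euclidean_space \<Rightarrow> 'a \<Rightarrow> real \<Rightarrow> 'a \<Rightarrow> real" where
"bump a b n x = (\<Prod>i\<in>Basis. flat 1 (n * (x \<bullet> i - a \<bullet> i) - 1) * flat 1 (n * (b \<bullet> i - x \<bullet> i) - 1))"

lemma flat_1_bounds: "0 \<le> flat 1 t" "flat 1 t \<le> 1" "t > 0 \<Longrightarrow> flat 1 t > 0"
by (auto simp: flat_def)

lemma smooth_bump: "smooth (bump a b n)"
proof -
have 1: "(\<lambda>x. flat 1 (n * (x \<bullet> i - a \<bullet> i) - 1)) = (\<lambda>x. flat 1 ((- n * (a \<bullet> i) - 1) + x \<bullet> (n *\<^sub>R i)))"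
 and 2: "(\<lambda>x. flat 1 (n * (b \<bullet> i - x \<bullet> i) - 1)) = (\<lambda>x. flat 1 ((n * (b \<bullet> i) - 1) + x \<bullet> (- n *\<^sub>R i)))" for i
 by (auto simp: algebra_simps)
show ?thesis
 unfolding bump_def[abs_def]
 by (intro smooth_prod smooth_mult) (auto simp only: 1 2 smooth_flat_affine finite_Basis)
qed

lemma bump_bounds: "0 \<le> bump a b n x" "bump a b n x \<le> 1"
proof -
have "0 \<le> flat 1 s * flat 1 t" "flat 1 s * flat 1 t \<le> 1" for s t
 using flat_1_bounds by (auto intro: mult_le_one)
thus "0 \<le> bump a b n x" "bump a b n x \<le> 1"
 unfolding bump_def by (auto intro: prod_nonneg prod_le_1)
qed

lemma One_inner: "i \<in> Basis \<Longrightarrow> (One :: 'a::euclidean_space) \<bullet> i = 1"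
using inner_sum_left_Basis[of i "\<lambda>_. 1"] by simp

lemma bump_support:
assumes "n > 0" "bump a b n x \<noteq> 0"
shows "x \<in> cbox (a + (1/n) *\<^sub>R One) (b - (1/n) *\<^sub>R One)"
proof -
have "flat 1 (n * (x \<bullet> i - a \<bullet> i) - 1) \<noteq> 0" "flat 1 (n * (b \<bullet> i - x \<bullet> i) - 1) \<noteq> 0" if "i \<in> Basis" for i
 using assms(2) that by (auto simp: bump_def)
hence "n * (x \<bullet> i - a \<bullet> i) - 1 > 0" "n * (b \<bullet> i - x \<bullet> i) - 1 > 0" if "i \<in> Basis" for i
 using that by (metis flat_def)+
hence "a \<bullet> i + 1/n \<le> x \<bullet> i" "x \<bullet> i \<le> b \<bullet> i - 1/n" if "i \<in> Basis" for i
 using assms(1) that less_imp_le by (fastforce simp: field_simps)+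
thus ?thesis
 by (simp add: mem_box inner_add_left inner_diff_left One_inner)
qed

lemma bump_test:
assumes "n > 0" "box a b \<subseteq> W"
shows "bump a b n \<in> test_functions W"
proof -
let ?C = "cbox (a + (1/n) *\<^sub>R One) (b - (1/n) *\<^sub>R One)"
have "{x. bump a b n x \<noteq> 0} \<subseteq> ?C" using bump_support[OF assms(1)] by auto
hence *: "closure {x. bump a b n x \<noteq> 0} \<subseteq> ?C" by (rule closure_minimal) (rule closed_cbox)
moreover have "?C \<subseteq> box a b"
proof
 fix x assume x: "x \<in> ?C"
 show "x \<in> box a b"
  unfolding mem_box
 proof
  fix i :: 'a assume i: "i \<in> Basis"
  have "1 / n > 0" using assms(1) by simp
  moreover have "a \<bullet> i + 1/n \<le> x \<bullet> i" "x \<bullet> i \<le> b \<bullet> i - 1/n"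
  using x i by (auto simp: mem_box inner_add_left inner_diff_left One_inner)
  ultimately show "a \<bullet> i < x \<bullet> i \<and> x \<bullet> i < b \<bullet> i" by linarith
 qed
qed
ultimately show ?thesis
 using assms(2) smooth_bump compact_Int_closed[of ?C "closure {x. bump a b n x \<noteq> 0}"]
 by (auto simp: test_functions_def Int_absorb1)
qed

lemma bump_pos:
assumes "n > 0" "x \<in> box (a + (1/n) *\<^sub>R One) (b - (1/n) *\<^sub>R One)"
shows "bump a b n x > 0"
unfolding bump_def
proof (rule prod_pos)
fix i :: 'a assume i: "i \<in> Basis"
have "n * (x \<bullet> i - a \<bullet> i) - 1 > 0" "n * (b \<bullet> i - x \<bullet> i) - 1 > 0"
 using assms i by (auto simp: mem_box inner_add_left inner_diff_left One_inner field_simps)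
thus "0 < flat 1 (n * (x \<bullet> i - a \<bullet> i) - 1) * flat 1 (n * (b \<bullet> i - x \<bullet> i) - 1)"
 using flat_1_bounds(3) by simp
qed

lemma flat_1_at_top: "(flat 1 \<longlongrightarrow> 1) at_top"
proof -
have "((\<lambda>t. exp (- inverse t)) \<longlongrightarrow> exp (- 0)) (at_top :: real filter)"
 by (intro tendsto_intros tendsto_inverse_0_at_top filterlim_ident)
moreover have "eventually (\<lambda>t. exp (- inverse t) = flat 1 t) at_top"
 using eventually_gt_at_top[of 0] by eventually_elim (simp add: flat_def)
ultimately show ?thesis using Lim_transform_eventually by fastforce
qed

lemma bump_tendsto: "(\<lambda>n. bump a b (real (Suc n)) x) \<longlonglongrightarrow> indicator (box a b) x"
proof (cases "x \<in> box a b")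
case True
have lim: "(\<lambda>n. flat 1 (real (Suc n) * c - 1)) \<longlonglongrightarrow> 1" if "c > 0" for c :: real
proof (rule filterlim_compose[OF flat_1_at_top])
 have "filterlim (\<lambda>n. real (Suc n) * c) at_top sequentially"
  by (rule filterlim_at_top_mult_tendsto_pos[OF tendsto_const that
  filterlim_compose[OF filterlim_real_sequentially filterlim_Suc]])
 thus "filterlim (\<lambda>n. real (Suc n) * c - 1) at_top sequentially"
  using filterlim_tendsto_add_at_top[OF tendsto_const[of "-1"]] by simp
qed
have "(\<lambda>n. bump a b (real (Suc n)) x) \<longlonglongrightarrow> (\<Prod>i\<in>(Basis::'a set). 1 * 1)"
 unfolding bump_def using True by (intro tendsto_prod tendsto_mult lim) (auto simp: mem_box)
thus ?thesis using True by simp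
next
case False
have "bump a b (real (Suc n)) x = 0" for n
proof (rule ccontr)
 assume "bump a b (real (Suc n)) x \<noteq> 0"
 hence "x \<in> closure {x. bump a b (real (Suc n)) x \<noteq> 0}"
  by (intro subsetD[OF closure_subset] CollectI)
 thus False
  using bump_test[of "real (Suc n)" a b "box a b"] False by (auto simp: test_functions_def)
qed
thus ?thesis using False by simp
qed

section \<open>The fundamental lemma of the calculus of variations\<close>

lemma integral_lebesgue_on:
fixes f :: "'a::euclidean_space \<Rightarrow> 'b::euclidean_space"
assumes "S \<in> sets lebesgue"
shows "integral\<^sup>L (lebesgue_on S) f = integral\<^sup>L lebesgue (\<lambda>x. indicator S x *\<^sub>R f x)"
 "integrable (lebesgue_on S) f \<longleftrightarrow> integrable lebesgue (\<lambda>x. indicator S x *\<^sub>R f x)"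
using assms by (auto simp: integral_restrict_space integrable_restrict_space)

lemma AE_lebesgue_on:
"S \<in> sets lebesgue \<Longrightarrow> (AE x in lebesgue_on S. P x) \<longleftrightarrow> (AE x in lebesgue. x \<in> S \<longrightarrow> P x)"
by (simp add: AE_restrict_space_iff)

text \<open>Boxes form an intersection-stable generator of the Borel sets, so vanishing integrals
  extend to all Borel sets. The vanishing total integral serves the step to complements.\<close>

lemma integral_box_zero_imp_AE_zero:
fixes u :: "'a::euclidean_space \<Rightarrow> real"
assumes u: "integrable lborel u"
 and zero: "\<And>c d. (LINT x|lborel. indicator (box c d) x * u x) = 0"
 and all: "integral\<^sup>L lborel u = 0"
shows "AE x in lborel. u x = 0"
proof (rule sigma_finite_measure.density_zero[OF lborel.sigma_finite_measure_axioms u])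
have [measurable]: "u \<in> borel_measurable borel" using u by auto
fix A :: "'a set" assume "A \<in> sets lborel"
moreover have bs: "sets (borel :: 'a measure) = sigma_sets UNIV (range (\<lambda> (a, b). box a b))"
 by (subst borel_eq_box) (simp add: sets_measure_of)
ultimately have A: "A \<in> sigma_sets UNIV (range (\<lambda> (a, b). box a b))" by simp
have ii: "integrable lborel (\<lambda>x. indicator B x * u x)" if "B \<in> sets borel" for B
 using integrable_mult_indicator[OF _ u, of B] that by simp
have sb: "B \<in> sets borel" if "B \<in> sigma_sets UNIV (range (\<lambda> (a, b). box a b))" for B :: "'a set"
 using that bs by simp
have IS: "Int_stable (range (\<lambda> (a, b). box a b :: 'a set))"
proof (rule Int_stableI)
 fix a b assume "a \<in> range (\<lambda> (a, b). box a b :: 'a set)" "b \<in> range (\<lambda> (a, b). box a b :: 'a set)"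
 then obtain p q r t where "a = box p q" "b = box r t" by auto
 thus "a \<inter> b \<in> range (\<lambda> (a, b). box a b :: 'a set)"
  by (simp only: box_Int_box) (rule range_eqI[where x = "(_, _)"], simp)
qed
have sub: "range (\<lambda>(a, b). box a b) \<subseteq> Pow (UNIV :: 'a set)" by simp
have "(LINT x|lborel. indicator A x * u x) = 0"
 using IS sub A
proof (induction rule: sigma_sets_induct_disjoint)
 case (basic A)
 thus ?case using zero by auto
next
 case (compl A)
 have "(LINT x|lborel. indicator (UNIV - A) x * u x) = (LINT x|lborel. u x - indicator A x * u x)"
  by (intro Bochner_Integration.integral_cong) (auto simp: indicator_def)
 also have "\<dots> = 0"
  using u ii[OF sb[OF compl(1)]] compl(2) all by simp
 finally show ?case .
next
 case (union A)
 have 1: "set_integrable lborel (\<Union>i. A i) u"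
  unfolding set_integrable_def using ii[of "\<Union>i. A i"] sb union(2) by auto
 have "(LINT x:(\<Union>i. A i)|lborel. u x) = (\<Sum>i. LINT x:A i|lborel. u x)"
  using union(1) sb union(2) by (intro lebesgue_integral_countable_add 1) (auto simp: disjoint_family_on_def image_subset_iff)
 thus ?case using union(3) by (simp add: set_lebesgue_integral_def)
qed simp
thus "(LINT x:A|lborel. u x) = 0" by (simp add: set_lebesgue_integral_def)
qed

text \<open>Bumps converge boundedly to indicators of boxes, so \<open>u\<close> integrates to zero
  over every box inside \<open>W\<close>. Countably many such boxes cover \<open>W\<close>.\<close>

lemma fundamental_lemma:
fixes u :: "'a::euclidean_space \<Rightarrow> real"
assumes W: "open W" and u: "integrable (lebesgue_on W) u"
 and zero: "\<And>\<phi>. \<phi> \<in> test_functions W \<Longrightarrow> integral\<^sup>L (lebesgue_on W) (\<lambda>x. u x * \<phi> x) = 0"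
shows "AE x in lebesgue_on W. u x = 0"
proof -
have WL: "W \<in> sets lebesgue" using W by simp
define U where "U x = indicator W x * u x" for x
have U: "integrable lebesgue U" using u integral_lebesgue_on(2)[OF WL, of u] by (simp add: U_def[abs_def])
have U0: "(LINT x|lebesgue. U x * \<phi> x) = 0" if "\<phi> \<in> test_functions W" for \<phi>
 using zero[OF that] integral_lebesgue_on(1)[OF WL, of "\<lambda>x. u x * \<phi> x"] by (simp add: U_def mult.assoc)
\<comment> \<open>A Borel representative is needed because the extension from boxes to sets takes
  place on the Borel sets.\<close>
obtain U' where U': "U' \<in> borel_measurable lborel" "AE x in lborel. U x = U' x"
 using completion_ex_borel_measurable_real[of U lborel] U by auto
have AE': "AE x in lebesgue. U x = U' x" using U'(2) by (rule AE_completion)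
have U'm: "U' \<in> borel_measurable lebesgue" using U'(1) by (rule measurable_completion)
have iU': "integrable lebesgue U'"
 using U integrable_cong_AE[OF _ U'm AE'] by auto
have box0: "(LINT x|lborel. indicator (box c d) x * U' x) = 0" if "box c d \<subseteq> W" for c d
proof -
 have "(\<lambda>n. LINT x|lebesgue. U' x * bump c d (real (Suc n)) x) \<longlonglongrightarrow> (LINT x|lebesgue. U' x * indicator (box c d) x)"
 proof (rule integral_dominated_convergence[where w = "\<lambda>x. \<bar>U' x\<bar>"])
  show "(\<lambda>x. U' x * bump c d (real (Suc n)) x) \<in> borel_measurable lebesgue" for n
  by (intro borel_measurable_times U'm measurable_completion)
  (auto intro!: borel_measurable_continuous_onI smooth_continuous_on smooth_bump)
  show "(\<lambda>x. U' x * indicator (box c d) x) \<in> borel_measurable lebesgue"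
  by (intro borel_measurable_times U'm borel_measurable_indicator) auto
  show "integrable lebesgue (\<lambda>x. \<bar>U' x\<bar>)" using iU' by simp
  show "AE x in lebesgue. (\<lambda>n. U' x * bump c d (real (Suc n)) x) \<longlonglongrightarrow> U' x * indicator (box c d) x"
  by (intro AE_I2 tendsto_mult tendsto_const bump_tendsto)
  show "AE x in lebesgue. norm (U' x * bump c d (real (Suc n)) x) \<le> \<bar>U' x\<bar>" for n
  using bump_bounds[of c d "real (Suc n)"]
  by (intro AE_I2) (simp add: abs_mult mult_right_le_one_le del: of_nat_Suc)
 qed
 moreover have "(LINT x|lebesgue. U' x * bump c d (real (Suc n)) x) = 0" for n
 proof -
  have "(LINT x|lebesgue. U' x * bump c d (real (Suc n)) x) = (LINT x|lebesgue. U x * bump c d (real (Suc n)) x)"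
  proof (rule integral_cong_AE)
  show "AE x in lebesgue. U' x * bump c d (real (Suc n)) x = U x * bump c d (real (Suc n)) x"
  using AE' by eventually_elim simp
  qed (intro borel_measurable_times U'm borel_measurable_integrable[OF U] measurable_completion,
  auto intro!: borel_measurable_continuous_onI smooth_continuous_on smooth_bump)+
  thus ?thesis using U0[OF bump_test[OF _ that]] by simp
 qed
 ultimately have "(LINT x|lebesgue. U' x * indicator (box c d) x) = 0"
  using LIMSEQ_unique[OF _ tendsto_const] by fastforce
 thus ?thesis
  using U'(1) by (subst (asm) integral_completion) (auto simp: mult.commute)
qed
obtain D where D: "countable D" "D \<subseteq> Pow W" "\<And>X. X \<in> D \<Longrightarrow> \<exists>a b. X = box a b" "\<Union>D = W"
 using open_countable_Union_open_box[OF W] by metis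
have "AE x in lborel. x \<in> X \<longrightarrow> U' x = 0" if "X \<in> D" for X
proof -
 obtain p q where X: "X = box p q" using D(3)[OF \<open>X \<in> D\<close>] by auto
 have pq: "box p q \<subseteq> W" using D(2) that X by auto
 \<comment> \<open>Cutting off at one box of the cover makes the intersection with any other box a
   box inside \<open>W\<close>.\<close>
 define Z where "Z x = indicator (box p q) x * U' x" for x
 have "integrable lborel U'" using iU' U'(1) by (simp add: integrable_completion)
 hence iZ: "integrable lborel Z"
  using integrable_mult_indicator[of "box p q" lborel U'] by (simp add: Z_def[abs_def])
 have "AE x in lborel. Z x = 0"
 proof (rule integral_box_zero_imp_AE_zero[OF iZ])
  show "integral\<^sup>L lborel Z = 0" using box0[OF pq] by (simp add: Z_def[abs_def])
  fix c d
  obtain c' d' where cd: "box c d \<inter> box p q = box c' d'"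
  using that[OF box_Int_box] .
  have "(LINT x|lborel. indicator (box c d) x * Z x) = (LINT x|lborel. indicator (box c' d') x * U' x)"
  unfolding cd[symmetric] Z_def
  by (intro Bochner_Integration.integral_cong) (auto simp: indicator_def)
  thus "(LINT x|lborel. indicator (box c d) x * Z x) = 0" using box0[of c' d'] cd pq by auto
 qed
 thus ?thesis by eventually_elim (auto simp: Z_def X)
qed
hence "AE x in lborel. \<forall>X\<in>D. x \<in> X \<longrightarrow> U' x = 0"
 by (subst AE_ball_countable[OF D(1)]) blast
hence "AE x in lebesgue. \<forall>X\<in>D. x \<in> X \<longrightarrow> U' x = 0" by (rule AE_completion)
with AE' have "AE x in lebesgue. x \<in> W \<longrightarrow> u x = 0"
 by eventually_elim (use D(4) in \<open>auto simp: U_def indicator_def split: if_splits\<close>)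
thus ?thesis by (simp add: AE_lebesgue_on[OF WL])
qed

section \<open>Integration by parts\<close>

lemma compact_support_Ex_bound:
assumes "compact (closure {x. \<phi> x \<noteq> 0})"
shows "\<exists>R>0. \<forall>x. \<phi> x \<noteq> 0 \<longrightarrow> norm x \<le> R"
proof -
obtain R where R: "R > 0" "\<forall>x\<in>closure {x. \<phi> x \<noteq> 0}. norm x \<le> R"
 using compact_imp_bounded[OF assms] by (auto simp: bounded_pos)
have "norm x \<le> R" if "\<phi> x \<noteq> 0" for x
 using that R(2) closure_subset[of "{x. \<phi> x \<noteq> 0}"] by auto
with R(1) show ?thesis by blast
qed

lemma integral_lborel_translate:
fixes g :: "'a::euclidean_space \<Rightarrow> real"
assumes "g \<in> borel_measurable borel"
shows "(LINT x|lborel. g (c + x)) = integral\<^sup>L lborel g"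
 "integrable lborel (\<lambda>x. g (c + x)) \<longleftrightarrow> integrable lborel g"
using assms integral_distr[of "(+) c" lborel borel g] integrable_distr_eq[of "(+) c" lborel borel g]
by (auto simp: lborel_distr_plus)

lemma integrable_bounded_support:
fixes g :: "'a::euclidean_space \<Rightarrow> real"
assumes "g \<in> borel_measurable lebesgue" "AE x in lebesgue. \<bar>g x\<bar> \<le> C" "\<And>x. norm x > R \<Longrightarrow> g x = 0"
shows "integrable lebesgue g"
proof -
have i: "integrable lebesgue (\<lambda>x. indicator (cball (0::'a) R) x *\<^sub>R (\<bar>C\<bar> :: real))"
 using lmeasurable_cball[of "0::'a" R] by (auto simp: fmeasurable_def intro!: integrable_real_indicator)
show ?thesis
proof (rule Bochner_Integration.integrable_bound[OF i assms(1)])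
 show "AE x in lebesgue. norm (g x) \<le> norm (indicator (cball 0 R) x *\<^sub>R (\<bar>C\<bar> :: real))"
  using assms(2)
 proof eventually_elim
  case (elim x)
  thus ?case using assms(3)[of x] by (cases "norm x \<le> R") (auto simp: indicator_def)
 qed
qed
qed

text \<open>Translation invariance makes the integral of every difference quotient zero, and the
  Lipschitz bound dominates the quotients on a bounded set. This is the source of all integration by
  parts below.\<close>

lemma directional_derivative_integral_zero:
fixes g D :: "'a::euclidean_space \<Rightarrow> real"
assumes lip: "L-lipschitz_on UNIV g" and supp: "\<And>x. norm x > R \<Longrightarrow> g x = 0"
 and der: "AE x in lebesgue. ((\<lambda>t. (g (x + t *\<^sub>R a) - g x) / t) \<longlongrightarrow> D x) (at 0)"
 and D: "D \<in> borel_measurable lebesgue"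
shows "integrable lebesgue D" "integral\<^sup>L lebesgue D = 0"
proof -
have cont: "continuous_on UNIV g" using lip by (rule lipschitz_on_continuous_on)
hence gm: "g \<in> borel_measurable borel" by (rule borel_measurable_continuous_onI)
have gma: "(\<lambda>x. g (x + c)) \<in> borel_measurable borel" for c
 by (intro borel_measurable_continuous_onI continuous_on_compose2[OF cont] continuous_intros) auto
have L0: "L \<ge> 0" using lip by (rule lipschitz_on_nonneg)
have lipD: "\<bar>g x - g y\<bar> \<le> L * norm (x - y)" for x y
 using lipschitz_onD[OF lip, of x y] by (simp add: dist_norm)
define t where "t n = inverse (real (Suc n))" for n
have t: "0 < t n" "t n \<le> 1" for n by (auto simp: t_def inverse_eq_divide)
define q where "q n x = (g (x + t n *\<^sub>R a) - g x) / t n" for n x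
have qb: "\<bar>q n x\<bar> \<le> L * norm a" for n x
proof -
 have "\<bar>g (x + t n *\<^sub>R a) - g x\<bar> \<le> (L * norm a) * t n"
  using lipD[of "x + t n *\<^sub>R a" x] t(1)[of n] by (simp add: ac_simps)
 thus ?thesis using t(1)[of n] by (simp add: q_def abs_divide pos_divide_le_eq ac_simps)
qed
have q0: "q n x = 0" if "norm x > R + norm a" for n x
proof -
 have "norm (t n *\<^sub>R a) \<le> norm a"
  using mult_left_le_one_le[of "norm a" "t n"] t[of n] by simp
 hence "norm (x + t n *\<^sub>R a) > R" "norm x > R"
  using that norm_diff_ineq[of x "t n *\<^sub>R a"] norm_ge_zero[of a] by linarith+
 thus ?thesis using supp by (simp add: q_def)
qed
have qm: "q n \<in> borel_measurable borel" for n
 unfolding q_def by (intro borel_measurable_divide borel_measurable_diff gma gm borel_measurable_const)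
have gi: "integrable lborel g"
proof -
 have "bounded (g ` cball 0 R)"
  by (intro compact_imp_bounded compact_continuous_image continuous_on_subset[OF cont]) auto
 then obtain C where C: "\<forall>y\<in>g ` cball 0 R. norm y \<le> C"
  by (auto simp: bounded_iff)
 have "\<bar>g x\<bar> \<le> max C 0" for x using supp[of x] C by (cases "norm x \<le> R") (auto simp: le_max_iff_disj)
 hence "integrable lebesgue g"
  using supp gm by (intro integrable_bounded_support[where C = "max C 0" and R = R] measurable_completion) auto
 thus ?thesis using gm by (simp add: integrable_completion)
qed
have q_int: "integral\<^sup>L lebesgue (q n) = 0" for n
proof -
 have "integral\<^sup>L lborel (q n) = ((LINT x|lborel. g (t n *\<^sub>R a + x)) - integral\<^sup>L lborel g) / t n"
  using gi integral_lborel_translate(2)[OF gm, of "t n *\<^sub>R a"]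
  by (simp add: q_def[abs_def] add.commute)
 also have "\<dots> = 0" using integral_lborel_translate(1)[OF gm] by simp
 finally show ?thesis using qm by (subst integral_completion) auto
qed
define w where "w x = indicator (cball 0 (R + norm a)) x * (L * norm a)" for x :: 'a
have wi: "integrable lebesgue w"
proof (rule integrable_bounded_support[where C = "L * norm a" and R = "R + norm a"])
 show "w \<in> borel_measurable lebesgue" unfolding w_def
  by (intro borel_measurable_times borel_measurable_indicator) auto
qed (use L0 in \<open>auto simp: w_def indicator_def\<close>)
have lim: "AE x in lebesgue. (\<lambda>n. q n x) \<longlonglongrightarrow> D x"
 using der
proof eventually_elim
 case (elim x)
 have "filterlim t (at 0) sequentially"
  unfolding t_def filterlim_at using LIMSEQ_inverse_real_of_nat by auto
 from filterlim_compose[OF elim this] show ?case by (simp add: q_def)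
qed
have bound: "AE x in lebesgue. norm (q n x) \<le> w x" for n
 using qb[of n] q0[of _ n] by (intro AE_I2) (auto simp: w_def indicator_def not_le)
have qm': "q n \<in> borel_measurable lebesgue" for n using qm by (intro measurable_completion) simp
show "integrable lebesgue D" by (rule integrable_dominated_convergence[OF D qm' wi lim bound])
have "(\<lambda>n. integral\<^sup>L lebesgue (q n)) \<longlonglongrightarrow> integral\<^sup>L lebesgue D"
 by (rule integral_dominated_convergence[OF D qm' wi lim bound])
thus "integral\<^sup>L lebesgue D = 0"
 unfolding q_int by (rule LIMSEQ_unique[OF _ tendsto_const])
qed

section \<open>Square integrable functions on a bounded open set\<close>

abbreviation meas where "meas W \<equiv> borel_measurable (lebesgue_on W)"

abbreviation L2_lim where "L2_lim W u v \<equiv> (\<lambda>n. L2_norm W (\<lambda>x. u n x - v x)) \<longlonglongrightarrow> 0"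

context
fixes W :: "'a::euclidean_space set"
assumes op: "open W" and bd: "bounded W"
begin

lemma W_lebesgue: "W \<in> sets lebesgue" using op by simp

lemma finite_measure_W: "finite_measure (lebesgue_on W)"
using op bd by (intro finite_measure_lebesgue_on bounded_set_imp_lmeasurable W_lebesgue)

lemma L2_inner_integrable:
assumes "u \<in> L2 W" "v \<in> L2 W"
shows "integrable (lebesgue_on W) (\<lambda>x. u x \<bullet> v x)"
proof (rule Bochner_Integration.integrable_bound)
show "integrable (lebesgue_on W) (\<lambda>x. (norm (u x))\<^sup>2 + (norm (v x))\<^sup>2)"
 using assms by (intro Bochner_Integration.integrable_add) (auto simp: L2_def)
show "(\<lambda>x. u x \<bullet> v x) \<in> meas W"
 using assms by (intro borel_measurable_inner) (auto simp: L2_def)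
have "\<bar>u x \<bullet> v x\<bar> \<le> (norm (u x))\<^sup>2 + (norm (v x))\<^sup>2" for x
proof -
 have "\<bar>u x \<bullet> v x\<bar> \<le> norm (u x) * norm (v x)" by (rule Cauchy_Schwarz_ineq2)
 also have "\<dots> \<le> (norm (u x))\<^sup>2 + (norm (v x))\<^sup>2"
 proof -
  have "0 \<le> (norm (u x) - norm (v x))\<^sup>2" "0 \<le> norm (u x) * norm (v x)" by auto
  moreover from this(1) have "2 * (norm (u x) * norm (v x)) \<le> (norm (u x))\<^sup>2 + (norm (v x))\<^sup>2"
  by (simp add: power2_eq_square algebra_simps)
  ultimately show ?thesis by linarith
 qed
 finally show ?thesis .
qed
thus "AE x in lebesgue_on W. norm (u x \<bullet> v x) \<le> norm ((norm (u x))\<^sup>2 + (norm (v x))\<^sup>2)"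
 by (intro AE_I2) auto
qed

lemma L2_iff:
"u \<in> L2 W \<longleftrightarrow> u \<in> meas W \<and> integrable (lebesgue_on W) (\<lambda>x. u x \<bullet> u x)"
by (simp add: L2_def dot_square_norm)

lemma L2_scale: "u \<in> L2 W \<Longrightarrow> (\<lambda>x. c *\<^sub>R u x) \<in> L2 W"
by (auto simp: L2_iff intro!: borel_measurable_scaleR)

lemma L2_add:
assumes "u \<in> L2 W" "v \<in> L2 W"
shows "(\<lambda>x. u x + v x) \<in> L2 W"
proof -
have "integrable (lebesgue_on W) (\<lambda>x. (u x \<bullet> u x + 2 * (u x \<bullet> v x)) + v x \<bullet> v x)"
 using L2_inner_integrable assms by (intro Bochner_Integration.integrable_add integrable_mult_right) auto
also have "(\<lambda>x. (u x \<bullet> u x + 2 * (u x \<bullet> v x)) + v x \<bullet> v x) = (\<lambda>x. (u x + v x) \<bullet> (u x + v x))"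
 by (auto simp: inner_add_left inner_add_right inner_commute)
finally show ?thesis using assms by (auto simp: L2_iff)
qed

lemma L2_diff: "u \<in> L2 W \<Longrightarrow> v \<in> L2 W \<Longrightarrow> (\<lambda>x. u x - v x) \<in> L2 W"
using L2_add[OF _ L2_scale[of v "-1"], of u] by simp

lemma L2_bounded:
assumes "u \<in> meas W" "AE x in lebesgue_on W. norm (u x) \<le> C"
shows "u \<in> L2 W"
proof -
interpret finite_measure "lebesgue_on W" by (rule finite_measure_W)
have "AE x in lebesgue_on W. norm ((norm (u x))\<^sup>2) \<le> C\<^sup>2"
 using assms(2) by eventually_elim (auto intro: power_mono)
thus ?thesis
 using assms(1) by (auto simp: L2_def intro!: integrable_const_bound)
qed

lemma L2_linear_image:
fixes L :: "'b::euclidean_space \<Rightarrow> 'c::euclidean_space"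
assumes "bounded_linear L" "u \<in> L2 W"
shows "(\<lambda>x. L (u x)) \<in> L2 W"
proof -
obtain K where K: "\<And>x. norm (L x) \<le> norm x * K" "K > 0"
 using bounded_linear.pos_bounded[OF assms(1)] by blast
have m: "(\<lambda>x. L (u x)) \<in> meas W"
 using assms(2) by (intro borel_measurable_continuous_on[OF linear_continuous_on[OF assms(1)]]) (auto simp: L2_def)
moreover have "integrable (lebesgue_on W) (\<lambda>x. (norm (L (u x)))\<^sup>2)"
proof (rule Bochner_Integration.integrable_bound)
 show "integrable (lebesgue_on W) (\<lambda>x. K\<^sup>2 * (norm (u x))\<^sup>2)" using assms(2) by (auto simp: L2_def)
 show "(\<lambda>x. (norm (L (u x)))\<^sup>2) \<in> meas W" using m by simp
 have "(norm (L (u x)))\<^sup>2 \<le> (norm (u x) * K)\<^sup>2" for x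
  by (intro power_mono K) simp
 thus "AE x in lebesgue_on W. norm ((norm (L (u x)))\<^sup>2) \<le> norm (K\<^sup>2 * (norm (u x))\<^sup>2)"
  by (intro AE_I2) (simp add: power_mult_distrib mult.commute)
qed
ultimately show ?thesis by (simp add: L2_def)
qed

lemma L2_integrable:
assumes "(u :: 'a \<Rightarrow> real) \<in> L2 W" shows "integrable (lebesgue_on W) u"
proof -
have "(\<lambda>x. 1::real) \<in> L2 W" by (rule L2_bounded[of _ 1]) auto
from L2_inner_integrable[OF assms this] show ?thesis by simp
qed

lemma L2_inner_cong:
assumes "AE x in lebesgue_on W. u x = u' x" "AE x in lebesgue_on W. v x = v' x"
 "u \<in> meas W" "u' \<in> meas W"
 "v \<in> meas W" "v' \<in> meas W"
shows "L2_inner W u v = L2_inner W u' v'"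
unfolding L2_inner_def
proof (rule integral_cong_AE)
show "AE x in lebesgue_on W. u x \<bullet> v x = u' x \<bullet> v' x"
 using assms(1,2) by eventually_elim simp
qed (use assms in auto)

lemma L2_norm_sq: "(L2_norm W u)\<^sup>2 = L2_inner W u u"
by (simp add: L2_norm_def L2_inner_def)

lemma L2_norm_nonneg: "0 \<le> L2_norm W u"
by (simp add: L2_norm_def L2_inner_def)

lemma L2_inner_add:
assumes "u \<in> L2 W" "v \<in> L2 W" "w \<in> L2 W"
shows "L2_inner W (\<lambda>x. u x + c * v x) w = L2_inner W u w + c * L2_inner W v (w :: 'a \<Rightarrow> real)"
using L2_inner_integrable[OF assms(1,3)] L2_inner_integrable[OF assms(2,3)]
by (simp add: L2_inner_def distrib_right mult.assoc)

lemma L2_sq_expand: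
assumes "u \<in> L2 W" "v \<in> L2 W"
shows "L2_inner W (\<lambda>x. u x + t *\<^sub>R v x) (\<lambda>x. u x + t *\<^sub>R v x)
  = L2_inner W u u + 2 * t * L2_inner W u v + t\<^sup>2 * L2_inner W v v"
proof -
have "(\<lambda>x. (u x + t *\<^sub>R v x) \<bullet> (u x + t *\<^sub>R v x)) = (\<lambda>x. u x \<bullet> u x + (2 * t) * (u x \<bullet> v x) + t\<^sup>2 * (v x \<bullet> v x))"
 by (auto simp: inner_add_left inner_add_right inner_commute power2_eq_square algebra_simps)
thus ?thesis
 using L2_inner_integrable[OF assms] L2_inner_integrable[OF assms(1,1)] L2_inner_integrable[OF assms(2,2)]
 by (simp add: L2_inner_def)
qed

lemma L2_cauchy_schwarz:
assumes "u \<in> L2 W" "v \<in> L2 W"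
shows "\<bar>L2_inner W u v\<bar> \<le> L2_norm W u * L2_norm W v"
proof -
let ?a = "L2_inner W u u" and ?b = "L2_inner W v v" and ?c = "L2_inner W u v"
have pos: "0 \<le> ?a + 2 * t * ?c + t\<^sup>2 * ?b" for t
 unfolding L2_sq_expand[OF assms, symmetric] by (simp add: L2_inner_def)
have b0: "0 \<le> ?b" by (simp add: L2_inner_def)
have "?c\<^sup>2 \<le> ?a * ?b"
proof (cases "?b = 0")
 case True
 have "?c = 0"
 proof (rule ccontr)
  assume c: "?c \<noteq> 0"
  \<comment> \<open>When the quadratic coefficient vanishes the polynomial is affine in
    \<open>t\<close>, and at this \<open>t\<close> it takes the value -1.\<close>
  thus False using pos[of "- (?a + 1) / (2 * ?c)"] True by (simp add: field_simps)
 qed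
 thus ?thesis using True by simp
next
 case False
 hence "?b > 0" using b0 by simp
 thus ?thesis using pos[of "- ?c / ?b"] by (simp add: field_simps power2_eq_square)
qed
hence "sqrt (?c\<^sup>2) \<le> sqrt (?a * ?b)" by (rule real_sqrt_le_mono)
thus ?thesis by (simp add: L2_norm_def real_sqrt_mult)
qed

lemma L2_inner_tendsto:
assumes "\<And>n. u n \<in> L2 W" "v \<in> L2 W" "z \<in> L2 W"
 and lim: "(\<lambda>n. L2_norm W (\<lambda>x. u n x - v x)) \<longlonglongrightarrow> 0"
shows "(\<lambda>n. L2_inner W (u n) z) \<longlonglongrightarrow> L2_inner W v z"
proof -
have d: "(\<lambda>x. u n x - v x) \<in> L2 W" for n using assms by (intro L2_diff)
have "(\<lambda>n. L2_inner W (\<lambda>x. u n x - v x) z) \<longlonglongrightarrow> 0"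
proof (rule Lim_null_comparison)
 show "\<forall>\<^sub>F n in sequentially. norm (L2_inner W (\<lambda>x. u n x - v x) z) \<le> L2_norm W (\<lambda>x. u n x - v x) * L2_norm W z"
  using L2_cauchy_schwarz[OF d assms(3)] by simp
 show "(\<lambda>n. L2_norm W (\<lambda>x. u n x - v x) * L2_norm W z) \<longlonglongrightarrow> 0"
  using tendsto_mult[OF lim tendsto_const[of "L2_norm W z"]] by simp
qed
moreover have "L2_inner W (\<lambda>x. u n x - v x) z = L2_inner W (u n) z - L2_inner W v z" for n
 using L2_inner_integrable[OF assms(1,3)] L2_inner_integrable[OF assms(2,3)]
 by (simp add: L2_inner_def inner_diff_left)
ultimately show ?thesis by (simp add: LIM_zero_iff)
qed

lemma L2_sq_tendsto:
assumes "\<And>n. u n \<in> L2 W" "v \<in> L2 W"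
 and lim: "(\<lambda>n. L2_norm W (\<lambda>x. u n x - v x)) \<longlonglongrightarrow> 0"
shows "(\<lambda>n. L2_inner W (u n) (u n)) \<longlonglongrightarrow> L2_inner W v v"
proof -
have "L2_inner W (u n) (u n) = (L2_norm W (\<lambda>x. u n x - v x))\<^sup>2 + (2 * L2_inner W (u n) v - L2_inner W v v)" for n
 using L2_sq_expand[OF assms(1,2), of n "-1"] by (simp add: L2_norm_sq)
moreover have "(\<lambda>n. (L2_norm W (\<lambda>x. u n x - v x))\<^sup>2 + (2 * L2_inner W (u n) v - L2_inner W v v))
  \<longlonglongrightarrow> 0\<^sup>2 + (2 * L2_inner W v v - L2_inner W v v)"
 by (intro tendsto_intros lim L2_inner_tendsto assms)
ultimately show ?thesis by simp
qed

lemma L2_norm_add_sq: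
assumes "u \<in> L2 W" "v \<in> L2 W"
shows "(L2_norm W (\<lambda>x. u x + v x))\<^sup>2 \<le> 2 * (L2_norm W u)\<^sup>2 + 2 * (L2_norm W v)\<^sup>2"
proof -
have "0 \<le> L2_inner W (\<lambda>x. u x + (-1) *\<^sub>R v x) (\<lambda>x. u x + (-1) *\<^sub>R v x)" by (simp add: L2_inner_def)
thus ?thesis
 using L2_sq_expand[OF assms, of "-1"] L2_sq_expand[OF assms, of 1] by (simp add: L2_norm_sq)
qed

end

section \<open>Test functions\<close>

lemma test_functions_mono: "\<phi> \<in> test_functions S \<Longrightarrow> S \<subseteq> T \<Longrightarrow> \<phi> \<in> test_functions T"
by (auto simp: test_functions_def)

lemma nonzero_in_closure: "\<phi> x \<noteq> 0 \<Longrightarrow> x \<in> closure {x. \<phi> x \<noteq> 0}"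
by (rule subsetD[OF closure_subset]) simp

lemma test_outside: "\<phi> \<in> test_functions S \<Longrightarrow> x \<notin> S \<Longrightarrow> \<phi> x = 0"
using nonzero_in_closure[of \<phi> x] by (auto simp: test_functions_def)

lemma closure_support_mono:
assumes "compact (closure {x. \<phi> x \<noteq> 0})" "closure {x. \<phi> x \<noteq> 0} \<subseteq> S" "{x. \<psi> x \<noteq> 0} \<subseteq> closure {x. \<phi> x \<noteq> 0}"
shows "compact (closure {x. \<psi> x \<noteq> 0})" "closure {x. \<psi> x \<noteq> 0} \<subseteq> S"
proof -
have *: "closure {x. \<psi> x \<noteq> 0} \<subseteq> closure {x. \<phi> x \<noteq> 0}" using assms(3) by (simp add: closure_minimal)
thus "closure {x. \<psi> x \<noteq> 0} \<subseteq> S" using assms(2) by simp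
have "compact (closure {x. \<phi> x \<noteq> 0} \<inter> closure {x. \<psi> x \<noteq> 0})"
 by (rule compact_Int_closed[OF assms(1)]) simp
thus "compact (closure {x. \<psi> x \<noteq> 0})" using * by (simp add: Int_absorb1)
qed

lemma test_pd:
assumes "\<phi> \<in> test_functions S"
shows "pd \<phi> a \<in> test_functions S"
proof -
have "{x. pd \<phi> a x \<noteq> 0} \<subseteq> closure {x. \<phi> x \<noteq> 0}"
proof (rule ccontr)
 assume "\<not> {x. pd \<phi> a x \<noteq> 0} \<subseteq> closure {x. \<phi> x \<noteq> 0}"
 then obtain x where x: "pd \<phi> a x \<noteq> 0" "x \<in> - closure {x. \<phi> x \<noteq> 0}" by auto
 have "(\<phi> has_derivative (\<lambda>h. 0)) (at x)"
 proof (rule has_derivative_transform_within_open[OF _ _ x(2)])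
  show "((\<lambda>x. 0) has_derivative (\<lambda>h. 0)) (at x)" by simp
  show "\<And>y. y \<in> - closure {x. \<phi> x \<noteq> 0} \<Longrightarrow> 0 = \<phi> y" using nonzero_in_closure[of \<phi>] by auto
 qed (auto simp: open_Compl)
 thus False using x(1) fun_cong[OF frechet_derivative_at, of \<phi> "\<lambda>h. 0" x a] by simp
qed
moreover have "smooth (pd \<phi> a)"
 using assms smooth_pd by (auto simp: test_functions_def)
ultimately show ?thesis
 using assms closure_support_mono[of \<phi> S "pd \<phi> a"] by (auto simp: test_functions_def)
qed

lemma test_linear_image:
assumes "bounded_linear L" "\<phi> \<in> test_functions S"
shows "(\<lambda>x. L (\<phi> x)) \<in> test_functions S"
proof -
interpret bounded_linear L by (rule assms(1))
have "{x. L (\<phi> x) \<noteq> 0} \<subseteq> closure {x. \<phi> x \<noteq> 0}"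
 by (clarify, rule nonzero_in_closure) (auto simp: zero)
thus ?thesis
 using assms(2) closure_support_mono[of \<phi> S "\<lambda>x. L (\<phi> x)"] smooth_linear_image[OF assms(1)]
 by (auto simp: test_functions_def)
qed

lemma pd_linear_image:
assumes "bounded_linear L" "smooth \<phi>"
shows "pd (\<lambda>x. L (\<phi> x)) a = (\<lambda>x. L (pd \<phi> a x))"
by (rule pd_fun, rule bounded_linear.has_derivative[OF assms(1)], rule smooth_has_derivative[OF assms(2)])

lemma test_smooth: "\<phi> \<in> test_functions S \<Longrightarrow> smooth \<phi>"
by (simp add: test_functions_def)

lemma test_add:
assumes "\<phi> \<in> test_functions S" "\<psi> \<in> test_functions S"
shows "(\<lambda>x. \<phi> x + \<psi> x) \<in> test_functions S"
proof -
let ?K = "closure {x. \<phi> x \<noteq> 0} \<union> closure {x. \<psi> x \<noteq> 0}"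
have c: "compact ?K" "?K \<subseteq> S" using assms by (auto simp: test_functions_def)
have "{x. \<phi> x + \<psi> x \<noteq> 0} \<subseteq> ?K"
proof
 fix x assume "x \<in> {x. \<phi> x + \<psi> x \<noteq> 0}"
 hence "\<phi> x \<noteq> 0 \<or> \<psi> x \<noteq> 0" by auto
 thus "x \<in> ?K" using nonzero_in_closure[of \<phi> x] nonzero_in_closure[of \<psi> x] by blast
qed
hence *: "closure {x. \<phi> x + \<psi> x \<noteq> 0} \<subseteq> ?K" using c by (intro closure_minimal compact_imp_closed) auto
have "compact (?K \<inter> closure {x. \<phi> x + \<psi> x \<noteq> 0})" by (rule compact_Int_closed[OF c(1)]) simp
thus ?thesis
 using * c(2) assms smooth_add by (auto simp: test_functions_def Int_absorb1)
qed

lemma test_bounded: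
fixes \<phi> :: "'a::euclidean_space \<Rightarrow> 'b::real_normed_vector"
assumes "\<phi> \<in> test_functions S"
shows "\<exists>C\<ge>0. \<forall>x. norm (\<phi> x) \<le> C"
proof -
let ?K = "closure {x. \<phi> x \<noteq> 0}"
have "compact (\<phi> ` ?K)"
 using assms by (intro compact_continuous_image smooth_continuous_on) (auto simp: test_functions_def)
then obtain C where C: "\<And>x. x \<in> ?K \<Longrightarrow> norm (\<phi> x) \<le> C"
 using compact_imp_bounded[of "\<phi> ` ?K"] that by (auto simp: bounded_iff)
have "norm (\<phi> x) \<le> max C 0" for x
 using C[of x] nonzero_in_closure[of \<phi> x] by (cases "\<phi> x = 0") (auto simp: le_max_iff_disj)
thus ?thesis by (intro exI[of _ "max C 0"]) auto
qed

lemma test_lipschitz: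
fixes \<phi> :: "'a::euclidean_space \<Rightarrow> 'b::real_normed_vector"
assumes "\<phi> \<in> test_functions S"
shows "\<exists>L. L-lipschitz_on UNIV \<phi>"
proof -
have "\<forall>i::'a. \<exists>C\<ge>0. \<forall>x. norm (pd \<phi> i x) \<le> C" using test_bounded[OF test_pd[OF assms]] by blast
then obtain C where C: "\<And>i::'a. C i \<ge> 0" "\<And>(i::'a) x. norm (pd \<phi> i x) \<le> C i" by metis
have "(\<Sum>i\<in>Basis. C i)-lipschitz_on UNIV \<phi>"
proof (rule bounded_derivative_imp_lipschitz)
 show "(\<phi> has_derivative frechet_derivative \<phi> (at x)) (at x within UNIV)" for x
  using smooth_has_derivative[OF test_smooth[OF assms]] by simp
 show "onorm (frechet_derivative \<phi> (at x)) \<le> (\<Sum>i\<in>Basis. C i)" for x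
 proof (rule onorm_le)
  fix h :: 'a
  interpret linear "frechet_derivative \<phi> (at x)"
  by (rule linear_frechet_derivative[OF smooth_differentiable[OF test_smooth[OF assms]]])
  have "frechet_derivative \<phi> (at x) h = frechet_derivative \<phi> (at x) (\<Sum>i\<in>Basis. (h \<bullet> i) *\<^sub>R i)"
  by (simp add: euclidean_representation)
  also have "\<dots> = (\<Sum>i\<in>Basis. (h \<bullet> i) *\<^sub>R pd \<phi> i x)" by (simp add: sum scale)
  also have "norm \<dots> \<le> (\<Sum>i\<in>Basis. C i * norm h)"
  by (rule order.trans[OF norm_sum], rule sum_mono) (use C Basis_le_norm in \<open>auto simp: mult.commute[of "C _"] intro!: mult_mono\<close>)
  finally show "norm (frechet_derivative \<phi> (at x) h) \<le> (\<Sum>i\<in>Basis. C i) * norm h"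
  by (simp only: sum_distrib_right)
 qed
qed (use C in \<open>auto intro: sum_nonneg\<close>)
thus ?thesis ..
qed

lemma test_measurable: "\<phi> \<in> test_functions S \<Longrightarrow> \<phi> \<in> borel_measurable borel"
by (intro borel_measurable_continuous_onI smooth_continuous_on test_smooth)

lemma test_measurable_lebesgue:
fixes \<phi> :: "'a::euclidean_space \<Rightarrow> 'b::euclidean_space"
shows "\<phi> \<in> test_functions S \<Longrightarrow> \<phi> \<in> borel_measurable lebesgue"
by (intro measurable_completion) (simp add: test_measurable)

lemma test_support_bounded:
"\<phi> \<in> test_functions S \<Longrightarrow> \<exists>R>0. \<forall>x. norm x > R \<longrightarrow> \<phi> x = 0"
using compact_support_Ex_bound[of \<phi>] unfolding test_functions_def by (metis (lifting) mem_Collect_eq not_le)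

lemma smooth_directional:
assumes "smooth \<phi>"
shows "((\<lambda>t. (\<phi> (x + t *\<^sub>R a) - \<phi> x) / t) \<longlongrightarrow> pd \<phi> a x) (at (0::real))"
proof -
have "((\<lambda>t. \<phi> (x + t *\<^sub>R a)) has_derivative (\<lambda>t. frechet_derivative \<phi> (at (x + 0 *\<^sub>R a)) (t *\<^sub>R a))) (at 0)"
 by (rule has_derivative_compose[OF _ smooth_has_derivative[OF assms]]) (auto intro!: derivative_eq_intros)
also have "(\<lambda>t. frechet_derivative \<phi> (at (x + 0 *\<^sub>R a)) (t *\<^sub>R a)) = (\<lambda>t. pd \<phi> a x * t)"
 using linear_scale[OF linear_frechet_derivative[OF smooth_differentiable[OF assms]]] by (auto simp: mult.commute)
finally show ?thesis by (simp add: has_field_derivative_def[symmetric] has_field_derivative_iff)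
qed

lemma lipschitz_mult_bounded:
fixes f g :: "'a::metric_space \<Rightarrow> real"
assumes "L-lipschitz_on UNIV f" "M-lipschitz_on UNIV g" "\<And>x. \<bar>f x\<bar> \<le> A" "\<And>x. \<bar>g x\<bar> \<le> B"
shows "(A * M + B * L)-lipschitz_on UNIV (\<lambda>x. f x * g x)"
proof (rule lipschitz_onI)
have A: "A \<ge> 0" and B: "B \<ge> 0" using assms(3,4)[of undefined] by linarith+
show "0 \<le> A * M + B * L" using A B lipschitz_on_nonneg[OF assms(1)] lipschitz_on_nonneg[OF assms(2)] by simp
fix x y
have "f x * g x - f y * g y = f x * (g x - g y) + (f x - f y) * g y" by (simp add: algebra_simps)
hence "\<bar>f x * g x - f y * g y\<bar> \<le> \<bar>f x\<bar> * \<bar>g x - g y\<bar> + \<bar>f x - f y\<bar> * \<bar>g y\<bar>"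
 by (metis abs_mult abs_triangle_ineq)
also have "\<dots> \<le> A * (M * dist x y) + (L * dist x y) * B"
 using lipschitz_onD[OF assms(1), of x y] lipschitz_onD[OF assms(2), of x y] assms(3)[of x] assms(4)[of y] A B
 by (intro add_mono mult_mono) (auto simp: dist_real_def)
finally show "dist (f x * g x) (f y * g y) \<le> (A * M + B * L) * dist x y"
 by (simp add: dist_real_def algebra_simps)
qed

text \<open>The product of \<open>u\<close> with a test function is Lipschitz of bounded support, so
  its directional derivative integrates to zero; the product rule is applied to the difference
  quotients.\<close>

lemma integral_by_parts:
fixes u Du \<phi> :: "'a::euclidean_space \<Rightarrow> real"
assumes u: "L-lipschitz_on UNIV u" "\<And>x. \<bar>u x\<bar> \<le> A" and \<phi>: "\<phi> \<in> test_functions UNIV"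
 and der: "AE x in lebesgue. ((\<lambda>t. (u (x + t *\<^sub>R a) - u x) / t) \<longlongrightarrow> Du x) (at 0)"
 and Du: "Du \<in> borel_measurable lebesgue" "AE x in lebesgue. \<bar>Du x\<bar> \<le> B"
shows "(LINT x|lebesgue. u x * pd \<phi> a x) = - (LINT x|lebesgue. Du x * \<phi> x)"
 "integrable lebesgue (\<lambda>x. u x * pd \<phi> a x)" "integrable lebesgue (\<lambda>x. Du x * \<phi> x)"
proof -
obtain M where M: "M-lipschitz_on UNIV \<phi>" using test_lipschitz[OF \<phi>] by blast
obtain P where P: "\<And>x. \<bar>\<phi> x\<bar> \<le> P" "P \<ge> 0" using test_bounded[OF \<phi>] by auto
obtain Q where Q: "\<And>x. \<bar>pd \<phi> a x\<bar> \<le> Q" "Q \<ge> 0" using test_bounded[OF test_pd[OF \<phi>], of a] by auto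
obtain R where R: "\<And>x. norm x > R \<Longrightarrow> \<phi> x = 0" using test_support_bounded[OF \<phi>] by auto
obtain R' where R': "\<And>x. norm x > R' \<Longrightarrow> pd \<phi> a x = 0" using test_support_bounded[OF test_pd[OF \<phi>], of a] by auto
have um: "u \<in> borel_measurable lebesgue"
 using lipschitz_on_continuous_on[OF u(1)] by (intro measurable_completion) (simp add: borel_measurable_continuous_onI)
have A0: "A \<ge> 0" using u(2)[of 0] by linarith
show i1: "integrable lebesgue (\<lambda>x. u x * pd \<phi> a x)"
proof (rule integrable_bounded_support[where C = "A * Q" and R = R'])
 show "(\<lambda>x. u x * pd \<phi> a x) \<in> borel_measurable lebesgue"
  by (intro borel_measurable_times um test_measurable_lebesgue[OF test_pd[OF \<phi>]])
 show "AE x in lebesgue. \<bar>u x * pd \<phi> a x\<bar> \<le> A * Q"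
  using u(2) Q A0 by (intro AE_I2) (auto simp: abs_mult intro!: mult_mono)
qed (simp add: R')
show i2: "integrable lebesgue (\<lambda>x. Du x * \<phi> x)"
proof (rule integrable_bounded_support[where C = "\<bar>B\<bar> * P" and R = R])
 show "(\<lambda>x. Du x * \<phi> x) \<in> borel_measurable lebesgue"
  by (intro borel_measurable_times Du test_measurable_lebesgue[OF \<phi>])
 show "AE x in lebesgue. \<bar>Du x * \<phi> x\<bar> \<le> \<bar>B\<bar> * P"
  using Du(2) by eventually_elim (use P in \<open>auto simp: abs_mult intro!: mult_mono\<close>)
qed (simp add: R)
have "(LINT x|lebesgue. u x * pd \<phi> a x + Du x * \<phi> x) = 0"
proof (rule directional_derivative_integral_zero(2)[OF lipschitz_mult_bounded[OF u(1) M u(2) P(1)]])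
 show "AE x in lebesgue. ((\<lambda>t. (u (x + t *\<^sub>R a) * \<phi> (x + t *\<^sub>R a) - u x * \<phi> x) / t) \<longlongrightarrow> u x * pd \<phi> a x + Du x * \<phi> x) (at 0)"
  using der
 proof eventually_elim
  case (elim x)
  have c: "((\<lambda>t. \<phi> (x + t *\<^sub>R a)) \<longlongrightarrow> \<phi> (x + 0 *\<^sub>R a)) (at (0::real))"
  by (rule isCont_tendsto_compose[of _ \<phi>])
  (use smooth_continuous_on[OF test_smooth[OF \<phi>], of UNIV] in \<open>auto simp: continuous_on_eq_continuous_at intro!: tendsto_eq_intros\<close>)
  have "((\<lambda>t. u x * ((\<phi> (x + t *\<^sub>R a) - \<phi> x) / t) + (u (x + t *\<^sub>R a) - u x) / t * \<phi> (x + t *\<^sub>R a))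
  \<longlongrightarrow> u x * pd \<phi> a x + Du x * \<phi> (x + 0 *\<^sub>R a)) (at 0)"
  by (intro tendsto_add tendsto_mult tendsto_const elim c smooth_directional test_smooth[OF \<phi>])
  moreover have "(\<lambda>t. u x * ((\<phi> (x + t *\<^sub>R a) - \<phi> x) / t) + (u (x + t *\<^sub>R a) - u x) / t * \<phi> (x + t *\<^sub>R a))
  = (\<lambda>t. (u (x + t *\<^sub>R a) * \<phi> (x + t *\<^sub>R a) - u x * \<phi> x) / t)"
  by (auto simp: diff_divide_distrib algebra_simps)
  ultimately show ?case by simp
 qed
qed (use i1 i2 R in auto)
thus "(LINT x|lebesgue. u x * pd \<phi> a x) = - (LINT x|lebesgue. Du x * \<phi> x)"
 using i1 i2 by simp
qed

section \<open>Weak gradients\<close>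

lemma integral_on_support:
fixes f :: "'a::euclidean_space \<Rightarrow> real"
assumes "open W" "\<And>x. x \<notin> W \<Longrightarrow> f x = 0"
shows "integral\<^sup>L (lebesgue_on W) f = integral\<^sup>L lebesgue f"
proof -
have "integral\<^sup>L (lebesgue_on W) f = integral\<^sup>L lebesgue (\<lambda>x. indicator W x *\<^sub>R f x)"
 using assms(1) by (intro integral_lebesgue_on) simp
also have "(\<lambda>x. indicator W x *\<^sub>R f x) = f"
 by (rule ext) (use assms(2) in \<open>auto simp: indicator_def\<close>)
finally show ?thesis .
qed

lemma test_UNIV_iff:
"\<phi> \<in> test_functions UNIV \<longleftrightarrow> smooth \<phi> \<and> (\<exists>R. \<forall>x. norm x > R \<longrightarrow> \<phi> x = 0)"
proof (intro iffI conjI)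
assume "smooth \<phi> \<and> (\<exists>R. \<forall>x. norm x > R \<longrightarrow> \<phi> x = 0)"
then obtain R where R: "smooth \<phi>" "\<And>x. norm x > R \<Longrightarrow> \<phi> x = 0" by blast
have "{x. \<phi> x \<noteq> 0} \<subseteq> cball 0 R"
proof
 fix x assume "x \<in> {x. \<phi> x \<noteq> 0}"
 thus "x \<in> cball 0 R" using R(2)[of x] by (cases "norm x > R") auto
qed
hence "closure {x. \<phi> x \<noteq> 0} \<subseteq> cball 0 R" by (rule closure_minimal) (rule closed_cball)
hence "compact (closure {x. \<phi> x \<noteq> 0})"
 using bounded_subset[OF bounded_cball] compact_eq_bounded_closed closed_closure by blast
thus "\<phi> \<in> test_functions UNIV" using R by (simp add: test_functions_def)
qed (use test_smooth test_support_bounded in blast)+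

lemma pd_affine:
assumes "smooth f"
shows "pd (\<lambda>x. f (c + s *\<^sub>R x)) a = (\<lambda>x. s *\<^sub>R pd f a (c + s *\<^sub>R x))"
proof -
have D: "((\<lambda>x. f (c + s *\<^sub>R x)) has_derivative (\<lambda>h. frechet_derivative f (at (c + s *\<^sub>R x)) (s *\<^sub>R h))) (at x)" for x
 by (rule has_derivative_compose[of "\<lambda>x. c + s *\<^sub>R x", OF _ smooth_has_derivative[OF assms]])
  (auto intro!: derivative_eq_intros)
show ?thesis
 unfolding pd_fun[OF D]
 by (simp add: linear_scale[OF linear_frechet_derivative[OF smooth_differentiable[OF assms]]])
qed

lemma test_translate:
assumes "\<phi> \<in> test_functions UNIV"
shows "(\<lambda>x. \<phi> (c + x)) \<in> test_functions UNIV" "pd (\<lambda>x. \<phi> (c + x)) a = (\<lambda>x. pd \<phi> a (c + x))"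
proof -
obtain R where R: "\<And>x. norm x > R \<Longrightarrow> \<phi> x = 0" using test_support_bounded[OF assms] by auto
have "\<phi> (c + x) = 0" if "norm x > R + norm c" for x
 using that norm_diff_ineq[of x c] by (intro R) (simp add: add.commute)
thus "(\<lambda>x. \<phi> (c + x)) \<in> test_functions UNIV"
 using smooth_affine_arg[OF test_smooth[OF assms], of c 1] unfolding test_UNIV_iff by auto
show "pd (\<lambda>x. \<phi> (c + x)) a = (\<lambda>x. pd \<phi> a (c + x))"
 using pd_affine[OF test_smooth[OF assms], of c 1 a] by simp
qed

lemma test_integrable:
assumes "(\<phi> :: 'a::euclidean_space \<Rightarrow> real) \<in> test_functions S"
shows "integrable lebesgue \<phi>"
proof -
obtain R C where "\<And>x. norm x > R \<Longrightarrow> \<phi> x = 0" "\<And>x. \<bar>\<phi> x\<bar> \<le> C"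
 using test_support_bounded[OF assms] test_bounded[OF assms] by auto
thus ?thesis
 by (intro integrable_bounded_support[where C = C and R = R] test_measurable_lebesgue[OF assms]) auto
qed

lemma difference_quotient_tendsto:
fixes p h :: "'a::euclidean_space \<Rightarrow> real"
assumes p: "p \<in> test_functions UNIV" and h: "integrable lebesgue h"
 and s: "s \<longlonglongrightarrow> 0" "\<And>n. s n \<noteq> 0"
shows "(\<lambda>n. LINT x|lebesgue. (p (s n *\<^sub>R a + x) - p x) / s n * h x) \<longlonglongrightarrow> (LINT x|lebesgue. pd p a x * h x)"
proof -
obtain L where L: "L-lipschitz_on UNIV p" using test_lipschitz[OF p] by blast
have hm: "h \<in> borel_measurable lebesgue" using h by simp
show ?thesis
proof (rule integral_dominated_convergence[where w = "\<lambda>x. (L * norm a) * \<bar>h x\<bar>"])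
 show "integrable lebesgue (\<lambda>x. (L * norm a) * \<bar>h x\<bar>)" using h by simp
 show "(\<lambda>x. (p (s n *\<^sub>R a + x) - p x) / s n * h x) \<in> borel_measurable lebesgue" for n
  by (intro borel_measurable_times hm borel_measurable_divide borel_measurable_diff
  test_measurable_lebesgue[OF p] test_measurable_lebesgue[OF test_translate(1)[OF p]] borel_measurable_const)
 show "(\<lambda>x. pd p a x * h x) \<in> borel_measurable lebesgue"
  by (intro borel_measurable_times hm test_measurable_lebesgue[OF test_pd[OF p]])
 have "filterlim s (at 0) sequentially" using s by (simp add: filterlim_at)
 thus "AE x in lebesgue. (\<lambda>n. (p (s n *\<^sub>R a + x) - p x) / s n * h x) \<longlonglongrightarrow> pd p a x * h x"
  using filterlim_compose[OF smooth_directional[OF test_smooth[OF p]]]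
  by (intro AE_I2 tendsto_mult tendsto_const) (simp add: add.commute)
 show "AE x in lebesgue. norm ((p (s n *\<^sub>R a + x) - p x) / s n * h x) \<le> (L * norm a) * \<bar>h x\<bar>" for n
 proof (rule AE_I2)
  fix x
  have "\<bar>p (s n *\<^sub>R a + x) - p x\<bar> \<le> L * norm a * \<bar>s n\<bar>"
  using lipschitz_onD[OF L, of "s n *\<^sub>R a + x" x] by (simp add: dist_norm ac_simps)
  hence "\<bar>(p (s n *\<^sub>R a + x) - p x) / s n\<bar> \<le> L * norm a"
  using s(2)[of n] by (simp add: abs_divide pos_divide_le_eq)
  thus "norm ((p (s n *\<^sub>R a + x) - p x) / s n * h x) \<le> (L * norm a) * \<bar>h x\<bar>"
  unfolding real_norm_def abs_mult by (rule mult_right_mono) simp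
 qed
qed
qed

lemma test_by_parts:
fixes p q :: "'a::euclidean_space \<Rightarrow> real"
assumes p: "p \<in> test_functions UNIV" and q: "q \<in> test_functions UNIV"
shows "(LINT x|lebesgue. p x * pd q a x) = - (LINT x|lebesgue. pd p a x * q x)"
proof -
obtain L where L: "L-lipschitz_on UNIV p" using test_lipschitz[OF p] by blast
obtain A where A: "\<And>x. \<bar>p x\<bar> \<le> A" using test_bounded[OF p] by auto
obtain B where B: "\<And>x. \<bar>pd p a x\<bar> \<le> B" using test_bounded[OF test_pd[OF p]] by (metis real_norm_def)
show ?thesis
 using smooth_directional[OF test_smooth[OF p]] B
 by (intro integral_by_parts(1)[OF L A q] test_measurable_lebesgue[OF test_pd[OF p]] AE_I2)
qed

lemma integral_lebesgue_translate:
fixes g :: "'a::euclidean_space \<Rightarrow> real"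
assumes "g \<in> borel_measurable borel"
shows "(LINT x|lebesgue. g (c + x)) = integral\<^sup>L lebesgue g"
proof -
have "(\<lambda>x. g (c + x)) \<in> borel_measurable borel" using assms by measurable
thus ?thesis
 using assms integral_lborel_translate(1)[OF assms, of c] by (simp add: integral_completion)
qed

text \<open>
Both sides are the derivative at \<open>0\<close> of \<open>t \<mapsto> \<integral> p(x + t a) \<partial>\<^sub>b q(x) dx\<close>; this avoids the symmetry of
second derivatives.
\<close>

lemma integral_pd_swap:
fixes p q :: "'a::euclidean_space \<Rightarrow> real"
assumes p: "p \<in> test_functions UNIV" and q: "q \<in> test_functions UNIV"
shows "(LINT x|lebesgue. pd p a x * pd q b x) = (LINT x|lebesgue. pd p b x * pd q a x)"
proof -
define s where "s n = inverse (real (Suc n))" for n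
have s0: "s \<longlonglongrightarrow> 0" unfolding s_def by (rule LIMSEQ_inverse_real_of_nat)
have s: "s \<longlonglongrightarrow> 0" "\<And>n. s n \<noteq> 0" "(\<lambda>n. - s n) \<longlonglongrightarrow> 0" "\<And>n. - s n \<noteq> 0"
 using s0 tendsto_minus[OF s0] by (auto simp: s_def)
have i: "integrable lebesgue (\<lambda>x. u x * v x)" if uv: "u \<in> test_functions UNIV" "v \<in> test_functions UNIV" for u v :: "'a \<Rightarrow> real"
proof -
 obtain C where C: "\<And>x. \<bar>u x\<bar> \<le> C" using test_bounded[OF uv(1)] by auto
 show ?thesis
 proof (rule Bochner_Integration.integrable_bound[OF integrable_mult_right[OF test_integrable[OF uv(2)], of C]])
  show "(\<lambda>x. u x * v x) \<in> borel_measurable lebesgue"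
  by (intro borel_measurable_times test_measurable_lebesgue[OF uv(1)] test_measurable_lebesgue[OF uv(2)])
  show "AE x in lebesgue. norm (u x * v x) \<le> norm (C * v x)"
  using C order.trans[OF C abs_ge_self] by (intro AE_I2) (auto simp: abs_mult intro: mult_right_mono)
 qed
qed
\<comment> \<open>Integration by parts moves the derivative in direction \<open>b\<close> from
  \<open>q\<close> to \<open>p\<close>, and translation moves the increment from \<open>p\<close> to
  \<open>q\<close> with the opposite sign; the two sign changes cancel.\<close>
have eq: "(LINT x|lebesgue. (p (s n *\<^sub>R a + x) - p x) / s n * pd q b x)
  = (LINT x|lebesgue. (q ((- s n) *\<^sub>R a + x) - q x) / (- s n) * pd p b x)" for n
proof -
 let ?ps = "\<lambda>x. p (s n *\<^sub>R a + x)" and ?qs = "\<lambda>x. q ((- s n) *\<^sub>R a + x)"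
 note ps = test_translate[OF p, of "s n *\<^sub>R a"] and qs = test_translate[OF q, of "(- s n) *\<^sub>R a"]
 have sp: "(LINT x|lebesgue. pd p b (s n *\<^sub>R a + x) * q x) = (LINT x|lebesgue. pd p b x * ?qs x)"
 proof -
  have "(\<lambda>x. pd p b x * ?qs x) \<in> borel_measurable borel"
  using test_measurable[OF test_pd[OF p]] test_measurable[OF qs(1)] by measurable
  from integral_lebesgue_translate[OF this, of "s n *\<^sub>R a"] show ?thesis by simp
 qed
 have "(LINT x|lebesgue. (?ps x - p x) / s n * pd q b x) = ((LINT x|lebesgue. ?ps x * pd q b x) - (LINT x|lebesgue. p x * pd q b x)) / s n"
  by (subst Bochner_Integration.integral_diff[symmetric])
  (simp_all add: i[OF ps(1) test_pd[OF q]] i[OF p test_pd[OF q]] left_diff_distrib[symmetric] diff_divide_distrib[symmetric] integral_divide_zero[symmetric] del: integral_divide_zero)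
 also have "\<dots> = ((LINT x|lebesgue. pd p b x * ?qs x) - (LINT x|lebesgue. pd p b x * q x)) / (- s n)"
 proof -
  have "(LINT x|lebesgue. ?ps x * pd q b x) = - (LINT x|lebesgue. pd p b x * ?qs x)"
  using test_by_parts[OF ps(1) q, of b] fun_cong[OF test_translate(2)[OF p, of "s n *\<^sub>R a" b]]
  by (simp add: sp)
  thus ?thesis unfolding test_by_parts[OF p q] by (simp add: diff_divide_distrib)
 qed
 also have "\<dots> = (LINT x|lebesgue. (?qs x - q x) / (- s n) * pd p b x)"
 proof -
  have "(\<lambda>x. (?qs x - q x) / (- s n) * pd p b x) = (\<lambda>x. (pd p b x * ?qs x - pd p b x * q x) / (- s n))"
  by (rule ext) (simp add: right_diff_distrib mult.commute)
  thus ?thesis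
  by (simp only: integral_divide_zero
  Bochner_Integration.integral_diff[OF i[OF test_pd[OF p] qs(1)] i[OF test_pd[OF p] q]])
 qed
 finally show ?thesis .
qed
have "(\<lambda>n. LINT x|lebesgue. (p (s n *\<^sub>R a + x) - p x) / s n * pd q b x) \<longlonglongrightarrow> (LINT x|lebesgue. pd p a x * pd q b x)"
 by (rule difference_quotient_tendsto[OF p test_integrable[OF test_pd[OF q]] s(1,2)])
moreover have "(\<lambda>n. LINT x|lebesgue. (p (s n *\<^sub>R a + x) - p x) / s n * pd q b x) \<longlonglongrightarrow> (LINT x|lebesgue. pd q a x * pd p b x)"
 unfolding eq by (rule difference_quotient_tendsto[OF q test_integrable[OF test_pd[OF p]] s(3,4)])
ultimately show ?thesis using LIMSEQ_unique by (fastforce simp: mult.commute)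
qed

text \<open>The classical Jacobian matrix. Unlike \<open>grad\<close> it is no arbitrary
  representative, so approximation statements are phrased with it.\<close>

definition jac :: "(real^'n \<Rightarrow> real^'n) \<Rightarrow> real^'n \<Rightarrow> real^'n^'n" where
"jac \<Phi> x = (\<chi> i j. pd \<Phi> (axis j 1) x $ i)"

lemma bounded_linear_entry: "bounded_linear (\<lambda>A :: real^'n^'m. A $ i $ j)"
by (rule bounded_linear_compose[OF bounded_linear_vec_nth bounded_linear_vec_nth])

lemma jac_entry:
assumes "smooth \<Phi>"
shows "jac \<Phi> x $ i $ j = pd (\<lambda>x. \<Phi> x $ i) (axis j 1) x"
using fun_cong[OF pd_linear_image[OF bounded_linear_vec_nth assms, of i "axis j 1"], of x]
by (simp add: jac_def)

lemma test_component: "\<Phi> \<in> test_functions S \<Longrightarrow> (\<lambda>x. (\<Phi> x :: real^'n) $ i) \<in> test_functions S"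
by (rule test_linear_image[OF bounded_linear_vec_nth])

definition sy :: "real^'n^'n \<Rightarrow> real^'n^'n" where
"sy A = (1/2) *\<^sub>R (A + transpose A)"

lemma symgrad_sy: "symgrad W v = (\<lambda>x. sy (grad W v x))"
by (simp add: symgrad_def sy_def)

lemma linear_sy: "linear sy"
by (rule linearI) (auto simp: sy_def transpose_def vec_eq_iff algebra_simps)

lemma bounded_linear_sy: "bounded_linear sy"
using linear_sy by (simp add: linear_conv_bounded_linear)

lemma inner_matrix: "(A :: real^'n^'m) \<bullet> B = (\<Sum>i\<in>UNIV. \<Sum>j\<in>UNIV. A $ i $ j * B $ i $ j)"
by (simp add: inner_vec_def)

lemma norm_transpose: "norm (transpose A :: real^'n^'n) = norm A"
proof -
have "transpose A \<bullet> transpose A = A \<bullet> A"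
 unfolding inner_matrix by (subst sum.swap) (simp add: transpose_def)
thus ?thesis by (simp add: norm_eq_sqrt_inner)
qed

lemma norm_sy: "norm (sy A) \<le> norm A"
using norm_triangle_ineq[of A "transpose A"] by (simp add: sy_def norm_transpose)

text \<open>The algebra behind Korn's inequality: after integration the mixed sum becomes the square
  of the divergence.\<close>

lemma sy_sq: "2 * (sy A \<bullet> sy A) = A \<bullet> A + (\<Sum>i\<in>UNIV. \<Sum>j\<in>UNIV. A $ i $ j * A $ j $ i)"
proof -
have "transpose A \<bullet> transpose A = A \<bullet> A" using norm_transpose[of A] by (simp add: norm_eq_sqrt_inner)
moreover have "A \<bullet> transpose A = (\<Sum>i\<in>UNIV. \<Sum>j\<in>UNIV. A $ i $ j * A $ j $ i)"
 by (simp add: inner_matrix transpose_def)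
moreover have "(A + transpose A) \<bullet> (A + transpose A) = A \<bullet> A + 2 * (A \<bullet> transpose A) + transpose A \<bullet> transpose A"
 by (simp add: inner_add_left inner_add_right inner_commute[of "transpose A" A])
moreover have "sy A \<bullet> sy A = ((A + transpose A) \<bullet> (A + transpose A)) / 4"
 unfolding sy_def by (simp only: inner_scaleR_left inner_scaleR_right)
ultimately show ?thesis by simp
qed

section \<open>Weak gradients, the space \<open>H10\<close> and Korn's inequality\<close>

context
fixes W :: "(real^'n) set"
assumes op: "open W" and bd: "bounded W"
begin

interpretation finite_measure "lebesgue_on W" by (rule finite_measure_W[OF op bd])

lemma measurable_on_W: "f \<in> borel_measurable lebesgue \<Longrightarrow> f \<in> meas W"
by (rule measurable_restrict_space1)

lemma test_L2: "(\<Phi> :: _ \<Rightarrow> 'b::euclidean_space) \<in> test_functions S \<Longrightarrow> \<Phi> \<in> L2 W"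
using test_bounded[of \<Phi> S]
by (auto intro!: L2_bounded[OF op bd] measurable_on_W test_measurable_lebesgue)

lemma component_L2: "v \<in> L2 W \<Longrightarrow> (\<lambda>x. (v x :: real^'m) $ i) \<in> L2 W"
by (rule L2_linear_image[OF op bd bounded_linear_vec_nth])

lemma entry_L2: "M \<in> L2 W \<Longrightarrow> (\<lambda>x. (M x :: real^'n^'n) $ i $ j) \<in> L2 W"
by (rule L2_linear_image[OF op bd bounded_linear_entry])

lemma L2_mult_integrable: "\<lbrakk>u \<in> L2 W; v \<in> L2 W\<rbrakk> \<Longrightarrow> integrable (lebesgue_on W) (\<lambda>x. u x * v x :: real)"
using L2_inner_integrable[OF op bd, of u v] by simp

lemma weak_grad_unique:
assumes "is_weak_grad W v M" "is_weak_grad W v M'"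
shows "AE x in lebesgue_on W. M x = M' x"
proof -
have M_L2: "M \<in> L2 W" "M' \<in> L2 W" using assms by (auto simp: is_weak_grad_def)
have "AE x in lebesgue_on W. M x $ i $ j - M' x $ i $ j = 0" for i j
proof (rule fundamental_lemma[OF op])
 show "integrable (lebesgue_on W) (\<lambda>x. M x $ i $ j - M' x $ i $ j)"
  using L2_integrable[OF op bd] entry_L2 M_L2 by (intro Bochner_Integration.integrable_diff) auto
 fix \<phi> :: "real^'n \<Rightarrow> real" assume \<phi>: "\<phi> \<in> test_functions W"
 have "(LINT x|lebesgue_on W. M x $ i $ j * \<phi> x) = (LINT x|lebesgue_on W. M' x $ i $ j * \<phi> x)"
 proof -
  have "- (LINT x|lebesgue_on W. P x $ i $ j * \<phi> x) = (LINT x|lebesgue_on W. v x $ i * pd \<phi> (axis j 1) x)"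
  if "is_weak_grad W v P" for P
  using that \<phi> by (simp add: is_weak_grad_def)
  from this[OF assms(1)] this[OF assms(2)] show ?thesis by simp
 qed
 thus "(LINT x|lebesgue_on W. (M x $ i $ j - M' x $ i $ j) * \<phi> x) = 0"
  using L2_mult_integrable[OF entry_L2[OF M_L2(1)] test_L2[OF \<phi>]]
  L2_mult_integrable[OF entry_L2[OF M_L2(2)] test_L2[OF \<phi>]]
  by (simp add: left_diff_distrib)
qed
hence "AE x in lebesgue_on W. \<forall>i\<in>UNIV. \<forall>j\<in>UNIV. M x $ i $ j - M' x $ i $ j = 0"
 by (simp only: AE_finite_all[OF finite]) simp
thus ?thesis by eventually_elim (simp add: vec_eq_iff)
qed

lemma grad_eq: "is_weak_grad W v M \<Longrightarrow> AE x in lebesgue_on W. grad W v x = M x"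
unfolding grad_def by (rule weak_grad_unique[OF someI[of "is_weak_grad W v"]]) auto

lemma grad_weak: "v \<in> H1 W \<Longrightarrow> is_weak_grad W v (grad W v)"
unfolding grad_def H1_def by (auto intro: someI_ex[of "is_weak_grad W v"])

lemma grad_L2: "v \<in> H1 W \<Longrightarrow> grad W v \<in> L2 W"
using grad_weak by (auto simp: is_weak_grad_def)

lemma weak_grad_add:
assumes "v \<in> L2 W" "w \<in> L2 W" "is_weak_grad W v M" "is_weak_grad W w P"
shows "is_weak_grad W (\<lambda>x. v x + w x) (\<lambda>x. M x + P x)"
proof -
have L: "M \<in> L2 W" "P \<in> L2 W" using assms by (auto simp: is_weak_grad_def)
show ?thesis
 unfolding is_weak_grad_def
proof (intro conjI ballI allI L2_add[OF op bd] L)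
 fix \<phi> :: "real^'n \<Rightarrow> real" and i j assume \<phi>: "\<phi> \<in> test_functions W"
 note T = test_L2[OF \<phi>] test_L2[OF test_pd[OF \<phi>]]
 show "(LINT x|lebesgue_on W. (v x + w x) $ i * pd \<phi> (axis j 1) x) = - (LINT x|lebesgue_on W. (M x + P x) $ i $ j * \<phi> x)"
  using assms(3,4) \<phi> L2_mult_integrable[OF component_L2[OF assms(1)] T(2)] L2_mult_integrable[OF component_L2[OF assms(2)] T(2)]
  L2_mult_integrable[OF entry_L2[OF L(1)] T(1)] L2_mult_integrable[OF entry_L2[OF L(2)] T(1)]
  by (simp add: is_weak_grad_def distrib_right)
qed
qed

lemma weak_grad_scale:
assumes "is_weak_grad W v M"
shows "is_weak_grad W (\<lambda>x. c *\<^sub>R v x) (\<lambda>x. c *\<^sub>R M x)"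
using assms L2_scale[OF op bd] by (auto simp: is_weak_grad_def mult.assoc)

lemma weak_grad_cong:
assumes "AE x in lebesgue_on W. v x = w x" "v \<in> meas W" "w \<in> meas W"
 "AE x in lebesgue_on W. M x = P x" "P \<in> meas W" "is_weak_grad W v M"
shows "is_weak_grad W w P"
proof -
have M_L2: "M \<in> L2 W" using assms by (auto simp: is_weak_grad_def)
have Mm: "M \<in> meas W" using M_L2 by (auto simp: L2_def)
have "integrable (lebesgue_on W) (\<lambda>x. P x \<bullet> P x)"
proof (rule integrable_cong_AE_imp[OF L2_inner_integrable[OF op bd M_L2 M_L2]])
 show "AE x in lebesgue_on W. M x \<bullet> M x = P x \<bullet> P x" using assms(4) by eventually_elim simp
qed (use assms(5) in simp)
hence P_L2: "P \<in> L2 W" using assms(5) by (simp add: L2_iff[OF op bd])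
have comp: "(\<lambda>x. f x $ i) \<in> meas W" if "f \<in> meas W" for f :: "_ \<Rightarrow> 'z::euclidean_space^'n" and i
 using borel_measurable_continuous_on[OF linear_continuous_on[OF bounded_linear_vec_nth] that] .
show ?thesis
 unfolding is_weak_grad_def
proof (intro conjI ballI allI P_L2)
 fix \<phi> :: "real^'n \<Rightarrow> real" and i j assume \<phi>: "\<phi> \<in> test_functions W"
 note m = measurable_on_W[OF test_measurable_lebesgue[OF \<phi>]] measurable_on_W[OF test_measurable_lebesgue[OF test_pd[OF \<phi>]]]
 have "(LINT x|lebesgue_on W. w x $ i * pd \<phi> (axis j 1) x) = (LINT x|lebesgue_on W. v x $ i * pd \<phi> (axis j 1) x)"
 proof (rule integral_cong_AE)
  show "AE x in lebesgue_on W. w x $ i * pd \<phi> (axis j 1) x = v x $ i * pd \<phi> (axis j 1) x"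
  using assms(1) by eventually_elim simp
 qed (intro borel_measurable_times m comp assms)+
 moreover have "(LINT x|lebesgue_on W. P x $ i $ j * \<phi> x) = (LINT x|lebesgue_on W. M x $ i $ j * \<phi> x)"
 proof (rule integral_cong_AE)
  show "AE x in lebesgue_on W. P x $ i $ j * \<phi> x = M x $ i $ j * \<phi> x"
  using assms(4) by eventually_elim simp
 qed (intro borel_measurable_times m comp[OF comp] assms Mm)+
 ultimately show "(LINT x|lebesgue_on W. w x $ i * pd \<phi> (axis j 1) x) = - (LINT x|lebesgue_on W. P x $ i $ j * \<phi> x)"
  using assms(6) \<phi> by (simp add: is_weak_grad_def)
qed
qed

lemma H1_add:
assumes "v \<in> H1 W" "w \<in> H1 W"
shows "v + w \<in> H1 W" "AE x in lebesgue_on W. grad W (v + w) x = grad W v x + grad W w x"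
proof -
have *: "is_weak_grad W (v + w) (\<lambda>x. grad W v x + grad W w x)"
 unfolding plus_fun_def using assms by (intro weak_grad_add grad_weak) (auto simp: H1_def)
thus "v + w \<in> H1 W"
 using assms L2_add[OF op bd, of v w] by (auto simp: H1_def plus_fun_def)
from * show "AE x in lebesgue_on W. grad W (v + w) x = grad W v x + grad W w x" by (rule grad_eq)
qed

lemma H1_scale:
assumes "v \<in> H1 W"
shows "c *\<^sub>R v \<in> H1 W" "AE x in lebesgue_on W. grad W (c *\<^sub>R v) x = c *\<^sub>R grad W v x"
proof -
have *: "is_weak_grad W (c *\<^sub>R v) (\<lambda>x. c *\<^sub>R grad W v x)"
 unfolding scaleR_fun_def using assms by (intro weak_grad_scale grad_weak) auto
thus "c *\<^sub>R v \<in> H1 W"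
 using assms L2_scale[OF op bd, of v] by (auto simp: H1_def scaleR_fun_def)
from * show "AE x in lebesgue_on W. grad W (c *\<^sub>R v) x = c *\<^sub>R grad W v x" by (rule grad_eq)
qed

lemma H1_diff:
assumes "v \<in> H1 W" "w \<in> H1 W"
shows "v - w \<in> H1 W" "AE x in lebesgue_on W. grad W (v - w) x = grad W v x - grad W w x"
proof -
have e: "v - w = v + (-1) *\<^sub>R w" by simp
note s = H1_scale[OF assms(2), of "-1"]
show "v - w \<in> H1 W" unfolding e by (rule H1_add[OF assms(1) s(1)])
show "AE x in lebesgue_on W. grad W (v - w) x = grad W v x - grad W w x"
 unfolding e using H1_add(2)[OF assms(1) s(1)] s(2) by eventually_elim simp
qed

lemma jac_measurable:
assumes "\<Phi> \<in> test_functions S" shows "jac \<Phi> \<in> borel_measurable lebesgue"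
proof -
have "continuous_on UNIV (jac \<Phi>)"
 unfolding jac_def
 by (intro continuous_on_vec_lambda bounded_linear.continuous_on[OF bounded_linear_vec_nth]
  smooth_continuous_on smooth_pd test_smooth[OF assms])
thus ?thesis by (intro measurable_completion) (simp add: borel_measurable_continuous_onI)
qed

lemma jac_L2: assumes "\<Phi> \<in> test_functions S" shows "jac \<Phi> \<in> L2 W"
proof -
have "\<forall>i j. \<exists>C\<ge>0. \<forall>x. norm (jac \<Phi> x $ i $ j) \<le> C"
 unfolding jac_entry[OF test_smooth[OF assms]]
 using test_bounded[OF test_pd[OF test_component[OF assms]]] by blast
then obtain C where C: "\<And>i j x. norm (jac \<Phi> x $ i $ j) \<le> C i j" by metis
have "norm (jac \<Phi> x) \<le> (\<Sum>i\<in>UNIV. \<Sum>j\<in>UNIV. C i j)" for x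
proof -
 have "norm (jac \<Phi> x) \<le> (\<Sum>i\<in>UNIV. norm (jac \<Phi> x $ i))" by (simp add: norm_vec_def L2_set_le_sum)
 also have "\<dots> \<le> (\<Sum>i\<in>UNIV. \<Sum>j\<in>UNIV. norm (jac \<Phi> x $ i $ j))"
  by (intro sum_mono) (simp add: norm_vec_def[of "jac \<Phi> x $ _"] L2_set_le_sum)
 also have "\<dots> \<le> (\<Sum>i\<in>UNIV. \<Sum>j\<in>UNIV. C i j)" by (intro sum_mono C)
 finally show ?thesis .
qed
thus ?thesis
 using jac_measurable[OF assms] by (intro L2_bounded[OF op bd] measurable_on_W) auto
qed

lemma test_weak_grad:
assumes \<Phi>: "\<Phi> \<in> test_functions W"
shows "is_weak_grad W \<Phi> (jac \<Phi>)" "\<Phi> \<in> H1 W"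
proof -
show "is_weak_grad W \<Phi> (jac \<Phi>)"
 unfolding is_weak_grad_def
proof (intro conjI ballI allI jac_L2[OF \<Phi>])
 fix \<phi> :: "real^'n \<Rightarrow> real" and i j assume \<phi>: "\<phi> \<in> test_functions W"
 have "(LINT x|lebesgue_on W. \<Phi> x $ i * pd \<phi> (axis j 1) x) = (LINT x|lebesgue. \<Phi> x $ i * pd \<phi> (axis j 1) x)"
  by (rule integral_on_support[OF op]) (simp add: test_outside[OF \<Phi>])
 also have "\<dots> = - (LINT x|lebesgue. pd (\<lambda>x. \<Phi> x $ i) (axis j 1) x * \<phi> x)"
  by (rule test_by_parts) (use test_functions_mono[OF test_component[OF \<Phi>]] test_functions_mono[OF \<phi>] in auto)
 also have "\<dots> = - (LINT x|lebesgue_on W. jac \<Phi> x $ i $ j * \<phi> x)"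
  unfolding jac_entry[OF test_smooth[OF \<Phi>]]
  by (subst integral_on_support[OF op]) (simp_all add: test_outside[OF \<phi>])
 finally show "(LINT x|lebesgue_on W. \<Phi> x $ i * pd \<phi> (axis j 1) x) = - (LINT x|lebesgue_on W. jac \<Phi> x $ i $ j * \<phi> x)" .
qed
thus "\<Phi> \<in> H1 W" using test_L2[OF \<Phi>] by (auto simp: H1_def)
qed

lemma H1_norm_approx:
assumes "\<Phi> \<in> test_functions W" "v \<in> H1 W"
shows "(H1_norm W (\<Phi> - v))\<^sup>2 = (L2_norm W (\<lambda>x. \<Phi> x - v x))\<^sup>2 + (L2_norm W (\<lambda>x. jac \<Phi> x - grad W v x))\<^sup>2"
proof -
note t = test_weak_grad[OF assms(1)]
have "AE x in lebesgue_on W. grad W (\<Phi> - v) x = jac \<Phi> x - grad W v x"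
 using H1_diff(2)[OF t(2) assms(2)] grad_eq[OF t(1)] by eventually_elim simp
moreover have "grad W (\<Phi> - v) \<in> meas W" "(\<lambda>x. jac \<Phi> x - grad W v x) \<in> meas W"
 using grad_L2[OF H1_diff(1)[OF t(2) assms(2)]] jac_L2[OF assms(1)] grad_L2[OF assms(2)]
 by (auto simp: L2_def intro!: borel_measurable_diff)
ultimately have "L2_inner W (grad W (\<Phi> - v)) (grad W (\<Phi> - v)) = L2_inner W (\<lambda>x. jac \<Phi> x - grad W v x) (\<lambda>x. jac \<Phi> x - grad W v x)"
 by (intro L2_inner_cong[OF op bd])
thus ?thesis
 by (simp add: H1_norm_def L2_norm_sq[OF op bd] fun_diff_def L2_inner_def)
qed

lemma H10_approx:
assumes "v \<in> H10 W"
obtains \<Phi> where "\<And>n. \<Phi> n \<in> test_functions W" "L2_lim W \<Phi> v"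
 "L2_lim W (\<lambda>n. jac (\<Phi> n)) (grad W v)"
proof -
obtain \<Phi> where \<Phi>: "\<And>n. \<Phi> n \<in> test_functions W" "(\<lambda>n. H1_norm W (\<Phi> n - v)) \<longlonglongrightarrow> 0" and v: "v \<in> H1 W"
 using assms by (auto simp: H10_def)
have b: "L2_norm W (\<lambda>x. \<Phi> n x - v x) \<le> H1_norm W (\<Phi> n - v)" "L2_norm W (\<lambda>x. jac (\<Phi> n) x - grad W v x) \<le> H1_norm W (\<Phi> n - v)" for n
proof -
 have "0 \<le> H1_norm W (\<Phi> n - v)" by (simp add: H1_norm_def)
 thus "L2_norm W (\<lambda>x. \<Phi> n x - v x) \<le> H1_norm W (\<Phi> n - v)" "L2_norm W (\<lambda>x. jac (\<Phi> n) x - grad W v x) \<le> H1_norm W (\<Phi> n - v)"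
  using H1_norm_approx[OF \<Phi>(1) v, of n] by (auto intro: power2_le_imp_le[rotated])
qed
have "L2_lim W \<Phi> v"
 by (rule tendsto_sandwich[OF _ _ tendsto_const \<Phi>(2)]) (auto simp: b L2_norm_nonneg[OF op bd])
moreover have "L2_lim W (\<lambda>n. jac (\<Phi> n)) (grad W v)"
 by (rule tendsto_sandwich[OF _ _ tendsto_const \<Phi>(2)]) (auto simp: b L2_norm_nonneg[OF op bd])
ultimately show thesis by (rule that[OF \<Phi>(1)])
qed

text \<open>Membership is reduced to convergence of Jacobians to an explicit gradient
  \<open>M\<close>, since \<open>H1_norm\<close> speaks of chosen gradients of differences.\<close>

lemma H10I:
assumes "v \<in> L2 W" "is_weak_grad W v M" "\<And>n. \<Phi> n \<in> test_functions W"
 and "L2_lim W \<Phi> v" "(\<lambda>n. L2_norm W (\<lambda>x. jac (\<Phi> n) x - M x)) \<longlonglongrightarrow> 0"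
shows "v \<in> H10 W"
proof -
have v: "v \<in> H1 W" using assms by (auto simp: H1_def)
have M_L2: "M \<in> L2 W" using assms by (auto simp: is_weak_grad_def)
have e: "L2_norm W (\<lambda>x. jac (\<Phi> n) x - grad W v x) = L2_norm W (\<lambda>x. jac (\<Phi> n) x - M x)" for n
proof -
 have "AE x in lebesgue_on W. jac (\<Phi> n) x - grad W v x = jac (\<Phi> n) x - M x"
  using grad_eq[OF assms(2)] by eventually_elim simp
 moreover have "(\<lambda>x. jac (\<Phi> n) x - grad W v x) \<in> meas W" "(\<lambda>x. jac (\<Phi> n) x - M x) \<in> meas W"
  using jac_L2[OF assms(3), of n] grad_L2[OF v] M_L2 by (auto simp: L2_def intro!: borel_measurable_diff)
 ultimately show ?thesis unfolding L2_norm_def by (subst L2_inner_cong[OF op bd]) auto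
qed
have "H1_norm W (\<Phi> n - v) = sqrt ((L2_norm W (\<lambda>x. \<Phi> n x - v x))\<^sup>2 + (L2_norm W (\<lambda>x. jac (\<Phi> n) x - M x))\<^sup>2)" for n
proof -
 have "H1_norm W (\<Phi> n - v) = sqrt ((H1_norm W (\<Phi> n - v))\<^sup>2)" by (simp add: H1_norm_def)
 thus ?thesis unfolding H1_norm_approx[OF assms(3) v] e .
qed
moreover have "(\<lambda>n. sqrt ((L2_norm W (\<lambda>x. \<Phi> n x - v x))\<^sup>2 + (L2_norm W (\<lambda>x. jac (\<Phi> n) x - M x))\<^sup>2)) \<longlonglongrightarrow> sqrt (0\<^sup>2 + 0\<^sup>2)"
 by (intro tendsto_intros assms)
ultimately have "(\<lambda>n. H1_norm W (\<Phi> n - v)) \<longlonglongrightarrow> 0" by simp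
thus ?thesis using v assms(3) by (auto simp: H10_def intro!: exI[of _ \<Phi>])
qed

lemma L2_norm_add_tendsto:
assumes "\<And>n. a n \<in> L2 W" "\<And>n. b n \<in> L2 W" "(\<lambda>n. L2_norm W (a n)) \<longlonglongrightarrow> 0" "(\<lambda>n. L2_norm W (b n)) \<longlonglongrightarrow> 0"
shows "(\<lambda>n. L2_norm W (\<lambda>x. a n x + b n x)) \<longlonglongrightarrow> 0"
proof (rule tendsto_sandwich[OF _ _ tendsto_const])
have "(\<lambda>n. sqrt (2 * (L2_norm W (a n))\<^sup>2 + 2 * (L2_norm W (b n))\<^sup>2)) \<longlonglongrightarrow> sqrt (2 * 0\<^sup>2 + 2 * 0\<^sup>2)"
 by (intro tendsto_intros assms)
thus "(\<lambda>n. sqrt (2 * (L2_norm W (a n))\<^sup>2 + 2 * (L2_norm W (b n))\<^sup>2)) \<longlonglongrightarrow> 0" by simp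
show "\<forall>\<^sub>F n in sequentially. L2_norm W (\<lambda>x. a n x + b n x) \<le> sqrt (2 * (L2_norm W (a n))\<^sup>2 + 2 * (L2_norm W (b n))\<^sup>2)"
 using L2_norm_add_sq[OF op bd assms(1,2)] by (intro always_eventually allI real_le_rsqrt)
qed (simp add: L2_norm_nonneg[OF op bd])

lemma H10_H1: "v \<in> H10 W \<Longrightarrow> v \<in> H1 W" by (simp add: H10_def)

lemma jac_add: "\<lbrakk>\<Phi> \<in> test_functions S; \<Psi> \<in> test_functions S\<rbrakk> \<Longrightarrow> jac (\<lambda>x. \<Phi> x + \<Psi> x) x = jac \<Phi> x + jac \<Psi> x"
proof -
assume a: "\<Phi> \<in> test_functions S" "\<Psi> \<in> test_functions S"
have "((\<lambda>x. \<Phi> x + \<Psi> x) has_derivative (\<lambda>h. pd \<Phi> h x + pd \<Psi> h x)) (at x)"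
 by (intro has_derivative_add smooth_has_derivative test_smooth[OF a(1)] test_smooth[OF a(2)])
from fun_cong[OF frechet_derivative_at[OF this]] show ?thesis
 by (simp add: jac_def vec_eq_iff)
qed

lemma H10_add: assumes "v \<in> H10 W" "w \<in> H10 W" shows "v + w \<in> H10 W"
proof -
obtain \<Phi> where \<Phi>: "\<And>n. \<Phi> n \<in> test_functions W" "L2_lim W \<Phi> v"
 "L2_lim W (\<lambda>n. jac (\<Phi> n)) (grad W v)" by (rule H10_approx[OF assms(1)]) blast
obtain \<Psi> where \<Psi>: "\<And>n. \<Psi> n \<in> test_functions W" "L2_lim W \<Psi> w"
 "L2_lim W (\<lambda>n. jac (\<Psi> n)) (grad W w)" by (rule H10_approx[OF assms(2)]) blast
note H = H10_H1[OF assms(1)] H10_H1[OF assms(2)]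
have L: "v \<in> L2 W" "w \<in> L2 W" using H by (auto simp: H1_def)
show ?thesis
 unfolding plus_fun_def
proof (rule H10I[where \<Phi> = "\<lambda>n x. \<Phi> n x + \<Psi> n x"])
 show "(\<lambda>x. v x + w x) \<in> L2 W" by (intro L2_add[OF op bd] L)
 show "is_weak_grad W (\<lambda>x. v x + w x) (\<lambda>x. grad W v x + grad W w x)"
  by (intro weak_grad_add L grad_weak H)
 show "(\<lambda>x. \<Phi> n x + \<Psi> n x) \<in> test_functions W" for n by (intro test_add \<Phi> \<Psi>)
 have "(\<lambda>n. L2_norm W (\<lambda>x. (\<Phi> n x - v x) + (\<Psi> n x - w x))) \<longlonglongrightarrow> 0"
  by (intro L2_norm_add_tendsto L2_diff[OF op bd] test_L2[OF \<Phi>(1)] test_L2[OF \<Psi>(1)] L \<Phi>(2) \<Psi>(2))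
 thus "(\<lambda>n. L2_norm W (\<lambda>x. \<Phi> n x + \<Psi> n x - (v x + w x))) \<longlonglongrightarrow> 0" by (simp add: algebra_simps)
 have "(\<lambda>n. L2_norm W (\<lambda>x. (jac (\<Phi> n) x - grad W v x) + (jac (\<Psi> n) x - grad W w x))) \<longlonglongrightarrow> 0"
  by (intro L2_norm_add_tendsto L2_diff[OF op bd] jac_L2[OF \<Phi>(1)] jac_L2[OF \<Psi>(1)] grad_L2 H \<Phi>(3) \<Psi>(3))
 thus "(\<lambda>n. L2_norm W (\<lambda>x. jac (\<lambda>x. \<Phi> n x + \<Psi> n x) x - (grad W v x + grad W w x))) \<longlonglongrightarrow> 0"
  by (simp add: jac_add[OF \<Phi>(1) \<Psi>(1)] algebra_simps)
qed
qed

lemma jac_scale: "\<Phi> \<in> test_functions S \<Longrightarrow> jac (\<lambda>x. c *\<^sub>R \<Phi> x) x = c *\<^sub>R jac \<Phi> x"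
using fun_cong[OF pd_linear_image[OF bounded_linear_scaleR_right test_smooth[of \<Phi> S], of c "axis _ 1"], of x]
by (simp add: jac_def vec_eq_iff)

lemma L2_norm_scale: "L2_norm W (\<lambda>x. c *\<^sub>R u x) = \<bar>c\<bar> * L2_norm W u"
by (simp add: L2_norm_def L2_inner_def real_sqrt_mult flip: mult.assoc)

lemma H10_scale: assumes "v \<in> H10 W" shows "c *\<^sub>R v \<in> H10 W"
proof -
obtain \<Phi> where \<Phi>: "\<And>n. \<Phi> n \<in> test_functions W" "L2_lim W \<Phi> v"
 "L2_lim W (\<lambda>n. jac (\<Phi> n)) (grad W v)" by (rule H10_approx[OF assms(1)]) blast
note H = H10_H1[OF assms(1)]
have L: "v \<in> L2 W" using H by (auto simp: H1_def)
show ?thesis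
 unfolding scaleR_fun_def
proof (rule H10I[where \<Phi> = "\<lambda>n x. c *\<^sub>R \<Phi> n x"])
 show "(\<lambda>x. c *\<^sub>R v x) \<in> L2 W" by (intro L2_scale[OF op bd] L)
 show "is_weak_grad W (\<lambda>x. c *\<^sub>R v x) (\<lambda>x. c *\<^sub>R grad W v x)"
  by (intro weak_grad_scale grad_weak H)
 show "(\<lambda>x. c *\<^sub>R \<Phi> n x) \<in> test_functions W" for n by (intro test_linear_image[OF bounded_linear_scaleR_right] \<Phi>)
 show "(\<lambda>n. L2_norm W (\<lambda>x. c *\<^sub>R \<Phi> n x - c *\<^sub>R v x)) \<longlonglongrightarrow> 0"
  unfolding scaleR_diff_right[symmetric] L2_norm_scale using tendsto_mult[OF tendsto_const[of "\<bar>c\<bar>"] \<Phi>(2)] by simp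
 show "(\<lambda>n. L2_norm W (\<lambda>x. jac (\<lambda>x. c *\<^sub>R \<Phi> n x) x - c *\<^sub>R grad W v x)) \<longlonglongrightarrow> 0"
  unfolding jac_scale[OF \<Phi>(1)] scaleR_diff_right[symmetric] L2_norm_scale
  using tendsto_mult[OF tendsto_const[of "\<bar>c\<bar>"] \<Phi>(3)] by simp
qed
qed

text \<open>The function \<phi> need not vanish near the boundary of \<open>W\<close>: the formula
  holds for the approximating test functions on the whole space and passes to the limit. In other
  words, extension by zero preserves the weak gradient.\<close>

lemma H10_by_parts:
assumes v: "v \<in> H10 W" and \<phi>: "(\<phi> :: real^'n \<Rightarrow> real) \<in> test_functions UNIV"
shows "(LINT x|lebesgue_on W. v x $ i * pd \<phi> (axis j 1) x) = - (LINT x|lebesgue_on W. grad W v x $ i $ j * \<phi> x)"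
proof -
obtain \<Phi> where \<Phi>: "\<And>n. \<Phi> n \<in> test_functions W" "L2_lim W \<Phi> v"
 "L2_lim W (\<lambda>n. jac (\<Phi> n)) (grad W v)" by (rule H10_approx[OF assms(1)]) blast
note H = H10_H1[OF v]
have L: "v \<in> L2 W" using H by (auto simp: H1_def)
\<comment> \<open>Placing the scalar factor in one component writes the integrals as inner products
  with fixed \<open>L2\<close> functions, to which convergence in norm applies.\<close>
define z where "z x = pd \<phi> (axis j 1) x *\<^sub>R (axis i 1 :: real^'n)" for x
define y where "y x = \<phi> x *\<^sub>R (axis i (axis j 1) :: real^'n^'n)" for x
have zL: "z \<in> L2 W" unfolding z_def
 by (intro L2_linear_image[OF op bd bounded_linear_scaleR_left] test_L2[OF test_pd[OF \<phi>]])
have yL: "y \<in> L2 W" unfolding y_def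
 by (intro L2_linear_image[OF op bd bounded_linear_scaleR_left] test_L2[OF \<phi>])
have 1: "L2_inner W u z = (LINT x|lebesgue_on W. u x $ i * pd \<phi> (axis j 1) x)" for u
 by (simp add: L2_inner_def z_def inner_axis mult.commute)
have 2: "L2_inner W M y = (LINT x|lebesgue_on W. M x $ i $ j * \<phi> x)" for M
 by (simp add: L2_inner_def y_def inner_axis mult.commute)
have eq: "L2_inner W (\<Phi> n) z = - L2_inner W (jac (\<Phi> n)) y" for n
proof -
 note t = \<Phi>(1)[of n]
 have "L2_inner W (\<Phi> n) z = (LINT x|lebesgue. \<Phi> n x $ i * pd \<phi> (axis j 1) x)"
  unfolding 1 by (rule integral_on_support[OF op]) (simp add: test_outside[OF t])
 also have "\<dots> = - (LINT x|lebesgue. pd (\<lambda>x. \<Phi> n x $ i) (axis j 1) x * \<phi> x)"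
  by (rule test_by_parts[OF _ \<phi>]) (use test_functions_mono[OF test_component[OF t]] in auto)
 also have "\<dots> = - L2_inner W (jac (\<Phi> n)) y"
  unfolding 2 jac_entry[OF test_smooth[OF t]]
  by (subst integral_on_support[OF op]) (simp_all add: test_outside[OF test_pd[OF test_component[OF t]]])
 finally show ?thesis .
qed
have "(\<lambda>n. L2_inner W (\<Phi> n) z) \<longlonglongrightarrow> L2_inner W v z"
 by (intro L2_inner_tendsto[OF op bd] test_L2[OF \<Phi>(1)] L zL \<Phi>(2))
moreover have "(\<lambda>n. L2_inner W (\<Phi> n) z) \<longlonglongrightarrow> - L2_inner W (grad W v) y"
 unfolding eq by (intro tendsto_minus L2_inner_tendsto[OF op bd] jac_L2[OF \<Phi>(1)] grad_L2[OF H] yL \<Phi>(3))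
ultimately show ?thesis unfolding 1 2 by (rule LIMSEQ_unique)
qed

text \<open>Exchanging the two derivatives turns the integral of \<open>A_ij A_ji\<close> into that
  of \<open>A_ii A_jj\<close>. The sum of the latter is the square of the trace, hence nonnegative,
  which is why the factor 2 suffices.\<close>

lemma korn_test:
assumes \<Phi>: "\<Phi> \<in> test_functions W"
shows "L2_inner W (jac \<Phi>) (jac \<Phi>) \<le> 2 * L2_inner W (\<lambda>x. sy (jac \<Phi> x)) (\<lambda>x. sy (jac \<Phi> x))"
proof -
define A where "A = jac \<Phi>"
have AL: "A \<in> L2 W" using jac_L2[OF \<Phi>] by (simp add: A_def)
have ii: "integrable (lebesgue_on W) (\<lambda>x. A x $ i $ j * A x $ k $ l)" for i j k l
 by (intro L2_mult_integrable entry_L2 AL)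
have swap: "(LINT x|lebesgue_on W. A x $ i $ j * A x $ j $ i) = (LINT x|lebesgue_on W. A x $ i $ i * A x $ j $ j)" for i j
proof -
 have t: "(\<lambda>x. \<Phi> x $ i) \<in> test_functions UNIV" for i
  using test_functions_mono[OF test_component[OF \<Phi>]] by auto
 have o: "x \<notin> W \<Longrightarrow> A x $ i $ j = 0" for x i j
  unfolding A_def jac_entry[OF test_smooth[OF \<Phi>]] by (rule test_outside[OF test_pd[OF test_component[OF \<Phi>]]])
 have "(LINT x|lebesgue_on W. A x $ i $ j * A x $ j $ i) = (LINT x|lebesgue. A x $ i $ j * A x $ j $ i)"
  by (rule integral_on_support[OF op]) (simp add: o)
 also have "\<dots> = (LINT x|lebesgue. A x $ i $ i * A x $ j $ j)"
  unfolding A_def jac_entry[OF test_smooth[OF \<Phi>]] by (rule integral_pd_swap[OF t t])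
 also have "\<dots> = (LINT x|lebesgue_on W. A x $ i $ i * A x $ j $ j)"
  by (rule integral_on_support[OF op, symmetric]) (simp add: o)
 finally show ?thesis .
qed
have "0 \<le> (LINT x|lebesgue_on W. (\<Sum>i\<in>UNIV. \<Sum>j\<in>UNIV. A x $ i $ i * A x $ j $ j))"
proof (rule integral_nonneg_AE, rule AE_I2)
 fix x
 have "(\<Sum>i\<in>UNIV. \<Sum>j\<in>UNIV. A x $ i $ i * A x $ j $ j) = (\<Sum>i\<in>UNIV. A x $ i $ i)\<^sup>2"
  by (simp add: power2_eq_square sum_product)
 thus "0 \<le> (\<Sum>i\<in>UNIV. \<Sum>j\<in>UNIV. A x $ i $ i * A x $ j $ j)" by simp
qed
also have "\<dots> = (LINT x|lebesgue_on W. (\<Sum>i\<in>UNIV. \<Sum>j\<in>UNIV. A x $ i $ j * A x $ j $ i))"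
 using ii by (simp add: Bochner_Integration.integral_sum swap)
finally have "L2_inner W A A \<le> L2_inner W A A + (LINT x|lebesgue_on W. (\<Sum>i\<in>UNIV. \<Sum>j\<in>UNIV. A x $ i $ j * A x $ j $ i))"
 by simp
also have "\<dots> = (LINT x|lebesgue_on W. A x \<bullet> A x + (\<Sum>i\<in>UNIV. \<Sum>j\<in>UNIV. A x $ i $ j * A x $ j $ i))"
 unfolding L2_inner_def
 by (intro Bochner_Integration.integral_add[symmetric] L2_inner_integrable[OF op bd] AL Bochner_Integration.integrable_sum ii)
also have "\<dots> = 2 * L2_inner W (\<lambda>x. sy (A x)) (\<lambda>x. sy (A x))"
 unfolding sy_sq[symmetric] L2_inner_def by simp
finally show ?thesis by (simp add: A_def)
qed

lemma L2_norm_mono: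
assumes "u \<in> meas W" "v \<in> L2 W" "\<And>x. norm (u x) \<le> norm (v x)"
shows "L2_norm W u \<le> L2_norm W v"
proof -
have le: "u x \<bullet> u x \<le> v x \<bullet> v x" for x
 using power_mono[OF assms(3)[of x] norm_ge_zero, of 2] by (simp add: power2_norm_eq_inner)
have "(LINT x|lebesgue_on W. u x \<bullet> u x) \<le> (LINT x|lebesgue_on W. v x \<bullet> v x)"
proof (rule integral_mono_AE)
 show v: "integrable (lebesgue_on W) (\<lambda>x. v x \<bullet> v x)" by (rule L2_inner_integrable[OF op bd assms(2,2)])
 show "integrable (lebesgue_on W) (\<lambda>x. u x \<bullet> u x)"
  by (rule Bochner_Integration.integrable_bound[OF v]) (use assms(1) le in auto)
qed (use le in auto)
thus ?thesis by (simp add: L2_norm_def L2_inner_def)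
qed

text \<open>Symmetrisation does not increase the norm, so both sides of the inequality for test
  functions pass to the limit in \<open>H10\<close>.\<close>

lemma korn:
assumes v: "v \<in> H10 W"
shows "L2_norm W (grad W v) \<le> sqrt 2 * L2_norm W (symgrad W v)"
proof -
obtain \<Phi> where \<Phi>: "\<And>n. \<Phi> n \<in> test_functions W"
 "L2_lim W (\<lambda>n. jac (\<Phi> n)) (grad W v)" by (rule H10_approx[OF assms(1)]) blast
note G = grad_L2[OF H10_H1[OF v]]
have syL: "(\<lambda>x. sy (u x)) \<in> L2 W" if "u \<in> L2 W" for u
 by (rule L2_linear_image[OF op bd bounded_linear_sy that])
have d: "(\<lambda>x. jac (\<Phi> n) x - grad W v x) \<in> L2 W" for n by (intro L2_diff[OF op bd] jac_L2[OF \<Phi>(1)] G)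
have "(\<lambda>n. L2_norm W (\<lambda>x. sy (jac (\<Phi> n) x) - sy (grad W v x))) \<longlonglongrightarrow> 0"
proof (rule tendsto_sandwich[OF _ _ tendsto_const \<Phi>(2)])
 have "L2_norm W (\<lambda>x. sy (jac (\<Phi> n) x) - sy (grad W v x)) \<le> L2_norm W (\<lambda>x. jac (\<Phi> n) x - grad W v x)" for n
  unfolding linear_diff[OF linear_sy, symmetric]
  using syL[OF d[of n]] d[of n] norm_sy by (intro L2_norm_mono) (auto simp: L2_def)
 thus "\<forall>\<^sub>F n in sequentially. L2_norm W (\<lambda>x. sy (jac (\<Phi> n) x) - sy (grad W v x)) \<le> L2_norm W (\<lambda>x. jac (\<Phi> n) x - grad W v x)" by simp
qed (simp add: L2_norm_nonneg[OF op bd])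
hence "(\<lambda>n. 2 * L2_inner W (\<lambda>x. sy (jac (\<Phi> n) x)) (\<lambda>x. sy (jac (\<Phi> n) x))) \<longlonglongrightarrow> 2 * L2_inner W (\<lambda>x. sy (grad W v x)) (\<lambda>x. sy (grad W v x))"
 by (intro tendsto_mult tendsto_const L2_sq_tendsto[OF op bd] syL G jac_L2[OF \<Phi>(1)])
moreover have "(\<lambda>n. L2_inner W (jac (\<Phi> n)) (jac (\<Phi> n))) \<longlonglongrightarrow> L2_inner W (grad W v) (grad W v)"
 by (intro L2_sq_tendsto[OF op bd] G jac_L2[OF \<Phi>(1)] \<Phi>(2))
ultimately have "L2_inner W (grad W v) (grad W v) \<le> 2 * L2_inner W (symgrad W v) (symgrad W v)"
 unfolding symgrad_sy by (rule tendsto_le[OF sequentially_bot]) (use korn_test[OF \<Phi>(1)] in auto)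
thus ?thesis
 unfolding L2_norm_def real_sqrt_mult[symmetric] by (rule real_sqrt_le_mono)
qed

lemma symgrad_L2: "v \<in> H1 W \<Longrightarrow> symgrad W v \<in> L2 W"
unfolding symgrad_sy by (rule L2_linear_image[OF op bd bounded_linear_sy grad_L2])

lemma symgrad_add: "\<lbrakk>v \<in> H1 W; w \<in> H1 W\<rbrakk> \<Longrightarrow> AE x in lebesgue_on W. symgrad W (v + w) x = symgrad W v x + symgrad W w x"
using H1_add(2)[of v w] unfolding symgrad_sy by (auto simp: linear_add[OF linear_sy])

lemma symgrad_scale: "v \<in> H1 W \<Longrightarrow> AE x in lebesgue_on W. symgrad W (c *\<^sub>R v) x = c *\<^sub>R symgrad W v x"
using H1_scale(2)[of v c] unfolding symgrad_sy by (auto simp: linear_scale[OF linear_sy])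

end

section \<open>Mollification\<close>

definition conv :: "('a::euclidean_space \<Rightarrow> real) \<Rightarrow> ('a \<Rightarrow> real) \<Rightarrow> 'a \<Rightarrow> real" where
"conv u \<eta> x = (LINT y|lebesgue. u y * \<eta> (x - y))"

lemma test_reflect:
assumes "\<phi> \<in> test_functions UNIV"
shows "(\<lambda>y. \<phi> (x - y)) \<in> test_functions UNIV" "pd (\<lambda>y. \<phi> (x - y)) a y = - pd \<phi> a (x - y)"
proof -
obtain R where R: "\<And>x. norm x > R \<Longrightarrow> \<phi> x = 0" using test_support_bounded[OF assms] by auto
have "\<phi> (x - y) = 0" if "norm y > R + norm x" for y
 using that norm_triangle_ineq2[of y x] by (intro R) (simp add: norm_minus_commute)
thus "(\<lambda>y. \<phi> (x - y)) \<in> test_functions UNIV"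
 using smooth_affine_arg[OF test_smooth[OF assms], of x "-1"] unfolding test_UNIV_iff by auto
show "pd (\<lambda>y. \<phi> (x - y)) a y = - pd \<phi> a (x - y)"
 using fun_cong[OF pd_affine[OF test_smooth[OF assms], of x "-1" a], of y] by simp
qed

lemma conv_integrable:
fixes \<eta> :: "'a::euclidean_space \<Rightarrow> real"
assumes "integrable lebesgue u" "\<eta> \<in> test_functions UNIV"
shows "integrable lebesgue (\<lambda>y. u y * \<eta> (x - y))"
proof -
obtain C where C: "\<And>x. \<bar>\<eta> x\<bar> \<le> C" using test_bounded[OF assms(2)] by auto
show ?thesis
proof (rule Bochner_Integration.integrable_bound[OF integrable_mult_right[OF assms(1), of C]])
 show "(\<lambda>y. u y * \<eta> (x - y)) \<in> borel_measurable lebesgue"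
  using assms(1) by (intro borel_measurable_times test_measurable_lebesgue[OF test_reflect(1)[OF assms(2)]]) auto
 show "AE y in lebesgue. norm (u y * \<eta> (x - y)) \<le> norm (C * u y)"
 proof (rule AE_I2)
  fix y
  have "\<bar>\<eta> (x - y)\<bar> * \<bar>u y\<bar> \<le> \<bar>C\<bar> * \<bar>u y\<bar>"
  using order.trans[OF C abs_ge_self] by (rule mult_right_mono) simp
  thus "norm (u y * \<eta> (x - y)) \<le> norm (C * u y)" by (simp add: abs_mult mult.commute)
 qed
qed
qed

text \<open>The mean value theorem along a segment with Lipschitz first derivatives. Uniformity in
  the base point is what permits differentiation of a convolution under the integral.\<close>

lemma test_taylor:
fixes \<eta> :: "'a::euclidean_space \<Rightarrow> real"
assumes \<eta>: "\<eta> \<in> test_functions UNIV"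
obtains C where "C \<ge> 0" "\<And>z h. \<bar>\<eta> (z + h) - \<eta> z - pd \<eta> h z\<bar> \<le> C * (norm h)\<^sup>2"
proof -
have "\<forall>i::'a. \<exists>L. L-lipschitz_on UNIV (pd \<eta> i)" using test_lipschitz[OF test_pd[OF \<eta>]] by blast
then obtain L where L: "\<And>i::'a. (L i)-lipschitz_on UNIV (pd \<eta> i)" by metis
have L0: "L i \<ge> 0" for i by (rule lipschitz_on_nonneg[OF L])
define C where "C = (\<Sum>i\<in>Basis. L i)"
have C0: "C \<ge> 0" unfolding C_def by (intro sum_nonneg L0)
have rep: "pd \<eta> h x = (\<Sum>i\<in>Basis. (h \<bullet> i) * pd \<eta> i x)" for h x
proof -
 interpret linear "frechet_derivative \<eta> (at x)"
  by (rule linear_frechet_derivative[OF smooth_differentiable[OF test_smooth[OF \<eta>]]])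
 have "pd \<eta> h x = pd \<eta> (\<Sum>i\<in>Basis. (h \<bullet> i) *\<^sub>R i) x" by (simp add: euclidean_representation)
 thus ?thesis by (simp add: sum scale)
qed
have d: "\<bar>pd \<eta> h (z + t *\<^sub>R h) - pd \<eta> h z\<bar> \<le> C * (norm h)\<^sup>2" if "0 \<le> t" "t \<le> 1" for t z h
proof -
 have "pd \<eta> h (z + t *\<^sub>R h) - pd \<eta> h z = (\<Sum>i\<in>Basis. (h \<bullet> i) * (pd \<eta> i (z + t *\<^sub>R h) - pd \<eta> i z))"
  unfolding rep[where h = h] by (simp add: sum_subtractf right_diff_distrib)
 also have "\<bar>\<dots>\<bar> \<le> (\<Sum>i\<in>Basis. norm h * (L i * norm h))"
 proof (rule order.trans[OF sum_abs], rule sum_mono)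
  fix i :: 'a assume i: "i \<in> Basis"
  have "\<bar>pd \<eta> i (z + t *\<^sub>R h) - pd \<eta> i z\<bar> \<le> L i * (t * norm h)"
  using lipschitz_onD[OF L, of "z + t *\<^sub>R h" z i] that by (simp add: dist_norm)
  also have "\<dots> \<le> L i * norm h" using that L0 by (intro mult_left_mono) (auto simp: mult_left_le_one_le)
  finally show "\<bar>h \<bullet> i * (pd \<eta> i (z + t *\<^sub>R h) - pd \<eta> i z)\<bar> \<le> norm h * (L i * norm h)"
  unfolding abs_mult using Basis_le_norm[OF i, of h] by (intro mult_mono) auto
 qed
 also have "\<dots> = C * (norm h)\<^sup>2"
  unfolding C_def sum_distrib_right by (intro sum.cong) (auto simp: power2_eq_square)
 finally show ?thesis .
qed
have "\<bar>\<eta> (z + h) - \<eta> z - pd \<eta> h z\<bar> \<le> C * (norm h)\<^sup>2" for z h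
proof -
 define \<psi> where "\<psi> t = \<eta> (z + t *\<^sub>R h) - t * pd \<eta> h z" for t
 have der: "(\<psi> has_real_derivative (pd \<eta> h (z + t *\<^sub>R h) - pd \<eta> h z)) (at t)" for t
 proof -
  have "((\<lambda>t. \<eta> (z + t *\<^sub>R h)) has_derivative (\<lambda>s. frechet_derivative \<eta> (at (z + t *\<^sub>R h)) (s *\<^sub>R h))) (at t)"
  by (rule has_derivative_compose[OF _ smooth_has_derivative[OF test_smooth[OF \<eta>]]]) (auto intro!: derivative_eq_intros)
  also have "(\<lambda>s. frechet_derivative \<eta> (at (z + t *\<^sub>R h)) (s *\<^sub>R h)) = (*) (pd \<eta> h (z + t *\<^sub>R h))"
  using linear_scale[OF linear_frechet_derivative[OF smooth_differentiable[OF test_smooth[OF \<eta>]]]] by (auto simp: mult.commute)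
  finally have "((\<lambda>t. \<eta> (z + t *\<^sub>R h)) has_real_derivative pd \<eta> h (z + t *\<^sub>R h)) (at t)"
  by (simp add: has_field_derivative_def)
  thus ?thesis unfolding \<psi>_def by (auto intro!: derivative_eq_intros)
 qed
 obtain t where "0 < t" "t < 1" "\<psi> 1 - \<psi> 0 = (1 - 0) * (pd \<eta> h (z + t *\<^sub>R h) - pd \<eta> h z)"
  using MVT2[of 0 1 \<psi> "\<lambda>t. pd \<eta> h (z + t *\<^sub>R h) - pd \<eta> h z"] der by auto
 thus ?thesis using d[where t = t and h = h and z = z] by (simp add: \<psi>_def)
qed
with C0 show thesis by (rule that)
qed

text \<open>The Taylor remainder is integrated against \<open>|u|\<close>; its quadratic bound in
  \<open>h\<close> is uniform in \<open>y\<close>, so integrability of \<open>u\<close> is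
  enough.\<close>

lemma conv_has_derivative:
fixes \<eta> :: "'a::euclidean_space \<Rightarrow> real"
assumes u: "integrable lebesgue u" and \<eta>: "\<eta> \<in> test_functions UNIV"
shows "(conv u \<eta> has_derivative (\<lambda>h. conv u (pd \<eta> h) x)) (at x)"
proof -
obtain C where C: "C \<ge> 0" "\<And>z h. \<bar>\<eta> (z + h) - \<eta> z - pd \<eta> h z\<bar> \<le> C * (norm h)\<^sup>2"
 by (rule test_taylor[OF \<eta>]) blast
define K where "K = C * (LINT y|lebesgue. \<bar>u y\<bar>)"
have i: "integrable lebesgue (\<lambda>y. u y * \<eta> (z - y))" "integrable lebesgue (\<lambda>y. u y * pd \<eta> h (z - y))" for z h
 using conv_integrable[OF u \<eta>] conv_integrable[OF u test_pd[OF \<eta>]] by auto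
have lin: "linear (\<lambda>h. conv u (pd \<eta> h) x)"
proof (rule linearI)
 fix h k :: 'a and c :: real
 have l: "linear (frechet_derivative \<eta> (at z))" for z
  by (rule linear_frechet_derivative[OF smooth_differentiable[OF test_smooth[OF \<eta>]]])
 show "conv u (pd \<eta> (h + k)) x = conv u (pd \<eta> h) x + conv u (pd \<eta> k) x"
  unfolding conv_def linear_add[OF l] distrib_left by (intro Bochner_Integration.integral_add i)
 show "conv u (pd \<eta> (c *\<^sub>R h)) x = c *\<^sub>R conv u (pd \<eta> h) x"
  unfolding conv_def linear_scale[OF l] by (simp add: mult.left_commute)
qed
have b: "\<bar>conv u \<eta> (x + h) - conv u \<eta> x - conv u (pd \<eta> h) x\<bar> \<le> K * (norm h)\<^sup>2" for h
proof -
 define w where "w y = u y * \<eta> (x + h - y) - u y * \<eta> (x - y) - u y * pd \<eta> h (x - y)" for y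
 have iw: "integrable lebesgue w"
  unfolding w_def by (intro Bochner_Integration.integrable_diff i)
 have eq: "conv u \<eta> (x + h) - conv u \<eta> x - conv u (pd \<eta> h) x = integral\<^sup>L lebesgue w"
  unfolding conv_def w_def using i by (simp add: Bochner_Integration.integral_diff)
 have "\<bar>integral\<^sup>L lebesgue w\<bar> \<le> (LINT y|lebesgue. \<bar>w y\<bar>)"
  by (rule integral_abs_bound)
 also have "(LINT y|lebesgue. \<bar>w y\<bar>) \<le> (LINT y|lebesgue. (C * (norm h)\<^sup>2) * \<bar>u y\<bar>)"
 proof (rule integral_mono)
  show "integrable lebesgue (\<lambda>y. \<bar>w y\<bar>)" using iw by simp
  show "integrable lebesgue (\<lambda>y. (C * (norm h)\<^sup>2) * \<bar>u y\<bar>)" using u by simp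
  fix y
  have "w y = u y * (\<eta> ((x - y) + h) - \<eta> (x - y) - pd \<eta> h (x - y))"
  by (simp add: w_def algebra_simps)
  thus "\<bar>w y\<bar> \<le> (C * (norm h)\<^sup>2) * \<bar>u y\<bar>"
  using mult_left_mono[OF C(2)[of "x - y" h], of "\<bar>u y\<bar>"] by (simp add: abs_mult mult.commute)
 qed
 also have "\<dots> = K * (norm h)\<^sup>2" by (simp add: K_def)
 finally show ?thesis unfolding eq .
qed
show ?thesis
 unfolding has_derivative_at
proof
 show "bounded_linear (\<lambda>h. conv u (pd \<eta> h) x)" using lin by (simp add: linear_conv_bounded_linear)
 show "(\<lambda>h. norm (conv u \<eta> (x + h) - conv u \<eta> x - conv u (pd \<eta> h) x) / norm h) \<midarrow>0\<rightarrow> 0"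
 proof (rule tendsto_sandwich[OF _ _ tendsto_const])
  show "((\<lambda>h::'a. K * norm h) \<longlongrightarrow> 0) (at 0)" by (auto intro!: tendsto_eq_intros)
  show "\<forall>\<^sub>F h in at 0. norm (conv u \<eta> (x + h) - conv u \<eta> x - conv u (pd \<eta> h) x) / norm h \<le> K * norm h"
  using b by (auto simp: eventually_at_filter divide_le_eq power2_eq_square mult.assoc)
 qed simp
qed
qed

lemma pd_conv:
fixes \<eta> :: "'a::euclidean_space \<Rightarrow> real"
assumes "integrable lebesgue u" "\<eta> \<in> test_functions UNIV"
shows "pd (conv u \<eta>) a x = conv u (pd \<eta> a) x"
using fun_cong[OF frechet_derivative_at[OF conv_has_derivative[OF assms, of x]], of a] by simp

lemma smooth_conv:
fixes \<eta> :: "'a::euclidean_space \<Rightarrow> real"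
assumes u: "integrable lebesgue u" and \<eta>: "\<eta> \<in> test_functions UNIV"
shows "smooth (conv u \<eta>)"
proof (rule smooth_coinduct[where A = "conv u ` test_functions UNIV"])
show "conv u \<eta> \<in> conv u ` test_functions UNIV" using \<eta> by simp
fix g x a assume "g \<in> conv u ` test_functions UNIV"
then obtain \<phi> where \<phi>: "g = conv u \<phi>" "\<phi> \<in> test_functions UNIV" by auto
show "g differentiable (at x)" using conv_has_derivative[OF u \<phi>(2)] unfolding \<phi>(1) differentiable_def by blast
have "pd g a = conv u (pd \<phi> a)" unfolding \<phi>(1) pd_conv[OF u \<phi>(2)] by simp
thus "pd g a \<in> conv u ` test_functions UNIV" using test_pd[OF \<phi>(2)] by auto
qed

text \<open>Evenness turns \<open>\<eta> n (x - y)\<close> into a translate in \<open>y\<close>, so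
  that its integral is 1 by translation invariance alone.\<close>

definition mollifier :: "(nat \<Rightarrow> 'a::euclidean_space \<Rightarrow> real) \<Rightarrow> bool" where
"mollifier \<eta> \<longleftrightarrow> (\<forall>n. \<eta> n \<in> test_functions UNIV \<and> (\<forall>x. 0 \<le> \<eta> n x) \<and> integral\<^sup>L lebesgue (\<eta> n) = 1 \<and> (\<forall>x. \<eta> n (- x) = \<eta> n x)
  \<and> (\<forall>x. \<eta> n x \<noteq> 0 \<longrightarrow> norm x \<le> 1 / real (Suc n)))"

lemma mollifier_exists: "\<exists>\<eta> :: nat \<Rightarrow> 'a::euclidean_space \<Rightarrow> real. mollifier \<eta>"
proof -
have "\<exists>\<eta> :: 'a \<Rightarrow> real. \<eta> \<in> test_functions UNIV \<and> (\<forall>x. 0 \<le> \<eta> x) \<and> integral\<^sup>L lebesgue \<eta> = 1 \<and> (\<forall>x. \<eta> (- x) = \<eta> x) \<and> (\<forall>x. \<eta> x \<noteq> 0 \<longrightarrow> norm x \<le> 1 / real (Suc n))" for n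
proof -
 \<comment> \<open>In the box of half-width \<open>e\<close> the sum of the coordinates' absolute
   values is at most \<open>e * DIM('a)\<close>, and this choice makes that
   \<open>1 / Suc n\<close>.\<close>
 define e where "e = 1 / (real (Suc n) * DIM('a))"
 have e: "e > 0" by (simp add: e_def)
 define b where "b = bump (- (e *\<^sub>R One)) (e *\<^sub>R One :: 'a) (2 / e)"
 have bt: "b \<in> test_functions UNIV" unfolding b_def by (rule bump_test) (use e in auto)
 have sym: "b (- x) = b x" for x
  unfolding b_def bump_def by (intro prod.cong refl) (simp add: mult.commute add.commute)
 have b0: "0 \<le> b x" for x by (simp add: b_def bump_bounds)
 have pos: "b x > 0" if "x \<in> box (- ((e/2) *\<^sub>R One)) ((e/2) *\<^sub>R One)" for x
  unfolding b_def
 proof (rule bump_pos)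
  have "- (e *\<^sub>R One) + (1 / (2 / e)) *\<^sub>R One = (- ((e/2) *\<^sub>R One) :: 'a)" "e *\<^sub>R One - (1 / (2 / e)) *\<^sub>R One = ((e/2) *\<^sub>R One :: 'a)"
  by (simp_all add: scaleR_add_left[symmetric] scaleR_left_diff_distrib[symmetric] scaleR_minus_left[symmetric] del: scaleR_minus_left)
  thus "x \<in> box (- (e *\<^sub>R One) + (1 / (2 / e)) *\<^sub>R One) (e *\<^sub>R One - (1 / (2 / e)) *\<^sub>R One)" using that by simp
 qed (use e in simp)
 have supp: "norm x \<le> 1 / real (Suc n)" if "b x \<noteq> 0" for x
 proof -
  have x: "x \<in> box (- (e *\<^sub>R One)) (e *\<^sub>R One)"
  using test_outside[of b "box (- (e *\<^sub>R One)) (e *\<^sub>R One)" x] bump_test[of "2/e"] e that by (auto simp: b_def)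
  have "norm x \<le> (\<Sum>i\<in>Basis. \<bar>x \<bullet> i\<bar>)" by (rule norm_le_l1)
  also have "\<dots> \<le> (\<Sum>i\<in>(Basis::'a set). e)"
  using x by (intro sum_mono) (force simp: mem_box One_inner)
  also have "\<dots> = 1 / real (Suc n)" by (simp add: e_def)
  finally show ?thesis .
 qed
 define I where "I = integral\<^sup>L lebesgue b"
 have "I \<noteq> 0"
 proof
  assume "I = 0"
  hence "AE x in lebesgue. b x = 0"
  using integral_nonneg_eq_0_iff_AE[OF test_integrable[OF bt]] b0 by (simp add: I_def)
  hence "AE x in lebesgue. x \<notin> box (- ((e/2) *\<^sub>R One)) ((e/2) *\<^sub>R (One::'a))"
  by eventually_elim (use pos in fastforce)
  hence "box (- ((e/2) *\<^sub>R One)) ((e/2) *\<^sub>R (One::'a)) \<in> null_sets lebesgue"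
  by (subst AE_iff_null_sets) auto
  hence "negligible (box (- ((e/2) *\<^sub>R One)) ((e/2) *\<^sub>R (One::'a)))" by (simp add: negligible_iff_null_sets)
  moreover have "0 \<in> box (- ((e/2) *\<^sub>R One)) ((e/2) *\<^sub>R (One::'a))" using e by (auto simp: mem_box One_inner)
  ultimately show False using open_not_negligible[OF open_box] by blast
 qed
 moreover have "I \<ge> 0" unfolding I_def using b0 by (simp add: integral_nonneg_AE)
 ultimately have I: "I > 0" by simp
 show ?thesis
  by (rule exI[of _ "\<lambda>x. inverse I *\<^sub>R b x"])
  (use test_linear_image[OF bounded_linear_scaleR_right bt] b0 I supp sym in \<open>auto simp: I_def\<close>)
qed
thus ?thesis unfolding mollifier_def by metis
qed

lemma mollifier_reflect_integral:
assumes "mollifier \<eta>"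
shows "(LINT y|lebesgue. \<eta> n (x - y)) = 1"
proof -
note t = assms(1)[unfolded mollifier_def, rule_format, of n]
have "(LINT y|lebesgue. \<eta> n (x - y)) = (LINT y|lebesgue. \<eta> n (- x + y))"
 using t by (metis (no_types, lifting) minus_diff_eq uminus_add_conv_diff)
also have "\<dots> = 1"
 using integral_lebesgue_translate[OF test_measurable, of "\<eta> n" UNIV "-x"] t by simp
finally show ?thesis .
qed

lemma conv_bound:
assumes "mollifier \<eta>" "integrable lebesgue u" "AE y in lebesgue. \<bar>u y\<bar> \<le> B"
shows "\<bar>conv u (\<eta> n) x\<bar> \<le> B"
proof -
note t = assms(1)[unfolded mollifier_def, rule_format, of n]
note tr = mollifier_reflect_integral[OF assms(1), of n x]
have "\<bar>conv u (\<eta> n) x\<bar> \<le> (LINT y|lebesgue. \<bar>u y * \<eta> n (x - y)\<bar>)"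
 unfolding conv_def by (rule integral_abs_bound)
also have "\<dots> \<le> (LINT y|lebesgue. B * \<eta> n (x - y))"
proof (rule integral_mono_AE)
 show "AE y in lebesgue. \<bar>u y * \<eta> n (x - y)\<bar> \<le> B * \<eta> n (x - y)"
  using assms(3) by eventually_elim (use t in \<open>auto simp: abs_mult intro!: mult_right_mono\<close>)
qed (use conv_integrable[OF assms(2)] test_integrable[OF test_reflect(1)] t in auto)
also have "\<dots> = B" using tr by simp
finally show ?thesis .
qed

lemma conv_tendsto:
assumes \<eta>: "mollifier \<eta>" and u: "integrable lebesgue u" and c: "isCont u x"
shows "(\<lambda>n. conv u (\<eta> n) x) \<longlonglongrightarrow> u x"
proof (rule LIMSEQ_I)
fix r :: real assume r: "r > 0"
then obtain d where d: "d > 0" "\<And>y. dist y x < d \<Longrightarrow> \<bar>u y - u x\<bar> < r / 2"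
 using c unfolding continuous_at_eps_delta dist_real_def by (meson half_gt_zero)
obtain N where N: "1 / real (Suc N) < d" using d(1) by (metis nat_approx_posE)
have "norm (conv u (\<eta> n) x - u x) < r" if n: "n \<ge> N" for n
proof -
 note t = \<eta>[unfolded mollifier_def, rule_format, of n]
 have i: "integrable lebesgue (\<lambda>y. u y * \<eta> n (x - y))" "integrable lebesgue (\<lambda>y. \<eta> n (x - y))"
  using conv_integrable[OF u] test_integrable[OF test_reflect(1)] t by auto
 have "conv u (\<eta> n) x - u x = (LINT y|lebesgue. u y * \<eta> n (x - y) - u x * \<eta> n (x - y))"
  using i mollifier_reflect_integral[OF \<eta>, of n x] by (simp add: conv_def)
 also have "\<bar>\<dots>\<bar> \<le> (LINT y|lebesgue. \<bar>u y * \<eta> n (x - y) - u x * \<eta> n (x - y)\<bar>)"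
  by (rule integral_abs_bound)
 also have "\<dots> \<le> (LINT y|lebesgue. (r/2) * \<eta> n (x - y))"
 proof (rule integral_mono)
  fix y
  show "\<bar>u y * \<eta> n (x - y) - u x * \<eta> n (x - y)\<bar> \<le> r / 2 * \<eta> n (x - y)"
  proof (cases "\<eta> n (x - y) = 0")
  case False
  hence "norm (x - y) \<le> 1 / real (Suc n)" using t by blast
  also have "\<dots> \<le> 1 / real (Suc N)" using n by (intro divide_left_mono) auto
  finally have "dist y x < d" using N by (simp add: dist_norm norm_minus_commute)
  hence "\<bar>u y - u x\<bar> \<le> r / 2" using d(2) less_imp_le by blast
  hence "\<bar>u y - u x\<bar> * \<eta> n (x - y) \<le> r / 2 * \<eta> n (x - y)"
  by (rule mult_right_mono) (use t in simp)
  thus ?thesis using t by (simp add: left_diff_distrib[symmetric] abs_mult)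
  qed simp
 qed (use i in auto)
 also have "\<dots> = r / 2" using mollifier_reflect_integral[OF \<eta>, of n x] by simp
 finally show ?thesis using r by simp
qed
thus "\<exists>no. \<forall>n\<ge>no. norm (conv u (\<eta> n) x - u x) < r" by blast
qed

section \<open>Lipschitz continuity of functions with bounded weak gradient\<close>

lemma smooth_lipschitz_segment:
fixes F :: "'a::euclidean_space \<Rightarrow> real"
assumes "smooth F" "\<And>a z. \<bar>pd F a z\<bar> \<le> B * norm a"
shows "\<bar>F x - F y\<bar> \<le> B * norm (x - y)"
proof -
have "norm (F x - F y) \<le> B * norm (x - y)"
 by (rule differentiable_bound[where S = UNIV and f' = "\<lambda>z. frechet_derivative F (at z)"])
  (use smooth_has_derivative[OF assms(1)] assms(2) in \<open>auto intro: onorm_le\<close>)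
thus ?thesis by simp
qed

lemma norm_axis_sum_le: "\<bar>\<Sum>j\<in>UNIV. a $ j * (A $ i $ j :: real)\<bar> \<le> norm a * norm A"
for A :: "real^'n^'m" and a :: "real^'n"
proof -
have "(\<Sum>j\<in>UNIV. a $ j * A $ i $ j) = a \<bullet> (A $ i)" by (simp add: inner_vec_def)
also have "\<bar>\<dots>\<bar> \<le> norm a * norm (A $ i)" by (rule Cauchy_Schwarz_ineq2)
also have "\<dots> \<le> norm a * norm A" by (intro mult_left_mono Finite_Cartesian_Product.norm_nth_le) auto
finally show ?thesis .
qed

lemma pd_axis_sum:
fixes \<phi> :: "real^'n \<Rightarrow> real"
assumes "smooth \<phi>" shows "pd \<phi> a x = (\<Sum>j\<in>UNIV. a $ j * pd \<phi> (axis j 1) x)"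
proof -
interpret linear "frechet_derivative \<phi> (at x)"
 by (rule linear_frechet_derivative[OF smooth_differentiable[OF assms]])
have "pd \<phi> a x = pd \<phi> (\<Sum>j\<in>UNIV. a $ j *s axis j 1) x" by (simp add: basis_expansion)
thus ?thesis by (simp add: sum scale scalar_mult_eq_scaleR)
qed

context
fixes W :: "(real^'n) set"
assumes op: "open W" and bd: "bounded W"
begin

text \<open>The extension by zero is mollified on the whole space, where segments may leave
  \<open>W\<close>. The derivative of the mollification averages the extended weak gradient and is
  bounded by \<open>B\<close>; at continuity points the mollifications converge to
  \<open>V\<close>.\<close>

lemma H10_lipschitz:
assumes v: "v \<in> H10 W" and B: "AE x in lebesgue_on W. norm (grad W v x) \<le> B" and B0: "B \<ge> 0"
 and V: "\<And>x. V x = indicator W x * v x $ i" and xy: "isCont V x" "isCont V y"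
shows "\<bar>V x - V y\<bar> \<le> B * norm (x - y)"
proof -
obtain \<eta> :: "nat \<Rightarrow> real^'n \<Rightarrow> real" where \<eta>: "mollifier \<eta>" using mollifier_exists by blast
have OL: "W \<in> sets lebesgue" using op by simp
have vL: "v \<in> L2 W" using H10_H1[OF op bd v] by (simp add: H1_def)
note GL = grad_L2[OF op bd H10_H1[OF op bd v]]
have iV: "integrable lebesgue V"
 using L2_integrable[OF op bd component_L2[OF op bd vL, of i]] unfolding integral_lebesgue_on(2)[OF OL]
 by (simp add: V[abs_def])
have g_int: "integrable lebesgue (\<lambda>z. indicator W z * grad W v z $ i $ j)" for j
 using L2_integrable[OF op bd entry_L2[OF op bd GL, of i j]] unfolding integral_lebesgue_on(2)[OF OL] by simp
define D where "D a z = (\<Sum>j\<in>UNIV. a $ j * (indicator W z * grad W v z $ i $ j))" for a z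
have iD: "integrable lebesgue (D a)" for a
 unfolding D_def using g_int by (intro Bochner_Integration.integrable_sum integrable_mult_right)
have DB: "AE z in lebesgue. \<bar>D a z\<bar> \<le> B * norm a" for a
proof -
 have "AE z in lebesgue. z \<in> W \<longrightarrow> norm (grad W v z) \<le> B" using B by (simp add: AE_lebesgue_on[OF OL])
 thus ?thesis
 proof eventually_elim
  case (elim z)
  show ?case
  proof (cases "z \<in> W")
  case z: True
  have "\<bar>D a z\<bar> \<le> norm a * norm (grad W v z)" using z norm_axis_sum_le[of a "grad W v z" i] by (simp add: D_def)
  also have "\<dots> \<le> norm a * B" using elim z by (intro mult_left_mono) auto
  finally show ?thesis by (simp add: mult.commute)
  qed (use B0 in \<open>simp add: D_def\<close>)
 qed
qed
\<comment> \<open>Integration by parts with the reflected kernel, which is a test function on the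
  whole space but in general not on \<open>W\<close>; this is where \<open>H10_by_parts\<close> is
  needed.\<close>
have pdF: "pd (conv V (\<eta> n)) a z = conv (D a) (\<eta> n) z" for n a z
proof -
 have t: "\<eta> n \<in> test_functions UNIV" using \<eta> by (simp add: mollifier_def)
 define \<phi> where "\<phi> y = \<eta> n (z - y)" for y
 have \<phi>: "\<phi> \<in> test_functions UNIV" unfolding \<phi>_def by (rule test_reflect(1)[OF t])
 have iVp: "integrable lebesgue (\<lambda>y. V y * pd \<phi> (axis j 1) y)" for j
  using conv_integrable[OF iV test_pd[OF t], of z "axis j 1"] unfolding \<phi>_def test_reflect(2)[OF t] by simp
 have ig: "integrable lebesgue (\<lambda>y. (indicator W y * grad W v y $ i $ j) * \<phi> y)" for j
  unfolding \<phi>_def by (rule conv_integrable[OF g_int t])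
 have hp: "(LINT y|lebesgue. V y * pd \<phi> (axis j 1) y) = - (LINT y|lebesgue. (indicator W y * grad W v y $ i $ j) * \<phi> y)" for j
  using H10_by_parts[OF op bd v \<phi>, of i j] unfolding integral_lebesgue_on(1)[OF OL] by (simp add: V mult.assoc)
 have "pd (conv V (\<eta> n)) a z = - (LINT y|lebesgue. V y * pd \<phi> a y)"
  unfolding pd_conv[OF iV t] conv_def \<phi>_def test_reflect(2)[OF t] by simp
 also have "(LINT y|lebesgue. V y * pd \<phi> a y) = (LINT y|lebesgue. (\<Sum>j\<in>UNIV. a $ j * (V y * pd \<phi> (axis j 1) y)))"
  unfolding pd_axis_sum[OF test_smooth[OF \<phi>], where a = a] by (simp add: sum_distrib_left mult.left_commute)
 also have "\<dots> = (\<Sum>j\<in>UNIV. a $ j * (LINT y|lebesgue. V y * pd \<phi> (axis j 1) y))"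
  using iVp by (subst Bochner_Integration.integral_sum) auto
 also have "\<dots> = (\<Sum>j\<in>UNIV. a $ j * - (LINT y|lebesgue. (indicator W y * grad W v y $ i $ j) * \<phi> y))"
  unfolding hp ..
 also have "\<dots>
  = - (LINT y|lebesgue. (\<Sum>j\<in>UNIV. a $ j * ((indicator W y * grad W v y $ i $ j) * \<phi> y)))"
  using ig by (subst Bochner_Integration.integral_sum) (auto simp: sum_negf)
 also have "(LINT y|lebesgue. (\<Sum>j\<in>UNIV. a $ j * ((indicator W y * grad W v y $ i $ j) * \<phi> y))) = conv (D a) (\<eta> n) z"
  unfolding conv_def D_def \<phi>_def by (simp add: sum_distrib_right mult.assoc)
 finally show ?thesis by simp
qed
have "\<bar>conv V (\<eta> n) x - conv V (\<eta> n) y\<bar> \<le> B * norm (x - y)" for n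
proof (rule smooth_lipschitz_segment)
 show "smooth (conv V (\<eta> n))" by (rule smooth_conv[OF iV]) (use \<eta> in \<open>simp add: mollifier_def\<close>)
 show "\<bar>pd (conv V (\<eta> n)) a z\<bar> \<le> B * norm a" for a z
  unfolding pdF by (rule conv_bound[OF \<eta> iD DB])
qed
moreover have "(\<lambda>n. \<bar>conv V (\<eta> n) x - conv V (\<eta> n) y\<bar>) \<longlonglongrightarrow> \<bar>V x - V y\<bar>"
 by (intro tendsto_intros conv_tendsto[OF \<eta> iV] xy)
ultimately show ?thesis
 by (intro LIMSEQ_le_const2) auto
qed

end

section \<open>Lipschitz functions in \<open>H10\<close>\<close>

text \<open>Unlike \<open>max 0 (t - \<delta>)\<close>, this truncation is continuously differentiable, which keeps gradients continuous almost everywhere.\<close>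

definition ctrunc :: "real \<Rightarrow> real \<Rightarrow> real" where
"ctrunc \<delta> t = (if t \<le> \<delta> then 0 else (t - \<delta>)\<^sup>2 / t)"

definition ctrunc' :: "real \<Rightarrow> real \<Rightarrow> real" where
"ctrunc' \<delta> t = (if t \<le> \<delta> then 0 else 1 - (\<delta> / t)\<^sup>2)"

lemma ctrunc_derivative:
assumes "\<delta> > 0"
shows "(ctrunc \<delta> has_real_derivative ctrunc' \<delta> t) (at t)"
proof -
consider "t < \<delta>" | "t = \<delta>" | "t > \<delta>" by linarith
thus ?thesis
proof cases
 case 1
 have "eventually (\<lambda>s. s < \<delta>) (nhds t)"
  using 1 by (simp add: eventually_nhds_in_open[of "{..<\<delta>}", simplified])
 hence "eventually (\<lambda>s. ctrunc \<delta> s = 0) (nhds t)" by eventually_elim (simp add: ctrunc_def)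
 hence "(ctrunc \<delta> has_real_derivative 0) (at t)" by (subst DERIV_cong_ev[OF refl _ refl]) auto
 thus ?thesis using 1 by (simp add: ctrunc'_def)
next
 case 2
 have "((\<lambda>h. (ctrunc \<delta> (\<delta> + h) - ctrunc \<delta> \<delta>) / h) \<longlongrightarrow> 0) (at 0)"
 proof (rule Lim_null_comparison)
  show "((\<lambda>h. \<bar>h\<bar> / \<delta>) \<longlongrightarrow> 0) (at 0)" using assms by (auto intro!: tendsto_eq_intros)
  have "\<bar>(ctrunc \<delta> (\<delta> + h) - ctrunc \<delta> \<delta>) / h\<bar> \<le> \<bar>h\<bar> / \<delta>" for h
  proof (cases "h > 0")
  case True
  hence "(ctrunc \<delta> (\<delta> + h) - ctrunc \<delta> \<delta>) / h = h / (\<delta> + h)"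
  by (simp add: ctrunc_def power2_eq_square)
  also have "\<dots> \<le> h / \<delta>" using True assms by (intro divide_left_mono) auto
  finally show ?thesis using True assms by (simp add: ctrunc_def)
  qed (use assms in \<open>auto simp: ctrunc_def divide_nonpos_pos\<close>)
  thus "\<forall>\<^sub>F h in at 0. norm ((ctrunc \<delta> (\<delta> + h) - ctrunc \<delta> \<delta>) / h) \<le> \<bar>h\<bar> / \<delta>" by simp
 qed
 thus ?thesis using 2 by (simp add: DERIV_def ctrunc'_def)
next
 case 3
 have "eventually (\<lambda>s. s > \<delta>) (nhds t)"
  using 3 by (simp add: eventually_nhds_in_open[of "{\<delta><..}", simplified])
 hence "eventually (\<lambda>s. ctrunc \<delta> s = (s - \<delta>)\<^sup>2 / s) (nhds t)" by eventually_elim (simp add: ctrunc_def)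
 moreover have "((\<lambda>s. (s - \<delta>)\<^sup>2 / s) has_real_derivative ctrunc' \<delta> t) (at t)"
  using 3 assms by (auto intro!: derivative_eq_intros simp: ctrunc'_def field_simps power2_eq_square)
 ultimately show ?thesis by (subst DERIV_cong_ev[OF refl _ refl]) auto
qed
qed

lemma ctrunc'_bounds: assumes "\<delta> > 0" shows "0 \<le> ctrunc' \<delta> t" "ctrunc' \<delta> t \<le> 1"
proof -
have "(\<delta> / t)\<^sup>2 \<le> 1" if "t > \<delta>" using assms that by (simp add: power_le_one)
thus "0 \<le> ctrunc' \<delta> t" "ctrunc' \<delta> t \<le> 1" by (auto simp: ctrunc'_def)
qed

lemma ctrunc'_max: "\<delta> > 0 \<Longrightarrow> ctrunc' \<delta> t = 1 - (\<delta> / max t \<delta>)\<^sup>2"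
by (auto simp: ctrunc'_def max_def)

lemma isCont_ctrunc': "\<delta> > 0 \<Longrightarrow> isCont (ctrunc' \<delta>) t"
proof -
assume \<delta>: "\<delta> > 0"
have "ctrunc' \<delta> = (\<lambda>t. 1 - (\<delta> / max t \<delta>)\<^sup>2)" using ctrunc'_max[OF \<delta>] by auto
moreover have "max t \<delta> \<noteq> 0" using \<delta> by (simp add: max_def)
ultimately show ?thesis by (simp add: continuous_intros)
qed

lemma ctrunc_close: assumes "\<delta> > 0" "t \<ge> 0" shows "\<bar>ctrunc \<delta> t - t\<bar> \<le> 2 * \<delta>"
proof (cases "t \<le> \<delta>")
case False
hence "ctrunc \<delta> t - t = - (2 * \<delta> - \<delta> * (\<delta> / t))" using assms(1) by (simp add: ctrunc_def field_simps power2_eq_square)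
moreover have "0 \<le> \<delta> * (\<delta> / t)" "\<delta> * (\<delta> / t) \<le> \<delta>" using False assms by (auto simp: divide_le_eq)
ultimately show ?thesis using assms by linarith
qed (use assms in \<open>auto simp: ctrunc_def\<close>)

lemma ctrunc_lipschitz: assumes "\<delta> > 0" shows "1-lipschitz_on UNIV (ctrunc \<delta>)"
proof (rule bounded_derivative_imp_lipschitz)
show "(ctrunc \<delta> has_derivative (\<lambda>h. ctrunc' \<delta> t * h)) (at t within UNIV)" for t
 using ctrunc_derivative[OF assms, of t] by (simp add: has_field_derivative_def)
show "onorm (\<lambda>h. ctrunc' \<delta> t * h) \<le> 1" for t
 using ctrunc'_bounds[OF assms, of t] by (intro onorm_le) (auto simp: abs_mult mult_left_le_one_le)
qed auto

lemma directional_of_has_derivative: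
assumes "(w has_derivative D) (at x)"
shows "((\<lambda>t. (w (x + t *\<^sub>R a) - w x) / t) \<longlongrightarrow> D a) (at (0::real))"
proof -
have "((\<lambda>t. x + t *\<^sub>R a) has_derivative (\<lambda>t. t *\<^sub>R a)) (at (0::real))"
 by (auto intro!: derivative_eq_intros)
from has_derivative_compose[OF this, of w D] assms
have "((\<lambda>t. w (x + t *\<^sub>R a)) has_derivative (\<lambda>t. D (t *\<^sub>R a))) (at (0::real))" by simp
also have "(\<lambda>t. D (t *\<^sub>R a)) = (\<lambda>t. D a * t)"
 using linear_scale[OF has_derivative_linear[OF assms]] by (auto simp: mult.commute)
finally show ?thesis by (simp add: has_field_derivative_def[symmetric] has_field_derivative_iff)
qed

text \<open>The Jacobian matrix of a scalar function times the constant vector \<open>e\<close>, if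
  \<open>d\<close> is the gradient of that function.\<close>

definition outer :: "real^'n \<Rightarrow> real^'n \<Rightarrow> real^'n^'n" where
"outer e d = (\<chi> i j. e $ i * d $ j)"

lemma bounded_linear_outer: "bounded_linear (outer e)"
unfolding linear_conv_bounded_linear[symmetric]
by (rule linearI) (auto simp: outer_def vec_eq_iff algebra_simps)

section \<open>Approximation of Lipschitz functions by test functions\<close>

context
fixes W :: "(real^'n) set"
assumes op: "open W" and bd: "bounded W"
begin

interpretation finite_measure "lebesgue_on W" by (rule finite_measure_W[OF op bd])

lemma L2_norm_dominated:
fixes f :: "nat \<Rightarrow> real^'n \<Rightarrow> 'b::euclidean_space"
assumes m: "\<And>n. f n \<in> meas W" and C: "\<And>n. AE x in lebesgue_on W. norm (f n x) \<le> C"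
 and lim: "AE x in lebesgue_on W. (\<lambda>n. f n x) \<longlonglongrightarrow> 0"
shows "(\<lambda>n. L2_norm W (f n)) \<longlonglongrightarrow> 0"
proof -
have "(\<lambda>n. LINT x|lebesgue_on W. (norm (f n x))\<^sup>2) \<longlonglongrightarrow> (LINT x|lebesgue_on W. (0::real))"
proof (rule integral_dominated_convergence[where w = "\<lambda>_. C\<^sup>2"])
 show "AE x in lebesgue_on W. (\<lambda>n. (norm (f n x))\<^sup>2) \<longlonglongrightarrow> 0"
  using lim
 proof eventually_elim
  case (elim x)
  have "(\<lambda>n. (norm (f n x))\<^sup>2) \<longlonglongrightarrow> (norm (0::'b))\<^sup>2" by (intro tendsto_intros elim)
  thus ?case by simp
 qed
 show "AE x in lebesgue_on W. norm ((norm (f n x))\<^sup>2) \<le> C\<^sup>2" for n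
  using C[of n] by eventually_elim (auto intro: power_mono)
qed (use m in auto)
hence "(\<lambda>n. sqrt (LINT x|lebesgue_on W. (norm (f n x))\<^sup>2)) \<longlonglongrightarrow> sqrt 0" by (intro tendsto_real_sqrt) simp
thus ?thesis by (simp add: L2_norm_def L2_inner_def dot_square_norm)
qed

lemma H10I_eps:
assumes v: "v \<in> L2 W" "is_weak_grad W v M"
 and ap: "\<And>\<epsilon>::real. \<epsilon> > 0 \<Longrightarrow> \<exists>\<Phi>\<in>test_functions W. L2_norm W (\<lambda>x. \<Phi> x - v x) \<le> \<epsilon> \<and> L2_norm W (\<lambda>x. jac \<Phi> x - M x) \<le> \<epsilon>"
shows "v \<in> H10 W"
proof -
have "\<forall>n. \<exists>\<Phi>. \<Phi> \<in> test_functions W \<and> L2_norm W (\<lambda>x. \<Phi> x - v x) \<le> inverse (real (Suc n)) \<and> L2_norm W (\<lambda>x. jac \<Phi> x - M x) \<le> inverse (real (Suc n))"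
proof
 fix n
 show "\<exists>\<Phi>. \<Phi> \<in> test_functions W \<and> L2_norm W (\<lambda>x. \<Phi> x - v x) \<le> inverse (real (Suc n)) \<and> L2_norm W (\<lambda>x. jac \<Phi> x - M x) \<le> inverse (real (Suc n))"
  using ap[of "inverse (real (Suc n))"] by auto
qed
from choice[OF this] obtain \<Phi> where \<Phi>: "\<And>n. \<Phi> n \<in> test_functions W" "\<And>n. L2_norm W (\<lambda>x. \<Phi> n x - v x) \<le> inverse (real (Suc n))"
 "\<And>n. L2_norm W (\<lambda>x. jac (\<Phi> n) x - M x) \<le> inverse (real (Suc n))" by auto
show ?thesis
proof (rule H10I[OF op bd v \<Phi>(1)])
 show "L2_lim W \<Phi> v"
  by (rule tendsto_sandwich[OF _ _ tendsto_const LIMSEQ_inverse_real_of_nat])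
  (use \<Phi>(2) in \<open>auto simp: L2_norm_nonneg[OF op bd]\<close>)
 show "(\<lambda>n. L2_norm W (\<lambda>x. jac (\<Phi> n) x - M x)) \<longlonglongrightarrow> 0"
  by (rule tendsto_sandwich[OF _ _ tendsto_const LIMSEQ_inverse_real_of_nat])
  (use \<Phi>(3) in \<open>auto simp: L2_norm_nonneg[OF op bd]\<close>)
qed
qed

lemma L2_norm_triangle_le:
assumes "a \<in> L2 W" "b \<in> L2 W" "L2_norm W a \<le> \<epsilon> / 2" "L2_norm W b \<le> \<epsilon> / 2"
shows "L2_norm W (\<lambda>x. a x + b x) \<le> \<epsilon>"
proof (rule power2_le_imp_le)
have e: "0 \<le> \<epsilon>" using assms(3) L2_norm_nonneg[OF op bd, of a] by linarith
have "(L2_norm W (\<lambda>x. a x + b x))\<^sup>2 \<le> 2 * (L2_norm W a)\<^sup>2 + 2 * (L2_norm W b)\<^sup>2"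
 by (rule L2_norm_add_sq[OF op bd assms(1,2)])
also have "\<dots> \<le> 2 * (\<epsilon> / 2)\<^sup>2 + 2 * (\<epsilon> / 2)\<^sup>2"
 using assms(3,4) by (intro add_mono mult_left_mono power_mono L2_norm_nonneg[OF op bd]) auto
also have "\<dots> = \<epsilon>\<^sup>2" by (simp add: power2_eq_square)
finally show "(L2_norm W (\<lambda>x. a x + b x))\<^sup>2 \<le> \<epsilon>\<^sup>2" .
show "0 \<le> \<epsilon>" by (rule e)
qed

text \<open>Truncation at a level \<open>d n\<close> makes the support compact in \<open>W\<close>,
  and mollification makes the function smooth. Truncated gradients converge where
  \<open>w > 0\<close>, and at zeros of \<open>w\<close> because \<open>Dw\<close> vanishes there;
  mollified gradients converge at continuity points of \<open>Dw\<close>.\<close>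

lemma lipschitz_H10:
fixes w :: "real^'n \<Rightarrow> real" and Dw :: "real^'n \<Rightarrow> real^'n"
assumes lip: "L-lipschitz_on UNIV w" and w0: "\<And>x. w x \<ge> 0" and out: "\<And>x. x \<notin> W \<Longrightarrow> w x = 0"
 and der: "AE x in lebesgue. (w has_derivative (\<lambda>h. Dw x \<bullet> h)) (at x)"
 and cont: "AE x in lebesgue. isCont Dw x" and crit: "AE x in lebesgue. w x = 0 \<longrightarrow> Dw x = 0"
 and Dm: "Dw \<in> borel_measurable lebesgue" and B: "\<And>x. norm (Dw x) \<le> B"
shows "(\<lambda>x. w x *\<^sub>R e) \<in> H10 W" "is_weak_grad W (\<lambda>x. w x *\<^sub>R e) (\<lambda>x. outer e (Dw x))"
proof -
obtain \<eta> :: "nat \<Rightarrow> real^'n \<Rightarrow> real" where \<eta>: "mollifier \<eta>" using mollifier_exists by blast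
have \<eta>t: "\<eta> k \<in> test_functions UNIV" for k using \<eta> by (simp add: mollifier_def)
have wc: "continuous_on UNIV w" using lip by (rule lipschitz_on_continuous_on)
obtain R where R: "\<And>x. x \<in> W \<Longrightarrow> norm x \<le> R" using bd by (auto simp: bounded_iff)
have R': "x \<notin> W" if "norm x > R" for x using R[of x] that by auto
have "bounded (w ` closure W)"
 using bd by (intro compact_imp_bounded compact_continuous_image continuous_on_subset[OF wc]) (auto simp: compact_closure)
then obtain A where "\<forall>y\<in>w ` closure W. norm y \<le> A" by (auto simp: bounded_iff)
hence A: "\<bar>w x\<bar> \<le> max A 0" for x using closure_subset[of W] out[of x] by (cases "x \<in> W") (auto simp: le_max_iff_disj)
have Djm: "(\<lambda>x. Dw x $ j) \<in> borel_measurable lebesgue" for j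
 by (rule borel_measurable_continuous_on[OF linear_continuous_on[OF bounded_linear_vec_nth] Dm])
have DjB: "\<bar>Dw x $ j\<bar> \<le> B" for x j
 using order.trans[OF component_le_norm_cart B] by blast
have wm: "w \<in> borel_measurable lebesgue" using wc by (intro measurable_completion) (simp add: borel_measurable_continuous_onI)
have wL: "(\<lambda>x. w x *\<^sub>R e) \<in> L2 W"
 by (rule L2_linear_image[OF op bd bounded_linear_scaleR_left], rule L2_bounded[OF op bd])
  (use A wm measurable_on_W[OF op bd] in auto)
have DL: "Dw \<in> L2 W" by (rule L2_bounded[OF op bd measurable_on_W[OF op bd Dm], of B]) (use B in auto)
have OL: "(\<lambda>x. outer e (d x)) \<in> L2 W" if "d \<in> L2 W" for d
 by (rule L2_linear_image[OF op bd bounded_linear_outer that])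
show wg: "is_weak_grad W (\<lambda>x. w x *\<^sub>R e) (\<lambda>x. outer e (Dw x))"
 unfolding is_weak_grad_def
proof (intro conjI ballI allI OL DL)
 fix \<phi> :: "real^'n \<Rightarrow> real" and i j assume \<phi>: "\<phi> \<in> test_functions W"
 have ad: "AE x in lebesgue. ((\<lambda>t. (w (x + t *\<^sub>R axis j 1) - w x) / t) \<longlongrightarrow> Dw x $ j) (at 0)"
  using der
 proof eventually_elim
  case (elim x)
  show ?case using directional_of_has_derivative[OF elim, of "axis j 1"] by (simp add: inner_axis)
 qed
 have "(LINT x|lebesgue. w x * pd \<phi> (axis j 1) x) = - (LINT x|lebesgue. Dw x $ j * \<phi> x)"
  using test_functions_mono[OF \<phi>] DjB by (intro integral_by_parts(1)[OF lip A _ ad Djm]) auto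
 thus "(LINT x|lebesgue_on W. (w x *\<^sub>R e) $ i * pd \<phi> (axis j 1) x) = - (LINT x|lebesgue_on W. outer e (Dw x) $ i $ j * \<phi> x)"
  by (subst (1 2) integral_on_support[OF op]) (simp_all add: out test_outside[OF \<phi>] outer_def mult.commute[of _ "e $ i"] mult.assoc)
qed
show "(\<lambda>x. w x *\<^sub>R e) \<in> H10 W"
proof (rule H10I_eps[OF wL wg])
 fix \<epsilon> :: real assume \<epsilon>: "\<epsilon> > 0"
 define d where "d n = inverse (real (Suc n))" for n
 have d0: "d n > 0" for n by (simp add: d_def)
 have dlim: "d \<longlonglongrightarrow> 0" unfolding d_def by (rule LIMSEQ_inverse_real_of_nat)
 define u where "u n x = ctrunc (d n) (w x)" for n x
 define Du where "Du n x = ctrunc' (d n) (w x) *\<^sub>R Dw x" for n x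
 have ulip: "L-lipschitz_on UNIV (u n)" for n
  unfolding u_def using lipschitz_on_compose2[OF lip lipschitz_on_subset[OF ctrunc_lipschitz[OF d0]]] by simp
 have uc: "continuous_on UNIV (u n)" for n using ulip by (rule lipschitz_on_continuous_on)
 have um: "u n \<in> borel_measurable lebesgue" for n using uc by (intro measurable_completion) (simp add: borel_measurable_continuous_onI)
 have ub: "\<bar>u n x\<bar> \<le> max A 0 + 2 * d n" for n x
  using ctrunc_close[OF d0 w0, of n x] A[of x] unfolding u_def by linarith
 have uout: "u n x = 0" if "x \<notin> W" for n x using out[OF that] d0[of n] by (simp add: u_def ctrunc_def)
 have ui: "integrable lebesgue (u n)" for n
  by (rule integrable_bounded_support[where C = "max A 0 + 2 * d n" and R = R]) (use um ub uout R' in auto)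
 have ctm: "(\<lambda>x. ctrunc' (d n) (w x)) \<in> borel_measurable lebesgue" for n
  by (rule borel_measurable_continuous_on[OF _ wm]) (simp add: continuous_on_eq_continuous_at isCont_ctrunc' d0)
 have Dum: "Du n \<in> borel_measurable lebesgue" for n
  unfolding Du_def by (intro borel_measurable_scaleR ctm Dm)
 have DuB: "norm (Du n x) \<le> B" for n x
 proof -
  have "norm (Du n x) \<le> 1 * B" unfolding Du_def norm_scaleR
  using ctrunc'_bounds[OF d0, of n "w x"] B[of x] by (intro mult_mono) auto
  thus ?thesis by simp
 qed
 have Djum: "(\<lambda>x. Du n x $ j) \<in> borel_measurable lebesgue" for n j
  by (rule borel_measurable_continuous_on[OF linear_continuous_on[OF bounded_linear_vec_nth] Dum])
 have DjuB: "\<bar>Du n x $ j\<bar> \<le> B" for n x j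
  using order.trans[OF component_le_norm_cart DuB] by blast
 have Duout: "Du n x = 0" if "x \<notin> W" for n x using out[OF that] d0[of n] by (simp add: Du_def ctrunc'_def)
 have Dui: "integrable lebesgue (\<lambda>x. Du n x $ j)" for n j
  by (rule integrable_bounded_support[where C = B and R = R]) (use Djum DjuB Duout R' in auto)
 have uder: "AE x in lebesgue. (u n has_derivative (\<lambda>h. Du n x \<bullet> h)) (at x)" for n
  using der
 proof eventually_elim
  case (elim x)
  have "(u n has_derivative (\<lambda>h. ctrunc' (d n) (w x) * (Dw x \<bullet> h))) (at x)"
  unfolding u_def
  by (rule has_derivative_compose[OF elim, of "ctrunc (d n)" "\<lambda>s. ctrunc' (d n) (w x) * s"])
  (use ctrunc_derivative[OF d0] in \<open>simp add: has_field_derivative_def\<close>)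
  thus ?case by (simp add: Du_def)
 qed
 have pdu: "pd (conv (u n) (\<eta> k)) (axis j 1) x = conv (\<lambda>y. Du n y $ j) (\<eta> k) x" for n k j x
 proof -
  define \<phi> where "\<phi> y = \<eta> k (x - y)" for y
  have \<phi>: "\<phi> \<in> test_functions UNIV" unfolding \<phi>_def by (rule test_reflect(1)[OF \<eta>t])
  have ad: "AE x in lebesgue. ((\<lambda>t. (u n (x + t *\<^sub>R axis j 1) - u n x) / t) \<longlongrightarrow> Du n x $ j) (at 0)"
  using uder[of n]
  proof eventually_elim
  case (elim x)
  show ?case using directional_of_has_derivative[OF elim, of "axis j 1"] by (simp add: inner_axis)
  qed
  have "(LINT y|lebesgue. u n y * pd \<phi> (axis j 1) y) = - (LINT y|lebesgue. Du n y $ j * \<phi> y)"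
  using DjuB by (intro integral_by_parts(1)[OF ulip ub \<phi> ad Djum]) auto
  thus ?thesis unfolding pd_conv[OF ui \<eta>t] unfolding conv_def \<phi>_def test_reflect(2)[OF \<eta>t] by simp
 qed
 have L2u: "(\<lambda>x. u n x *\<^sub>R e) \<in> L2 W" for n
  by (rule L2_linear_image[OF op bd bounded_linear_scaleR_left], rule L2_bounded[OF op bd])
  (use ub um measurable_on_W[OF op bd] in auto)
 have L2Du: "Du n \<in> L2 W" for n
  by (rule L2_bounded[OF op bd measurable_on_W[OF op bd Dum], where C = B]) (use DuB in auto)
 have AEO: "AE x in lebesgue_on W. P x" if "AE x in lebesgue. P x" for P
  using that op by (auto simp: AE_lebesgue_on elim: eventually_mono)
 have d1: "d n \<le> 1" for n by (simp add: d_def inverse_eq_divide)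
 have lim1: "(\<lambda>n. L2_norm W (\<lambda>x. u n x *\<^sub>R e - w x *\<^sub>R e)) \<longlonglongrightarrow> 0"
 proof (rule L2_norm_dominated[where C = "2 * norm e"])
  show "(\<lambda>x. u n x *\<^sub>R e - w x *\<^sub>R e) \<in> meas W" for n
  using um wm by (intro measurable_on_W[OF op bd] borel_measurable_diff borel_measurable_scaleR) auto
  have b: "norm (u n x *\<^sub>R e - w x *\<^sub>R e) \<le> 2 * d n * norm e" for n x
  using mult_right_mono[OF ctrunc_close[OF d0 w0, of n x] norm_ge_zero[of e]]
  by (simp add: u_def scaleR_left_diff_distrib[symmetric])
  show "AE x in lebesgue_on W. norm (u n x *\<^sub>R e - w x *\<^sub>R e) \<le> 2 * norm e" for n
  proof (rule AE_I2)
  fix x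
  have "2 * d n * norm e \<le> 2 * 1 * norm e" using d1 by (intro mult_right_mono mult_left_mono) auto
  thus "norm (u n x *\<^sub>R e - w x *\<^sub>R e) \<le> 2 * norm e" using b[of n x] by linarith
  qed
  show "AE x in lebesgue_on W. (\<lambda>n. u n x *\<^sub>R e - w x *\<^sub>R e) \<longlonglongrightarrow> 0"
  proof (rule AE_I2, rule Lim_null_comparison)
  fix x
  show "\<forall>\<^sub>F n in sequentially. norm (u n x *\<^sub>R e - w x *\<^sub>R e) \<le> 2 * d n * norm e" using b by simp
  have "(\<lambda>n. 2 * d n * norm e) \<longlonglongrightarrow> 2 * 0 * norm e" by (intro tendsto_intros dlim)
  thus "(\<lambda>n. 2 * d n * norm e) \<longlonglongrightarrow> 0" by simp
  qed
 qed
 obtain Ke where Ke: "\<And>x. norm (outer e x) \<le> norm x * Ke" "Ke > 0"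
  using bounded_linear.pos_bounded[OF bounded_linear_outer[of e]] by blast
 note og_diff = linear_diff[OF bounded_linear.linear[OF bounded_linear_outer[of e]]]
 have ogm: "(\<lambda>x. outer e (f x)) \<in> meas W" if "f \<in> borel_measurable lebesgue" for f
  by (rule borel_measurable_continuous_on[OF linear_continuous_on[OF bounded_linear_outer] measurable_on_W[OF op bd that]])
 have ogB: "norm (outer e a - outer e b) \<le> 2 * B * Ke" if "norm a \<le> B" "norm b \<le> B" for a b
 proof -
  have "norm (a - b) \<le> 2 * B" using norm_triangle_ineq4[of a b] that by linarith
  hence "norm (a - b) * Ke \<le> 2 * B * Ke" using Ke(2) by (intro mult_right_mono) auto
  thus ?thesis using Ke(1)[of "a - b"] unfolding og_diff by linarith
 qed
 have oglim: "(\<lambda>n. outer e (f n) - outer e l) \<longlonglongrightarrow> 0" if "f \<longlonglongrightarrow> l" for f l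
  using bounded_linear.tendsto[OF bounded_linear_outer that] by (simp add: LIM_zero_iff)
 have lim2: "(\<lambda>n. L2_norm W (\<lambda>x. outer e (Du n x) - outer e (Dw x))) \<longlonglongrightarrow> 0"
 proof (rule L2_norm_dominated[where C = "2 * B * Ke"])
  have "AE x in lebesgue. (\<lambda>n. outer e (Du n x) - outer e (Dw x)) \<longlonglongrightarrow> 0"
  using crit
  proof eventually_elim
  case (elim x)
  show ?case
  proof (rule oglim, cases "w x = 0")
  case False
  hence wx: "w x > 0" using w0[of x] by simp
  have "(\<lambda>n. 1 - (d n / max (w x) (d n))\<^sup>2) \<longlonglongrightarrow> 1 - (0 / max (w x) 0)\<^sup>2"
  using wx by (intro tendsto_intros dlim) auto
  hence "(\<lambda>n. ctrunc' (d n) (w x)) \<longlonglongrightarrow> 1" by (simp add: ctrunc'_max[OF d0])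
  from tendsto_scaleR[OF this tendsto_const] show "(\<lambda>n. Du n x) \<longlonglongrightarrow> Dw x" by (simp add: Du_def)
  qed (use elim in \<open>simp add: Du_def\<close>)
  qed
  thus "AE x in lebesgue_on W. (\<lambda>n. outer e (Du n x) - outer e (Dw x)) \<longlonglongrightarrow> 0"
  by (rule AEO)
 qed (intro borel_measurable_diff ogm Dum Dm, intro AE_I2 ogB DuB B)
 \<comment> \<open>The truncation level is fixed first, each error getting half of \<epsilon>; the
   mollification index is chosen afterwards, depending on it.\<close>
 obtain n where n: "L2_norm W (\<lambda>x. u n x *\<^sub>R e - w x *\<^sub>R e) \<le> \<epsilon> / 2" "L2_norm W (\<lambda>x. outer e (Du n x) - outer e (Dw x)) \<le> \<epsilon> / 2"
 proof -
  have "\<forall>\<^sub>F n in sequentially. L2_norm W (\<lambda>x. u n x *\<^sub>R e - w x *\<^sub>R e) < \<epsilon> / 2" "\<forall>\<^sub>F n in sequentially. L2_norm W (\<lambda>x. outer e (Du n x) - outer e (Dw x)) < \<epsilon> / 2"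
  using order_tendstoD(2)[OF lim1, of "\<epsilon>/2"] order_tendstoD(2)[OF lim2, of "\<epsilon>/2"] \<epsilon> by auto
  hence "\<forall>\<^sub>F n in sequentially. L2_norm W (\<lambda>x. u n x *\<^sub>R e - w x *\<^sub>R e) < \<epsilon> / 2 \<and> L2_norm W (\<lambda>x. outer e (Du n x) - outer e (Dw x)) < \<epsilon> / 2"
  by (rule eventually_conj)
  thus thesis using that unfolding eventually_sequentially by (meson less_imp_le order_refl)
 qed
 define G where "G k x = (\<chi> j. conv (\<lambda>y. Du n y $ j) (\<eta> k) x)" for k x
 have cm: "conv (u n) (\<eta> k) \<in> borel_measurable lebesgue" for k
  by (intro measurable_completion) (simp add: borel_measurable_continuous_onI smooth_continuous_on[OF smooth_conv[OF ui \<eta>t]])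
 have Gc: "continuous_on UNIV (G k)" for k
  unfolding G_def by (intro continuous_on_vec_lambda smooth_continuous_on smooth_conv Dui \<eta>t)
 have Gm: "G k \<in> borel_measurable lebesgue" for k
  using Gc by (intro measurable_completion) (simp add: borel_measurable_continuous_onI)
 have GB: "norm (G k x) \<le> real (CARD('n)) * B" for k x
 proof -
  have "norm (G k x) \<le> (\<Sum>j\<in>UNIV. \<bar>G k x $ j\<bar>)" by (rule norm_le_l1_cart)
  also have "\<dots> \<le> (\<Sum>j\<in>(UNIV::'n set). B)"
  using DjuB by (intro sum_mono) (simp add: G_def conv_bound[OF \<eta> Dui])
  finally show ?thesis by simp
 qed
 have cb: "\<bar>conv (u n) (\<eta> k) x\<bar> \<le> max A 0 + 2 * d n" for k x
  by (rule conv_bound[OF \<eta> ui], rule AE_I2, rule ub)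
 have lim3: "(\<lambda>k. L2_norm W (\<lambda>x. conv (u n) (\<eta> k) x *\<^sub>R e - u n x *\<^sub>R e)) \<longlonglongrightarrow> 0"
 proof (rule L2_norm_dominated[where C = "2 * (max A 0 + 2 * d n) * norm e"])
  show "(\<lambda>x. conv (u n) (\<eta> k) x *\<^sub>R e - u n x *\<^sub>R e) \<in> meas W" for k
  by (intro measurable_on_W[OF op bd] borel_measurable_diff borel_measurable_scaleR cm um borel_measurable_const)
  show "AE x in lebesgue_on W. norm (conv (u n) (\<eta> k) x *\<^sub>R e - u n x *\<^sub>R e) \<le> 2 * (max A 0 + 2 * d n) * norm e" for k
  proof (rule AE_I2)
  fix x
  have "\<bar>conv (u n) (\<eta> k) x - u n x\<bar> \<le> 2 * (max A 0 + 2 * d n)"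
  proof -
  have "\<bar>a - b\<bar> \<le> 2 * C" if "\<bar>a\<bar> \<le> C" "\<bar>b\<bar> \<le> C" for a b C :: real using that by linarith
  from this[OF cb ub] show ?thesis .
  qed
  from mult_right_mono[OF this norm_ge_zero[of e]]
  show "norm (conv (u n) (\<eta> k) x *\<^sub>R e - u n x *\<^sub>R e) \<le> 2 * (max A 0 + 2 * d n) * norm e"
  by (simp add: scaleR_left_diff_distrib[symmetric])
  qed
  show "AE x in lebesgue_on W. (\<lambda>k. conv (u n) (\<eta> k) x *\<^sub>R e - u n x *\<^sub>R e) \<longlonglongrightarrow> 0"
  proof (rule AE_I2)
  fix x
  have "isCont (u n) x" using uc by (simp add: continuous_on_eq_continuous_at)
  from tendsto_scaleR[OF conv_tendsto[OF \<eta> ui this] tendsto_const]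
  show "(\<lambda>k. conv (u n) (\<eta> k) x *\<^sub>R e - u n x *\<^sub>R e) \<longlonglongrightarrow> 0" by (simp add: LIM_zero_iff)
  qed
 qed
 define C4 where "C4 = (real (CARD('n)) * B + B) * Ke"
 have lim4: "(\<lambda>k. L2_norm W (\<lambda>x. outer e (G k x) - outer e (Du n x))) \<longlonglongrightarrow> 0"
 proof (rule L2_norm_dominated[where C = C4])
  show "AE x in lebesgue_on W. norm (outer e (G k x) - outer e (Du n x)) \<le> C4" for k
  proof (rule AE_I2)
  fix x
  have "norm (G k x - Du n x) \<le> real (CARD('n)) * B + B" using norm_triangle_ineq4[of "G k x" "Du n x"] GB[of k x] DuB[of n x] by linarith
  hence "norm (G k x - Du n x) * Ke \<le> C4" unfolding C4_def using Ke(2) by (intro mult_right_mono) auto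
  thus "norm (outer e (G k x) - outer e (Du n x)) \<le> C4" using Ke(1)[of "G k x - Du n x"] unfolding og_diff by linarith
  qed
  have "AE x in lebesgue. (\<lambda>k. outer e (G k x) - outer e (Du n x)) \<longlonglongrightarrow> 0"
  using cont
  proof eventually_elim
  case (elim x)
  have "isCont w x" using wc by (simp add: continuous_on_eq_continuous_at)
  hence "isCont (\<lambda>x. ctrunc' (d n) (w x)) x"
  by (rule isCont_o2[OF _ isCont_ctrunc'[OF d0]])
  hence "isCont (\<lambda>y. Du n y $ j) x" for j unfolding Du_def
  by (intro continuous_intros elim)
  hence "(\<lambda>k. G k x $ j) \<longlonglongrightarrow> Du n x $ j" for j
  unfolding G_def using conv_tendsto[OF \<eta> Dui] by simp
  thus ?case by (intro oglim vec_tendstoI)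
  qed
  thus "AE x in lebesgue_on W. (\<lambda>k. outer e (G k x) - outer e (Du n x)) \<longlonglongrightarrow> 0"
  by (rule AEO)
 qed (intro borel_measurable_diff ogm Gm Dum)
 define K where "K = {x. w x \<ge> d n}"
 \<comment> \<open>The superlevel set avoids the complement of \<open>W\<close>, where
   \<open>w\<close> is zero. Being compact, it has a positive distance to that complement, which
   leaves room for the mollifier.\<close>
 have KW: "K \<subseteq> W" using out d0[of n] by (auto simp: K_def) (metis not_less)
 have "closed K" unfolding K_def by (intro closed_Collect_le continuous_on_const wc)
 hence Kc: "compact K" using bounded_subset[OF bd KW] by (simp add: compact_eq_bounded_closed)
 obtain r where r: "r > 0" "(\<Union>x\<in>K. cball x r) \<subseteq> W"
  using compact_subset_open_imp_cball_epsilon_subset[OF Kc op KW] by blast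
 have ev3: "\<forall>\<^sub>F k in sequentially. inverse (real (Suc k)) < r"
  using order_tendstoD(2)[OF LIMSEQ_inverse_real_of_nat r(1)] .
 have "\<forall>\<^sub>F k in sequentially. L2_norm W (\<lambda>x. conv (u n) (\<eta> k) x *\<^sub>R e - u n x *\<^sub>R e) < \<epsilon> / 2 \<and>
  L2_norm W (\<lambda>x. outer e (G k x) - outer e (Du n x)) < \<epsilon> / 2 \<and> inverse (real (Suc k)) < r"
  using order_tendstoD(2)[OF lim3, of "\<epsilon>/2"] order_tendstoD(2)[OF lim4, of "\<epsilon>/2"] \<epsilon> ev3 by (auto intro: eventually_conj)
 then obtain k where k: "L2_norm W (\<lambda>x. conv (u n) (\<eta> k) x *\<^sub>R e - u n x *\<^sub>R e) \<le> \<epsilon> / 2"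
  "L2_norm W (\<lambda>x. outer e (G k x) - outer e (Du n x)) \<le> \<epsilon> / 2" "inverse (real (Suc k)) < r"
  unfolding eventually_sequentially by (meson less_imp_le order_refl)
 define F where "F = conv (u n) (\<eta> k)"
 have Fs: "smooth F" unfolding F_def by (rule smooth_conv[OF ui \<eta>t])
 have Ft: "F \<in> test_functions W"
 proof -
  define S where "S = (\<Union>x\<in>K. \<Union>y\<in>cball 0 r. {x + y})"
  have Sc: "compact S" unfolding S_def by (rule compact_sums'[OF Kc]) simp
  have SW: "S \<subseteq> W"
  proof
  fix z assume "z \<in> S"
  then obtain x y where "x \<in> K" "y \<in> cball 0 r" "z = x + y" by (auto simp: S_def)
  hence "z \<in> cball x r" by (simp add: dist_norm)
  thus "z \<in> W" using r(2) \<open>x \<in> K\<close> by blast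
  qed
  have "{x. F x \<noteq> 0} \<subseteq> S"
  proof
  fix x assume "x \<in> {x. F x \<noteq> 0}"
  hence "(LINT y|lebesgue. u n y * \<eta> k (x - y)) \<noteq> 0" by (simp add: F_def conv_def)
  hence "\<exists>y. u n y * \<eta> k (x - y) \<noteq> 0"
  by (rule contrapos_np) (simp only: not_ex not_not Bochner_Integration.integral_zero)
  then obtain y where y: "u n y \<noteq> 0" "\<eta> k (x - y) \<noteq> 0" by auto
  have "w y \<ge> d n" using y(1) by (auto simp: u_def ctrunc_def split: if_splits)
  moreover have "norm (x - y) \<le> inverse (real (Suc k))" using y(2) \<eta> by (simp add: mollifier_def inverse_eq_divide)
  ultimately have "y \<in> K" "x - y \<in> cball 0 r" using k(3) by (auto simp: K_def)
  moreover have "x = y + (x - y)" by simp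
  ultimately show "x \<in> S" unfolding S_def by blast
  qed
  hence cl: "closure {x. F x \<noteq> 0} \<subseteq> S" using Sc by (intro closure_minimal compact_imp_closed)
  moreover have "compact (closure {x. F x \<noteq> 0})"
  using compact_Int_closed[OF Sc closed_closure, of "{x. F x \<noteq> 0}"] cl by (simp add: Int_absorb1)
  ultimately show ?thesis using Fs SW by (auto simp: test_functions_def)
 qed
 have jacF: "jac (\<lambda>x. F x *\<^sub>R e) x = outer e (G k x)" for x
 proof -
  have "pd (\<lambda>x. F x *\<^sub>R e) a x = pd F a x *\<^sub>R e" for a
  using fun_cong[OF pd_linear_image[OF bounded_linear_scaleR_left Fs, of e a], of x] by simp
  thus ?thesis
  by (simp add: jac_def outer_def vec_eq_iff G_def F_def mult.commute pdu)
 qed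
 show "\<exists>\<Phi>\<in>test_functions W. L2_norm W (\<lambda>x. \<Phi> x - w x *\<^sub>R e) \<le> \<epsilon> \<and> L2_norm W (\<lambda>x. jac \<Phi> x - outer e (Dw x)) \<le> \<epsilon>"
 proof (intro bexI conjI)
  show T: "(\<lambda>x. F x *\<^sub>R e) \<in> test_functions W" by (rule test_linear_image[OF bounded_linear_scaleR_left Ft])
  have "L2_norm W (\<lambda>x. (F x *\<^sub>R e - u n x *\<^sub>R e) + (u n x *\<^sub>R e - w x *\<^sub>R e)) \<le> \<epsilon>"
  using k(1) n(1) unfolding F_def[symmetric]
  by (intro L2_norm_triangle_le L2_diff[OF op bd] wL L2u test_L2[OF op bd T])
  thus "L2_norm W (\<lambda>x. F x *\<^sub>R e - w x *\<^sub>R e) \<le> \<epsilon>" by simp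
  have OG: "(\<lambda>x. outer e (G k x)) \<in> L2 W"
  using jac_L2[OF op bd T] unfolding jacF[abs_def] .
  have "L2_norm W (\<lambda>x. (outer e (G k x) - outer e (Du n x)) + (outer e (Du n x) - outer e (Dw x))) \<le> \<epsilon>"
  using k(2) n(2) by (intro L2_norm_triangle_le L2_diff[OF op bd] OG OL DL L2Du) auto
  thus "L2_norm W (\<lambda>x. jac (\<lambda>x. F x *\<^sub>R e) x - outer e (Dw x)) \<le> \<epsilon>" by (simp add: jacF)
 qed
qed
qed

end

section \<open>Polynomials of bounded degree\<close>

definition monoms :: "nat \<Rightarrow> (real^'n \<Rightarrow> real) set" where
"monoms k = {\<lambda>x. \<Prod>i\<in>UNIV. (x $ i) ^ e i | e. (\<Sum>i\<in>UNIV. e i) \<le> k}"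

lemma polys_span: "polys k = span (monoms k)"
by (simp add: polys_def monoms_def)

lemma finite_monoms: "finite (monoms k :: (real^'n \<Rightarrow> real) set)"
proof -
have "(monoms k :: (real^'n \<Rightarrow> real) set) \<subseteq> (\<lambda>e x. \<Prod>i\<in>UNIV. (x $ i) ^ e i) ` PiE UNIV (\<lambda>_. {..k})"
proof
 fix f :: "real^'n \<Rightarrow> real" assume "f \<in> monoms k"
 then obtain e where e: "f = (\<lambda>x. \<Prod>i\<in>UNIV. (x $ i) ^ e i)" "(\<Sum>i\<in>UNIV. e i) \<le> k" by (auto simp: monoms_def)
 have "e i \<le> k" for i using member_le_sum[of i UNIV e] e(2) by simp
 thus "f \<in> (\<lambda>e x. \<Prod>i\<in>UNIV. (x $ i) ^ e i) ` PiE UNIV (\<lambda>_. {..k})" using e(1) by (intro image_eqI[of _ _ e]) auto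
qed
moreover have "finite (PiE (UNIV :: 'n set) (\<lambda>_. {..k}))" by (intro finite_PiE) auto
ultimately show ?thesis using finite_surj by blast
qed

lemma subspace_polys: "subspace (polys k)" by (simp add: polys_def subspace_span)

lemma polys_mono: "k \<le> l \<Longrightarrow> f \<in> polys k \<Longrightarrow> f \<in> polys l"
proof -
assume "k \<le> l" "f \<in> polys k"
hence "monoms k \<subseteq> (monoms l :: (real^'a \<Rightarrow> real) set)"
 unfolding monoms_def by (blast intro: order.trans)
from span_mono[OF this] \<open>f \<in> polys k\<close> show "f \<in> polys l" by (auto simp: polys_span)
qed

lemma polys_add: "f \<in> polys k \<Longrightarrow> g \<in> polys k \<Longrightarrow> (\<lambda>x. f x + g x) \<in> polys k"
using subspace_add[OF subspace_polys, of f k g] by (simp add: plus_fun_def)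

lemma polys_scale: "f \<in> polys k \<Longrightarrow> (\<lambda>x. c * f x) \<in> polys k"
using subspace_scale[OF subspace_polys, of f k c] by (simp add: scaleR_fun_def)

lemma polys_const: "(\<lambda>x :: real^'n. c) \<in> polys k"
proof -
have "(\<lambda>x :: real^'n. 1) \<in> monoms k" unfolding monoms_def by (auto intro!: exI[of _ "\<lambda>_. 0"])
hence "(\<lambda>x :: real^'n. 1) \<in> polys k" unfolding polys_span by (rule span_base)
from polys_scale[OF this, of c] show ?thesis by simp
qed

lemma polys_sum: "(\<And>i. i \<in> I \<Longrightarrow> f i \<in> polys k) \<Longrightarrow> (\<lambda>x. \<Sum>i\<in>I. f i x) \<in> polys k"
by (induction I rule: infinite_finite_induct) (auto intro: polys_const polys_add)

lemma polys_induct [consumes 1, case_names monom add scale]: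
assumes "f \<in> polys k" and "\<And>e. (\<Sum>i\<in>UNIV. e i) \<le> k \<Longrightarrow> P (\<lambda>x. \<Prod>i\<in>UNIV. (x $ i) ^ e i)"
 and "\<And>f g. \<lbrakk>f \<in> polys k; g \<in> polys k; P f; P g\<rbrakk> \<Longrightarrow> P (\<lambda>x. f x + g x)"
 and "\<And>f c. \<lbrakk>f \<in> polys k; P f\<rbrakk> \<Longrightarrow> P (\<lambda>x. c * f x)"
shows "P f"
proof -
have z: "P (\<lambda>x. 0)" using assms(4)[of "\<lambda>x. \<Prod>i\<in>UNIV. (x $ i) ^ 0" 0] assms(2)[of "\<lambda>_. 0"] polys_const[of 1 k] by simp
have "f \<in> span (monoms k)" using assms(1) by (simp add: polys_span)
hence "f \<in> polys k \<and> P f"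
proof (induction rule: span_induct_alt)
 case base
 thus ?case using z polys_const[of 0 k] by (simp add: zero_fun_def)
next
 case (step c x y)
 obtain e where e: "x = (\<lambda>x. \<Prod>i\<in>UNIV. (x $ i) ^ e i)" "(\<Sum>i\<in>UNIV. e i) \<le> k" using step(1) by (auto simp: monoms_def)
 have x: "x \<in> polys k" using step(1) by (simp add: polys_span span_base)
 have "P x" using assms(2)[OF e(2)] e(1) by simp
 hence "P (\<lambda>z. c * x z)" "(\<lambda>z. c * x z) \<in> polys k" using assms(4)[OF x] polys_scale[OF x] by auto
 hence "P (\<lambda>z. c * x z + y z)" "(\<lambda>z. c * x z + y z) \<in> polys k" using assms(3) polys_add step(2) by blast+
 thus ?case by (simp add: plus_fun_def scaleR_fun_def)
qed
thus ?thesis ..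
qed

lemma polys_mult:
assumes "f \<in> polys k" "g \<in> polys l"
shows "(\<lambda>x. f x * g x) \<in> polys (k + l)"
using assms(1)
proof (induction rule: polys_induct)
case (monom e)
note e = monom
show ?case
 using assms(2)
proof (induction rule: polys_induct)
 case (monom e')
 have "(\<lambda>x :: real^'a. (\<Prod>i\<in>UNIV. (x $ i) ^ e i) * (\<Prod>i\<in>UNIV. (x $ i) ^ e' i)) = (\<lambda>x. \<Prod>i\<in>UNIV. (x $ i) ^ (e i + e' i))"
  by (simp add: power_add prod.distrib)
 moreover have "(\<Sum>i\<in>UNIV. e i + e' i) \<le> k + l" using e monom by (simp add: sum.distrib)
 hence "(\<lambda>x. \<Prod>i\<in>UNIV. (x $ i) ^ (e i + e' i)) \<in> monoms (k + l)"
  unfolding monoms_def by (intro CollectI exI[of _ "\<lambda>i. e i + e' i"]) auto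
 ultimately show ?case by (simp add: polys_span span_base)
next
 case (add f g)
 thus ?case using polys_add[OF add(3,4)] by (simp add: distrib_left)
next
 case (scale f c)
 thus ?case using polys_scale[OF scale(2), of c] by (simp add: mult.left_commute)
qed
next
case (add f g)
thus ?case using polys_add[OF add(3,4)] by (simp add: distrib_right)
next
case (scale f c)
thus ?case using polys_scale[OF scale(2), of c] by (simp add: mult.assoc)
qed

lemma polys_prod:
assumes "finite I" "\<And>i. i \<in> I \<Longrightarrow> f i \<in> polys (k i)"
shows "(\<lambda>x. \<Prod>i\<in>I. f i x) \<in> polys (\<Sum>i\<in>I. k i)"
using assms by (induction I) (auto intro: polys_const polys_mult)

lemma polys_coord: "(\<lambda>x :: real^'n. x $ i) \<in> polys 1"
proof -
have "(\<lambda>x :: real^'n. \<Prod>j\<in>UNIV. (x $ j) ^ (if j = i then 1 else 0)) = (\<lambda>x. x $ i)"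
proof
 fix x :: "real^'n"
 have "(\<Prod>j\<in>UNIV. (x $ j) ^ (if j = i then 1 else 0)) = (\<Prod>j\<in>UNIV. if j = i then x $ j else 1)"
  by (intro prod.cong) auto
 thus "(\<Prod>j\<in>UNIV. (x $ j) ^ (if j = i then 1 else 0)) = x $ i" by simp
qed
hence "(\<lambda>x :: real^'n. x $ i) \<in> monoms 1"
 unfolding monoms_def by (intro CollectI exI[of _ "\<lambda>j. if j = i then 1 else 0"]) auto
thus ?thesis by (simp add: polys_span span_base)
qed

lemma polys_power: "f \<in> polys k \<Longrightarrow> (\<lambda>x. f x ^ n) \<in> polys (n * k)"
by (induction n) (auto intro: polys_const polys_mult)

lemma polys_affine: "(\<lambda>x :: real^'n. c + a \<bullet> x) \<in> polys 1"
proof -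
have "(\<lambda>x :: real^'n. c + (\<Sum>i\<in>UNIV. a $ i * x $ i)) \<in> polys 1"
 by (intro polys_add polys_const polys_sum polys_scale polys_coord)
thus ?thesis by (simp add: inner_vec_def)
qed

lemma polys_affine_arg:
assumes "f \<in> polys k" shows "(\<lambda>x. f (c + s *\<^sub>R x)) \<in> polys k"
using assms
proof (induction rule: polys_induct)
case (monom e)
have "(\<lambda>x :: real^'a. c $ i + s * x $ i) \<in> polys 1" for i
 by (intro polys_add polys_const polys_scale polys_coord)
hence "(\<lambda>x :: real^'a. \<Prod>i\<in>UNIV. (c $ i + s * x $ i) ^ e i) \<in> polys (\<Sum>i\<in>UNIV. e i * 1)"
 by (intro polys_prod polys_power) auto
thus ?case using polys_mono[OF monom] by simp
next
case (add f g)
thus ?case using polys_add[OF add(3,4)] by simp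
next
case (scale f c)
thus ?case using polys_scale[OF scale(2)] by simp
qed

text \<open>The partial derivatives are kept in the same space \<open>polys k\<close>; the sharp
  degree is of no interest, because one inverse estimate is to serve functions and gradients
  alike.\<close>

lemma polys_has_derivative:
assumes "f \<in> polys k"
shows "\<exists>D. (\<forall>j. D j \<in> polys k) \<and> (\<forall>x. (f has_derivative (\<lambda>h. \<Sum>j\<in>UNIV. D j x * h $ j)) (at x))"
using assms
proof (induction rule: polys_induct)
case (monom e)
have "\<exists>D. (\<forall>j. D j \<in> polys (\<Sum>i\<in>I. e i)) \<and>
 (\<forall>x. ((\<lambda>x. \<Prod>i\<in>I. (x $ i) ^ e i) has_derivative (\<lambda>h. \<Sum>j\<in>UNIV. D j x * h $ j)) (at x))" if "finite I" for I :: "'a set"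
 using that
proof (induction I)
 case empty
 show ?case by (intro exI[of _ "\<lambda>_ _. 0"]) (auto intro: polys_const)
next
 case (insert i I)
 then obtain D where D: "\<And>j. D j \<in> polys (\<Sum>i\<in>I. e i)"
  "\<And>x. ((\<lambda>x. \<Prod>i\<in>I. (x $ i) ^ e i) has_derivative (\<lambda>h. \<Sum>j\<in>UNIV. D j x * h $ j)) (at x)" by blast
 define E where "E j x = (x $ i) ^ e i * D j x + (if j = i then real (e i) * (x $ i) ^ (e i - 1) * (\<Prod>i\<in>I. (x $ i) ^ e i) else 0)" for j and x :: "real^'a"
 have c: "(\<lambda>x :: real^'a. (x $ i) ^ n) \<in> polys n" for n i using polys_power[OF polys_coord, of i n] by simp
 have P: "(\<lambda>x :: real^'a. \<Prod>i\<in>I. (x $ i) ^ e i) \<in> polys (\<Sum>i\<in>I. e i)"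
  by (rule polys_prod[OF insert(1)]) (rule c)
 have "E j \<in> polys (e i + (\<Sum>i\<in>I. e i))" for j
 proof -
  have "(\<lambda>x :: real^'a. (x $ i) ^ e i * D j x) \<in> polys (e i + (\<Sum>i\<in>I. e i))" by (intro polys_mult c D)
  moreover have "(\<lambda>x :: real^'a. real (e i) * ((x $ i) ^ (e i - 1) * (\<Prod>i\<in>I. (x $ i) ^ e i))) \<in> polys (e i + (\<Sum>i\<in>I. e i))"
  by (intro polys_scale polys_mono[OF _ polys_mult[OF c P]]) simp
  ultimately show ?thesis
  unfolding E_def using polys_add polys_const[of 0] by (cases "j = i") (auto simp: mult.assoc)
 qed
 moreover have "((\<lambda>x. \<Prod>i\<in>insert i I. (x $ i) ^ e i) has_derivative (\<lambda>h. \<Sum>j\<in>UNIV. E j x * h $ j)) (at x)" for x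
 proof -
  have n: "((\<lambda>x :: real^'a. x $ i) has_derivative (\<lambda>h. h $ i)) (at x)"
  by (rule bounded_linear_imp_has_derivative[OF bounded_linear_vec_nth])
  have "((\<lambda>x. (x $ i) ^ e i * (\<Prod>i\<in>I. (x $ i) ^ e i)) has_derivative
  (\<lambda>h. (x $ i) ^ e i * (\<Sum>j\<in>UNIV. D j x * h $ j) + (of_nat (e i) * h $ i * (x $ i) ^ (e i - 1)) * (\<Prod>i\<in>I. (x $ i) ^ e i))) (at x)"
  by (intro has_derivative_mult has_derivative_power n D)
  also have "(\<lambda>h. (x $ i) ^ e i * (\<Sum>j\<in>UNIV. D j x * h $ j) + (of_nat (e i) * h $ i * (x $ i) ^ (e i - 1)) * (\<Prod>i\<in>I. (x $ i) ^ e i))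
  = (\<lambda>h. \<Sum>j\<in>UNIV. E j x * h $ j)"
  proof
  fix h :: "real^'a"
  have "(\<Sum>j\<in>UNIV. E j x * h $ j) = (\<Sum>j\<in>UNIV. (x $ i) ^ e i * (D j x * h $ j)) +
  (\<Sum>j\<in>UNIV. if j = i then real (e i) * (x $ i) ^ (e i - 1) * (\<Prod>i\<in>I. (x $ i) ^ e i) * h $ j else 0)"
  unfolding E_def sum.distrib[symmetric] by (intro sum.cong) (auto simp: algebra_simps)
  thus "(x $ i) ^ e i * (\<Sum>j\<in>UNIV. D j x * h $ j) + (of_nat (e i) * h $ i * (x $ i) ^ (e i - 1)) * (\<Prod>i\<in>I. (x $ i) ^ e i) = (\<Sum>j\<in>UNIV. E j x * h $ j)"
  by (simp add: sum_distrib_left mult.commute mult.left_commute)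
  qed
  finally show ?thesis using insert(1,2) by simp
 qed
 ultimately show ?case using insert(1,2) by (intro exI[of _ E]) auto
qed
from this[of UNIV] obtain D where D: "\<And>j. D j \<in> polys (\<Sum>i\<in>UNIV. e i)"
 "\<And>x. ((\<lambda>x. \<Prod>i\<in>UNIV. (x $ i) ^ e i) has_derivative (\<lambda>h. \<Sum>j\<in>UNIV. D j x * h $ j)) (at x)" by auto
thus ?case using polys_mono[OF monom] by (intro exI[of _ D]) auto
next
case (add f g)
then obtain D E where D: "\<And>j. D j \<in> polys k" "\<And>x. (f has_derivative (\<lambda>h. \<Sum>j\<in>UNIV. D j x * h $ j)) (at x)"
 and E: "\<And>j. E j \<in> polys k" "\<And>x. (g has_derivative (\<lambda>h. \<Sum>j\<in>UNIV. E j x * h $ j)) (at x)" by blast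
show ?case
proof (intro exI[of _ "\<lambda>j x. D j x + E j x"] conjI allI)
 show "(\<lambda>x. D j x + E j x) \<in> polys k" for j by (intro polys_add D E)
 show "((\<lambda>x. f x + g x) has_derivative (\<lambda>h. \<Sum>j\<in>UNIV. (D j x + E j x) * h $ j)) (at x)" for x
  using has_derivative_add[OF D(2)[of x] E(2)[of x]] by (simp add: distrib_right sum.distrib)
qed
next
case (scale f c)
then obtain D where D: "\<And>j. D j \<in> polys k" "\<And>x. (f has_derivative (\<lambda>h. \<Sum>j\<in>UNIV. D j x * h $ j)) (at x)" by blast
show ?case
proof (intro exI[of _ "\<lambda>j x. c * D j x"] conjI allI)
 show "(\<lambda>x. c * D j x) \<in> polys k" for j by (intro polys_scale D)
 show "((\<lambda>x. c * f x) has_derivative (\<lambda>h. \<Sum>j\<in>UNIV. c * D j x * h $ j)) (at x)" for x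
  using has_derivative_mult_right[OF D(2)[of x], of c] by (simp add: sum_distrib_left mult.assoc)
qed
qed

lemma polys_continuous_on: "f \<in> polys k \<Longrightarrow> continuous_on S f"
using polys_has_derivative[of f k] by (auto intro!: continuous_at_imp_continuous_on dest: has_derivative_continuous)

section \<open>Polynomials restricted to lines\<close>

lemma polys_on_line:
assumes "f \<in> polys k" shows "\<exists>q. degree q \<le> k \<and> (\<forall>t. f (c + t *\<^sub>R u) = poly q t)"
using assms
proof (induction rule: polys_induct)
case (monom e)
define q where "q = (\<Prod>i\<in>UNIV. [:c $ i, u $ i:] ^ e i)"
have "degree q \<le> (\<Sum>i\<in>UNIV. degree ([:c $ i, u $ i:] ^ e i))"
 unfolding q_def using degree_prod_sum_le[of UNIV "\<lambda>i. [:c $ i, u $ i:] ^ e i"] by (simp add: o_def)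
also have "\<dots> \<le> (\<Sum>i\<in>UNIV. e i)"
proof (rule sum_mono)
 fix i
 have "degree ([:c $ i, u $ i:] ^ e i) \<le> degree [:c $ i, u $ i:] * e i" by (rule degree_power_le)
 also have "\<dots> \<le> 1 * e i" by (intro mult_right_mono) auto
 finally show "degree ([:c $ i, u $ i:] ^ e i) \<le> e i" by simp
qed
finally have "degree q \<le> k" using monom by simp
thus ?case by (intro exI[of _ q]) (auto simp: q_def poly_prod)
next
case (add f g)
then obtain p q where "degree p \<le> k" "degree q \<le> k" "\<And>t. f (c + t *\<^sub>R u) = poly p t" "\<And>t. g (c + t *\<^sub>R u) = poly q t" by blast
thus ?case by (intro exI[of _ "p + q"]) (auto intro: degree_add_le)
next
case (scale f d)
then obtain p where "degree p \<le> k" "\<And>t. f (c + t *\<^sub>R u) = poly p t" by blast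
thus ?case by (intro exI[of _ "smult d p"]) (auto intro: order.trans[OF degree_smult_le])
qed

lemma polys_zero_on_line:
assumes f: "f \<in> polys k" and Z: "\<And>t. t \<in> Z \<Longrightarrow> f (c + t *\<^sub>R u) = 0" and Zc: "infinite Z \<or> card Z > k"
shows "f (c + t *\<^sub>R u) = 0"
proof -
obtain q where q: "degree q \<le> k" "\<And>t. f (c + t *\<^sub>R u) = poly q t" using polys_on_line[OF f] by blast
have "q = 0"
proof (rule ccontr)
 assume q0: "q \<noteq> 0"
 have sub: "Z \<subseteq> {t. poly q t = 0}" using Z q(2) by auto
 have "finite Z" using finite_subset[OF sub poly_roots_finite[OF q0]] .
 moreover have "card Z \<le> degree q"
  using card_mono[OF poly_roots_finite[OF q0] sub] card_poly_roots_bound[OF q0] by linarith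
 ultimately show False using Zc q(1) by auto
qed
thus ?thesis using q(2) by simp
qed

lemma polys_zero_on_ball:
assumes f: "f \<in> polys k" and r: "r > 0" and Z: "\<And>x. x \<in> ball c r \<Longrightarrow> f x = 0"
shows "f = (\<lambda>x. 0)"
proof
fix x
define u where "u = x - c"
have pos: "0 < r / (norm u + 1)" using r by (simp add: add_nonneg_pos)
have "f (c + t *\<^sub>R u) = 0" if "t \<in> {0<..<r / (norm u + 1)}" for t
proof (rule Z)
 have "t * norm u \<le> t * (norm u + 1)" using that by (intro mult_left_mono) auto
 also have "\<dots> < r" using that by (simp add: less_divide_eq add_nonneg_pos)
 finally show "c + t *\<^sub>R u \<in> ball c r" using that by (simp add: dist_norm)
qed
hence "f (c + 1 *\<^sub>R u) = 0"
 by (rule polys_zero_on_line[OF f]) (assumption, rule disjI1, rule infinite_Ioo[OF pos])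
thus "f x = 0" by (simp add: u_def)
qed

section \<open>The inverse estimate for polynomials\<close>

lemma integral_lborel_affine:
fixes f :: "'a::euclidean_space \<Rightarrow> real"
assumes [measurable]: "f \<in> borel_measurable borel" and c: "c \<noteq> 0"
shows "integral\<^sup>L lborel f = \<bar>c\<bar> ^ DIM('a) * integral\<^sup>L lborel (\<lambda>x. f (t + c *\<^sub>R x))"
by (subst lborel_affine[OF c, of t], subst integral_real_density)
 (auto simp: integral_distr)

lemma continuous_integrable_on_compact:
fixes f :: "'a::euclidean_space \<Rightarrow> real"
assumes "compact K" "continuous_on K f"
shows "integrable (lebesgue_on K) f"
proof -
have "bounded (f ` K)" using assms by (intro compact_imp_bounded compact_continuous_image)
then obtain C where C: "\<And>x. x \<in> K \<Longrightarrow> norm (f x) \<le> C" by (auto simp: bounded_iff)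
have KL: "K \<in> lmeasurable" using assms(1) by (rule lmeasurable_compact)
interpret finite_measure "lebesgue_on K" by (rule finite_measure_lebesgue_on[OF KL])
show ?thesis
proof (rule integrable_const_bound[of _ C])
 show "AE x in lebesgue_on K. norm (f x) \<le> C" using C by (intro AE_I2) (simp add: space_restrict_space)
 show "f \<in> borel_measurable (lebesgue_on K)"
  using assms KL by (intro continuous_imp_measurable_on_sets_lebesgue) auto
qed
qed

text \<open>Equivalence of norms on a finite-dimensional space: the supremum over the unit ball is a
  seminorm, and the integral over the small ball is definite because a polynomial that vanishes on a
  ball is zero.\<close>

lemma polys_inverse_estimate_unit:
fixes k :: nat
assumes \<rho>: "\<rho> > 0"
shows "\<exists>C\<ge>0. \<forall>p\<in>polys k. \<forall>x\<in>cball (0::real^'n) 1. \<bar>p x\<bar> \<le> C * sqrt (LINT y|lebesgue_on (cball 0 \<rho>). (p y)\<^sup>2)"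
proof -
define ip where "ip p q = (LINT y|lebesgue_on (cball (0::real^'n) \<rho>). p y * q y :: real)" for p q
have ii: "integrable (lebesgue_on (cball (0::real^'n) \<rho>)) (\<lambda>y. p y * q y)" if "p \<in> polys k" "q \<in> polys k" for p q
 by (intro continuous_integrable_on_compact continuous_on_mult polys_continuous_on[OF that(1)] polys_continuous_on[OF that(2)]) auto
interpret F: pos_form "polys k" ip
proof
 fix u v w :: "real^'n \<Rightarrow> real" and c :: real
 assume u: "u \<in> polys k"
 show "0 \<le> ip u u" by (simp add: ip_def)
 show "u = 0" if z: "ip u u = 0"
 proof -
  have "AE y in lebesgue_on (cball 0 \<rho>). u y * u y = 0"
  using z integral_nonneg_eq_0_iff_AE[OF ii[OF u u]] by (simp add: ip_def)
  hence AE: "AE y in lebesgue. y \<in> cball 0 \<rho> \<longrightarrow> u y = 0" by (simp add: AE_lebesgue_on)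
  have "u x = 0" if x: "x \<in> ball 0 \<rho>" for x
  proof (rule ccontr)
  assume ux: "u x \<noteq> 0"
  define O' where "O' = ball 0 \<rho> \<inter> u -` (- {0})"
  have "open O'" unfolding O'_def
  by (intro continuous_open_preimage polys_continuous_on[OF u]) auto
  moreover have "x \<in> O'" using x ux by (simp add: O'_def)
  moreover have "AE y in lebesgue. y \<notin> O'" using AE by eventually_elim (auto simp: O'_def)
  hence "O' \<in> null_sets lebesgue" using \<open>open O'\<close> by (subst AE_iff_null_sets) auto
  ultimately show False using open_not_negligible[of O'] by (auto simp: negligible_iff_null_sets)
  qed
  thus ?thesis using polys_zero_on_ball[OF u \<rho>, of 0] by (simp add: zero_fun_def)
 qed
 assume w: "w \<in> polys k"
 show "ip (c *\<^sub>R u) w = c * ip u w" by (simp add: ip_def scaleR_fun_def mult.assoc)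
next
 fix u v w :: "real^'n \<Rightarrow> real" assume u: "u \<in> polys k" and v: "v \<in> polys k"
 show "ip u v = ip v u" by (simp add: ip_def mult.commute)
 assume w: "w \<in> polys k"
 show "ip (u + v) w = ip u w + ip v w" using ii[OF u w] ii[OF v w] by (simp add: ip_def plus_fun_def distrib_right)
qed (rule subspace_polys)
define S where "S p = (SUP x\<in>cball (0::real^'n) 1. \<bar>p x :: real\<bar>)" for p
have bdd: "bdd_above ((\<lambda>x. \<bar>p x\<bar>) ` cball 0 1)" if "p \<in> polys k" for p :: "real^'n \<Rightarrow> real"
 by (intro bounded_imp_bdd_above compact_imp_bounded compact_continuous_image continuous_intros polys_continuous_on[OF that]) auto
have "\<exists>C\<ge>0. \<forall>p\<in>span (monoms k). S p \<le> C * F.nm p"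
proof (rule F.seminorm_bounded[OF finite_monoms])
 show "span (monoms k) \<subseteq> polys k" by (simp add: polys_span)
 fix u :: "real^'n \<Rightarrow> real" assume "u \<in> span (monoms k)"
 hence u: "u \<in> polys k" by (simp add: polys_span)
 have up: "\<bar>u x\<bar> \<le> S u" if "x \<in> cball 0 1" for x unfolding S_def using that by (intro cSUP_upper[where f = "\<lambda>x. \<bar>u x\<bar>"] bdd[OF u])
 show "0 \<le> S u" using up[of 0] by (simp add: order.trans[OF abs_ge_zero])
 show "S (u + v) \<le> S u + S v" if "v \<in> span (monoms k)" for v
 proof -
  have v: "v \<in> polys k" using that by (simp add: polys_span)
  have "\<bar>v x\<bar> \<le> S v" if "x \<in> cball 0 1" for x unfolding S_def using that by (intro cSUP_upper[where f = "\<lambda>x. \<bar>v x\<bar>"] bdd[OF v])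
  hence "\<bar>(u + v) x\<bar> \<le> S u + S v" if "x \<in> cball 0 1" for x using up that by (fastforce simp: plus_fun_def)
  thus ?thesis unfolding S_def[of "u + v"] by (intro cSUP_least) auto
 qed
 show "S (c *\<^sub>R u) = \<bar>c\<bar> * S u" for c
 proof (rule order_antisym)
  show "S (c *\<^sub>R u) \<le> \<bar>c\<bar> * S u"
  unfolding S_def[of "c *\<^sub>R u"] using up by (intro cSUP_least) (auto simp: scaleR_fun_def abs_mult mult_left_mono)
  show "\<bar>c\<bar> * S u \<le> S (c *\<^sub>R u)"
  proof (cases "c = 0")
  case True
  thus ?thesis by (simp add: S_def scaleR_fun_def)
  next
  case False
  have cu: "c *\<^sub>R u \<in> polys k" using subspace_scale[OF subspace_polys u] .
  have "\<bar>c * u x\<bar> \<le> S (c *\<^sub>R u)" if "x \<in> cball 0 1" for x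
  using cSUP_upper[OF that bdd[OF cu]] by (simp add: S_def scaleR_fun_def)
  hence "S u \<le> S (c *\<^sub>R u) / \<bar>c\<bar>"
  unfolding S_def[of u] using False by (intro cSUP_least) (auto simp: field_simps abs_mult)
  thus ?thesis using False by (simp add: field_simps)
  qed
 qed
qed
then obtain C where C: "C \<ge> 0" "\<And>p. p \<in> polys k \<Longrightarrow> S p \<le> C * F.nm p" by (auto simp: polys_span)
have "\<bar>p x\<bar> \<le> C * sqrt (LINT y|lebesgue_on (cball 0 \<rho>). (p y)\<^sup>2)" if p: "p \<in> polys k" and x: "x \<in> cball (0::real^'n) 1" for p x
proof -
 have "\<bar>p x\<bar> \<le> S p" unfolding S_def using x by (intro cSUP_upper[where f = "\<lambda>x. \<bar>p x\<bar>"] bdd[OF p])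
 also have "\<dots> \<le> C * F.nm p" by (rule C(2)[OF p])
 finally show ?thesis by (simp add: F.nm_def ip_def power2_eq_square)
qed
thus ?thesis using C(1) by blast
qed

abbreviation inverse_constant :: "(real^'n \<Rightarrow> real) set \<Rightarrow> real \<Rightarrow> real \<Rightarrow> bool" where
"inverse_constant P \<rho> C \<equiv> \<forall>p\<in>P. \<forall>c d K. d > 0 \<longrightarrow> compact K \<longrightarrow> cball c (\<rho> * d) \<subseteq> K \<longrightarrow> K \<subseteq> cball c d \<longrightarrow>
  (\<forall>x\<in>K. (p x)\<^sup>2 \<le> C / d ^ CARD('n) * (LINT y|lebesgue_on K. (p y)\<^sup>2))"

text \<open>An affine change of variables maps the unit ball to the ball of radius \<open>d\<close>
  around \<open>K\<close> and the ball of radius \<rho> to the one inside \<open>K\<close>. The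
  shape of \<open>K\<close> does not enter otherwise, and the Jacobian produces the power of
  \<open>d\<close>.\<close>

lemma polys_inverse_estimate:
fixes k :: nat
assumes \<rho>: "\<rho> > 0"
shows "\<exists>C\<ge>0. \<forall>p\<in>polys k. \<forall>c d K. d > 0 \<longrightarrow> compact K \<longrightarrow> cball c (\<rho> * d) \<subseteq> K \<longrightarrow> K \<subseteq> cball c d \<longrightarrow>
  (\<forall>x\<in>K. (p (x :: real^'n))\<^sup>2 \<le> C / d ^ CARD('n) * (LINT y|lebesgue_on K. (p y)\<^sup>2))"
proof -
obtain C where C: "C \<ge> 0" "\<And>p x. p \<in> polys k \<Longrightarrow> x \<in> cball (0::real^'n) 1 \<Longrightarrow> \<bar>p x\<bar> \<le> C * sqrt (LINT y|lebesgue_on (cball 0 \<rho>). (p y)\<^sup>2)"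
 using polys_inverse_estimate_unit[OF \<rho>, of k] by blast
have "(p x)\<^sup>2 \<le> C\<^sup>2 / d ^ CARD('n) * (LINT y|lebesgue_on K. (p y)\<^sup>2)"
 if p: "p \<in> polys k" and d: "d > 0" and K: "compact K" "cball c (\<rho> * d) \<subseteq> K" "K \<subseteq> cball c d" and x: "x \<in> K" for p c d K and x :: "real^'n"
proof -
 define q where "q y = p (c + d *\<^sub>R y)" for y
 define y0 where "y0 = (1/d) *\<^sub>R (x - c)"
 have q: "q \<in> polys k" unfolding q_def by (rule polys_affine_arg[OF p])
 have xy: "q y0 = p x" using d by (simp add: q_def y0_def)
 have "norm (x - c) \<le> d" using K(3) x by (auto simp: dist_norm norm_minus_commute)
 hence y0: "y0 \<in> cball 0 1" using d by (simp add: y0_def)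
 have pc: "continuous_on S p" for S by (rule polys_continuous_on[OF p])
 \<comment> \<open>Cutting off the integrand allows the substitution to be made on the whole
   space.\<close>
 define g where "g y = indicator (cball c (\<rho> * d)) y * (p y)\<^sup>2" for y
 have gm: "g \<in> borel_measurable borel" unfolding g_def
  by (intro borel_measurable_times borel_measurable_power borel_measurable_continuous_onI[OF pc]
  borel_measurable_indicator) auto
 have g_aff: "g (c + d *\<^sub>R y) = indicator (cball 0 \<rho>) y * (q y)\<^sup>2" for y
  using d by (simp add: g_def q_def indicator_def dist_norm)
 have "(LINT y|lebesgue_on (cball 0 \<rho>). (q y)\<^sup>2) = (LINT y|lebesgue. g (c + d *\<^sub>R y))"
  unfolding g_aff by (subst integral_lebesgue_on) auto
 also have "\<dots> = (LINT y|lborel. g (c + d *\<^sub>R y))"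
  using gm by (intro integral_completion) simp
 also have "\<dots> = integral\<^sup>L lborel g / d ^ CARD('n)"
  using integral_lborel_affine[OF gm, of d c] d by simp
 also have "integral\<^sup>L lborel g = integral\<^sup>L lebesgue g" using gm by (simp add: integral_completion)
 also have "integral\<^sup>L lebesgue g = (LINT y|lebesgue_on (cball c (\<rho> * d)). (p y)\<^sup>2)"
  unfolding g_def by (subst integral_lebesgue_on) auto
 finally have qI: "(LINT y|lebesgue_on (cball 0 \<rho>). (q y)\<^sup>2) = (LINT y|lebesgue_on (cball c (\<rho> * d)). (p y)\<^sup>2) / d ^ CARD('n)" .
 have KS: "K \<in> sets lebesgue" using lmeasurable_compact[OF K(1)] by auto
 have "(LINT y|lebesgue_on (cball c (\<rho> * d)). (p y)\<^sup>2) \<le> (LINT y|lebesgue_on K. (p y)\<^sup>2)"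
 proof -
  have 1: "integrable lebesgue (\<lambda>y. indicator S y *\<^sub>R (p y)\<^sup>2)" if "compact S" for S
  using continuous_integrable_on_compact[OF that continuous_on_power[OF pc, of S 2]] lmeasurable_compact[OF that]
  by (subst (asm) integral_lebesgue_on(2)) auto
  have "(LINT y|lebesgue. indicator (cball c (\<rho> * d)) y *\<^sub>R (p y)\<^sup>2) \<le> (LINT y|lebesgue. indicator K y *\<^sub>R (p y)\<^sup>2)"
  using 1[OF K(1)] 1[OF compact_cball] K(2) by (intro integral_mono) (auto simp: indicator_def)
  thus ?thesis using KS by (subst (1 2) integral_lebesgue_on(1)) auto
 qed
 hence le: "(LINT y|lebesgue_on (cball 0 \<rho>). (q y)\<^sup>2) \<le> (LINT y|lebesgue_on K. (p y)\<^sup>2) / d ^ CARD('n)"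
  unfolding qI using d by (intro divide_right_mono) auto
 have "\<bar>p x\<bar>\<^sup>2 \<le> (C * sqrt (LINT y|lebesgue_on (cball 0 \<rho>). (q y)\<^sup>2))\<^sup>2"
  using C(2)[OF q y0] unfolding xy by (intro power_mono) auto
 also have "\<dots> = C\<^sup>2 * (LINT y|lebesgue_on (cball 0 \<rho>). (q y)\<^sup>2)" by (simp add: power_mult_distrib)
 also have "\<dots> \<le> C\<^sup>2 * ((LINT y|lebesgue_on K. (p y)\<^sup>2) / d ^ CARD('n))" by (intro mult_left_mono le) auto
 finally show ?thesis by simp
qed
thus ?thesis by (intro exI[of _ "C\<^sup>2"]) auto
qed

section \<open>Finite element functions\<close>

lemma smooth_coord: "smooth (\<lambda>x :: real^'n. x $ i)"
proof (rule smooth_coinduct[where A = "insert (\<lambda>x :: real^'n. x $ i) (range (\<lambda>c x. c))"])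
have d: "((\<lambda>x :: real^'n. x $ i) has_derivative (\<lambda>h. h $ i)) (at x)" for x
 by (intro bounded_linear_imp_has_derivative bounded_linear_vec_nth)
show "g differentiable (at x)" if "g \<in> insert (\<lambda>x :: real^'n. x $ i) (range (\<lambda>c x. c))" for g x
 using that d by (auto intro: differentiableI)
show "(\<lambda>x. pd g a x) \<in> insert (\<lambda>x :: real^'n. x $ i) (range (\<lambda>c x. c))"
 if "g \<in> insert (\<lambda>x :: real^'n. x $ i) (range (\<lambda>c x. c))" for g a
 using that pd_fun[OF d] by auto
qed simp

lemma smooth_polys: "p \<in> polys k \<Longrightarrow> smooth (p :: real^'n \<Rightarrow> real)"
proof (induction rule: polys_induct)
case (monom e)
have "smooth (\<lambda>x :: real^'n. (x $ i) ^ n)" for i n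
 by (induction n) (auto intro: smooth_mult smooth_coord smooth_const)
thus ?case by (intro smooth_prod) auto
next
case (add f g)
thus ?case by (intro smooth_add)
next
case (scale f c)
thus ?case by (intro smooth_mult smooth_const)
qed

lemma smooth_mult_test:
fixes p \<phi> :: "'a::euclidean_space \<Rightarrow> real"
assumes "smooth p" "\<phi> \<in> test_functions S"
shows "(\<lambda>x. p x * \<phi> x) \<in> test_functions S"
proof -
have \<phi>: "smooth \<phi>" "compact (closure {x. \<phi> x \<noteq> 0})" "closure {x. \<phi> x \<noteq> 0} \<subseteq> S"
 using assms(2) by (auto simp: test_functions_def)
have "{x. p x * \<phi> x \<noteq> 0} \<subseteq> closure {x. \<phi> x \<noteq> 0}" using closure_subset[of "{x. \<phi> x \<noteq> 0}"] by auto
thus ?thesis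
 using closure_support_mono[OF \<phi>(2,3), where \<psi> = "\<lambda>x. p x * \<phi> x"] smooth_mult[OF assms(1) \<phi>(1)]
 unfolding test_functions_def by blast
qed

lemma smooth_by_parts:
fixes p \<phi> :: "'a::euclidean_space \<Rightarrow> real"
assumes p: "smooth p" and \<phi>: "\<phi> \<in> test_functions UNIV"
shows "(LINT x|lebesgue. p x * pd \<phi> a x) = - (LINT x|lebesgue. pd p a x * \<phi> x)"
proof -
have pd: "pd (\<lambda>x. p x * \<phi> x) a = (\<lambda>x. p x * pd \<phi> a x + pd p a x * \<phi> x)"
proof
 fix x
 have "((\<lambda>x. p x * \<phi> x) has_derivative (\<lambda>h. p x * pd \<phi> h x + pd p h x * \<phi> x)) (at x)"
  by (intro has_derivative_mult smooth_has_derivative p test_smooth[OF \<phi>])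
 from fun_cong[OF frechet_derivative_at[OF this], of a]
 show "pd (\<lambda>x. p x * \<phi> x) a x = p x * pd \<phi> a x + pd p a x * \<phi> x" by simp
qed
note t = smooth_mult_test[OF p \<phi>]
obtain L where "L-lipschitz_on UNIV (\<lambda>x. p x * \<phi> x)" using test_lipschitz[OF t] by blast
moreover obtain R where "\<And>x. norm x > R \<Longrightarrow> p x * \<phi> x = 0" using test_support_bounded[OF t] by blast
ultimately have "integral\<^sup>L lebesgue (pd (\<lambda>x. p x * \<phi> x) a) = 0"
 by (rule directional_derivative_integral_zero(2))
  (use smooth_directional[OF test_smooth[OF t]] test_measurable_lebesgue[OF test_pd[OF t]] in auto)
moreover have "integrable lebesgue (\<lambda>x. p x * pd \<phi> a x)"
 by (rule test_integrable[OF smooth_mult_test[OF p test_pd[OF \<phi>]]])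
moreover have "integrable lebesgue (\<lambda>x. pd p a x * \<phi> x)"
 by (rule test_integrable[OF smooth_mult_test[OF smooth_pd[OF p] \<phi>]])
ultimately show ?thesis unfolding pd by simp
qed

text \<open>The function \<open>v\<close> itself is zero off the open cells by the choice of
  representatives. The polynomial \<open>p\<close> supplies its values on the faces, and
  \<open>D\<close> is its Jacobian with polynomial entries.\<close>

definition cell_poly ::
"nat \<Rightarrow> (real^'n) set \<Rightarrow> (real^'n \<Rightarrow> real^'n) \<Rightarrow> (real^'n \<Rightarrow> real^'n) \<Rightarrow> (real^'n \<Rightarrow> real^'n^'n) \<Rightarrow> bool" where
"cell_poly s K v p D \<longleftrightarrow> (\<forall>i. (\<lambda>x. p x $ i) \<in> polys s) \<and> (\<forall>i j. (\<lambda>x. D x $ i $ j) \<in> polys s) \<and>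
  (\<forall>i x. ((\<lambda>x. p x $ i) has_derivative (\<lambda>h. \<Sum>j\<in>UNIV. D x $ i $ j * h $ j)) (at x)) \<and>
  (\<forall>x\<in>interior K. v x = p x)"

lemma cell_polyD:
assumes "cell_poly s K v p D"
shows "(\<lambda>x. p x $ i) \<in> polys s" "(\<lambda>x. D x $ i $ j) \<in> polys s"
 "((\<lambda>x. p x $ i) has_derivative (\<lambda>h. \<Sum>j\<in>UNIV. D x $ i $ j * h $ j)) (at x)"
 "x \<in> interior K \<Longrightarrow> v x = p x"
using assms by (auto simp: cell_poly_def)

lemma cell_poly_exists:
fixes v :: "real^'n \<Rightarrow> real^'n"
assumes v: "v \<in> pw_polys s \<tau>" and K: "K \<in> \<tau>"
shows "\<exists>p D. cell_poly s K v p D"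
proof -
obtain p where p: "\<forall>b\<in>Basis. (\<lambda>x. p x \<bullet> b) \<in> polys s" "\<And>x. x \<in> interior K \<Longrightarrow> v x = p x"
 using v K by (auto simp: pw_polys_def)
have p': "(\<lambda>x. p x $ i) \<in> polys s" for i
proof -
 have "(axis i 1 :: real^'n) \<in> Basis" by (auto simp: Basis_vec_def)
 with p(1) have "(\<lambda>x. p x \<bullet> axis i 1) \<in> polys s" by blast
 thus ?thesis by (simp add: inner_axis)
qed
from polys_has_derivative[OF p'] have "\<forall>i. \<exists>D. (\<forall>j. D j \<in> polys s) \<and> (\<forall>x. ((\<lambda>x. p x $ i) has_derivative (\<lambda>h. \<Sum>j\<in>UNIV. D j x * h $ j)) (at x))"
 by blast
from choice[OF this] obtain D where D: "\<And>i j. D i j \<in> polys s" "\<And>i x. ((\<lambda>x. p x $ i) has_derivative (\<lambda>h. \<Sum>j\<in>UNIV. D i j x * h $ j)) (at x)"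
 by blast
have "cell_poly s K v p (\<lambda>x. \<chi> i j. D i j x)" using p' D p(2) by (simp add: cell_poly_def)
thus ?thesis by blast
qed

lemma poly_matrix_continuous:
assumes "\<And>i j. (\<lambda>x. (D x :: real^'n^'n) $ i $ j) \<in> polys s"
shows "continuous_on S D"
proof -
have "continuous_on S (\<lambda>x. \<chi> i j. D x $ i $ j)"
 by (intro continuous_on_vec_lambda polys_continuous_on[OF assms])
thus ?thesis by simp
qed

locale fe_mesh =
fixes W :: "(real^'n) set" and \<tau> :: "(real^'n) set set"
assumes dom: "polyhedral_domain W" and mesh: "mesh_of W \<tau>"
begin

lemma op: "open W" and bd: "bounded W" and W_connected: "connected W" and W_nonempty: "W \<noteq> {}"
and interior_closure_W: "interior (closure W) = W"
using dom by (auto simp: polyhedral_domain_def)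

lemma finite_\<tau>: "finite \<tau>" and Union_\<tau>: "\<Union>\<tau> = closure W"
and cells_face: "\<lbrakk>K \<in> \<tau>; K' \<in> \<tau>\<rbrakk> \<Longrightarrow> (K \<inter> K') face_of K"
and cell_simplex: "K \<in> \<tau> \<Longrightarrow> int CARD('n) simplex K"
using mesh by (auto simp: mesh_of_def triangulation_def)

lemma \<tau>_nonempty: "\<tau> \<noteq> {}"
proof
assume "\<tau> = {}"
hence "closure W = {}" using Union_\<tau> by simp
thus False using W_nonempty by simp
qed

lemma
assumes K: "K \<in> \<tau>"
shows cell_compact: "compact K" and cell_convex: "convex K" and cell_interior: "interior K \<noteq> {}"
 and cell_subset: "K \<subseteq> closure W" and cell_interior_subset: "interior K \<subseteq> W" and cell_diameter: "diameter K > 0"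
 and cell_rel_interior: "rel_interior K = interior K"
proof -
show "compact K" and c: "convex K" using cell_simplex[OF K] compact_simplex convex_simplex by blast+
have "aff_dim K = int DIM(real^'n)" using aff_dim_simplex[OF cell_simplex[OF K]] by simp
hence "affine hull K = UNIV" by (rule aff_dim_eq_full[THEN iffD1])
thus rel: "rel_interior K = interior K" by (rule rel_interior_interior)
have "K \<noteq> {}" using cell_simplex[OF K] by auto
thus ne: "interior K \<noteq> {}" using rel_interior_eq_empty[OF c] rel by simp
show sub: "K \<subseteq> closure W" using K Union_\<tau> by auto
show "interior K \<subseteq> W" using interior_mono[OF sub] interior_closure_W by simp
obtain x e where e: "e > 0" "cball x e \<subseteq> K" using ne by (metis ex_in_conv mem_interior_cball)
have "diameter (cball x e) \<le> diameter K"
 using e(2) compact_imp_bounded[OF \<open>compact K\<close>] by (rule diameter_subset)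
thus "diameter K > 0" using e(1) by simp
qed

lemma interior_disjoint:
assumes "K \<in> \<tau>" "K' \<in> \<tau>" "x \<in> interior K" "x \<in> interior K'"
shows "K = K'"
proof -
have *: "K \<subseteq> K'" if "K \<in> \<tau>" "K' \<in> \<tau>" "x \<in> interior K" "x \<in> interior K'" for K K'
proof (rule ccontr)
 assume "\<not> K \<subseteq> K'"
 hence "K \<inter> K' \<noteq> K" by blast
 from face_of_disjoint_rel_interior[OF cells_face[OF that(1,2)] this] have "K \<inter> K' \<inter> interior K = {}"
  by (simp add: cell_rel_interior[OF that(1)])
 thus False using that(3,4) interior_subset by blast
qed
show ?thesis using *[OF assms] *[OF assms(2,1,4,3)] by blast
qed

lemma skeleton_negligible: "AE x in lebesgue. \<forall>K\<in>\<tau>. x \<in> K \<longrightarrow> x \<in> interior K"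
proof (rule AE_finite_allI[OF finite_\<tau>])
fix K assume K: "K \<in> \<tau>"
have "frontier K \<in> null_sets lebesgue" using negligible_convex_frontier[OF cell_convex[OF K]] by (simp add: negligible_iff_null_sets)
from AE_not_in[OF this] show "AE x in lebesgue. x \<in> K \<longrightarrow> x \<in> interior K"
 by eventually_elim (use compact_imp_closed[OF cell_compact[OF K]] in \<open>auto simp: frontier_def\<close>)
qed

lemma AE_in_interior: "AE x in lebesgue. x \<in> W \<longrightarrow> x \<in> (\<Union>K\<in>\<tau>. interior K)"
using skeleton_negligible
proof eventually_elim
fix x assume x: "\<forall>K\<in>\<tau>. x \<in> K \<longrightarrow> x \<in> interior K"
show "x \<in> W \<longrightarrow> x \<in> (\<Union>K\<in>\<tau>. interior K)"
proof
 assume "x \<in> W"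
 hence "x \<in> \<Union>\<tau>" unfolding Union_\<tau> by (rule subsetD[OF closure_subset])
 with x show "x \<in> (\<Union>K\<in>\<tau>. interior K)" by blast
qed
qed

lemma AE_on_cells:
assumes "\<And>K. K \<in> \<tau> \<Longrightarrow> AE x in lebesgue. x \<in> interior K \<longrightarrow> P x"
shows "AE x in lebesgue_on W. P x"
proof -
have "AE x in lebesgue. \<forall>K\<in>\<tau>. x \<in> interior K \<longrightarrow> P x" using assms by (intro AE_finite_allI finite_\<tau>)
hence "AE x in lebesgue. x \<in> W \<longrightarrow> P x" using AE_in_interior by eventually_elim blast
thus ?thesis by (simp add: AE_lebesgue_on[OF W_lebesgue[OF op bd]])
qed

text \<open>On the open cell both the global weak gradient and the classical Jacobian are weak
  gradients of \<open>v\<close>, and these are unique almost everywhere.\<close>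

lemma cell_grad:
assumes v: "v \<in> H1 W" and K: "K \<in> \<tau>" and p: "cell_poly s K v p D"
shows "AE x in lebesgue. x \<in> interior K \<longrightarrow> grad W v x = D x"
proof -
let ?U = "interior K"
have U: "open ?U" "bounded ?U" "?U \<subseteq> W"
 using bounded_subset[OF bd cell_interior_subset[OF K]] cell_interior_subset[OF K] by auto
have UL: "?U \<in> sets lebesgue" using U(1) by simp
have wg: "is_weak_grad W v (grad W v)" by (rule grad_weak[OF op bd v])
have "is_weak_grad ?U v (grad W v)"
 unfolding is_weak_grad_def
proof (intro conjI ballI allI)
 have g: "grad W v \<in> L2 W" using wg by (simp add: is_weak_grad_def)
 have "grad W v \<in> meas W" using g by (simp add: L2_def)
 hence "grad W v \<in> borel_measurable (lebesgue_on ?U)" by (rule measurable_restrict_mono) (rule U(3))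
 moreover have "integrable (lebesgue_on ?U) (\<lambda>x. (norm (grad W v x))\<^sup>2)"
 proof -
  have "integrable (lebesgue_on W) (\<lambda>x. (norm (grad W v x))\<^sup>2)" using g by (simp add: L2_def)
  hence "integrable lebesgue (\<lambda>x. indicator W x *\<^sub>R (norm (grad W v x))\<^sup>2)"
  by (rule integral_lebesgue_on(2)[OF W_lebesgue[OF op bd], THEN iffD1])
  from integrable_mult_indicator[OF UL this]
  have "integrable lebesgue (\<lambda>x. indicator ?U x *\<^sub>R indicator W x *\<^sub>R (norm (grad W v x))\<^sup>2)" .
  also have "(\<lambda>x. indicator ?U x *\<^sub>R indicator W x *\<^sub>R (norm (grad W v x))\<^sup>2) = (\<lambda>x. indicator ?U x *\<^sub>R (norm (grad W v x))\<^sup>2)"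
  using U(3) by (auto simp: fun_eq_iff indicator_def)
  finally show ?thesis by (rule integral_lebesgue_on(2)[OF UL, THEN iffD2])
 qed
 ultimately show "grad W v \<in> L2 ?U" by (simp add: L2_def)
 fix \<phi> :: "real^'n \<Rightarrow> real" and i j assume \<phi>: "\<phi> \<in> test_functions ?U"
 have \<phi>': "\<phi> \<in> test_functions W" using test_functions_mono[OF \<phi> U(3)] .
 have 0: "\<phi> x = 0" "pd \<phi> (axis j 1) x = 0" if "x \<notin> ?U" for x
  using test_outside[OF \<phi> that] test_outside[OF test_pd[OF \<phi>] that] by auto
 have "(LINT x|lebesgue_on ?U. v x $ i * pd \<phi> (axis j 1) x) = (LINT x|lebesgue. v x $ i * pd \<phi> (axis j 1) x)"
  by (rule integral_on_support) (use 0 in auto)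
 also have "\<dots> = (LINT x|lebesgue_on W. v x $ i * pd \<phi> (axis j 1) x)"
  by (rule integral_on_support[symmetric, OF op]) (use 0 U(3) in auto)
 also have "\<dots> = - (LINT x|lebesgue_on W. grad W v x $ i $ j * \<phi> x)"
  using wg \<phi>' by (simp add: is_weak_grad_def)
 also have "(LINT x|lebesgue_on W. grad W v x $ i $ j * \<phi> x) = (LINT x|lebesgue. grad W v x $ i $ j * \<phi> x)"
  by (rule integral_on_support[OF op]) (use 0 U(3) in auto)
 also have "\<dots> = (LINT x|lebesgue_on ?U. grad W v x $ i $ j * \<phi> x)"
  by (rule integral_on_support[symmetric]) (use 0 in auto)
 finally show "(LINT x|lebesgue_on ?U. v x $ i * pd \<phi> (axis j 1) x) = - (LINT x|lebesgue_on ?U. grad W v x $ i $ j * \<phi> x)" .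
qed
moreover have "is_weak_grad ?U v D"
 unfolding is_weak_grad_def
proof (intro conjI ballI allI)
 have Dc: "continuous_on S D" for S by (rule poly_matrix_continuous) (rule cell_polyD(2)[OF p])
 have "bounded (D ` K)" using Dc cell_compact[OF K] by (intro compact_imp_bounded compact_continuous_image)
 then obtain C where "\<And>x. x \<in> K \<Longrightarrow> norm (D x) \<le> C" by (auto simp: bounded_iff)
 hence "AE x in lebesgue_on ?U. norm (D x) \<le> C" using interior_subset[of K] by (intro AE_I2) auto
 moreover have "D \<in> borel_measurable (lebesgue_on ?U)"
  using Dc UL by (intro continuous_imp_measurable_on_sets_lebesgue) auto
 ultimately show "D \<in> L2 ?U" using L2_bounded[OF U(1,2)] by blast
 fix \<phi> :: "real^'n \<Rightarrow> real" and i j assume \<phi>: "\<phi> \<in> test_functions ?U"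
 have 0: "\<phi> x = 0" "pd \<phi> (axis j 1) x = 0" if "x \<notin> ?U" for x
  using test_outside[OF \<phi> that] test_outside[OF test_pd[OF \<phi>] that] by auto
 have Dj: "pd (\<lambda>x. p x $ i) (axis j 1) = (\<lambda>x. D x $ i $ j)"
 proof -
  have "(\<lambda>x. pd (\<lambda>x. p x $ i) (axis j 1) x) = (\<lambda>x. \<Sum>k\<in>UNIV. D x $ i $ k * (axis j 1 :: real^'n) $ k)"
  by (rule pd_fun) (rule cell_polyD(3)[OF p])
  thus ?thesis by (simp add: axis_def if_distrib[of "\<lambda>x. _ * x"] cong: if_cong)
 qed
 have "(LINT x|lebesgue_on ?U. v x $ i * pd \<phi> (axis j 1) x) = (LINT x|lebesgue_on ?U. p x $ i * pd \<phi> (axis j 1) x)"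
  by (rule Bochner_Integration.integral_cong) (use cell_polyD(4)[OF p] in auto)
 also have "\<dots> = (LINT x|lebesgue. p x $ i * pd \<phi> (axis j 1) x)"
  by (rule integral_on_support) (use 0 in auto)
 also have "\<dots> = - (LINT x|lebesgue. D x $ i $ j * \<phi> x)"
  using smooth_by_parts[OF smooth_polys[OF cell_polyD(1)[OF p]] test_functions_mono[OF \<phi>], of i "axis j 1"]
  unfolding fun_cong[OF Dj] by simp
 also have "(LINT x|lebesgue. D x $ i $ j * \<phi> x) = (LINT x|lebesgue_on ?U. D x $ i $ j * \<phi> x)"
  by (rule integral_on_support[symmetric]) (use 0 in auto)
 finally show "(LINT x|lebesgue_on ?U. v x $ i * pd \<phi> (axis j 1) x) = - (LINT x|lebesgue_on ?U. D x $ i $ j * \<phi> x)" .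
qed
ultimately have "AE x in lebesgue_on ?U. grad W v x = D x" by (rule weak_grad_unique[OF U(1,2)])
thus ?thesis by (simp add: AE_lebesgue_on[OF UL])
qed

section \<open>Finite element functions as Lipschitz functions\<close>

lemma Xh_D: assumes "v \<in> Xh W s \<tau>" shows "v \<in> H10 W" "v \<in> H1 W" "v \<in> pw_polys s \<tau>"
using assms H10_H1[OF op bd] by (auto simp: Xh_def)

lemma grad_bounded:
assumes "v \<in> Xh W s \<tau>"
shows "\<exists>B\<ge>0. AE x in lebesgue_on W. norm (grad W v x) \<le> B"
proof -
have "\<exists>B. AE x in lebesgue. x \<in> interior K \<longrightarrow> norm (grad W v x) \<le> B" if K: "K \<in> \<tau>" for K
proof -
 obtain p D where p: "cell_poly s K v p D" using cell_poly_exists[OF Xh_D(3)[OF assms] K] by blast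
 have Dc: "continuous_on S D" for S by (rule poly_matrix_continuous) (rule cell_polyD(2)[OF p])
 have "bounded (D ` K)" using Dc cell_compact[OF K] by (intro compact_imp_bounded compact_continuous_image)
 then obtain C where C: "\<And>x. x \<in> K \<Longrightarrow> norm (D x) \<le> C" by (auto simp: bounded_iff)
 have "AE x in lebesgue. x \<in> interior K \<longrightarrow> norm (grad W v x) \<le> C"
  using cell_grad[OF Xh_D(2)[OF assms] K p] by eventually_elim (use C interior_subset in auto)
 thus ?thesis by blast
qed
hence "\<forall>K\<in>\<tau>. \<exists>B. AE x in lebesgue. x \<in> interior K \<longrightarrow> norm (grad W v x) \<le> B" by blast
from bchoice[OF this] obtain B where B: "\<And>K. K \<in> \<tau> \<Longrightarrow> AE x in lebesgue. x \<in> interior K \<longrightarrow> norm (grad W v x) \<le> B K" by blast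
have "AE x in lebesgue_on W. norm (grad W v x) \<le> (\<Sum>K\<in>\<tau>. \<bar>B K\<bar>)"
proof (rule AE_on_cells)
 fix K assume K: "K \<in> \<tau>"
 have "\<bar>B K\<bar> \<le> (\<Sum>K\<in>\<tau>. \<bar>B K\<bar>)" by (rule member_le_sum[where f = "\<lambda>K. \<bar>B K\<bar>", OF K _ finite_\<tau>]) simp
 hence "B K \<le> (\<Sum>K\<in>\<tau>. \<bar>B K\<bar>)" by simp
 thus "AE x in lebesgue. x \<in> interior K \<longrightarrow> norm (grad W v x) \<le> (\<Sum>K\<in>\<tau>. \<bar>B K\<bar>)"
  using B[OF K] by (elim eventually_mono) (use order.trans[OF _ \<open>B K \<le> _\<close>] in blast)
qed
thus ?thesis by (intro exI[of _ "\<Sum>K\<in>\<tau>. \<bar>B K\<bar>"]) (auto intro: sum_nonneg)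
qed

lemma isCont_on_cell:
fixes v :: "real^'n \<Rightarrow> real^'n"
assumes "v \<in> pw_polys s \<tau>" "K \<in> \<tau>" "x \<in> interior K"
shows "isCont (\<lambda>x. indicator W x * v x $ i) x"
proof -
obtain p D where p: "cell_poly s K v p D" using cell_poly_exists[OF assms(1,2)] by blast
have "isCont (\<lambda>x. p x $ i) x" using polys_continuous_on[OF cell_polyD(1)[OF p], of UNIV] by (simp add: continuous_on_eq_continuous_at)
moreover have "eventually (\<lambda>y. indicator W y * v y $ i = p y $ i) (nhds x)"
 using eventually_nhds_in_open[OF open_interior assms(3)]
 by eventually_elim (use cell_polyD(4)[OF p] cell_interior_subset[OF assms(2)] in auto)
ultimately show ?thesis by (rule isCont_cong[THEN iffD2, rotated])
qed

lemma isCont_outside: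
assumes "x \<notin> closure W" shows "isCont (\<lambda>x. indicator W x * (v x $ i :: real)) x"
proof -
have "x \<notin> closure W" by (rule assms)
hence "eventually (\<lambda>y. y \<in> - closure W) (nhds x)" by (intro eventually_nhds_in_open) auto
hence "eventually (\<lambda>y. indicator W y * (v y $ i :: real) = 0) (nhds x)"
 by eventually_elim (use closure_subset[of W] in \<open>auto simp: indicator_def\<close>)
from isCont_cong[OF this] show ?thesis by simp
qed

text \<open>Interior points of cells and points off the closure of \<open>W\<close> are continuity
  points of the extension by zero. Comparison with outside points encodes the boundary
  condition.\<close>

lemma Xh_lipschitz:
assumes v: "v \<in> Xh W s \<tau>" and B: "AE x in lebesgue_on W. norm (grad W v x) \<le> B" "B \<ge> 0"
 and x: "x \<in> (\<Union>K\<in>\<tau>. interior K)"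
shows "y \<in> (\<Union>K\<in>\<tau>. interior K) \<Longrightarrow> \<bar>v x $ i - v y $ i\<bar> \<le> B * norm (x - y)"
 and "y \<notin> closure W \<Longrightarrow> \<bar>v x $ i\<bar> \<le> B * norm (x - y)"
proof -
have xO: "x \<in> W" using x cell_interior_subset by blast
have cx: "isCont (\<lambda>x. indicator W x * v x $ i) z" if "z \<in> (\<Union>K\<in>\<tau>. interior K)" for z
 using that isCont_on_cell[OF Xh_D(3)[OF v]] by blast
note L = H10_lipschitz[OF op bd Xh_D(1)[OF v] B, where V = "\<lambda>x. indicator W x * v x $ i" and i = i and x = x and y = y, OF refl cx[OF x]]
show "\<bar>v x $ i - v y $ i\<bar> \<le> B * norm (x - y)" if y: "y \<in> (\<Union>K\<in>\<tau>. interior K)"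
proof -
 have "y \<in> W" using y cell_interior_subset by blast
 thus ?thesis using L[OF cx[OF y]] xO by simp
qed
show "\<bar>v x $ i\<bar> \<le> B * norm (x - y)" if y: "y \<notin> closure W"
proof -
 have "y \<notin> W" using y closure_subset by blast
 thus ?thesis using L[OF isCont_outside[OF y]] xO by simp
qed
qed

lemma outside_exists: "\<exists>y. y \<notin> closure W"
using bounded_closure[OF bd] not_bounded_UNIV by (metis UNIV_eq_I)

text \<open>A Lipschitz constant zero together with a comparison point outside forces zero on the
  open cells. The chosen representatives vanish elsewhere, so the equality holds everywhere and
  norms become definite.\<close>

lemma Xh_grad_zero:
assumes v: "v \<in> Xh W s \<tau>" and B: "AE x in lebesgue_on W. grad W v x = 0"
shows "v = 0"
proof
fix x
have "v x $ i = 0" for i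
proof (cases "x \<in> (\<Union>K\<in>\<tau>. interior K)")
 case True
 obtain y where y: "y \<notin> closure W" using outside_exists by blast
 have "AE x in lebesgue_on W. norm (grad W v x) \<le> 0" using B by simp
 from Xh_lipschitz(2)[OF v this order_refl True y, of i] show ?thesis by simp
next
 case False
 thus ?thesis using Xh_D(3)[OF v] by (simp add: pw_polys_def)
qed
thus "v x = 0 x" by (simp add: vec_eq_iff zero_fun_def)
qed

lemma Ynorm_zero:
assumes v: "v \<in> Xh W s \<tau>" and z: "L2_norm W (symgrad W v) = 0"
shows "v = 0"
proof (rule Xh_grad_zero[OF v])
have g: "grad W v \<in> L2 W" by (rule grad_L2[OF op bd Xh_D(2)[OF v]])
have "L2_norm W (grad W v) = 0"
 using korn[OF op bd Xh_D(1)[OF v]] z L2_norm_nonneg[OF op bd, of "grad W v"] by simp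
hence "L2_inner W (grad W v) (grad W v) = 0" using L2_norm_sq[OF op bd, of "grad W v"] by simp
hence "AE x in lebesgue_on W. grad W v x \<bullet> grad W v x = 0"
 using integral_nonneg_eq_0_iff_AE[OF L2_inner_integrable[OF op bd g g]] by (simp add: L2_inner_def)
thus "AE x in lebesgue_on W. grad W v x = 0" by simp
qed

section \<open>Finite dimension of the discrete spaces\<close>

lemma pw_polys_span: "pw_polys s \<tau> \<subseteq> span ((\<lambda>(K, q, b) x. if x \<in> interior K then q x *\<^sub>R (b :: 'b::euclidean_space) else 0) ` (\<tau> \<times> monoms s \<times> Basis))"
proof
let ?A = "(\<lambda>(K, q, b) x. if x \<in> interior K then q x *\<^sub>R (b :: 'b) else 0) ` (\<tau> \<times> monoms s \<times> Basis)"
fix v :: "real^'n \<Rightarrow> 'b" assume v: "v \<in> pw_polys s \<tau>"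
hence "\<forall>K\<in>\<tau>. \<exists>p. (\<forall>b\<in>Basis. (\<lambda>x. p x \<bullet> b) \<in> polys s) \<and> (\<forall>x\<in>interior K. v x = p x)" by (simp add: pw_polys_def)
then obtain p where p: "\<And>K b. K \<in> \<tau> \<Longrightarrow> b \<in> Basis \<Longrightarrow> (\<lambda>x. p K x \<bullet> b) \<in> polys s" "\<And>K x. K \<in> \<tau> \<Longrightarrow> x \<in> interior K \<Longrightarrow> v x = p K x"
 by metis
have *: "(\<lambda>x. if x \<in> interior K then q x *\<^sub>R b else 0) \<in> span ?A" if K: "K \<in> \<tau>" and b: "b \<in> Basis" and q: "q \<in> polys s" for K b q
 using q
proof (induction rule: polys_induct)
 case (monom e)
 have "(\<lambda>x. \<Prod>i\<in>UNIV. (x $ i) ^ e i) \<in> monoms s" using monom by (auto simp: monoms_def)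
 with K b show ?case by (intro span_base image_eqI[where x = "(K, (\<lambda>x. \<Prod>i\<in>UNIV. (x $ i) ^ e i), b)"]) auto
next
 case (add f g)
 have "(\<lambda>x. if x \<in> interior K then (f x + g x) *\<^sub>R b else 0)
  = (\<lambda>x. if x \<in> interior K then f x *\<^sub>R b else 0) + (\<lambda>x. if x \<in> interior K then g x *\<^sub>R b else 0)"
  by (simp add: fun_eq_iff scaleR_add_left)
 thus ?case using span_add[OF add(3,4)] by simp
next
 case (scale f c)
 have "(\<lambda>x. if x \<in> interior K then (c * f x) *\<^sub>R b else 0) = c *\<^sub>R (\<lambda>x. if x \<in> interior K then f x *\<^sub>R b else 0)"
  by (simp add: fun_eq_iff scaleR_fun_def)
 thus ?case using span_scale[OF scale(2), of c] by simp
qed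
have "v = (\<Sum>K\<in>\<tau>. \<Sum>b\<in>Basis. (\<lambda>x. if x \<in> interior K then (p K x \<bullet> b) *\<^sub>R b else 0))"
proof
 fix x
 have fs: "(\<Sum>i\<in>I. f i) x = (\<Sum>i\<in>I. f i x)" for I and f :: "'i \<Rightarrow> real^'n \<Rightarrow> 'b"
  by (induction I rule: infinite_finite_induct) auto
 have e: "(\<Sum>K\<in>\<tau>. \<Sum>b\<in>Basis. (\<lambda>x. if x \<in> interior K then (p K x \<bullet> b) *\<^sub>R b else 0)) x = (\<Sum>K\<in>\<tau>. if x \<in> interior K then p K x else 0)"
  unfolding fs by (intro sum.cong) (auto simp: euclidean_representation)
 show "v x = (\<Sum>K\<in>\<tau>. \<Sum>b\<in>Basis. (\<lambda>x. if x \<in> interior K then (p K x \<bullet> b) *\<^sub>R b else 0)) x"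
 proof (cases "x \<in> (\<Union>K\<in>\<tau>. interior K)")
  case True
  then obtain K where K: "K \<in> \<tau>" "x \<in> interior K" by blast
  have "(\<Sum>K'\<in>\<tau>. if x \<in> interior K' then p K' x else 0) = (\<Sum>K'\<in>\<tau>. if K' = K then p K x else 0)"
  using K interior_disjoint by (intro sum.cong) auto
  thus ?thesis unfolding e using K finite_\<tau> p(2) by simp
 next
  case False
  thus ?thesis unfolding e using v by (auto simp: pw_polys_def intro!: sum.neutral)
 qed
qed
also have "\<dots> \<in> span ?A" using p(1) by (intro span_sum *) auto
finally show "v \<in> span ?A" .
qed

text \<open>The divergence is linear only almost everywhere, its gradient being a chosen
  representative, so the constraint is shown to be linear under the integral.\<close>

lemma subspace_Vh: "subspace (Vh W s r \<tau>)"
proof -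
have pw: "subspace (pw_polys s \<tau> :: (real^'n \<Rightarrow> real^'n) set)"
proof (rule subspaceI)
 show "0 \<in> (pw_polys s \<tau> :: (real^'n \<Rightarrow> real^'n) set)"
  using polys_const[of 0 s] by (auto simp: pw_polys_def intro!: exI[of _ "\<lambda>_. 0"])
next
 fix u v :: "real^'n \<Rightarrow> real^'n" and c :: real assume u: "u \<in> pw_polys s \<tau>"
 show "c *\<^sub>R u \<in> pw_polys s \<tau>"
  unfolding pw_polys_def
 proof (intro CollectI conjI ballI)
  fix K assume "K \<in> \<tau>"
  then obtain p where "\<forall>b\<in>Basis. (\<lambda>x. p x \<bullet> b) \<in> polys s" "\<And>x. x \<in> interior K \<Longrightarrow> u x = p x"
  using u by (auto simp: pw_polys_def)
  thus "\<exists>p. (\<forall>b\<in>Basis. (\<lambda>x. p x \<bullet> b) \<in> polys s) \<and> (\<forall>x\<in>interior K. (c *\<^sub>R u) x = p x)"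
  by (intro exI[of _ "\<lambda>x. c *\<^sub>R p x"] conjI ballI) (simp_all add: scaleR_fun_def polys_scale)
 qed (use u in \<open>auto simp: pw_polys_def scaleR_fun_def\<close>)
 assume v: "v \<in> pw_polys s \<tau>"
 show "u + v \<in> pw_polys s \<tau>"
  unfolding pw_polys_def
 proof (intro CollectI conjI ballI)
  fix K assume "K \<in> \<tau>"
  then obtain p q where "\<forall>b\<in>Basis. (\<lambda>x. p x \<bullet> b) \<in> polys s" "\<And>x. x \<in> interior K \<Longrightarrow> u x = p x"
  "\<forall>b\<in>Basis. (\<lambda>x. q x \<bullet> b) \<in> polys s" "\<And>x. x \<in> interior K \<Longrightarrow> v x = q x"
  using u v unfolding pw_polys_def mem_Collect_eq by (elim conjE) (drule (1) bspec, drule (1) bspec, blast)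
  thus "\<exists>p. (\<forall>b\<in>Basis. (\<lambda>x. p x \<bullet> b) \<in> polys s) \<and> (\<forall>x\<in>interior K. (u + v) x = p x)"
  by (intro exI[of _ "\<lambda>x. p x + q x"] conjI ballI) (simp_all add: inner_add_left polys_add)
 qed (use u v in \<open>auto simp: pw_polys_def\<close>)
qed
have X: "subspace (Xh W s \<tau>)"
proof (rule subspaceI)
 have "(0 :: real^'n \<Rightarrow> real^'n) \<in> H10 W"
 proof (rule H10I[OF op bd, where M = "\<lambda>x. 0" and \<Phi> = "\<lambda>n x. 0"])
  have s: "smooth (\<lambda>x :: real^'n. 0 :: real^'n)" by (rule smooth_const)
  thus "(\<lambda>x :: real^'n. 0 :: real^'n) \<in> test_functions W" by (simp add: test_functions_def)
  have z: "(\<lambda>x. 0 :: 'b::euclidean_space) \<in> L2 W" by (simp add: L2_def)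
  show "0 \<in> (L2 W :: (real^'n \<Rightarrow> real^'n) set)" using z by (simp add: zero_fun_def)
  show "is_weak_grad W 0 (\<lambda>x. 0)" using z by (simp add: is_weak_grad_def)
  have j: "jac (\<lambda>x :: real^'n. 0 :: real^'n) x = 0" for x by (simp add: jac_def vec_eq_iff)
  show "(\<lambda>n. L2_norm W (\<lambda>x. 0 - 0 x :: real^'n)) \<longlonglongrightarrow> 0" "(\<lambda>n. L2_norm W (\<lambda>x. jac (\<lambda>x :: real^'n. 0 :: real^'n) x - 0)) \<longlonglongrightarrow> 0"
  by (simp_all add: L2_norm_def L2_inner_def j)
 qed
 thus "0 \<in> Xh W s \<tau>" using subspace_0[OF pw] by (simp add: Xh_def)
qed (use H10_add[OF op bd] H10_scale[OF op bd] subspace_add[OF pw] subspace_scale[OF pw] in \<open>auto simp: Xh_def\<close>)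
have L: "(\<lambda>x. trace (M x)) \<in> L2 W" if "M \<in> L2 W" for M :: "real^'n \<Rightarrow> real^'n^'n"
proof -
 have "bounded_linear (trace :: real^'n^'n \<Rightarrow> real)" unfolding trace_def by (intro bounded_linear_sum bounded_linear_entry)
 from L2_linear_image[OF op bd this that] show ?thesis .
qed
have dL: "divg W u \<in> L2 W" if "u \<in> Xh W s \<tau>" for u
 unfolding divg_def by (rule L[OF grad_L2[OF op bd Xh_D(2)[OF that]]])
have mL: "u \<in> L2 W \<Longrightarrow> u \<in> meas W" for u :: "real^'n \<Rightarrow> real" by (simp add: L2_def)
have qL: "q \<in> L2 W" if "q \<in> Qh W r \<tau>" for q using that by (simp add: Qh_def L20_def)
have add: "L2_inner W (divg W (u + v)) q = L2_inner W (divg W u) q + L2_inner W (divg W v) q"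
 if u: "u \<in> Xh W s \<tau>" and v: "v \<in> Xh W s \<tau>" and q: "q \<in> L2 W" for u v q
proof -
 have a: "AE x in lebesgue_on W. divg W (u + v) x = divg W u x + 1 * divg W v x"
  using H1_add(2)[OF op bd Xh_D(2)[OF u] Xh_D(2)[OF v]] by eventually_elim (simp add: divg_def trace_add)
 have "(\<lambda>x. divg W u x + 1 * divg W v x) \<in> meas W"
  by (intro borel_measurable_add borel_measurable_times borel_measurable_const mL dL u v)
 from L2_inner_cong[OF op bd a _ mL[OF dL[OF subspace_add[OF X u v]]] this mL[OF q] mL[OF q]]
 have "L2_inner W (divg W (u + v)) q = L2_inner W (\<lambda>x. divg W u x + 1 * divg W v x) q" by simp
 also have "\<dots> = L2_inner W (divg W u) q + 1 * L2_inner W (divg W v) q"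
  by (rule L2_inner_add[OF op bd dL[OF u] dL[OF v] q])
 finally show ?thesis by simp
qed
have scale: "L2_inner W (divg W (c *\<^sub>R u)) q = c * L2_inner W (divg W u) q"
 if u: "u \<in> Xh W s \<tau>" and q: "q \<in> L2 W" for u q c
proof -
 have a: "AE x in lebesgue_on W. divg W (c *\<^sub>R u) x = c * divg W u x"
  using H1_scale(2)[OF op bd Xh_D(2)[OF u], of c] by eventually_elim (simp add: divg_def trace_def sum_distrib_left)
 have "(\<lambda>x. c * divg W u x) \<in> meas W"
  by (intro borel_measurable_times borel_measurable_const mL dL u)
 from L2_inner_cong[OF op bd a _ mL[OF dL[OF subspace_scale[OF X u]]] this mL[OF q] mL[OF q]]
 have "L2_inner W (divg W (c *\<^sub>R u)) q = L2_inner W (\<lambda>x. c * divg W u x) q" by simp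
 also have "\<dots> = c * L2_inner W (divg W u) q" by (simp add: L2_inner_def mult.assoc)
 finally show ?thesis .
qed
have z: "L2_inner W (divg W 0) q = 0" if "q \<in> L2 W" for q
 using scale[OF subspace_0[OF X] that, of 0] by simp
show ?thesis
proof (rule subspaceI)
 show "0 \<in> Vh W s r \<tau>" using subspace_0[OF X] z qL by (auto simp: Vh_def)
 show "u + v \<in> Vh W s r \<tau>" if "u \<in> Vh W s r \<tau>" "v \<in> Vh W s r \<tau>" for u v
  using that subspace_add[OF X] add qL by (auto simp: Vh_def)
 show "c *\<^sub>R u \<in> Vh W s r \<tau>" if "u \<in> Vh W s r \<tau>" for u c
  using that subspace_scale[OF X] scale qL by (auto simp: Vh_def)
qed
qed

lemma Vh_finite_dim: "\<exists>Bs. finite Bs \<and> Vh W s r \<tau> = span Bs"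
proof -
obtain Bs where Bs: "Bs \<subseteq> Vh W s r \<tau>" "independent Bs" "Vh W s r \<tau> \<subseteq> span Bs" by (rule maximal_independent_subset)
have "Vh W s r \<tau> \<subseteq> pw_polys s \<tau>" by (auto simp: Vh_def Xh_def)
moreover have "finite (\<tau> \<times> (monoms s :: (real^'n \<Rightarrow> real) set) \<times> (Basis :: (real^'n) set))"
 by (intro finite_cartesian_product finite_\<tau> finite_monoms finite_Basis)
hence "finite Bs"
 using independent_span_bound[OF finite_imageI Bs(2) order.trans[OF order.trans[OF Bs(1)] pw_polys_span]] calculation by blast
moreover have "span Bs = Vh W s r \<tau>" using span_subspace[OF Bs(1,3) subspace_Vh] .
ultimately show ?thesis by blast
qed

text \<open>The scalar estimate is summed over the matrix entries, and the integral over the cell is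
  enlarged to \<open>W\<close>. It serves both symmetric gradients of finite element functions and
  gradients of bubbles.\<close>

lemma cell_inverse_estimate:
assumes inv: "inverse_constant (polys s :: (real^'n \<Rightarrow> real) set) \<rho> C"
 and \<rho>: "\<rho> > 0" and C: "C \<ge> 0" and K: "K \<in> \<tau>" "cball c (\<rho> * diameter K) \<subseteq> K"
 and E: "\<And>i j. (\<lambda>x. (E x :: real^'n^'n) $ i $ j) \<in> polys s" and T: "T \<in> L2 W"
 and g: "AE x in lebesgue. x \<in> interior K \<longrightarrow> T x = E x" and x: "x \<in> K"
shows "(norm (E x))\<^sup>2 \<le> C / diameter K ^ CARD('n) * (L2_norm W T)\<^sup>2"
proof -
have Ec: "continuous_on S E" for S by (rule poly_matrix_continuous[OF E])
have cK: "compact K" by (rule cell_compact[OF K(1)])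
have KL: "K \<in> sets lebesgue" using lmeasurable_compact[OF cK] by auto
have d: "diameter K > 0" by (rule cell_diameter[OF K(1)])
have "c \<in> K" using K(2) d \<rho> by auto
hence sub: "K \<subseteq> cball c (diameter K)"
 using diameter_bounded_bound[OF compact_imp_bounded[OF cK]] by auto
have sq: "(norm A)\<^sup>2 = (\<Sum>i\<in>UNIV. \<Sum>j\<in>UNIV. (A $ i $ j)\<^sup>2)" for A :: "real^'n^'n"
 unfolding power2_norm_eq_inner inner_matrix by (simp add: power2_eq_square)
have ii: "integrable (lebesgue_on K) (\<lambda>y. (E y $ i $ j)\<^sup>2)" for i j
 by (intro continuous_integrable_on_compact cK continuous_on_power polys_continuous_on[OF E])
have EK: "(norm (E x))\<^sup>2 \<le> C / diameter K ^ CARD('n) * (LINT y|lebesgue_on K. (norm (E y))\<^sup>2)" if x: "x \<in> K" for x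
proof -
 have "(norm (E x))\<^sup>2 \<le> (\<Sum>i\<in>UNIV. \<Sum>j\<in>UNIV. C / diameter K ^ CARD('n) * (LINT y|lebesgue_on K. (E y $ i $ j)\<^sup>2))"
  unfolding sq by (intro sum_mono inv[rule_format, OF E d cK K(2) sub x])
 also have "\<dots> = C / diameter K ^ CARD('n) * (LINT y|lebesgue_on K. (norm (E y))\<^sup>2)"
  unfolding sq using ii by (simp add: Bochner_Integration.integral_sum sum_distrib_left)
 finally show ?thesis .
qed
have "(LINT y|lebesgue_on K. (norm (E y))\<^sup>2) = (LINT y|lebesgue. indicator K y *\<^sub>R (norm (E y))\<^sup>2)"
 by (rule integral_lebesgue_on(1)[OF KL])
also have "\<dots> \<le> (LINT y|lebesgue. indicator W y *\<^sub>R (T y \<bullet> T y))"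
proof (rule integral_mono_AE)
 have "integrable (lebesgue_on K) (\<lambda>y. (norm (E y))\<^sup>2)"
  by (intro continuous_integrable_on_compact cK continuous_intros Ec)
 thus "integrable lebesgue (\<lambda>y. indicator K y *\<^sub>R (norm (E y))\<^sup>2)"
  by (rule integral_lebesgue_on(2)[OF KL, THEN iffD1])
 show "integrable lebesgue (\<lambda>y. indicator W y *\<^sub>R (T y \<bullet> T y))"
  by (rule integral_lebesgue_on(2)[OF W_lebesgue[OF op bd], THEN iffD1]) (rule L2_inner_integrable[OF op bd T T])
 show "AE y in lebesgue. indicator K y *\<^sub>R (norm (E y))\<^sup>2 \<le> indicator W y *\<^sub>R (T y \<bullet> T y)"
  using g skeleton_negligible
 proof eventually_elim
  fix y assume y: "y \<in> interior K \<longrightarrow> T y = E y" "\<forall>K\<in>\<tau>. y \<in> K \<longrightarrow> y \<in> interior K"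
  show "indicator K y *\<^sub>R (norm (E y))\<^sup>2 \<le> indicator W y *\<^sub>R (T y \<bullet> T y)"
  proof (cases "y \<in> K")
  case True
  hence "y \<in> interior K" "y \<in> W" "T y = E y" using y K(1) cell_interior_subset[OF K(1)] by auto
  thus ?thesis using True by (simp add: power2_norm_eq_inner)
  qed simp
 qed
qed
also have "\<dots> = (L2_norm W (T))\<^sup>2"
 unfolding L2_norm_sq[OF op bd] L2_inner_def by (rule integral_lebesgue_on(1)[symmetric, OF W_lebesgue[OF op bd]])
finally have le: "(LINT y|lebesgue_on K. (norm (E y))\<^sup>2) \<le> (L2_norm W (T))\<^sup>2" .
have "C / diameter K ^ CARD('n) * (LINT y|lebesgue_on K. (norm (E y))\<^sup>2) \<le> C / diameter K ^ CARD('n) * (L2_norm W (T))\<^sup>2"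
 using C d by (intro mult_left_mono[OF le]) auto
with EK[OF x] show ?thesis by (rule order.trans)
qed

lemma symgrad_cell_bound:
assumes inv: "inverse_constant (polys s :: (real^'n \<Rightarrow> real) set) \<rho> C"
 and \<rho>: "\<rho> > 0" and C: "C \<ge> 0" and v: "v \<in> Xh W s \<tau>" and K: "K \<in> \<tau>" "cball c (\<rho> * diameter K) \<subseteq> K"
shows "AE x in lebesgue. x \<in> interior K \<longrightarrow>
 (norm (symgrad W v x))\<^sup>2 \<le> C / diameter K ^ CARD('n) * (L2_norm W (symgrad W v))\<^sup>2"
proof -
obtain p D where p: "cell_poly s K v p D" using cell_poly_exists[OF Xh_D(3)[OF v] K(1)] by blast
define E where "E x = sy (D x)" for x
have E: "(\<lambda>x. E x $ i $ j) \<in> polys s" for i j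
proof -
 have "(\<lambda>x. 1/2 * (D x $ i $ j + D x $ j $ i)) \<in> polys s" by (intro polys_scale polys_add cell_polyD(2)[OF p])
 moreover have "(\<lambda>x. E x $ i $ j) = (\<lambda>x. 1/2 * (D x $ i $ j + D x $ j $ i))"
  by (simp add: E_def sy_def transpose_def fun_eq_iff)
 ultimately show ?thesis by simp
qed
have g: "AE x in lebesgue. x \<in> interior K \<longrightarrow> symgrad W v x = E x"
 using cell_grad[OF Xh_D(2)[OF v] K(1) p] by eventually_elim (simp add: symgrad_sy E_def)
have T: "symgrad W v \<in> L2 W" by (rule symgrad_L2[OF op bd Xh_D(2)[OF v]])
show ?thesis
 using g
proof eventually_elim
 fix x assume x: "x \<in> interior K \<longrightarrow> symgrad W v x = E x"
 show "x \<in> interior K \<longrightarrow> (norm (symgrad W v x))\<^sup>2 \<le> C / diameter K ^ CARD('n) * (L2_norm W (symgrad W v))\<^sup>2"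
  using cell_inverse_estimate[OF inv \<rho> C K E T g, of x] x interior_subset by auto
qed
qed

lemma cell_grad_zero:
assumes v: "v \<in> H1 W" and K: "K \<in> \<tau>" and z: "\<And>x. x \<in> interior K \<Longrightarrow> v x = 0"
shows "AE x in lebesgue. x \<in> interior K \<longrightarrow> grad W v x = 0"
proof -
have "cell_poly 0 K v (\<lambda>x. 0) (\<lambda>x. 0)" using z polys_const[of 0 0] by (auto simp: cell_poly_def)
from cell_grad[OF v K this] show ?thesis .
qed

text \<open>Cells on which \<open>v\<close> vanishes identically may be arbitrarily small, since the
  gradient is zero there; only the remaining ones need the lower bound
  \<open>\<delta>\<close>.\<close>

lemma symgrad_bound:
assumes inv: "inverse_constant (polys s :: (real^'n \<Rightarrow> real) set) \<rho> C"
 and \<rho>: "\<rho> > 0" and C: "C \<ge> 0" and v: "v \<in> Xh W s \<tau>" and reg: "\<And>K. K \<in> \<tau> \<Longrightarrow> \<exists>c. cball c (\<rho> * diameter K) \<subseteq> K"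
 and \<delta>: "\<delta> > 0" "\<And>K x. \<lbrakk>K \<in> \<tau>; x \<in> interior K; v x \<noteq> 0\<rbrakk> \<Longrightarrow> \<delta> \<le> diameter K"
shows "AE x in lebesgue_on W. (norm (symgrad W v x))\<^sup>2 \<le> C / \<delta> ^ CARD('n) * (L2_norm W (symgrad W v))\<^sup>2"
proof (rule AE_on_cells)
fix K assume K: "K \<in> \<tau>"
show "AE x in lebesgue. x \<in> interior K \<longrightarrow> (norm (symgrad W v x))\<^sup>2 \<le> C / \<delta> ^ CARD('n) * (L2_norm W (symgrad W v))\<^sup>2"
proof (cases "\<exists>x\<in>interior K. v x \<noteq> 0")
 case True
 hence dK: "\<delta> \<le> diameter K" using \<delta>(2)[OF K] by blast
 obtain c where c: "cball c (\<rho> * diameter K) \<subseteq> K" using reg[OF K] by blast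
 have "C / diameter K ^ CARD('n) \<le> C / \<delta> ^ CARD('n)"
  using C \<delta>(1) dK by (intro divide_left_mono power_mono mult_pos_pos zero_less_power) auto
 hence "C / diameter K ^ CARD('n) * (L2_norm W (symgrad W v))\<^sup>2 \<le> C / \<delta> ^ CARD('n) * (L2_norm W (symgrad W v))\<^sup>2"
  by (rule mult_right_mono) simp
 with symgrad_cell_bound[OF inv \<rho> C v K c] show ?thesis
  by (elim eventually_mono) (use order.trans in blast)
next
 case False
 hence "AE x in lebesgue. x \<in> interior K \<longrightarrow> grad W v x = 0" by (intro cell_grad_zero[OF Xh_D(2)[OF v] K]) auto
 thus ?thesis
 proof eventually_elim
  fix x assume x: "x \<in> interior K \<longrightarrow> grad W v x = 0"
  have "0 \<le> C / \<delta> ^ CARD('n) * (L2_norm W (symgrad W v))\<^sup>2" using C \<delta>(1) by simp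
  thus "x \<in> interior K \<longrightarrow> (norm (symgrad W v x))\<^sup>2 \<le> C / \<delta> ^ CARD('n) * (L2_norm W (symgrad W v))\<^sup>2"
  using x by (auto simp: symgrad_sy linear_0[OF linear_sy])
 qed
qed
qed

end

section \<open>Barycentric coordinates\<close>

definition verts :: "'a::real_vector set \<Rightarrow> 'a set" where
"verts K = {p. p extreme_point_of K}"

text \<open>The gradient of the barycentric coordinate of the vertex \<open>p\<close>: the affine
  function with value 1 at \<open>p\<close> must drop to 0 at every other vertex. Affine
  independence guarantees that such a vector exists.\<close>

definition hgrad :: "'a::euclidean_space set \<Rightarrow> 'a \<Rightarrow> 'a" where
"hgrad K p = (SOME g. \<forall>q\<in>verts K - {p}. g \<bullet> (q - p) = -1)"

text \<open>The barycentric coordinate as an affine function on the whole space, so that it can be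
  evaluated outside the cell and differentiated.\<close>

definition lam :: "'a::euclidean_space set \<Rightarrow> 'a \<Rightarrow> 'a \<Rightarrow> real" where
"lam K p x = 1 + hgrad K p \<bullet> (x - p)"

context fe_mesh
begin

lemma
assumes K: "K \<in> \<tau>"
shows verts_finite: "finite (verts K)" and verts_indep: "\<not> affine_dependent (verts K)"
 and verts_card: "card (verts K) = CARD('n) + 1" and verts_hull: "convex hull (verts K) = K"
 and verts_affine_hull: "affine hull (verts K) = UNIV" and verts_subset: "verts K \<subseteq> K"
proof -
obtain C where C: "finite C" "\<not> affine_dependent C" "int (card C) = int CARD('n) + 1" "K = convex hull C"
 using cell_simplex[OF K] unfolding simplex by blast
have v: "verts K = C"
 using extreme_point_of_convex_hull_affine_independent[OF C(2)] by (auto simp: verts_def C(4))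
show "finite (verts K)" "\<not> affine_dependent (verts K)" "card (verts K) = CARD('n) + 1" "convex hull (verts K) = K"
 using C v by auto
show "verts K \<subseteq> K" by (auto simp: verts_def extreme_point_of_def)
have "aff_dim K = int DIM(real^'n)" using aff_dim_simplex[OF cell_simplex[OF K]] by simp
hence "affine hull K = UNIV" by (rule aff_dim_eq_full[THEN iffD1])
thus "affine hull (verts K) = UNIV" unfolding v by (simp add: C(4) affine_hull_convex_hull)
qed

lemma lam_vertex:
assumes K: "K \<in> \<tau>" and p: "p \<in> verts K" and q: "q \<in> verts K"
shows "lam K p q = (if q = p then 1 else 0)"
proof (cases "q = p")
case False
have "independent ((\<lambda>x. - p + x) ` (verts K - {p}))"
 using affine_dependent_iff_dependent2[OF p] verts_indep[OF K] by simp
then obtain g where g: "linear g" "\<And>x. x \<in> (\<lambda>x. - p + x) ` (verts K - {p}) \<Longrightarrow> g x = (-1 :: real)"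
 using linear_independent_extend[of "(\<lambda>x. - p + x) ` (verts K - {p})" "\<lambda>_. -1 :: real"] by blast
\<comment> \<open>The functional prescribed on the independent edge vectors is turned into an inner
  product with a vector.\<close>
have "\<forall>q\<in>verts K - {p}. adjoint g 1 \<bullet> (q - p) = -1"
proof
 fix q assume "q \<in> verts K - {p}"
 hence "g (- p + q) = -1" by (intro g(2)) auto
 thus "adjoint g 1 \<bullet> (q - p) = -1"
  using adjoint_works[OF g(1), of "q - p" 1] by (simp add: inner_commute)
qed
hence "\<forall>q\<in>verts K - {p}. hgrad K p \<bullet> (q - p) = -1"
 unfolding hgrad_def by (rule someI[where P = "\<lambda>g. \<forall>q\<in>verts K - {p}. g \<bullet> (q - p) = -1"])
thus ?thesis using False q by (simp add: lam_def)
qed (simp add: lam_def)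

lemma lam_combination:
assumes "sum u V = 1"
shows "lam K p (\<Sum>q\<in>V. u q *\<^sub>R q) = (\<Sum>q\<in>V. u q * lam K p q)"
proof -
have "(\<Sum>q\<in>V. u q * lam K p q) = (\<Sum>q\<in>V. u q) * (1 - hgrad K p \<bullet> p) + (\<Sum>q\<in>V. u q * (hgrad K p \<bullet> q))"
 unfolding sum_distrib_right sum.distrib[symmetric]
 by (intro sum.cong refl) (simp add: lam_def inner_diff_right algebra_simps)
thus ?thesis by (simp add: lam_def inner_diff_right inner_sum_right assms)
qed

lemma lam_convex: "lam K p ((1 - t) *\<^sub>R x + t *\<^sub>R y) = (1 - t) * lam K p x + t * lam K p y"
by (simp add: lam_def inner_diff_right inner_add_right algebra_simps)

lemma lam_coeff:
assumes K: "K \<in> \<tau>" and V: "V \<subseteq> verts K" and u: "sum u V = 1" and p: "p \<in> verts K"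
shows "lam K p (\<Sum>q\<in>V. u q *\<^sub>R q) = (if p \<in> V then u p else 0)"
proof -
have fV: "finite V" using finite_subset[OF V verts_finite[OF K]] .
have "lam K p (\<Sum>q\<in>V. u q *\<^sub>R q) = (\<Sum>q\<in>V. u q * (if q = p then 1 else 0))"
 unfolding lam_combination[OF u] using V lam_vertex[OF K p] by (intro sum.cong) auto
also have "\<dots> = (if p \<in> V then u p else 0)" using fV by (simp add: if_distrib[of "\<lambda>x. _ * x"] cong: if_cong)
finally show ?thesis .
qed

lemma lam_sum:
assumes K: "K \<in> \<tau>"
shows "(\<Sum>p\<in>verts K. lam K p x) = 1" "(\<Sum>p\<in>verts K. lam K p x *\<^sub>R p) = x"
proof -
have "x \<in> affine hull (verts K)" by (simp add: verts_affine_hull[OF K])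
then obtain u where u: "sum u (verts K) = 1" "(\<Sum>p\<in>verts K. u p *\<^sub>R p) = x"
 unfolding affine_hull_finite[OF verts_finite[OF K]] by blast
have *: "lam K p x = u p" if "p \<in> verts K" for p
 using lam_coeff[OF K order_refl u(1) that] u(2) that by simp
show "(\<Sum>p\<in>verts K. lam K p x) = 1" using u(1) * by simp
show "(\<Sum>p\<in>verts K. lam K p x *\<^sub>R p) = x" using u(2) * by simp
qed

lemma lam_mem_iff:
assumes K: "K \<in> \<tau>"
shows "x \<in> K \<longleftrightarrow> (\<forall>p\<in>verts K. 0 \<le> lam K p x)"
proof
assume "x \<in> K"
hence "x \<in> convex hull (verts K)" using verts_hull[OF K] by simp
then obtain u where u: "\<forall>p\<in>verts K. 0 \<le> u p" "sum u (verts K) = 1" "(\<Sum>p\<in>verts K. u p *\<^sub>R p) = x"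
 unfolding convex_hull_finite[OF verts_finite[OF K]] by blast
thus "\<forall>p\<in>verts K. 0 \<le> lam K p x" using lam_coeff[OF K order_refl u(2)] by auto
next
assume "\<forall>p\<in>verts K. 0 \<le> lam K p x"
hence "x \<in> convex hull (verts K)"
 unfolding convex_hull_finite[OF verts_finite[OF K]] using lam_sum[OF K, of x]
 by (intro CollectI exI[of _ "\<lambda>p. lam K p x"]) auto
thus "x \<in> K" using verts_hull[OF K] by simp
qed

lemma lam_nonneg: "\<lbrakk>K \<in> \<tau>; p \<in> verts K; x \<in> K\<rbrakk> \<Longrightarrow> 0 \<le> lam K p x"
using lam_mem_iff by blast

lemma lam_le_1: assumes "K \<in> \<tau>" "p \<in> verts K" "x \<in> K" shows "lam K p x \<le> 1"
proof -
have "lam K p x \<le> (\<Sum>p\<in>verts K. lam K p x)"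
 by (rule member_le_sum[OF assms(2)]) (use lam_nonneg[OF assms(1) _ assms(3)] verts_finite[OF assms(1)] in auto)
thus ?thesis by (simp add: lam_sum[OF assms(1)])
qed

lemma other_vertex: assumes "K \<in> \<tau>" shows "\<exists>q\<in>verts K. q \<noteq> p"
proof (rule ccontr)
assume "\<not> ?thesis"
hence "verts K \<subseteq> {p}" by blast
from card_mono[OF _ this] have "card (verts K) \<le> 1" by simp
thus False by (simp add: verts_card[OF assms])
qed

lemma hgrad_nonzero: assumes "K \<in> \<tau>" "p \<in> verts K" shows "hgrad K p \<noteq> 0"
proof
assume 0: "hgrad K p = 0"
obtain q where "q \<in> verts K" "q \<noteq> p" using other_vertex[OF assms(1)] by blast
thus False using lam_vertex[OF assms, of q] 0 by (simp add: lam_def)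
qed

lemma lam_pos_interior: assumes K: "K \<in> \<tau>" and p: "p \<in> verts K" and x: "x \<in> interior K" shows "0 < lam K p x"
proof -
obtain e where e: "e > 0" "cball x e \<subseteq> K" using x mem_interior_cball by blast
define g where "g = hgrad K p"
have g0: "norm g > 0" using hgrad_nonzero[OF K p] by (simp add: g_def)
define y where "y = x - (e / norm g) *\<^sub>R g"
have "y \<in> cball x e" using e g0 by (simp add: y_def dist_norm)
hence "0 \<le> lam K p y" using e(2) lam_nonneg[OF K p] by blast
also have "lam K p y = lam K p x - e / norm g * (g \<bullet> g)"
 by (simp add: lam_def y_def g_def inner_diff_right algebra_simps)
also have "\<dots> < lam K p x" using e g0 by simp
finally show ?thesis .
qed

lemma verts_common:
assumes "K \<in> \<tau>" "K' \<in> \<tau>"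
shows "{p. p extreme_point_of (K \<inter> K')} = verts K \<inter> K'" "verts K \<inter> K' = verts K' \<inter> K"
proof -
have *: "{p. p extreme_point_of (K \<inter> K')} = verts K \<inter> K'" if "K \<in> \<tau>" "K' \<in> \<tau>" for K K'
 using extreme_point_of_face[OF cells_face[OF that]] verts_subset[OF that(1)] by (auto simp: verts_def)
show "{p. p extreme_point_of (K \<inter> K')} = verts K \<inter> K'" by (rule *[OF assms])
thus "verts K \<inter> K' = verts K' \<inter> K" using *[OF assms(2,1)] by (simp add: Int_commute)
qed

text \<open>By conformity the intersection of two cells is a face of both, spanned by the shared
  vertices, and coordinates with respect to these are unique. This makes bubbles continuous across
  cells.\<close>

lemma lam_common:
assumes K: "K \<in> \<tau>" and K': "K' \<in> \<tau>" and x: "x \<in> K" "x \<in> K'" and p: "p \<in> verts K"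
shows "lam K p x = (if p \<in> verts K' then lam K' p x else 0)"
proof -
let ?F = "K \<inter> K'" and ?E = "verts K \<inter> K'"
have "?F = convex hull ?E"
 using Krein_Milman_Minkowski[of ?F] verts_common(1)[OF K K'] compact_Int[OF cell_compact[OF K] cell_compact[OF K']]
  convex_Int[OF cell_convex[OF K] cell_convex[OF K']] by simp
hence xE: "x \<in> convex hull ?E" using x by blast
have fE: "finite ?E" using verts_finite[OF K] by simp
obtain u where u: "sum u ?E = 1" "(\<Sum>p\<in>?E. u p *\<^sub>R p) = x"
 using xE unfolding convex_hull_finite[OF fE] by blast
have 1: "lam K p x = (if p \<in> ?E then u p else 0)" using lam_coeff[OF K _ u(1) p] u(2) by simp
have 2: "lam K' p x = (if p \<in> ?E then u p else 0)" if "p \<in> verts K'"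
 using lam_coeff[OF K' _ u(1) that] u(2) verts_common(2)[OF K K'] by simp
show ?thesis using 1 2 verts_common(2)[OF K K'] by auto
qed

text \<open>
If a cell reaches from a point \<open>x\<close> of \<open>W\<close> beyond \<open>y\<close>, to \<open>y'\<close>, then every cell near \<open>x\<close> on the segment also contains \<open>y'\<close>,
so the cells cover a neighbourhood of \<open>y\<close>.
\<close>

lemma segment_in_W:
assumes K: "K \<in> \<tau>" and x: "x \<in> W" "x \<in> K" and y': "y' \<in> K" and y: "y \<in> open_segment x y'"
shows "y \<in> W"
proof -
obtain t where t: "0 < t" "t < 1" "y = (1 - t) *\<^sub>R x + t *\<^sub>R y'" and xy': "x \<noteq> y'"
 using y by (auto simp: in_segment)
obtain r where r: "r > 0" "ball x r \<subseteq> W" using op x(1) by (meson open_contains_ball)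
define e where "e = min (t / 2) (r / (2 * norm (y' - x)))"
have n: "norm (y' - x) > 0" using xy' by simp
have e: "0 < e" "e < t" using t r n by (auto simp: e_def)
define z where "z = x + e *\<^sub>R (y' - x)"
have "norm (z - x) = e * norm (y' - x)" using e by (simp add: z_def)
also have "\<dots> \<le> r / (2 * norm (y' - x)) * norm (y' - x)" using n by (intro mult_right_mono) (auto simp: e_def)
also have "\<dots> < r" using n r by simp
finally have "z \<in> ball x r" by (simp add: dist_norm norm_minus_commute)
hence zW: "z \<in> W" using r by blast
have zseg: "z \<in> open_segment x y'"
 using e t xy' unfolding in_segment z_def by (intro conjI exI[of _ e]) (auto simp: algebra_simps)
\<comment> \<open>A neighbourhood of \<open>z\<close> that meets only cells containing
  \<open>z\<close>.\<close>
define U where "U = W \<inter> (\<Inter>K'\<in>{K'\<in>\<tau>. z \<notin> K'}. - K')"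
have "open U" unfolding U_def
 using op finite_\<tau> cell_compact by (intro open_Int open_INT) (auto simp: compact_imp_closed)
moreover have "z \<in> U" using zW by (simp add: U_def)
ultimately obtain d where d: "d > 0" "ball z d \<subseteq> U" by (meson open_contains_ball)
\<comment> \<open>The homothety with centre \<open>y'\<close> and ratio \<open>1 - s\<close> maps
  \<open>z\<close> to \<open>y\<close>, and therefore the ball around \<open>z\<close> to a ball
  around \<open>y\<close>.\<close>
define s where "s = (t - e) / (1 - e)"
have s: "0 \<le> s" "s < 1" "s * (1 - e) = t - e" using e t by (auto simp: s_def)
have yz: "y = (1 - s) *\<^sub>R z + s *\<^sub>R y'"
proof -
 have "(1 - s) *\<^sub>R z + s *\<^sub>R y' = x + ((1 - s) * e + s) *\<^sub>R (y' - x)" by (simp add: z_def algebra_simps)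
 also have "(1 - s) * e + s = t" using s(3) by (simp add: algebra_simps)
 finally show ?thesis by (simp add: t(3) algebra_simps)
qed
have "ball y ((1 - s) * d) \<subseteq> closure W"
proof
 fix a assume a: "a \<in> ball y ((1 - s) * d)"
 define b where "b = z + (1 / (1 - s)) *\<^sub>R (a - y)"
 have "norm (b - z) = norm (a - y) / (1 - s)" using s by (simp add: b_def)
 also have "\<dots> < d" using a s by (simp add: pos_divide_less_eq dist_norm norm_minus_commute mult.commute)
 finally have bU: "b \<in> U" using d by (auto simp: dist_norm norm_minus_commute)
 hence "b \<in> \<Union>\<tau>" unfolding Union_\<tau> U_def using closure_subset by auto
 then obtain K' where K': "K' \<in> \<tau>" "b \<in> K'" by blast
 have zK': "z \<in> K'" using bU K' by (auto simp: U_def)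
 have zK: "z \<in> K" using zseg x(2) y' cell_convex[OF K] by (meson convex_contains_open_segment subsetD)
 \<comment> \<open>The point \<open>z\<close> lies in the common face and strictly between
   \<open>x\<close> and \<open>y'\<close>, so the face property puts the endpoint \<open>y'\<close>
   into the face.\<close>
 have "y' \<in> K \<inter> K'"
  using cells_face[OF K K'(1)] zK zK' x(2) y' zseg unfolding face_of_def by blast
 hence "(1 - s) *\<^sub>R b + s *\<^sub>R y' \<in> K'"
  using s K'(2) by (intro convexD_alt[OF cell_convex[OF K'(1)]]) auto
 moreover have "(1 - s) *\<^sub>R b + s *\<^sub>R y' = a"
 proof -
  have "(1 - s) *\<^sub>R b = (1 - s) *\<^sub>R z + (a - y)" using s by (simp add: b_def scaleR_add_right)
  thus ?thesis using yz by simp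
 qed
 ultimately show "a \<in> closure W" using K'(1) Union_\<tau> by auto
qed
moreover have "y \<in> ball y ((1 - s) * d)" using s d by simp
ultimately have "y \<in> interior (closure W)" using interior_maximal[OF _ open_ball] by blast
thus ?thesis by (simp add: interior_closure_W)
qed

end

section \<open>Neighbouring cells have comparable size\<close>

locale regular_mesh = fe_mesh W \<tau> for W :: "(real^'n) set" and \<tau> +
fixes \<rho> :: real
assumes \<rho>: "\<rho> > 0" and inner_ball: "K \<in> \<tau> \<Longrightarrow> \<exists>c. cball c (\<rho> * diameter K) \<subseteq> K"
begin

text \<open>A barycentric coordinate stays between 0 and 1 on the inscribed ball, which bounds its
  gradient by the reciprocal of the ball's diameter. Along an edge at its vertex it changes by 1, so
  the edge cannot be shorter than that diameter.\<close>

lemma edge_length: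
assumes K: "K \<in> \<tau>" and p: "p \<in> verts K" and q: "q \<in> verts K" and pq: "p \<noteq> q"
shows "2 * \<rho> * diameter K \<le> norm (p - q)"
proof -
obtain c where c: "cball c (\<rho> * diameter K) \<subseteq> K" using inner_ball[OF K] by blast
define r where "r = \<rho> * diameter K"
have r: "r > 0" using \<rho> cell_diameter[OF K] by (simp add: r_def)
define g where "g = hgrad K p"
have g0: "norm g > 0" using hgrad_nonzero[OF K p] by (simp add: g_def)
have "c + (r / norm g) *\<^sub>R g \<in> cball c r" "c - (r / norm g) *\<^sub>R g \<in> cball c r"
 using r g0 by (simp_all add: dist_norm)
hence "c + (r / norm g) *\<^sub>R g \<in> K" "c - (r / norm g) *\<^sub>R g \<in> K" using c unfolding r_def by blast+
hence "lam K p (c + (r / norm g) *\<^sub>R g) \<le> 1" "0 \<le> lam K p (c - (r / norm g) *\<^sub>R g)"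
 using lam_le_1[OF K p] lam_nonneg[OF K p] by auto
moreover have "lam K p (c + (r / norm g) *\<^sub>R g) - lam K p (c - (r / norm g) *\<^sub>R g) = 2 * (r / norm g * (g \<bullet> g))"
 by (simp add: lam_def g_def[symmetric] inner_diff_right inner_add_right)
moreover have "r / norm g * (g \<bullet> g) = r * norm g" using g0 by (simp add: dot_square_norm power2_eq_square)
ultimately have 1: "2 * (r * norm g) \<le> 1" by linarith
have "1 = g \<bullet> (p - q)" using lam_vertex[OF K p q] pq by (simp add: lam_def g_def inner_diff_right)
also have "\<dots> \<le> norm g * norm (p - q)" by (rule norm_cauchy_schwarz)
finally have "2 * r * 1 \<le> 2 * r * (norm g * norm (p - q))" using r by (intro mult_left_mono) auto
also have "\<dots> = 2 * (r * norm g) * norm (p - q)" by simp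
also have "\<dots> \<le> 1 * norm (p - q)" by (intro mult_right_mono 1) auto
finally show ?thesis by (simp add: r_def)
qed

text \<open>Two common points force the common face to have two vertices, hence an edge shared by
  both cells; its length is comparable to the diameter of either cell.\<close>

lemma common_points_comparable:
assumes K: "K \<in> \<tau>" "K' \<in> \<tau>" and xy: "x \<in> K" "x \<in> K'" "y \<in> K" "y \<in> K'" "x \<noteq> y"
shows "2 * \<rho> * diameter K' \<le> diameter K"
proof -
let ?F = "K \<inter> K'" and ?E = "verts K \<inter> K'"
have F: "?F = convex hull ?E"
 using Krein_Milman_Minkowski[of ?F] verts_common(1)[OF K] compact_Int[OF cell_compact[OF K(1)] cell_compact[OF K(2)]]
  convex_Int[OF cell_convex[OF K(1)] cell_convex[OF K(2)]] by simp
have "\<exists>p\<in>?E. \<exists>q\<in>?E. p \<noteq> q"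
proof (rule ccontr)
 assume "\<not> ?thesis"
 then obtain p where "?E \<subseteq> {p}" by blast
 hence "?F \<subseteq> {p}" unfolding F using hull_mono[of ?E "{p}" convex] by simp
 thus False using xy by blast
qed
then obtain p q where pq: "p \<in> ?E" "q \<in> ?E" "p \<noteq> q" by blast
have "2 * \<rho> * diameter K' \<le> norm (p - q)"
 using pq verts_common(2)[OF K] by (intro edge_length[OF K(2)]) auto
also have "\<dots> \<le> diameter K"
 using diameter_bounded_bound[OF compact_imp_bounded[OF cell_compact[OF K(1)]], of p q] pq verts_subset[OF K(1)]
 by (auto simp: dist_norm)
finally show ?thesis .
qed

text \<open>Shrinking the cells at \<open>x\<close> towards \<open>x\<close> to the same size gives disjoint balls in a ball of comparable size.\<close>

lemma card_cells_at:
"real (card {K\<in>\<tau>. x \<in> K}) * \<rho> ^ CARD('n) \<le> 1"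
proof (cases "{K\<in>\<tau>. x \<in> K} = {}")
case False
let ?C = "{K\<in>\<tau>. x \<in> K}"
have fC: "finite ?C" using finite_\<tau> by simp
define t where "t = Min (diameter ` ?C)"
have t: "t > 0" "\<And>K. K \<in> ?C \<Longrightarrow> t \<le> diameter K"
 using False fC cell_diameter by (auto simp: t_def Min_gr_iff)
have "\<forall>K\<in>?C. \<exists>c. cball c (\<rho> * diameter K) \<subseteq> K" using inner_ball by blast
then obtain c where c: "\<And>K. K \<in> ?C \<Longrightarrow> cball (c K) (\<rho> * diameter K) \<subseteq> K" by metis
define B where "B K = ball (x + (t / diameter K) *\<^sub>R (c K - x)) (\<rho> * t)" for K
have B: "B K \<subseteq> K \<inter> cball x t" if K: "K \<in> ?C" for K
proof
 fix y assume y: "y \<in> B K"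
 define s where "s = t / diameter K"
 have d: "diameter K > 0" using cell_diameter K by blast
 have s: "0 < s" "s \<le> 1" "s * diameter K = t" using t(1) t(2)[OF K] d by (auto simp: s_def)
 define z where "z = x + (1 / s) *\<^sub>R (y - x)"
 have "z - c K = (1 / s) *\<^sub>R (y - (x + s *\<^sub>R (c K - x)))" using s by (simp add: z_def algebra_simps)
 hence "norm (z - c K) = norm (y - (x + s *\<^sub>R (c K - x))) / s" using s by simp
 also have "\<dots> \<le> (\<rho> * t) / s"
  using y s by (intro divide_right_mono) (auto simp: B_def s_def dist_norm norm_minus_commute)
 also have "\<dots> = \<rho> * diameter K" using s by (simp add: s(3)[symmetric])
 finally have zK: "z \<in> K" using c[OF K] by (auto simp: dist_norm norm_minus_commute)
 have "x \<in> K" using K by simp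
 have yz: "y = (1 - s) *\<^sub>R x + s *\<^sub>R z" using s by (simp add: z_def algebra_simps)
 have yK: "y \<in> K" unfolding yz using s zK K by (intro convexD_alt[OF cell_convex]) auto
 have "norm (y - x) = s * norm (z - x)" using s by (simp add: z_def)
 moreover have "norm (z - x) \<le> diameter K"
  using diameter_bounded_bound[OF compact_imp_bounded[OF cell_compact] zK \<open>x \<in> K\<close>] K by (simp add: dist_norm)
 hence "s * norm (z - x) \<le> s * diameter K" using s(1) by (intro mult_left_mono) auto
 ultimately have "norm (y - x) \<le> s * diameter K" by linarith
 hence "y \<in> cball x t" using s by (simp add: dist_norm norm_minus_commute)
 with yK show "y \<in> K \<inter> cball x t" by blast
qed
have Bi: "B K \<subseteq> interior K" if "K \<in> ?C" for K using B[OF that] by (intro interior_maximal) (auto simp: B_def)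
have disj: "pairwise (\<lambda>K K'. disjnt (B K) (B K')) ?C"
 unfolding pairwise_def disjnt_def
proof (intro ballI impI)
 fix K K' assume KK: "K \<in> ?C" "K' \<in> ?C" "K \<noteq> K'"
 show "B K \<inter> B K' = {}"
 proof (rule ccontr)
  assume "B K \<inter> B K' \<noteq> {}"
  then obtain y where "y \<in> B K" "y \<in> B K'" by blast
  hence "y \<in> interior K" "y \<in> interior K'" using Bi KK by blast+
  thus False using interior_disjoint[of K K' y] KK by blast
 qed
qed
have "(\<Sum>K\<in>?C. measure lebesgue (B K)) = measure lebesgue (\<Union>K\<in>?C. B K)"
 by (rule measure_UNION'[symmetric, OF fC _ disj]) (simp add: B_def)
also have "\<dots> \<le> measure lebesgue (cball x t)"
 using B fC by (intro measure_mono_fmeasurable) (auto simp: B_def)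
finally have "(\<Sum>K\<in>?C. measure lebesgue (B K)) \<le> unit_ball_vol (real CARD('n)) * t ^ CARD('n)"
 using t by (simp add: content_cball)
hence "real (card ?C) * (unit_ball_vol (real CARD('n)) * (\<rho> * t) ^ CARD('n)) \<le> unit_ball_vol (real CARD('n)) * t ^ CARD('n)"
 using t \<rho> by (simp add: B_def content_ball)
hence "(real (card ?C) * \<rho> ^ CARD('n)) * (unit_ball_vol (real CARD('n)) * t ^ CARD('n)) \<le> 1 * (unit_ball_vol (real CARD('n)) * t ^ CARD('n))"
 by (simp add: power_mult_distrib mult_ac)
moreover have "0 < unit_ball_vol (real CARD('n)) * t ^ CARD('n)" using t by simp
ultimately show ?thesis by (rule mult_right_le_imp_le)
next
case True
thus ?thesis by (simp only: True card.empty of_nat_0 mult_zero_left zero_le_one)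
qed

text \<open>A small sphere around \<open>x\<close> is connected from dimension 2 on and is covered
  by the cells at \<open>x\<close>. The closed unions of the two groups of cells must meet on it, so
  a cell of each group shares both \<open>x\<close> and a second point.\<close>

lemma cells_chain:
assumes n: "CARD('n) \<ge> 2" and x: "x \<in> W"
 and S: "S \<subseteq> {K\<in>\<tau>. x \<in> K}" "S \<noteq> {}" "S \<noteq> {K\<in>\<tau>. x \<in> K}"
shows "\<exists>K\<in>S. \<exists>K'\<in>{K\<in>\<tau>. x \<in> K} - S. 2 * \<rho> * diameter K' \<le> diameter K"
proof -
let ?C = "{K\<in>\<tau>. x \<in> K}"
have fC: "finite ?C" using finite_\<tau> by simp
define U where "U = W \<inter> (\<Inter>K'\<in>{K'\<in>\<tau>. x \<notin> K'}. - K')"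
have "open U" unfolding U_def
 using op finite_\<tau> cell_compact by (intro open_Int open_INT) (auto simp: compact_imp_closed)
moreover have "x \<in> U" using x by (simp add: U_def)
ultimately obtain d where d: "d > 0" "ball x d \<subseteq> U" by (meson open_contains_ball)
define t where "t = Min (diameter ` ?C)"
have ne: "?C \<noteq> {}" using S by blast
have t: "t > 0" "\<And>K. K \<in> ?C \<Longrightarrow> t \<le> diameter K"
 using ne fC cell_diameter by (auto simp: t_def Min_gr_iff)
\<comment> \<open>The radius is below \<open>d\<close>, so the sphere sees only cells at
  \<open>x\<close>; its double is below the smallest diameter, so every such cell crosses the
  sphere.\<close>
define r where "r = min (d / 2) (t / 3)"
have r: "r > 0" "r < d" "2 * r < t" using d t by (auto simp: r_def)
have meet: "K \<inter> sphere x r \<noteq> {}" if K: "K \<in> ?C" for K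
proof -
 have "\<exists>y\<in>K. norm (y - x) > r"
 proof (rule ccontr)
  assume "\<not> ?thesis"
  hence le: "norm (y - x) \<le> r" if "y \<in> K" for y using that by force
  have "diameter K \<le> 2 * r"
  proof (rule diameter_le)
  show "norm (y - z) \<le> 2 * r" if "y \<in> K" "z \<in> K" for y z
  using le[OF that(1)] le[OF that(2)] norm_triangle_ineq4[of "y - x" "z - x"] by simp
  qed (use K in auto)
  thus False using t(2)[OF K] r by linarith
 qed
 then obtain y where y: "y \<in> K" "norm (y - x) > r" by blast
 define z where "z = (1 - r / norm (y - x)) *\<^sub>R x + (r / norm (y - x)) *\<^sub>R y"
 have zK: "z \<in> K" unfolding z_def using y r K by (intro convexD_alt[OF cell_convex]) (auto simp: divide_le_eq)
 have "z - x = (r / norm (y - x)) *\<^sub>R (y - x)" by (simp add: z_def algebra_simps)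
 moreover have "norm (y - x) > 0" using y r by linarith
 ultimately have "norm (z - x) = r" using r by simp
 hence "z \<in> sphere x r" by (simp add: dist_norm norm_minus_commute)
 with zK show ?thesis by blast
qed
have cov: "sphere x r \<subseteq> \<Union>?C"
proof
 fix y assume "y \<in> sphere x r"
 hence "y \<in> U" using d r by auto
 hence "y \<in> \<Union>\<tau>" unfolding Union_\<tau> U_def using closure_subset by auto
 thus "y \<in> \<Union>?C" using \<open>y \<in> U\<close> by (auto simp: U_def)
qed
have cl: "closed (\<Union>T)" if "T \<subseteq> ?C" for T
 using that finite_subset[OF that fC] cell_compact compact_imp_closed by (intro closed_Union) auto
have "connected (sphere x r)" using connected_sphere[of x r] n by simp
hence "\<Union>S \<inter> \<Union>(?C - S) \<inter> sphere x r \<noteq> {}"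
proof (rule contrapos_pp)
 assume "\<not> \<Union>S \<inter> \<Union>(?C - S) \<inter> sphere x r \<noteq> {}"
 moreover have "\<Union>S \<inter> sphere x r \<noteq> {}" using S meet by blast
 moreover have "\<Union>(?C - S) \<inter> sphere x r \<noteq> {}" using S meet by blast
 moreover have "sphere x r \<subseteq> \<Union>S \<union> \<Union>(?C - S)" using cov by blast
 moreover have "closed (\<Union>S)" "closed (\<Union>(?C - S))" using cl S(1) by auto
 ultimately show "\<not> connected (sphere x r)" unfolding connected_closed by blast
qed
then obtain y K K' where y: "y \<in> sphere x r" "y \<in> K" "K \<in> S" "y \<in> K'" "K' \<in> ?C - S" by blast
have "x \<noteq> y" using y(1) r by auto
hence "2 * \<rho> * diameter K' \<le> diameter K"
 using y S(1) by (intro common_points_comparable[of K K' x y]) auto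
thus ?thesis using y by blast
qed

text \<open>Start from \<open>K\<close> and allow the diameter to grow by the factor
  \<open>1 + 1 / (2 * \<rho>)\<close> in each round. A round adds a cell until all cells at
  \<open>x\<close> are reached, and \<open>card_cells_at\<close> limits the number of rounds by the
  shape constant alone.\<close>

lemma cells_comparable:
assumes n: "CARD('n) \<ge> 2" and x: "x \<in> W" "x \<in> K" "x \<in> K'" and K: "K \<in> \<tau>" "K' \<in> \<tau>"
 and N: "1 / \<rho> ^ CARD('n) \<le> real N"
shows "diameter K' \<le> (1 + 1 / (2 * \<rho>)) ^ N * diameter K"
proof -
let ?C = "{K\<in>\<tau>. x \<in> K}" and ?A = "1 + 1 / (2 * \<rho>)"
have fC: "finite ?C" using finite_\<tau> by simp
have A: "?A \<ge> 1" "?A \<ge> 0" using \<rho> by auto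
have dK: "diameter K > 0" by (rule cell_diameter[OF K(1)])
define S where "S j = {K'\<in>?C. diameter K' \<le> ?A ^ j * diameter K}" for j
have mono: "S j \<subseteq> S (Suc j)" for j
proof -
 have "?A ^ j * diameter K \<le> ?A ^ Suc j * diameter K"
  using A dK by (intro mult_right_mono power_increasing) auto
 thus ?thesis by (auto simp: S_def intro: order.trans)
qed
have "S j = ?C \<or> j < card (S j)" for j
proof (induction j)
 case 0
 have "K \<in> S 0" using K x by (simp add: S_def)
 hence "card (S 0) > 0" using fC unfolding card_gt_0_iff using finite_subset[OF _ fC, of "S 0"] by (auto simp: S_def)
 thus ?case by simp
next
 case (Suc j)
 show ?case
 proof (cases "S j = ?C")
  case True
  moreover have "S (Suc j) \<subseteq> ?C" by (auto simp: S_def)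
  ultimately show ?thesis using mono[of j] by blast
 next
  case False
  hence j: "j < card (S j)" using Suc by simp
  have sub: "S j \<subseteq> ?C" by (auto simp: S_def)
  moreover have "S j \<noteq> {}" using j by auto
  ultimately obtain K1 K2 where K12: "K1 \<in> S j" "K2 \<in> ?C - S j" "2 * \<rho> * diameter K2 \<le> diameter K1"
  using cells_chain[OF n x(1) _ _ False] by blast
  have "diameter K2 \<le> 1 / (2 * \<rho>) * diameter K1" using K12(3) \<rho> by (simp add: field_simps)
  also have "\<dots> \<le> ?A * diameter K1" using diameter_ge_0[of K1] K12(1) cell_compact
  by (intro mult_right_mono) (auto simp: S_def compact_imp_bounded)
  also have "\<dots> \<le> ?A * (?A ^ j * diameter K)" using K12(1) A by (intro mult_left_mono) (auto simp: S_def)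
  finally have "K2 \<in> S (Suc j)" using K12(2) by (simp add: S_def mult.assoc)
  hence "S j \<subset> S (Suc j)" using mono[of j] K12(2) by blast
  hence "card (S j) < card (S (Suc j))"
  using finite_subset[OF _ fC, of "S (Suc j)"] by (intro psubset_card_mono) (auto simp: S_def)
  thus ?thesis using j by simp
 qed
qed
from this[of N] have "S N = ?C"
proof
 assume l: "N < card (S N)"
 have "card (S N) \<le> card ?C" using fC by (intro card_mono) (auto simp: S_def)
 moreover have "real (card ?C) \<le> 1 / \<rho> ^ CARD('n)" using card_cells_at[of x] \<rho> by (simp add: field_simps)
 ultimately show ?thesis using l N by linarith
qed
thus ?thesis using K(2) x(3) by (auto simp: S_def)
qed

end

section \<open>Bubble functions\<close>

text \<open>Invariance under changes on null sets, used to replace a bubble by the representative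
  that vanishes on the skeleton.\<close>

lemma H10_cong:
assumes op: "open W" and bd: "bounded W" and v: "v \<in> H10 W"
 and w: "w \<in> meas W" and AE: "AE x in lebesgue_on W. v x = w x"
shows "w \<in> H10 W"
proof -
have vL: "v \<in> L2 W" using H10_H1[OF op bd v] by (simp add: H1_def)
hence vm: "v \<in> meas W" by (simp add: L2_def)
have gm: "grad W v \<in> meas W" using grad_L2[OF op bd H10_H1[OF op bd v]] by (simp add: L2_def)
obtain \<Phi> where \<Phi>: "\<And>n. \<Phi> n \<in> test_functions W" "L2_lim W \<Phi> v"
 "L2_lim W (\<lambda>n. jac (\<Phi> n)) (grad W v)" using H10_approx[OF op bd v] by blast
show ?thesis
proof (rule H10I[OF op bd, where M = "grad W v" and \<Phi> = \<Phi>])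
 have "integrable (lebesgue_on W) (\<lambda>x. v x \<bullet> v x)" using vL by (simp add: L2_iff[OF op bd])
 hence "integrable (lebesgue_on W) (\<lambda>x. w x \<bullet> w x)"
  by (rule integrable_cong_AE_imp) (use AE w in \<open>auto elim: eventually_mono\<close>)
 thus "w \<in> L2 W" using w by (simp add: L2_iff[OF op bd])
 show "is_weak_grad W w (grad W v)"
  by (rule weak_grad_cong[OF op bd AE vm w _ gm grad_weak[OF op bd H10_H1[OF op bd v]]]) simp
 have "L2_norm W (\<lambda>x. \<Phi> n x - w x) = L2_norm W (\<lambda>x. \<Phi> n x - v x)" for n
 proof -
  have \<Phi>m: "\<Phi> n \<in> meas W" using test_L2[OF op bd \<Phi>(1)[of n]] by (simp add: L2_def)
  have "AE x in lebesgue_on W. \<Phi> n x - w x = \<Phi> n x - v x" using AE by eventually_elim simp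
  thus ?thesis
  unfolding L2_norm_def using \<Phi>m w vm by (intro arg_cong[where f = sqrt] L2_inner_cong[OF op bd]) auto
 qed
 thus "L2_lim W \<Phi> w" using \<Phi>(2) by simp
qed (use \<Phi> in auto)
qed

lemma norm_outer: "norm (outer e d) = norm e * norm d"
proof -
have "outer e d \<bullet> outer e d = (e \<bullet> e) * (d \<bullet> d)"
 unfolding inner_matrix inner_vec_def sum_product by (intro sum.cong refl) (simp add: outer_def mult_ac)
thus ?thesis by (simp add: norm_eq_sqrt_inner real_sqrt_mult)
qed

definition bub :: "'a::euclidean_space set \<Rightarrow> 'a set \<Rightarrow> 'a \<Rightarrow> real" where
"bub S K x = (\<Prod>p\<in>S. lam K p x)"

definition bub_grad :: "(real^'n) set \<Rightarrow> (real^'n) set \<Rightarrow> real^'n \<Rightarrow> real^'n" where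
"bub_grad S K = (SOME D. (\<forall>j. (\<lambda>x. D x $ j) \<in> polys (card S)) \<and> (\<forall>x. (bub S K has_derivative (\<lambda>h. D x \<bullet> h)) (at x)))"

lemma bub_polys: assumes "finite S" shows "bub S K \<in> polys (card S)"
proof -
have "lam K p = (\<lambda>x. (1 - hgrad K p \<bullet> p) + hgrad K p \<bullet> x)" for p by (simp add: lam_def inner_diff_right fun_eq_iff)
hence "lam K p \<in> polys 1" for p using polys_affine by metis
from polys_prod[OF assms, of "lam K" "\<lambda>_. 1"] this have "(\<lambda>x. \<Prod>p\<in>S. lam K p x) \<in> polys (card S)" by simp
moreover have "bub S K = (\<lambda>x. \<Prod>p\<in>S. lam K p x)" by (simp add: bub_def fun_eq_iff)
ultimately show ?thesis by simp
qed

lemma bub_grad: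
assumes "finite S"
shows "(\<lambda>x. bub_grad S K x $ j) \<in> polys (card S)" "(bub S K has_derivative (\<lambda>h. bub_grad S K x \<bullet> h)) (at x)"
proof -
obtain D where D: "\<And>j. D j \<in> polys (card S)" "\<And>x. (bub S K has_derivative (\<lambda>h. \<Sum>j\<in>UNIV. D j x * h $ j)) (at x)"
 using polys_has_derivative[OF bub_polys[OF assms]] by blast
have "\<exists>D. (\<forall>j. (\<lambda>x. D x $ j) \<in> polys (card S)) \<and> (\<forall>x. (bub S K has_derivative (\<lambda>h. D x \<bullet> h)) (at x))"
 using D by (intro exI[of _ "\<lambda>x. \<chi> j. D j x"]) (simp add: inner_vec_def)
from someI_ex[OF this] show "(\<lambda>x. bub_grad S K x $ j) \<in> polys (card S)"
 "(bub S K has_derivative (\<lambda>h. bub_grad S K x \<bullet> h)) (at x)" unfolding bub_grad_def[symmetric] by blast+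
qed

lemma bub_grad_continuous: assumes "finite S" shows "continuous_on T (bub_grad S K)"
proof -
have "continuous_on T (\<lambda>x. \<chi> j. bub_grad S K x $ j)"
 by (intro continuous_on_vec_lambda polys_continuous_on[OF bub_grad(1)[OF assms]])
thus ?thesis by simp
qed

section \<open>Bubbles as finite element functions\<close>

context fe_mesh
begin

text \<open>The product of the hat functions of the vertices in \<open>S\<close>. The choice of the
  cell is immaterial by \<open>bubble_cell\<close>; the support consists of the cells that have
  \<open>S\<close> among their vertices.\<close>

definition bubble :: "(real^'n) set \<Rightarrow> real^'n \<Rightarrow> real" where
"bubble S x = (if \<exists>K\<in>\<tau>. x \<in> K \<and> S \<subseteq> verts K then bub S (SOME K. K \<in> \<tau> \<and> x \<in> K \<and> S \<subseteq> verts K) x else 0)"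

definition bubble_grad :: "(real^'n) set \<Rightarrow> real^'n \<Rightarrow> real^'n" where
"bubble_grad S x = (\<Sum>K\<in>{K\<in>\<tau>. S \<subseteq> verts K}. indicator (interior K) x *\<^sub>R bub_grad S K x)"

text \<open>Two cells at \<open>x\<close> have the same coordinates there for shared vertices. If a
  vertex of \<open>S\<close> is missing in \<open>K\<close>, its coordinate in the other cell is
  zero at \<open>x\<close>, and so is the product.\<close>

lemma bubble_cell:
assumes K: "K \<in> \<tau>" and x: "x \<in> K"
shows "bubble S x = (if S \<subseteq> verts K then bub S K x else 0)"
proof (cases "\<exists>K\<in>\<tau>. x \<in> K \<and> S \<subseteq> verts K")
case True
define K' where "K' = (SOME K. K \<in> \<tau> \<and> x \<in> K \<and> S \<subseteq> verts K)"
have "K' \<in> \<tau> \<and> x \<in> K' \<and> S \<subseteq> verts K'" unfolding K'_def by (rule someI_ex) (use True in blast)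
hence K': "K' \<in> \<tau>" "x \<in> K'" "S \<subseteq> verts K'" by auto
have w: "bubble S x = bub S K' x" using True by (simp add: bubble_def K'_def)
show ?thesis
proof (cases "S \<subseteq> verts K")
 case True
 have "bub S K' x = bub S K x"
  unfolding bub_def using lam_common[OF K'(1) K K'(2) x] subsetD[OF K'(3)] subsetD[OF True] by (intro prod.cong) auto
 thus ?thesis using w True by simp
next
 case False
 then obtain p where p: "p \<in> S" "p \<notin> verts K" by blast
 have "lam K' p x = 0" using lam_common[OF K'(1) K K'(2) x] K'(3) p by auto
 hence "bub S K' x = 0" unfolding bub_def using p(1) finite_subset[OF K'(3) verts_finite[OF K'(1)]] by (auto intro: prod_zero)
 thus ?thesis using w False by simp
qed
qed (use K x in \<open>auto simp: bubble_def\<close>)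

lemma bubble_outside: "x \<notin> closure W \<Longrightarrow> bubble S x = 0"
using Union_\<tau> by (auto simp: bubble_def)

lemma bubble_bounds: "0 \<le> bubble S x" "bubble S x \<le> 1"
proof -
have "0 \<le> bubble S x \<and> bubble S x \<le> 1"
proof (cases "x \<in> closure W")
 case True
 then obtain K where K: "K \<in> \<tau>" "x \<in> K" using Union_\<tau> by blast
 have "0 \<le> bub S K x \<and> bub S K x \<le> 1" if "S \<subseteq> verts K"
  unfolding bub_def using lam_nonneg[OF K(1) _ K(2)] lam_le_1[OF K(1) _ K(2)] that
  by (intro conjI prod_nonneg prod_le_1) auto
 thus ?thesis by (simp add: bubble_cell[OF K])
qed (simp add: bubble_outside)
thus "0 \<le> bubble S x" "bubble S x \<le> 1" by auto
qed

lemma bubble_grad_cell: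
assumes K: "K \<in> \<tau>" and x: "x \<in> interior K"
shows "bubble_grad S x = (if S \<subseteq> verts K then bub_grad S K x else 0)"
proof -
have "bubble_grad S x = (\<Sum>K'\<in>{K\<in>\<tau>. S \<subseteq> verts K}. if K' = K then bub_grad S K x else 0)"
 unfolding bubble_grad_def using interior_disjoint[OF K _ x] x by (intro sum.cong) (auto simp: indicator_def)
also have "\<dots> = (if S \<subseteq> verts K then bub_grad S K x else 0)" using K finite_\<tau> by (subst sum.delta) auto
finally show ?thesis .
qed

lemma bubble_grad_outside: "x \<notin> closure W \<Longrightarrow> bubble_grad S x = 0"
unfolding bubble_grad_def using cell_interior_subset closure_subset[of W]
by (intro sum.neutral) (auto simp: indicator_def)

lemma bubble_grad_bound:
assumes S: "finite S"
shows "\<exists>B\<ge>0. (\<forall>K\<in>\<tau>. \<forall>x\<in>K. norm (bub_grad S K x) \<le> B) \<and> (\<forall>x. norm (bubble_grad S x) \<le> B)"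
proof -
have "\<forall>K\<in>\<tau>. \<exists>b\<ge>0. \<forall>x\<in>K. norm (bub_grad S K x) \<le> b"
proof
 fix K assume "K \<in> \<tau>"
 hence "bounded (bub_grad S K ` K)"
  by (intro compact_imp_bounded compact_continuous_image bub_grad_continuous[OF S] cell_compact)
 thus "\<exists>b\<ge>0. \<forall>x\<in>K. norm (bub_grad S K x) \<le> b" unfolding bounded_pos by (auto intro: less_imp_le)
qed
from bchoice[OF this] obtain b where b: "\<And>K. K \<in> \<tau> \<Longrightarrow> b K \<ge> 0" "\<And>K x. \<lbrakk>K \<in> \<tau>; x \<in> K\<rbrakk> \<Longrightarrow> norm (bub_grad S K x) \<le> b K" by blast
have le: "b K \<le> sum b \<tau>" if "K \<in> \<tau>" for K using b(1) that finite_\<tau> by (intro member_le_sum) auto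
have 1: "norm (bub_grad S K x) \<le> sum b \<tau>" if "K \<in> \<tau>" "x \<in> K" for K x using b(2)[OF that] le[OF that(1)] by linarith
have B0: "0 \<le> sum b \<tau>" using b(1) by (intro sum_nonneg)
have "norm (bubble_grad S x) \<le> sum b \<tau>" for x
proof (cases "\<exists>K\<in>\<tau>. x \<in> interior K")
 case True
 then obtain K where K: "K \<in> \<tau>" "x \<in> interior K" by blast
 show ?thesis using bubble_grad_cell[OF K, of S] 1[OF K(1), of x] K(2) interior_subset[of K] B0 by auto
next
 case False
 hence "bubble_grad S x = 0" unfolding bubble_grad_def by (intro sum.neutral) (auto simp: indicator_def)
 thus ?thesis using B0 by simp
qed
thus ?thesis using 1 B0 by blast
qed

text \<open>The set \<open>S\<close> consists of the vertices of the face with \<open>x0\<close> in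
  its relative interior. Hence every cell of the bubble's support contains \<open>x0\<close>, which
  ties the support to the neighbourhood of one point.\<close>

lemma carrier_cell:
assumes K0: "K0 \<in> \<tau>" and x0: "x0 \<in> K0" and S: "S = {p\<in>verts K0. 0 < lam K0 p x0}" and K: "K \<in> \<tau>" "S \<subseteq> verts K"
shows "x0 \<in> K" "p \<in> verts K \<Longrightarrow> p \<notin> S \<Longrightarrow> lam K p x0 = 0" "S \<noteq> {}"
proof -
have z: "lam K0 p x0 = 0" if "p \<in> verts K0 - S" for p using lam_nonneg[OF K0 _ x0, of p] that by (auto simp: S)
have sub: "S \<subseteq> verts K0" by (auto simp: S)
have 1: "(\<Sum>p\<in>S. lam K0 p x0) = 1"
 using sum.mono_neutral_left[OF verts_finite[OF K0] sub, of "\<lambda>p. lam K0 p x0"] z lam_sum(1)[OF K0, of x0] by auto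
have 2: "(\<Sum>p\<in>S. lam K0 p x0 *\<^sub>R p) = x0"
 using sum.mono_neutral_left[OF verts_finite[OF K0] sub, of "\<lambda>p. lam K0 p x0 *\<^sub>R p"] z lam_sum(2)[OF K0, of x0] by auto
show "S \<noteq> {}" using 1 by auto
have l: "lam K p x0 = (if p \<in> S then lam K0 p x0 else 0)" if "p \<in> verts K" for p
 using lam_coeff[OF K 1 that] unfolding 2 .
thus "p \<in> verts K \<Longrightarrow> p \<notin> S \<Longrightarrow> lam K p x0 = 0" by simp
show "x0 \<in> K" unfolding lam_mem_iff[OF K(1)] using l by (auto simp: S)
qed

text \<open>Where the bubble is nonzero, all coordinates of \<open>S\<close> are positive and the
  others are zero at \<open>x0\<close>, so the segment from \<open>x0\<close> to \<open>y\<close>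
  can be prolonged inside the cell. Then \<open>segment_in_W\<close> places \<open>y\<close> in the
  open domain.\<close>

lemma bubble_outside_W:
assumes K0: "K0 \<in> \<tau>" and x0: "x0 \<in> K0" "x0 \<in> W" and S: "S = {p\<in>verts K0. 0 < lam K0 p x0}" and y: "y \<notin> W"
shows "bubble S y = 0"
proof (rule ccontr)
assume ne: "bubble S y \<noteq> 0"
hence "y \<in> \<Union>\<tau>" using bubble_outside Union_\<tau> by blast
then obtain K where K: "K \<in> \<tau>" "y \<in> K" by blast
hence SK: "S \<subseteq> verts K" and bne: "bub S K y \<noteq> 0" using ne bubble_cell[OF K] by (auto split: if_splits)
have fS: "finite S" using finite_subset[OF SK verts_finite[OF K(1)]] .
note c = carrier_cell[OF K0 x0(1) S K(1) SK]
have pos: "0 < lam K p y" if "p \<in> S" for p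
proof -
 have "lam K p y \<noteq> 0" using bne fS that unfolding bub_def by (auto simp: prod_zero_iff)
 thus ?thesis using lam_nonneg[OF K(1) _ K(2), of p] that SK by auto
qed
\<comment> \<open>Prolonging by the fraction \<open>d\<close> lowers a coordinate of
  \<open>S\<close> by at most \<open>d\<close>, so it remains nonnegative.\<close>
define d where "d = Min ((\<lambda>p. lam K p y) ` S)"
have d: "d > 0" "\<And>p. p \<in> S \<Longrightarrow> d \<le> lam K p y" using pos fS c(3) by (auto simp: d_def)
define y' where "y' = y + d *\<^sub>R (y - x0)"
have "y' \<in> K"
 unfolding lam_mem_iff[OF K(1)]
proof
 fix p assume p: "p \<in> verts K"
 have e: "lam K p y' = lam K p y + d * (lam K p y - lam K p x0)"
  by (simp add: lam_def y'_def inner_diff_right inner_add_right algebra_simps)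
 show "0 \<le> lam K p y'"
 proof (cases "p \<in> S")
  case True
  have "d * lam K p x0 \<le> d * 1" using d lam_le_1[OF K(1) p c(1)] by (intro mult_left_mono) auto
  moreover have "0 \<le> d * lam K p y" using d pos[OF True] by simp
  ultimately show ?thesis using d(2)[OF True] e by (simp add: algebra_simps)
 next
  case False
  hence "lam K p x0 = 0" using c(2) p by simp
  thus ?thesis using e d lam_nonneg[OF K(1) p K(2)] by simp
 qed
qed
moreover have "y \<in> open_segment x0 y'"
proof -
 have "y \<noteq> x0" using y x0 by auto
 have "x0 \<noteq> y'"
 proof
  assume "x0 = y'"
  hence "(1 + d) *\<^sub>R (y - x0) = 0" by (simp add: y'_def algebra_simps)
  thus False using d \<open>y \<noteq> x0\<close> by simp
 qed
 moreover have "y = (1 - 1 / (1 + d)) *\<^sub>R x0 + (1 / (1 + d)) *\<^sub>R y'"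
 proof -
  have "(1 - 1 / (1 + d)) *\<^sub>R x0 + (1 / (1 + d)) *\<^sub>R y' = x0 + (1 / (1 + d)) *\<^sub>R (y' - x0)" by (simp add: algebra_simps)
  also have "y' - x0 = (1 + d) *\<^sub>R (y - x0)" by (simp add: y'_def algebra_simps)
  finally show ?thesis using d by simp
 qed
 ultimately show ?thesis using d unfolding in_segment by (intro conjI exI[of _ "1 / (1 + d)"]) auto
qed
ultimately have "y \<in> W" using segment_in_W[OF K(1) x0(2) c(1)] by blast
thus False using y by simp
qed

text \<open>Along any segment the closed cells and the complement of \<open>W\<close> form a finite
  closed cover, and on each of these sets the same Lipschitz constant holds. Local bounds therefore
  chain to a global one, although \<open>W\<close> need not be convex.\<close>

lemma bubble_lipschitz:
assumes S: "finite S" and out: "\<And>x. x \<notin> W \<Longrightarrow> bubble S x = 0"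
shows "\<exists>L. L-lipschitz_on UNIV (bubble S)"
proof -
obtain B where B: "B \<ge> 0" "\<And>K x. \<lbrakk>K \<in> \<tau>; x \<in> K\<rbrakk> \<Longrightarrow> norm (bub_grad S K x) \<le> B"
 using bubble_grad_bound[OF S] by blast
have cell: "\<bar>bubble S x - bubble S y\<bar> \<le> B * norm (x - y)" if A: "A \<in> insert (- W) \<tau>" and xy: "x \<in> A" "y \<in> A" for A x y
proof (cases "A \<in> \<tau> \<and> S \<subseteq> verts A")
 case True
 have "norm (bub S A x - bub S A y) \<le> B * norm (x - y)"
 proof (rule differentiable_bound[OF cell_convex])
  show "A \<in> \<tau>" using True by simp
  show "(bub S A has_derivative (\<lambda>h. bub_grad S A z \<bullet> h)) (at z within A)" for z
  using bub_grad(2)[OF S] by (rule has_derivative_at_withinI)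
  show "onorm (\<lambda>h. bub_grad S A z \<bullet> h) \<le> B" if "z \<in> A" for z
  using B(2)[OF _ that] True
  by (intro onorm_le) (metis Cauchy_Schwarz_ineq2 order.trans mult_right_mono norm_ge_zero real_norm_def)
 qed (use xy in auto)
 moreover have "bubble S x = bub S A x" "bubble S y = bub S A y" using True xy by (auto simp: bubble_cell)
 ultimately show ?thesis by simp
next
 case False
 have "bubble S z = 0" if "z \<in> A" for z
 proof (cases "A \<in> \<tau>")
  case True
  thus ?thesis using bubble_cell[OF True that, of S] False by simp
 next
  case False
  thus ?thesis using A that out by auto
 qed
 hence "bubble S x = 0" "bubble S y = 0" using xy by auto
 thus ?thesis using B by simp
qed
have "B-lipschitz_on UNIV (bubble S)"
proof (rule lipschitz_onI[OF _ B(1)])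
 fix x y :: "real^'n"
 define l where "l t = x + t *\<^sub>R (y - x)" for t :: real
 have ll: "norm (l s - l t) = norm (y - x) * dist s t" for s t
  by (simp add: l_def dist_norm algebra_simps flip: scaleR_diff_left scaleR_diff_right)
 have "lipschitz_on (B * norm (y - x)) {0..1} (\<lambda>t. bubble S (l t))"
 proof (rule lipschitz_on_closed_Union[where I = "insert (- W) \<tau>" and U = "\<lambda>A. l -` A"])
  fix A assume A: "A \<in> insert (- W) \<tau>"
  show "lipschitz_on (B * norm (y - x)) (l -` A) (\<lambda>t. bubble S (l t))"
  proof (rule lipschitz_onI)
  fix s t assume "s \<in> l -` A" "t \<in> l -` A"
  hence "\<bar>bubble S (l s) - bubble S (l t)\<bar> \<le> B * norm (l s - l t)" using cell[OF A] by auto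
  thus "dist (bubble S (l s)) (bubble S (l t)) \<le> B * norm (y - x) * dist s t" by (simp add: ll dist_real_def)
  qed (use B in auto)
  have "closed A" using A op cell_compact by (auto intro: compact_imp_closed)
  moreover have "continuous_on UNIV l" unfolding l_def by (intro continuous_intros)
  ultimately show "closed (l -` A)" using continuous_closed_vimage continuous_on_eq_continuous_at by blast
 next
  show "{0..1} \<subseteq> (\<Union>A\<in>insert (- W) \<tau>. l -` A)"
  proof
  fix t
  have "l t \<in> \<Union>\<tau> \<or> l t \<in> - W" unfolding Union_\<tau> using closure_subset by blast
  thus "t \<in> (\<Union>A\<in>insert (- W) \<tau>. l -` A)" by auto
  qed
 qed (use finite_\<tau> B in auto)
 from lipschitz_onD[OF this, of 0 1] show "dist (bubble S x) (bubble S y) \<le> B * dist x y"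
  by (simp add: l_def dist_norm norm_minus_commute dist_real_def)
qed
thus ?thesis ..
qed

lemma AE_off_skeleton: "AE x in lebesgue. (\<exists>K\<in>\<tau>. x \<in> interior K) \<or> x \<notin> closure W"
using skeleton_negligible by eventually_elim (use Union_\<tau> in blast)

text \<open>Off the skeleton the bubble locally equals one polynomial or zero, which gives
  derivatives and their continuity. The condition at zeros holds because the bubble is positive
  inside the cells of its support.\<close>

lemma bubble_H10:
assumes S: "finite S" and out: "\<And>x. x \<notin> W \<Longrightarrow> bubble S x = 0"
shows "(\<lambda>x. bubble S x *\<^sub>R e) \<in> H10 W" "is_weak_grad W (\<lambda>x. bubble S x *\<^sub>R e) (\<lambda>x. outer e (bubble_grad S x))"
proof -
obtain L where L: "L-lipschitz_on UNIV (bubble S)" using bubble_lipschitz[OF S out] by blast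
obtain B where B: "\<And>x. norm (bubble_grad S x) \<le> B" using bubble_grad_bound[OF S] by blast
have near: "eventually (\<lambda>y. bubble S y = (if S \<subseteq> verts K then bub S K y else 0) \<and> bubble_grad S y = (if S \<subseteq> verts K then bub_grad S K y else 0)) (nhds x)"
 if "K \<in> \<tau>" "x \<in> interior K" for K x
 using eventually_nhds_in_open[OF open_interior that(2)]
 by eventually_elim (use that(1) bubble_cell bubble_grad_cell interior_subset in \<open>blast\<close>)
have far: "eventually (\<lambda>y. bubble S y = 0 \<and> bubble_grad S y = 0) (nhds x)" if "x \<notin> closure W" for x
proof -
 have "eventually (\<lambda>y. y \<in> - closure W) (nhds x)" using that by (intro eventually_nhds_in_open) auto
 thus ?thesis by eventually_elim (simp add: bubble_outside bubble_grad_outside)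
qed
have der: "(bubble S has_derivative (\<lambda>h. bubble_grad S x \<bullet> h)) (at x) \<and> isCont (bubble_grad S) x \<and> (bubble S x = 0 \<longrightarrow> bubble_grad S x = 0)"
 if x: "(\<exists>K\<in>\<tau>. x \<in> interior K) \<or> x \<notin> closure W" for x
proof -
 have *: ?thesis if e: "eventually (\<lambda>y. bubble S y = f y \<and> bubble_grad S y = g y) (nhds x)"
  and f: "(f has_derivative (\<lambda>h. g x \<bullet> h)) (at x)" and g: "isCont g x" and z: "f x = 0 \<longrightarrow> g x = 0" for f g
 proof -
  have x: "bubble S x = f x" "bubble_grad S x = g x" using eventually_nhds_x_imp_x[OF e] by auto
  have "(bubble S has_derivative (\<lambda>h. g x \<bullet> h)) (at x)"
  by (rule has_derivative_transform_eventually[OF f]) (use e x in \<open>auto simp: eventually_at_filter elim: eventually_mono\<close>)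
  moreover have "isCont (bubble_grad S) x"
  using isCont_cong[OF eventually_mono[OF e], where f = "bubble_grad S" and g = g] g by simp
  ultimately show ?thesis using x z by simp
 qed
 from x show ?thesis
 proof
  assume "\<exists>K\<in>\<tau>. x \<in> interior K"
  then obtain K where K: "K \<in> \<tau>" "x \<in> interior K" by blast
  show ?thesis
  proof (cases "S \<subseteq> verts K")
  case True
  have "bub S K x > 0" unfolding bub_def using lam_pos_interior[OF K(1) _ K(2)] True by (intro prod_pos) auto
  moreover have "isCont (bub_grad S K) x" using bub_grad_continuous[OF S, of UNIV] by (simp add: continuous_on_eq_continuous_at)
  ultimately show ?thesis using near[OF K] True by (intro *[where f = "bub S K" and g = "bub_grad S K"] bub_grad(2)[OF S]) auto
  next
  case False
  thus ?thesis using near[OF K] by (intro *[where f = "\<lambda>_. 0" and g = "\<lambda>_. 0"]) auto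
  qed
 next
  assume "x \<notin> closure W"
  from far[OF this] show ?thesis by (intro *[where f = "\<lambda>_. 0" and g = "\<lambda>_. 0"]) auto
 qed
qed
have m: "bubble_grad S \<in> borel_measurable lebesgue"
proof -
 have "bub_grad S K \<in> borel_measurable borel" for K
  by (intro borel_measurable_continuous_onI bub_grad_continuous[OF S])
 hence "bubble_grad S \<in> borel_measurable borel" unfolding bubble_grad_def
  by (intro borel_measurable_sum borel_measurable_scaleR borel_measurable_indicator) auto
 thus ?thesis by (simp add: measurable_completion)
qed
have AEs: "AE x in lebesgue. (bubble S has_derivative (\<lambda>h. bubble_grad S x \<bullet> h)) (at x)"
 "AE x in lebesgue. isCont (bubble_grad S) x" "AE x in lebesgue. bubble S x = 0 \<longrightarrow> bubble_grad S x = 0"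
 using AE_off_skeleton der by (auto elim!: eventually_mono)
note H = lipschitz_H10[OF op bd L bubble_bounds(1) out AEs m B]
show "(\<lambda>x. bubble S x *\<^sub>R e) \<in> H10 W" "is_weak_grad W (\<lambda>x. bubble S x *\<^sub>R e) (\<lambda>x. outer e (bubble_grad S x))"
 using H by auto
qed

text \<open>A constant direction makes the scalar bubble vector-valued; setting it to zero on the
  skeleton yields the representative demanded by \<open>pw_polys\<close>.\<close>

definition fe_bubble :: "(real^'n) set \<Rightarrow> real^'n \<Rightarrow> real^'n \<Rightarrow> real^'n" where
"fe_bubble S e x = (if x \<in> (\<Union>K\<in>\<tau>. interior K) then bubble S x *\<^sub>R e else 0)"

lemma fe_bubble_Xh:
assumes S: "finite S" "card S \<le> s" and out: "\<And>x. x \<notin> W \<Longrightarrow> bubble S x = 0"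
shows "fe_bubble S e \<in> Xh W s \<tau>" "AE x in lebesgue_on W. grad W (fe_bubble S e) x = outer e (bubble_grad S x)"
proof -
obtain L where "L-lipschitz_on UNIV (bubble S)" using bubble_lipschitz[OF S(1) out] by blast
from lipschitz_on_continuous_on[OF this] have cont: "continuous_on UNIV (bubble S)" .
have bm: "bubble S \<in> borel_measurable borel" using cont by (rule borel_measurable_continuous_onI)
have wm: "(\<lambda>x. bubble S x *\<^sub>R e) \<in> meas W"
 using bm by (intro measurable_on_W[OF op bd] measurable_completion) auto
have fb: "fe_bubble S e \<in> borel_measurable borel"
proof -
 have "open (\<Union>K\<in>\<tau>. interior K)" by blast
 hence [measurable]: "(\<Union>K\<in>\<tau>. interior K) \<in> sets borel" by (rule borel_open)
 note bm [measurable]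
 show ?thesis unfolding fe_bubble_def by measurable
qed
have fm: "fe_bubble S e \<in> meas W"
 using fb by (intro measurable_on_W[OF op bd] measurable_completion) auto
have eq: "AE x in lebesgue_on W. bubble S x *\<^sub>R e = fe_bubble S e x"
 by (rule AE_on_cells) (auto simp: fe_bubble_def)
have H: "fe_bubble S e \<in> H10 W" by (rule H10_cong[OF op bd bubble_H10(1)[OF S(1) out] fm eq])
have gm: "(\<lambda>x. outer e (bubble_grad S x)) \<in> meas W"
 using bubble_H10(2)[OF S(1) out, of e] by (simp add: is_weak_grad_def L2_def)
have "is_weak_grad W (fe_bubble S e) (\<lambda>x. outer e (bubble_grad S x))"
 by (rule weak_grad_cong[OF op bd eq wm fm _ gm bubble_H10(2)[OF S(1) out]]) simp
thus "AE x in lebesgue_on W. grad W (fe_bubble S e) x = outer e (bubble_grad S x)" by (rule grad_eq[OF op bd])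
have "fe_bubble S e \<in> pw_polys s \<tau>"
 unfolding pw_polys_def
proof (intro CollectI conjI ballI allI impI)
 fix K assume K: "K \<in> \<tau>"
 define p where "p x = (if S \<subseteq> verts K then bub S K x else 0) *\<^sub>R e" for x
 have "(\<lambda>x. p x \<bullet> b) \<in> polys s" for b
 proof (cases "S \<subseteq> verts K")
  case True
  have "(\<lambda>x. (e \<bullet> b) * bub S K x) \<in> polys s" by (intro polys_scale polys_mono[OF S(2)] bub_polys[OF S(1)])
  thus ?thesis using True by (simp add: p_def mult.commute)
 next
  case False
  thus ?thesis using polys_const[of 0 s] by (simp add: p_def)
 qed
 moreover have "fe_bubble S e x = p x" if "x \<in> interior K" for x
 proof -
  have "x \<in> K" using that interior_subset by blast
  thus ?thesis using K that bubble_cell[OF K, of x S] by (auto simp: fe_bubble_def p_def)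
 qed
 ultimately show "\<exists>p. (\<forall>b\<in>Basis. (\<lambda>x. p x \<bullet> b) \<in> polys s) \<and> (\<forall>x\<in>interior K. fe_bubble S e x = p x)" by blast
qed (auto simp: fe_bubble_def)
thus "fe_bubble S e \<in> Xh W s \<tau>" using H by (simp add: Xh_def)
qed

end

section \<open>A lower bound for cells that carry a bubble\<close>

context regular_mesh
begin

text \<open>
The gradient of a bubble is at least of order \<open>1/d\<close> on a cell of diameter \<open>d\<close>, while its support has diameter of order \<open>d\<close>;
the inverse inequality then bounds \<open>d\<close> from below.
\<close>

lemma bubble_size:
assumes n: "CARD('n) \<ge> 2"
 and inv: "inverse_constant (polys s :: (real^'n \<Rightarrow> real) set) \<rho> C" and C: "C \<ge> 0"
 and K0: "K0 \<in> \<tau>" and x0: "x0 \<in> K0" "x0 \<in> W" and card: "card {p\<in>verts K0. 0 < lam K0 p x0} \<le> s"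
 and h: "h > 0" and fe: "\<And>v. v \<in> Xh W s \<tau> \<Longrightarrow> L2_norm W (grad W v) \<le> Ci / h * L2_norm W v"
 and N: "1 / \<rho> ^ CARD('n) \<le> real N"
shows "((1 / (1 + real CARD('n))) ^ (1 + CARD('n)) * h)\<^sup>2
 \<le> C * Ci\<^sup>2 * (unit_ball_vol (real CARD('n)) * ((1 + 1 / (2 * \<rho>)) ^ N) ^ CARD('n)) * (diameter K0)\<^sup>2"
proof -
define S where "S = {p\<in>verts K0. 0 < lam K0 p x0}"
have SK: "S \<subseteq> verts K0" by (auto simp: S_def)
have fS: "finite S" using finite_subset[OF SK verts_finite[OF K0]] .
have S0: "S \<noteq> {}" by (rule carrier_cell(3)[OF K0 x0(1) S_def K0 SK])
have out: "bubble S y = 0" if "y \<notin> W" for y by (rule bubble_outside_W[OF K0 x0 S_def that])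
have cS: "card S \<le> s" using card by (simp add: S_def)
define e where "e = (axis undefined 1 :: real^'n)"
have e: "norm e = 1" by (simp add: e_def)
note X = fe_bubble_Xh[OF fS cS out, of e]
define d where "d = diameter K0"
have d: "d > 0" using cell_diameter[OF K0] by (simp add: d_def)
\<comment> \<open>All cells of the support contain \<open>x0\<close>, so their diameters are at most
  \<open>R\<close> and the support lies in the ball of this radius around \<open>x0\<close>.\<close>
define R where "R = (1 + 1 / (2 * \<rho>)) ^ N * d"
have R: "R > 0" using d \<rho> by (simp add: R_def add_pos_pos)
have supp: "norm (fe_bubble S e x) \<le> indicator (cball x0 R) x" for x
proof (cases "fe_bubble S e x = 0")
 case False
 then obtain K where K: "K \<in> \<tau>" "x \<in> interior K" and b: "bubble S x \<noteq> 0" by (auto simp: fe_bubble_def split: if_splits)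
 have xK: "x \<in> K" using K(2) interior_subset by blast
 have "S \<subseteq> verts K" using b bubble_cell[OF K(1) xK, of S] by (auto split: if_splits)
 hence "x0 \<in> K" by (rule carrier_cell(1)[OF K0 x0(1) S_def K(1)])
 hence "diameter K \<le> R" unfolding R_def d_def by (intro cells_comparable[OF n x0(2,1) _ K0 K(1) N])
 moreover have "dist x0 x \<le> diameter K"
  using diameter_bounded_bound[OF compact_imp_bounded[OF cell_compact[OF K(1)]] \<open>x0 \<in> K\<close> xK] .
 ultimately have "x \<in> cball x0 R" by simp
 moreover have "norm (fe_bubble S e x) \<le> 1" using K e bubble_bounds[of S x] by (auto simp: fe_bubble_def)
 ultimately show ?thesis by simp
qed simp
have vL: "fe_bubble S e \<in> L2 W" using Xh_D(2)[OF X(1)] by (simp add: H1_def)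
have "(L2_norm W (fe_bubble S e))\<^sup>2 = (LINT x|lebesgue. indicator W x *\<^sub>R (fe_bubble S e x \<bullet> fe_bubble S e x))"
 unfolding L2_norm_sq[OF op bd] L2_inner_def by (rule integral_lebesgue_on(1)[OF W_lebesgue[OF op bd]])
also have "\<dots> \<le> (LINT x|lebesgue. indicator (cball x0 R) x)"
proof (rule integral_mono)
 show "integrable lebesgue (\<lambda>x. indicator W x *\<^sub>R (fe_bubble S e x \<bullet> fe_bubble S e x))"
  by (rule integral_lebesgue_on(2)[OF W_lebesgue[OF op bd], THEN iffD1]) (rule L2_inner_integrable[OF op bd vL vL])
 show "integrable lebesgue (indicator (cball x0 R) :: _ \<Rightarrow> real)"
  using lmeasurable_cball lmeasurable_iff_integrable by blast
 fix x
 have "(norm (fe_bubble S e x))\<^sup>2 \<le> (indicator (cball x0 R) x)\<^sup>2" by (intro power_mono supp) simp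
 hence "fe_bubble S e x \<bullet> fe_bubble S e x \<le> indicator (cball x0 R) x"
  by (cases "x \<in> cball x0 R") (simp_all add: power2_norm_eq_inner)
 thus "indicator W x *\<^sub>R (fe_bubble S e x \<bullet> fe_bubble S e x) \<le> indicator (cball x0 R) x"
  by (cases "x \<in> W") simp_all
qed
also have "\<dots> = unit_ball_vol (real CARD('n)) * R ^ CARD('n)" using R by (simp add: content_cball)
finally have vn: "(L2_norm W (fe_bubble S e))\<^sup>2 \<le> unit_ball_vol (real CARD('n)) * R ^ CARD('n)" .
obtain c where c: "cball c (\<rho> * diameter K0) \<subseteq> K0" using inner_ball[OF K0] by blast
define E where "E x = outer e (bub_grad S K0 x)" for x
define B where "B = L2_norm W (grad W (fe_bubble S e))"
have EB: "(norm (bub_grad S K0 x))\<^sup>2 \<le> C / d ^ CARD('n) * B\<^sup>2" if x: "x \<in> K0" for x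
proof -
 have "(norm (E x))\<^sup>2 \<le> C / diameter K0 ^ CARD('n) * (L2_norm W (grad W (fe_bubble S e)))\<^sup>2"
 proof (rule cell_inverse_estimate[OF inv \<rho> C K0 c _ grad_L2[OF op bd Xh_D(2)[OF X(1)]] _ x])
  show "(\<lambda>x. E x $ i $ j) \<in> polys s" for i j
  proof -
  have "(\<lambda>x. e $ i * bub_grad S K0 x $ j) \<in> polys s" by (intro polys_scale polys_mono[OF cS] bub_grad(1)[OF fS])
  thus ?thesis by (simp add: E_def outer_def)
  qed
  have "AE x in lebesgue. x \<in> W \<longrightarrow> grad W (fe_bubble S e) x = outer e (bubble_grad S x)"
  using X(2) by (simp add: AE_lebesgue_on[OF W_lebesgue[OF op bd]])
  thus "AE x in lebesgue. x \<in> interior K0 \<longrightarrow> grad W (fe_bubble S e) x = E x"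
  by eventually_elim (use cell_interior_subset[OF K0] SK in \<open>auto simp: E_def bubble_grad_cell[OF K0]\<close>)
 qed
 thus ?thesis by (simp add: E_def norm_outer e d_def B_def)
qed
define G where "G = sqrt (C / d ^ CARD('n) * B\<^sup>2)"
have G2: "G\<^sup>2 = C / d ^ CARD('n) * B\<^sup>2" using C d by (simp add: G_def)
have G: "norm (bub_grad S K0 x) \<le> G" if "x \<in> K0" for x
 unfolding G_def using EB[OF that] by (rule real_le_rsqrt)
have "G \<ge> 0" using C d by (simp add: G_def)
obtain p where p: "p \<in> S" using S0 by blast
obtain q where q: "q \<in> verts K0" "q \<noteq> p" using other_vertex[OF K0] by blast
\<comment> \<open>At the barycentre of the face the bubble has the value
  \<open>(1 / card S) ^ card S\<close>; at a vertex \<open>q\<close> other than \<open>p\<close> the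
  factor of \<open>p\<close> vanishes. The mean value theorem between them bounds the gradient
  below.\<close>
define b where "b = (\<Sum>r\<in>S. (1 / real (card S)) *\<^sub>R r)"
have cS0: "card S > 0" using fS S0 by (simp add: card_gt_0_iff)
have s1: "(\<Sum>r\<in>S. 1 / real (card S)) = 1" using cS0 by simp
have lb: "lam K0 r b = (if r \<in> S then 1 / real (card S) else 0)" if "r \<in> verts K0" for r
 unfolding b_def by (rule lam_coeff[OF K0 SK s1 that])
have bK: "b \<in> K0" unfolding lam_mem_iff[OF K0] using lb by auto
have qK: "q \<in> K0" using q verts_subset[OF K0] by blast
have bub_b: "bub S K0 b = (1 / real (card S)) ^ card S"
proof -
 have "bub S K0 b = (\<Prod>r\<in>S. 1 / real (card S))" unfolding bub_def using lb SK by (intro prod.cong) auto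
 thus ?thesis by simp
qed
have bub_q: "bub S K0 q = 0" unfolding bub_def
 using lam_vertex[OF K0 _ q(1), of p] p q(2) SK fS by (auto intro!: prod_zero)
have "norm (bub S K0 b - bub S K0 q) \<le> G * norm (b - q)"
proof (rule differentiable_bound[OF cell_convex[OF K0]])
 show "(bub S K0 has_derivative (\<lambda>h. bub_grad S K0 z \<bullet> h)) (at z within K0)" for z
  using bub_grad(2)[OF fS] by (rule has_derivative_at_withinI)
 show "onorm (\<lambda>h. bub_grad S K0 z \<bullet> h) \<le> G" if "z \<in> K0" for z
  using G[OF that]
  by (intro onorm_le) (metis Cauchy_Schwarz_ineq2 order.trans mult_right_mono norm_ge_zero real_norm_def)
qed (use bK qK in auto)
moreover have "norm (b - q) \<le> d"
 using diameter_bounded_bound[OF compact_imp_bounded[OF cell_compact[OF K0]] bK qK] by (simp add: d_def dist_norm)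
ultimately have "(1 / real (card S)) ^ card S \<le> G * d"
 using bub_b bub_q mult_left_mono[OF _ \<open>G \<ge> 0\<close>, of "norm (b - q)" d] by simp
\<comment> \<open>A bound in terms of the dimension only, as a face of a simplex has at most
  \<open>1 + CARD('n)\<close> vertices.\<close>
moreover have "(1 / (1 + real CARD('n))) ^ (1 + CARD('n)) \<le> (1 / real (card S)) ^ card S"
proof -
 have cS1: "card S \<le> 1 + CARD('n)" using card_mono[OF verts_finite[OF K0] SK] verts_card[OF K0] by simp
 have "(1 / (1 + real CARD('n))) ^ (1 + CARD('n)) \<le> (1 / (1 + real CARD('n))) ^ card S"
  using cS1 by (intro power_decreasing) auto
 also have "\<dots> \<le> (1 / real (card S)) ^ card S"
  using cS1 cS0 by (intro power_mono divide_left_mono) auto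
 finally show ?thesis .
qed
ultimately have "((1 / (1 + real CARD('n))) ^ (1 + CARD('n)) * h)\<^sup>2 \<le> (G * d * h)\<^sup>2"
 using h by (intro power_mono mult_right_mono) auto
also have "\<dots> = C / d ^ CARD('n) * (B * h)\<^sup>2 * d\<^sup>2" by (simp add: power_mult_distrib G2 mult_ac)
\<comment> \<open>The inverse inequality replaces the gradient by the bubble, whose squared norm is
  at most the volume of the supporting ball, a multiple of \<open>d ^ CARD('n)\<close>. This power
  cancels the one of the cell estimate and leaves \<open>d^2\<close>.\<close>
also have "\<dots> \<le> C / d ^ CARD('n) * (Ci\<^sup>2 * (unit_ball_vol (real CARD('n)) * R ^ CARD('n))) * d\<^sup>2"
proof -
 have "B * h \<le> Ci * L2_norm W (fe_bubble S e)" using fe[OF X(1)] h by (simp add: B_def field_simps)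
 moreover have "0 \<le> B * h" using h by (simp add: B_def L2_norm_nonneg[OF op bd])
 ultimately have "(B * h)\<^sup>2 \<le> (Ci * L2_norm W (fe_bubble S e))\<^sup>2" by (rule power_mono)
 also have "\<dots> \<le> Ci\<^sup>2 * (unit_ball_vol (real CARD('n)) * R ^ CARD('n))"
  unfolding power_mult_distrib by (intro mult_left_mono vn) simp
 finally show ?thesis using C d by (intro mult_right_mono mult_left_mono) auto
qed
also have "\<dots> = C * Ci\<^sup>2 * (unit_ball_vol (real CARD('n)) * ((1 + 1 / (2 * \<rho>)) ^ N) ^ CARD('n)) * d\<^sup>2"
 using d by (simp add: R_def power_mult_distrib)
finally show ?thesis by (simp add: d_def)
qed

end

section \<open>Cells on which finite element functions do not vanish\<close>

context fe_mesh
begin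

text \<open>The domain equals the interior of its closure, so a point of a cell that is not in
  \<open>W\<close> is a limit of points outside the closure. The Lipschitz bound against those
  passes to the limit and forces the polynomial to vanish there.\<close>

lemma cell_poly_vanishes:
assumes v: "v \<in> Xh W s \<tau>" and K: "K \<in> \<tau>" and p: "cell_poly s K v p D" and y: "y \<in> K" "y \<notin> W"
shows "p y $ i = 0"
proof -
obtain B where B: "B \<ge> 0" "AE x in lebesgue_on W. norm (grad W v x) \<le> B" using grad_bounded[OF v] by blast
have y': "y \<in> closure (- closure W)" using y(2) interior_closure_W by (simp add: closure_complement)
have 1: "\<bar>p z $ i\<bar> - B * norm (z - y) \<le> 0" if z: "z \<in> interior K" for z
proof -
 have vz: "v z = p z" by (rule cell_polyD(4)[OF p z])
 have "\<bar>p z $ i\<bar> \<le> B * norm (z - y)"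
 proof (rule field_le_epsilon)
  fix e :: real assume e: "e > 0"
  have "e / (B + 1) > 0" using e B by simp
  then obtain a where a: "a \<in> - closure W" "dist a y < e / (B + 1)" using y' by (meson closure_approachable)
  have "\<bar>v z $ i\<bar> \<le> B * norm (z - a)" using Xh_lipschitz(2)[OF v B(2,1), of z a i] z K a(1) by blast
  also have "norm (z - a) \<le> norm (z - y) + norm (a - y)" using norm_triangle_ineq4[of "z - y" "a - y"] by simp
  also have "B * (norm (z - y) + norm (a - y)) \<le> B * norm (z - y) + B * (e / (B + 1))"
  unfolding distrib_left using a(2) B(1) by (intro add_left_mono mult_left_mono) (auto simp: dist_norm)
  also have "B * (e / (B + 1)) \<le> e" using B e by (simp add: field_simps)
  finally show "\<bar>p z $ i\<bar> \<le> B * norm (z - y) + e" using vz B(1) by (simp add: mult_left_mono)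
 qed
 thus ?thesis by simp
qed
have "y \<in> closure (interior K)"
 using y(1) convex_closure_interior[OF cell_convex[OF K] cell_interior[OF K]] closure_subset by blast
have "\<bar>p y $ i\<bar> - B * norm (y - y) \<le> 0"
proof (rule continuous_le_on_closure[OF _ \<open>y \<in> closure (interior K)\<close>, where f = "\<lambda>z. \<bar>p z $ i\<bar> - B * norm (z - y)"])
 show "continuous_on (closure (interior K)) (\<lambda>z. \<bar>p z $ i\<bar> - B * norm (z - y))"
  by (intro continuous_intros polys_continuous_on[OF cell_polyD(1)[OF p]])
qed (rule 1)
thus ?thesis by simp
qed

lemma Xh_degree_zero: "v \<in> Xh W 0 \<tau> \<Longrightarrow> v = 0"
proof (rule Xh_grad_zero)
assume v: "v \<in> Xh W 0 \<tau>"
show "AE x in lebesgue_on W. grad W v x = 0"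
proof (rule AE_on_cells)
 fix K assume K: "K \<in> \<tau>"
 obtain p D where p: "cell_poly 0 K v p D" using cell_poly_exists[OF Xh_D(3)[OF v] K] by blast
 have c: "p x $ i = p 0 $ i" for x i
 proof -
  obtain q where q: "degree q \<le> 0" "\<And>t. p (0 + t *\<^sub>R x) $ i = poly q t" using polys_on_line[OF cell_polyD(1)[OF p]] by blast
  obtain a where "q = [:a:]" using q(1) degree_eq_zeroE by auto
  thus ?thesis using q(2)[of 1] q(2)[of 0] by simp
 qed
 have "cell_poly 0 K v p (\<lambda>x. 0)"
 proof -
  have "((\<lambda>x. p x $ i) has_derivative (\<lambda>h. 0)) (at x)" for i x
  proof -
  have e: "(\<lambda>x. p x $ i) = (\<lambda>x. p 0 $ i)" using c by (intro ext)
  show ?thesis unfolding e by (rule has_derivative_const)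
  qed
  thus ?thesis using cell_polyD[OF p] polys_const[of 0 0] by (simp add: cell_poly_def)
 qed
 from cell_grad[OF Xh_D(2)[OF v] K this] show "AE x in lebesgue. x \<in> interior K \<longrightarrow> grad W v x = 0" .
qed
qed

text \<open>A line through \<open>x\<close> that meets the three edge lines in three different
  points gives three zeros of a polynomial of degree at most 2.\<close>

lemma triangle_poly_zero:
fixes P :: "real^'n \<Rightarrow> real"
assumes P: "P \<in> polys 2" and K: "K \<in> \<tau>" and n: "CARD('n) = 2"
 and edges: "\<And>p q t. \<lbrakk>p \<in> verts K; q \<in> verts K; p \<noteq> q\<rbrakk> \<Longrightarrow> P (p + t *\<^sub>R (q - p)) = 0" and x: "x \<in> interior K"
shows "P x = 0"
proof -
have "card (verts K) = 3" using verts_card[OF K] n by simp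
then obtain p0 p1 p2 where V: "verts K = {p0, p1, p2}" "p0 \<noteq> p1" "p1 \<noteq> p2" "p0 \<noteq> p2" by (auto simp: card_3_iff)
define l0 l1 l2 where "l0 = lam K p0 x" and "l1 = lam K p1 x" and "l2 = lam K p2 x"
have l: "l0 > 0" "l1 > 0" "l2 > 0" using lam_pos_interior[OF K _ x] V by (auto simp: l0_def l1_def l2_def)
have s: "l0 + l1 + l2 = 1" using lam_sum(1)[OF K, of x] V by (simp add: l0_def l1_def l2_def)
have xr: "x = l0 *\<^sub>R p0 + l1 *\<^sub>R p1 + l2 *\<^sub>R p2"
 using lam_sum(2)[OF K, of x] V by (simp add: l0_def l1_def l2_def add.assoc)
have e: "P (a *\<^sub>R p + b *\<^sub>R q) = 0" if "p \<in> verts K" "q \<in> verts K" "p \<noteq> q" "a + b = 1" for p q a b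
proof -
 have "a *\<^sub>R p + b *\<^sub>R q = p + b *\<^sub>R (q - p)" using that(4) by (simp add: algebra_simps flip: scaleR_add_left)
 thus ?thesis using edges[OF that(1-3)] by simp
qed
\<comment> \<open>Along \<open>x + t *\<^sub>R u\<close> the three coordinates vanish at the
  elements of \<open>Z\<close>. Only the first two can coincide, and this choice of \<open>b\<close>
  separates them.\<close>
define b where "b = (if l0 = l1 then 2 else 1 :: real)"
have b: "b > 0" "l0 \<noteq> l1 / b" using l by (auto simp: b_def)
define u where "u = p0 + b *\<^sub>R p1 - (1 + b) *\<^sub>R p2"
define Z where "Z = {- l0, - (l1 / b), l2 / (1 + b)}"
have pos: "l1 / b > 0" "l2 / (1 + b) > 0" using l b by auto
have "- l0 \<noteq> - (l1 / b)" "- l0 \<noteq> l2 / (1 + b)" "- (l1 / b) \<noteq> l2 / (1 + b)" using b(2) l(1) pos by linarith+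
hence "card Z > 2" by (simp add: Z_def)
have xt: "x + t *\<^sub>R u = (l0 + t) *\<^sub>R p0 + (l1 + t * b) *\<^sub>R p1 + (l2 - t * (1 + b)) *\<^sub>R p2" for t
 by (simp add: xr u_def algebra_simps)
have "P (x + t *\<^sub>R u) = 0" if tZ: "t \<in> Z" for t
proof -
 have "t = - l0 \<or> t = - (l1 / b) \<or> t = l2 / (1 + b)" using tZ by (simp add: Z_def)
 then consider "t = - l0" | "t = - (l1 / b)" | "t = l2 / (1 + b)" by blast
 thus ?thesis
 proof cases
  case 1
  thus ?thesis unfolding xt using e[of p1 p2 "l1 + t * b" "l2 - t * (1 + b)"] V s by (simp add: algebra_simps)
 next
  case 2
  hence "l1 + t * b = 0" using b by simp
  moreover have "(l0 + t) + (l1 + t * b) + (l2 - t * (1 + b)) = 1" using s by (simp add: algebra_simps)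
  ultimately show ?thesis unfolding xt using e[of p0 p2 "l0 + t" "l2 - t * (1 + b)"] V by simp
 next
  case 3
  hence "l2 - t * (1 + b) = 0" using b by simp
  moreover have "(l0 + t) + (l1 + t * b) + (l2 - t * (1 + b)) = 1" using s by (simp add: algebra_simps)
  ultimately show ?thesis unfolding xt using e[of p0 p1 "l0 + t" "l1 + t * b"] V by simp
 qed
qed
hence "P (x + 0 *\<^sub>R u) = 0" by (rule polys_zero_on_line[OF P]) (assumption, rule disjI2, rule \<open>card Z > 2\<close>)
thus ?thesis by simp
qed

text \<open>Otherwise every point of the cell lying on a face with at most \<open>s\<close> vertices
  is outside \<open>W\<close>, where the polynomial vanishes. For \<open>s = 1\<close> this gives
  the vertices, for \<open>s = 2\<close> the edges, and in both cases the polynomial is zero on the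
  triangle.\<close>

lemma carrier_exists:
assumes n: "CARD('n) = 2" and v: "v \<in> Xh W s \<tau>" and K: "K \<in> \<tau>" and x: "x \<in> interior K" "v x \<noteq> 0"
shows "\<exists>x0\<in>K. x0 \<in> W \<and> card {p\<in>verts K. 0 < lam K p x0} \<le> s"
proof (rule ccontr)
assume no: "\<not> ?thesis"
have xK: "x \<in> K" "x \<in> W" using x(1) interior_subset cell_interior_subset[OF K] by blast+
have "card {p\<in>verts K. 0 < lam K p x} \<le> 3"
 using card_mono[OF verts_finite[OF K], of "{p\<in>verts K. 0 < lam K p x}"] verts_card[OF K] n by auto
\<comment> \<open>For \<open>s \<ge> 3\<close> the interior point \<open>x\<close> itself would
  qualify, as a triangle has only three vertices.\<close>
hence s3: "s < 3" using no xK by force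
have "s \<noteq> 0" using Xh_degree_zero[of v] v x(2) by (metis zero_fun_apply)
hence s: "s = 1 \<or> s = 2" using s3 by linarith
obtain p D where p: "cell_poly s K v p D" using cell_poly_exists[OF Xh_D(3)[OF v] K] by blast
have z: "p y $ i = 0" if "y \<in> K" "card {p\<in>verts K. 0 < lam K p y} \<le> s" for y i
 using cell_poly_vanishes[OF v K p that(1)] no that by blast
have comb: "{r\<in>verts K. 0 < lam K r (a + t *\<^sub>R (b - a))} \<subseteq> (if t = 0 then {a} else if t = 1 then {b} else {a, b})"
 if ab: "a \<in> verts K" "b \<in> verts K" for a b t
proof -
 have e: "a + t *\<^sub>R (b - a) = (1 - t) *\<^sub>R a + t *\<^sub>R b" by (simp add: algebra_simps)
 show ?thesis unfolding e lam_convex using lam_vertex[OF K _ ab(1)] lam_vertex[OF K _ ab(2)] by (auto split: if_splits)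
qed
have "p x $ i = 0" for i
proof (rule triangle_poly_zero[OF _ K n _ x(1)])
 show "(\<lambda>x. p x $ i) \<in> polys 2" using polys_mono[OF _ cell_polyD(1)[OF p]] s by auto
 fix a b t assume ab: "a \<in> verts K" "b \<in> verts K" "a \<noteq> b"
 have abK: "a \<in> K" "b \<in> K" using ab verts_subset[OF K] by auto
 have in_K: "a + t *\<^sub>R (b - a) \<in> K" if "t \<in> {0..1}" for t
  using convexD_alt[OF cell_convex[OF K] abK, of t] that by (simp add: algebra_simps)
 show "p (a + t *\<^sub>R (b - a)) $ i = 0"
 proof (cases "s = 1")
  case True
  show ?thesis
  proof (rule polys_zero_on_line[OF cell_polyD(1)[OF p], where Z = "{0, 1}"])
  fix t :: real assume t: "t \<in> {0, 1}"
  have "card {r\<in>verts K. 0 < lam K r (a + t *\<^sub>R (b - a))} \<le> card (if t = 0 then {a} else {b})"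
  using comb[OF ab(1,2), of t] t by (intro card_mono) (auto split: if_splits)
  thus "p (a + t *\<^sub>R (b - a)) $ i = 0" using True t by (intro z in_K) (auto split: if_splits)
  qed (use True in simp)
 next
  case False
  hence s2: "s = 2" using s by simp
  show ?thesis
  proof (rule polys_zero_on_line[OF cell_polyD(1)[OF p], where Z = "{0..1}"])
  fix t :: real assume t: "t \<in> {0..1}"
  have "card {r\<in>verts K. 0 < lam K r (a + t *\<^sub>R (b - a))} \<le> card {a, b}"
  using comb[OF ab(1,2), of t] by (intro card_mono) (auto split: if_splits)
  thus "p (a + t *\<^sub>R (b - a)) $ i = 0" using s2 t ab by (intro z in_K) auto
  qed (simp add: infinite_Icc)
 qed
qed
hence "v x = 0" using cell_polyD(4)[OF p x(1)] by (simp add: vec_eq_iff)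
thus False using x(2) by simp
qed

lemma mesh_size_pos: "mesh_size \<tau> > 0"
proof -
obtain K where K: "K \<in> \<tau>" using \<tau>_nonempty by blast
have "diameter K \<le> mesh_size \<tau>" unfolding mesh_size_def using K finite_\<tau> by (intro Max_ge) auto
thus ?thesis using cell_diameter[OF K] by linarith
qed

end

section \<open>The maximum norm of symmetric gradients\<close>

text \<open>In three dimensions this is quasi-uniformity. In two dimensions a nonzero function on
  the cell supplies a face with an admissible bubble, and \<open>bubble_size\<close> bounds the
  diameter.\<close>

lemma cell_size_bound:
fixes \<T> :: "(real^'n) set set set"
assumes dim: "CARD('n) = 2 \<or> CARD('n) = 3" and dom: "polyhedral_domain W"
 and mesh: "\<And>\<tau>. \<tau> \<in> \<T> \<Longrightarrow> mesh_of W \<tau>"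
 and \<rho>: "\<rho> > 0" "\<And>\<tau> K. \<lbrakk>\<tau> \<in> \<T>; K \<in> \<tau>\<rbrakk> \<Longrightarrow> \<exists>c. cball c (\<rho> * diameter K) \<subseteq> K"
 and quasi: "CARD('n) = 3 \<Longrightarrow> quasi_uniform_family \<T>" and inv: "inverse_ineq_family W s \<T>"
shows "\<exists>\<kappa>>0. \<forall>\<tau>\<in>\<T>. \<forall>v\<in>Xh W s \<tau>. \<forall>K\<in>\<tau>. \<forall>x\<in>interior K. v x \<noteq> 0 \<longrightarrow> \<kappa> * mesh_size \<tau> \<le> diameter K"
proof (cases "CARD('n) = 3")
case True
thus ?thesis using quasi unfolding quasi_uniform_family_def by blast
next
case False
hence n: "CARD('n) = 2" using dim by simp
obtain Ci where Ci: "\<And>\<tau> v. \<lbrakk>\<tau> \<in> \<T>; v \<in> Xh W s \<tau>\<rbrakk> \<Longrightarrow> L2_norm W (grad W v) \<le> Ci * mesh_size \<tau> powi (-1) * L2_norm W v"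
 using inv unfolding inverse_ineq_family_def by blast
obtain C where C: "C \<ge> 0" "inverse_constant (polys s :: (real^'n \<Rightarrow> real) set) \<rho> C"
 using polys_inverse_estimate[OF \<rho>(1), of s] by (elim exE conjE) (rule that)
obtain N where N: "1 / \<rho> ^ CARD('n) \<le> real N" using real_arch_simple by blast
define \<eta> where "\<eta> = (1 / (1 + real CARD('n))) ^ (1 + CARD('n))"
define Q where "Q = C * Ci\<^sup>2 * (unit_ball_vol (real CARD('n)) * ((1 + 1 / (2 * \<rho>)) ^ N) ^ CARD('n))"
have Q: "Q \<ge> 0" using C(1) \<rho>(1) by (simp add: Q_def)
have \<eta>: "\<eta> > 0" by (simp add: \<eta>_def)
\<comment> \<open>The summand 1 keeps the denominator positive in case \<open>Q = 0\<close>.\<close>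
define \<kappa> where "\<kappa> = \<eta> / (sqrt Q + 1)"
have sQ: "sqrt Q + 1 > 0" using Q by (simp add: add_nonneg_pos)
have \<kappa>: "\<kappa> > 0" using \<eta> sQ by (simp add: \<kappa>_def)
have "\<kappa> * mesh_size \<tau> \<le> diameter K"
 if \<tau>: "\<tau> \<in> \<T>" and v: "v \<in> Xh W s \<tau>" and K: "K \<in> \<tau>" and x: "x \<in> interior K" "v x \<noteq> 0" for \<tau> v K x
proof -
 interpret regular_mesh W \<tau> \<rho> by unfold_locales (use dom mesh[OF \<tau>] \<rho> \<tau> in auto)
 obtain x0 where x0: "x0 \<in> K" "x0 \<in> W" "card {p\<in>verts K. 0 < lam K p x0} \<le> s" using carrier_exists[OF n v K x] by blast
 have "(\<eta> * mesh_size \<tau>)\<^sup>2 \<le> Q * (diameter K)\<^sup>2"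
  unfolding \<eta>_def Q_def
  by (rule bubble_size[OF _ C(2,1) K x0 mesh_size_pos _ N]) (use n Ci[OF \<tau>] in \<open>auto simp: power_int_minus divide_inverse\<close>)
 hence "\<bar>\<eta> * mesh_size \<tau>\<bar> \<le> sqrt (Q * (diameter K)\<^sup>2)" by (metis real_sqrt_abs real_sqrt_le_iff)
 also have "\<dots> = sqrt Q * diameter K" using cell_diameter[OF K] by (simp add: real_sqrt_mult)
 also have "\<dots> \<le> (sqrt Q + 1) * diameter K" using cell_diameter[OF K] by (intro mult_right_mono) auto
 finally have "\<eta> * mesh_size \<tau> \<le> (sqrt Q + 1) * diameter K" by simp
 thus ?thesis using sQ by (simp add: \<kappa>_def pos_divide_le_eq mult.commute)
qed
thus ?thesis using \<kappa> by blast
qed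

text \<open>The power of \<open>h\<close> and the logarithm by which the constants of the theorem
  admit the maximum norm of \<open>Dv\<close> to exceed its \<open>L2\<close> norm.\<close>

definition sobolev_scale :: "nat \<Rightarrow> real \<Rightarrow> real" where
"sobolev_scale d h = (if d = 2 then sqrt (1 + \<bar>ln h\<bar>) * h powi (-1) else h powr (-3/2))"

lemma sobolev_scale_pos: "h > 0 \<Longrightarrow> sobolev_scale d h > 0"
by (simp add: sobolev_scale_def add_pos_nonneg)

lemma symgrad_family_bound:
fixes \<T> :: "(real^'n) set set set"
assumes dim: "CARD('n) = 2 \<or> CARD('n) = 3" and dom: "polyhedral_domain W"
 and mesh: "\<And>\<tau>. \<tau> \<in> \<T> \<Longrightarrow> mesh_of W \<tau>" and reg: "regular_family \<T>"
 and quasi: "CARD('n) = 3 \<Longrightarrow> quasi_uniform_family \<T>" and inv: "inverse_ineq_family W s \<T>"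
shows "\<exists>L\<ge>0. \<forall>\<tau>\<in>\<T>. \<forall>v\<in>Xh W s \<tau>. AE x in lebesgue_on W.
 norm (symgrad W v x) \<le> L * sobolev_scale CARD('n) (mesh_size \<tau>) * L2_norm W (symgrad W v)"
proof -
obtain \<rho> where \<rho>: "\<rho> > 0" "\<And>\<tau> K. \<lbrakk>\<tau> \<in> \<T>; K \<in> \<tau>\<rbrakk> \<Longrightarrow> \<exists>c. cball c (\<rho> * diameter K) \<subseteq> K"
 using reg unfolding regular_family_def by blast
have "\<exists>\<kappa>>0. \<forall>\<tau>\<in>\<T>. \<forall>v\<in>Xh W s \<tau>. \<forall>K\<in>\<tau>. \<forall>x\<in>interior K. v x \<noteq> 0 \<longrightarrow> \<kappa> * mesh_size \<tau> \<le> diameter K"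
 by (rule cell_size_bound) (fact dim dom mesh \<rho> quasi inv)+
then obtain \<kappa> where \<kappa>: "\<kappa> > 0" "\<forall>\<tau>\<in>\<T>. \<forall>v\<in>Xh W s \<tau>. \<forall>K\<in>\<tau>. \<forall>x\<in>interior K. v x \<noteq> 0 \<longrightarrow> \<kappa> * mesh_size \<tau> \<le> diameter K"
 by (elim exE conjE) (rule that)
obtain C where C: "C \<ge> 0" "inverse_constant (polys s :: (real^'n \<Rightarrow> real) set) \<rho> C"
 using polys_inverse_estimate[OF \<rho>(1), of s] by (elim exE conjE) (rule that)
define L where "L = sqrt (C / \<kappa> ^ CARD('n))"
have "AE x in lebesgue_on W. norm (symgrad W v x) \<le> L * sobolev_scale CARD('n) (mesh_size \<tau>) * L2_norm W (symgrad W v)"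
 if \<tau>: "\<tau> \<in> \<T>" and v: "v \<in> Xh W s \<tau>" for \<tau> v
proof -
 interpret fe_mesh W \<tau> by unfold_locales (use dom mesh[OF \<tau>] in auto)
 define h where "h = mesh_size \<tau>"
 have h: "h > 0" using mesh_size_pos by (simp add: h_def)
 \<comment> \<open>The inverse estimate yields the squared factor \<open>1 / h ^ CARD('n)\<close>.
   In dimension 3 this is the scale exactly; in dimension 2 the logarithm only enlarges it.\<close>
 have scale: "1 / h ^ CARD('n) \<le> (sobolev_scale CARD('n) h)\<^sup>2"
 proof (cases "CARD('n) = 2")
  case True
  have "1 * (1 / h\<^sup>2) \<le> (1 + \<bar>ln h\<bar>) * (1 / h\<^sup>2)" by (intro mult_right_mono) auto
  thus ?thesis using True by (simp add: sobolev_scale_def power_mult_distrib power_int_minus power_inverse divide_inverse)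
 next
  case False
  hence "CARD('n) = 3" using dim by simp
  moreover have "(h powr (-3/2))\<^sup>2 = 1 / h ^ 3"
  proof -
  have "(h powr (-3/2))\<^sup>2 = h powr (- 3)" using h by (simp add: power2_eq_square flip: powr_add)
  also have "\<dots> = 1 / h ^ 3" using h by (simp add: powr_minus divide_inverse powr_numeral)
  finally show ?thesis .
  qed
  ultimately show ?thesis by (simp add: sobolev_scale_def)
 qed
 have "AE x in lebesgue_on W. (norm (symgrad W v x))\<^sup>2 \<le> C / (\<kappa> * h) ^ CARD('n) * (L2_norm W (symgrad W v))\<^sup>2"
  by (rule symgrad_bound[OF C(2) \<rho>(1) C(1) v]) (use \<rho>(2)[OF \<tau>] \<kappa>(1) bspec[OF bspec[OF \<kappa>(2) \<tau>] v] h in \<open>auto simp: h_def\<close>)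
 thus ?thesis
 proof eventually_elim
  fix x assume x: "(norm (symgrad W v x))\<^sup>2 \<le> C / (\<kappa> * h) ^ CARD('n) * (L2_norm W (symgrad W v))\<^sup>2"
  have "C / (\<kappa> * h) ^ CARD('n) = L\<^sup>2 * (1 / h ^ CARD('n))" using C(1) \<kappa>(1) by (simp add: L_def power_mult_distrib)
  also have "\<dots> \<le> L\<^sup>2 * (sobolev_scale CARD('n) h)\<^sup>2" by (intro mult_left_mono scale) simp
  finally have "C / (\<kappa> * h) ^ CARD('n) * (L2_norm W (symgrad W v))\<^sup>2 \<le> L\<^sup>2 * (sobolev_scale CARD('n) h)\<^sup>2 * (L2_norm W (symgrad W v))\<^sup>2"
  by (rule mult_right_mono) simp
  with x have "(norm (symgrad W v x))\<^sup>2 \<le> (L * sobolev_scale CARD('n) h * L2_norm W (symgrad W v))\<^sup>2"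
  by (simp add: power_mult_distrib)
  moreover have "0 \<le> L * sobolev_scale CARD('n) h * L2_norm W (symgrad W v)"
  using C(1) \<kappa>(1) sobolev_scale_pos[OF h] by (simp add: L_def less_imp_le L2_norm_nonneg[OF op bd])
  ultimately have "norm (symgrad W v x) \<le> L * sobolev_scale CARD('n) h * L2_norm W (symgrad W v)"
  by (rule power2_le_imp_le)
  thus "norm (symgrad W v x) \<le> L * sobolev_scale CARD('n) (mesh_size \<tau>) * L2_norm W (symgrad W v)" by (simp add: h_def)
 qed
qed
thus ?thesis using C(1) \<kappa>(1) by (intro exI[of _ L]) (auto simp: L_def)
qed

section \<open>The Picard operator on the finite element space\<close>

lemma direction_sine_nonneg: "0 \<le> direction_sine (Ynorm W) f (span S)"
proof -
have N: "0 \<le> Ynorm W v" for v by (simp add: Ynorm_def L2_norm_def L2_inner_def)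
have "0 \<le> (INF v\<in>span S. Ynorm W (f - v))" using N span_zero by (intro cINF_greatest) blast+
thus ?thesis using N by (simp add: direction_sine_def)
qed

context fe_mesh
begin

text \<open>The bound in \<open>Hminus1\<close> makes the supremum finite. Korn's inequality then
  replaces the full gradient by the symmetric one at the price of \<open>sqrt 2\<close>.\<close>

lemma dual_norm_bound:
assumes V: "V \<subseteq> H10 W" "0 \<in> V" and f: "Hminus1 W f"
shows "0 \<le> dual_norm W V f" "u \<in> V \<Longrightarrow> f u \<le> sqrt 2 * dual_norm W V f * L2_norm W (symgrad W u)"
proof -
obtain M where M: "\<And>v. v \<in> H10 W \<Longrightarrow> \<bar>f v\<bar> \<le> M * L2_norm W (grad W v)" using f unfolding Hminus1_def by blast
define q where "q v = \<bar>f v\<bar> / L2_norm W (grad W v)" for v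
have "q v \<le> \<bar>M\<bar>" if "v \<in> V" for v
proof (cases "L2_norm W (grad W v) = 0")
 case False
 hence p: "L2_norm W (grad W v) > 0" using L2_norm_nonneg[OF op bd, of "grad W v"] by linarith
 have "\<bar>f v\<bar> \<le> M * L2_norm W (grad W v)" using M V(1) that by blast
 also have "\<dots> \<le> \<bar>M\<bar> * L2_norm W (grad W v)" using p by (intro mult_right_mono) auto
 finally show ?thesis using p by (simp add: q_def pos_divide_le_eq)
qed (simp add: q_def)
hence bdd: "bdd_above (q ` V)" by (intro bdd_aboveI2)
have up: "q v \<le> dual_norm W V f" if "v \<in> V" for v
 unfolding dual_norm_def q_def[symmetric] by (rule cSUP_upper[OF that bdd])
have "0 \<le> q 0" by (simp add: q_def L2_norm_nonneg[OF op bd])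
thus d0: "0 \<le> dual_norm W V f" using up[OF V(2)] by linarith
show "f u \<le> sqrt 2 * dual_norm W V f * L2_norm W (symgrad W u)" if u: "u \<in> V"
proof -
 have uH: "u \<in> H10 W" using V(1) u by blast
 have "f u \<le> dual_norm W V f * L2_norm W (grad W u)"
 proof (cases "L2_norm W (grad W u) = 0")
  case True
  thus ?thesis using M[OF uH] by simp
 next
  case False
  hence p: "L2_norm W (grad W u) > 0" using L2_norm_nonneg[OF op bd, of "grad W u"] by linarith
  thus ?thesis using up[OF u] by (simp add: q_def pos_divide_le_eq)
 qed
 also have "\<dots> \<le> dual_norm W V f * (sqrt 2 * L2_norm W (symgrad W u))" by (intro mult_left_mono korn[OF op bd uH] d0)
 finally show ?thesis by (simp add: mult_ac)
qed
qed

lemma picard_space_Vh: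
assumes bound: "\<And>v. v \<in> Xh W s \<tau> \<Longrightarrow> AE x in lebesgue_on W. norm (symgrad W v x) \<le> \<Lambda> * L2_norm W (symgrad W v)"
 and "\<Lambda> \<ge> 0" "\<mu> > 0" "\<tau>\<^sub>s \<ge> 0" "\<epsilon> > 0" and f: "Hminus1 W f" and Bs: "finite Bs" "Vh W s r \<tau> = span Bs"
shows "picard_space (lebesgue_on W) (Vh W s r \<tau>) (symgrad W) \<Lambda> \<mu> \<tau>\<^sub>s \<epsilon> (sqrt 2 * dual_norm W (Vh W s r \<tau>) f) f Bs"
proof -
have X: "u \<in> Xh W s \<tau>" if "u \<in> Vh W s r \<tau>" for u using that by (simp add: Vh_def)
have H: "u \<in> H10 W" "u \<in> H1 W" if "u \<in> Vh W s r \<tau>" for u using Xh_D[OF X[OF that]] by auto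
have sub: "Vh W s r \<tau> \<subseteq> H10 W" "0 \<in> Vh W s r \<tau>" using H subspace_0[OF subspace_Vh] by auto
have N: "sqrt (\<integral>x. symgrad W u x \<bullet> symgrad W u x \<partial>lebesgue_on W) = L2_norm W (symgrad W u)" for u
 by (simp add: L2_norm_def L2_inner_def)
show ?thesis
proof (intro picard_space.intro picard_space_axioms.intro)
 show "finite_measure (lebesgue_on W)" by (rule finite_measure_W[OF op bd])
 show "Vh W s r \<tau> = span Bs" "finite Bs" by (fact Bs)+
 show "symgrad W u \<in> meas W" if "u \<in> Vh W s r \<tau>" for u
  using symgrad_L2[OF op bd H(2)[OF that]] by (simp add: L2_def)
 show "AE x in lebesgue_on W. symgrad W (u + v) x = symgrad W u x + symgrad W v x"
  if "u \<in> Vh W s r \<tau>" "v \<in> Vh W s r \<tau>" for u v by (rule symgrad_add[OF op bd H(2)[OF that(1)] H(2)[OF that(2)]])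
 show "AE x in lebesgue_on W. symgrad W (c *\<^sub>R u) x = c *\<^sub>R symgrad W u x" if "u \<in> Vh W s r \<tau>" for u c
  by (rule symgrad_scale[OF op bd H(2)[OF that]])
 show "AE x in lebesgue_on W. norm (symgrad W u x) \<le> \<Lambda> * sqrt (\<integral>x. symgrad W u x \<bullet> symgrad W u x \<partial>lebesgue_on W)"
  if "u \<in> Vh W s r \<tau>" for u unfolding N by (rule bound[OF X[OF that]])
 show "u = 0" if "u \<in> Vh W s r \<tau>" "(\<integral>x. symgrad W u x \<bullet> symgrad W u x \<partial>lebesgue_on W) = 0" for u
  by (rule Ynorm_zero[OF X[OF that(1)]]) (use that(2) N[of u] in simp)
 show "f (u + v) = f u + f v" if "u \<in> Vh W s r \<tau>" "v \<in> Vh W s r \<tau>" for u v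
  using f H(1)[OF that(1)] H(1)[OF that(2)] by (simp add: Hminus1_def)
 show "f (c *\<^sub>R u) = c * f u" if "u \<in> Vh W s r \<tau>" for u c
  using f H(1)[OF that] by (simp add: Hminus1_def)
 show "f u \<le> sqrt 2 * dual_norm W (Vh W s r \<tau>) f * sqrt (\<integral>x. symgrad W u x \<bullet> symgrad W u x \<partial>lebesgue_on W)"
  if "u \<in> Vh W s r \<tau>" for u unfolding N by (rule dual_norm_bound(2)[OF sub f that])
 show "0 \<le> sqrt 2 * dual_norm W (Vh W s r \<tau>) f" using dual_norm_bound(1)[OF sub f] by simp
qed (fact assms)+
qed

end

section \<open>Comparison of the abstract constants with those of the theorem\<close>

lemma C_G_scale:
assumes "h > 0"
shows "C_G d Cst \<mu> \<tau>\<^sub>s \<epsilon> h F = sqrt (\<tau>\<^sub>s * inverse \<epsilon> ^ 3 * Cst * (sobolev_scale d h)\<^sup>2 * inverse \<mu> ^ 3 * F\<^sup>2 / 8)"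
proof -
have "(h powr (-3/2))\<^sup>2 = h powr (- 3)" using assms by (simp add: power2_eq_square flip: powr_add)
hence "(h powr (-3/2))\<^sup>2 = inverse h ^ 3" using assms by (simp add: powr_minus powr_numeral power_inverse)
thus ?thesis
 by (simp add: C_G_def sobolev_scale_def power_int_minus power_inverse power_mult_distrib mult_ac)
qed

lemma C_hat_G_scale:
"C_hat_G d Cst \<mu> \<tau>\<^sub>s \<epsilon> h F = Cst * inverse \<mu> * \<tau>\<^sub>s * inverse \<epsilon> ^ 2 * sobolev_scale d h *
  (C_G d Cst \<mu> \<tau>\<^sub>s \<epsilon> h F + inverse \<epsilon> * sobolev_scale d h * inverse \<mu> * F)"
by (simp add: C_hat_G_def sobolev_scale_def power_int_minus power_inverse mult_ac)

text \<open>Here \<open>sqrt 2\<close> is Korn's constant in the norm of the forcing. Its square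
  over the square of the 2 in \<open>2 * \<mu>\<close> leaves \<open>L^2 / 2\<close> as the factor
  to be dominated by \<open>Cst\<close>.\<close>

lemma C_G_dominates:
assumes "h > 0" "\<mu> > 0" "\<tau>\<^sub>s \<ge> 0" "\<epsilon> > 0" "L\<^sup>2 \<le> Cst"
shows "sqrt (\<tau>\<^sub>s * inverse \<epsilon> ^ 3 * (L * sobolev_scale d h * (sqrt 2 * F) / (2 * \<mu>))\<^sup>2 / (8 * \<mu>)) \<le> C_G d Cst \<mu> \<tau>\<^sub>s \<epsilon> h F"
proof -
define X where "X = \<tau>\<^sub>s * inverse \<epsilon> ^ 3 * (sobolev_scale d h)\<^sup>2 * inverse \<mu> ^ 3 * F\<^sup>2 / 8"
have X: "X \<ge> 0" using assms by (simp add: X_def)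
have "\<tau>\<^sub>s * inverse \<epsilon> ^ 3 * (L * sobolev_scale d h * (sqrt 2 * F) / (2 * \<mu>))\<^sup>2 / (8 * \<mu>) = (L\<^sup>2 / 2) * X"
 using assms by (simp add: X_def power_mult_distrib power_divide field_simps power3_eq_cube power2_eq_square)
also have "\<dots> \<le> Cst * X" using X assms(5) by (intro mult_right_mono) (simp_all, smt (verit) zero_le_power2)
also have "\<dots> = \<tau>\<^sub>s * inverse \<epsilon> ^ 3 * Cst * (sobolev_scale d h)\<^sup>2 * inverse \<mu> ^ 3 * F\<^sup>2 / 8" by (simp add: X_def)
finally show ?thesis unfolding C_G_scale[OF assms(1)] by (rule real_sqrt_le_mono)
qed

text \<open>The two summands carry the factors \<open>L / 2\<close> and
  \<open>sqrt 2 * L^2 / 2\<close>, and \<open>Cst\<close> exceeds both.\<close>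

lemma C_hat_G_dominates:
assumes h: "h > 0" and \<mu>: "\<mu> > 0" and \<tau>\<^sub>s: "\<tau>\<^sub>s \<ge> 0" and \<epsilon>: "\<epsilon> > 0" and L: "L \<ge> 0" and F: "F \<ge> 0"
 and Cst: "Cst = 1 + L + L\<^sup>2" and g: "g \<le> C_G d Cst \<mu> \<tau>\<^sub>s \<epsilon> h F"
shows "\<tau>\<^sub>s * inverse \<epsilon> ^ 2 * (L * sobolev_scale d h) / (2 * \<mu>) *
  (g + 2 * inverse \<epsilon> * (L * sobolev_scale d h) * (sqrt 2 * F) / (2 * \<mu>)) \<le> C_hat_G d Cst \<mu> \<tau>\<^sub>s \<epsilon> h F"
proof -
define S where "S = sobolev_scale d h"
define G where "G = C_G d Cst \<mu> \<tau>\<^sub>s \<epsilon> h F"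
define y where "y = inverse \<epsilon> * S * inverse \<mu> * F"
define A where "A = \<tau>\<^sub>s * inverse \<epsilon> ^ 2 * S * inverse \<mu>"
have S: "S > 0" using sobolev_scale_pos[OF h] by (simp add: S_def)
have y: "y \<ge> 0" using S \<epsilon> \<mu> F by (simp add: y_def)
have A: "A \<ge> 0" using S \<epsilon> \<mu> \<tau>\<^sub>s by (simp add: A_def)
have G0: "G \<ge> 0" using h \<mu> \<tau>\<^sub>s \<epsilon> L by (simp add: G_def C_G_scale Cst)
have "sqrt 2 \<le> (2::real)" using real_sqrt_le_mono[of 2 4] by simp
hence LL: "L / 2 * (sqrt 2 * L) \<le> Cst"
proof -
 have "L / 2 * (sqrt 2 * L) = sqrt 2 / 2 * L\<^sup>2" by (simp add: power2_eq_square)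
 also have "\<dots> \<le> 1 * L\<^sup>2" using \<open>sqrt 2 \<le> 2\<close> by (intro mult_right_mono) auto
 finally show ?thesis using L by (simp add: Cst)
qed
have "\<tau>\<^sub>s * inverse \<epsilon> ^ 2 * (L * S) / (2 * \<mu>) * (g + 2 * inverse \<epsilon> * (L * S) * (sqrt 2 * F) / (2 * \<mu>))
  = A * (L / 2 * g + L / 2 * (sqrt 2 * L) * y)"
 using \<mu> by (simp add: A_def y_def field_simps)
also have "\<dots> \<le> A * (Cst * G + Cst * y)"
proof (intro mult_left_mono add_mono A)
 have "L / 2 * g \<le> L / 2 * G" using g L by (intro mult_left_mono) (auto simp: G_def)
 also have "\<dots> \<le> Cst * G" using L G0 by (intro mult_right_mono) (auto simp: Cst)
 finally show "L / 2 * g \<le> Cst * G" .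
 show "L / 2 * (sqrt 2 * L) * y \<le> Cst * y" by (rule mult_right_mono[OF LL y])
qed
also have "\<dots> = Cst * inverse \<mu> * \<tau>\<^sub>s * inverse \<epsilon> ^ 2 * S * (G + y)" by (simp add: A_def algebra_simps)
finally show ?thesis unfolding C_hat_G_scale by (simp add: S_def G_def y_def)
qed

theorem theorem3p27:
  fixes \<Omega> :: "(real^'n) set" and \<T> :: "(real^'n) set set set" and s r :: nat
  assumes dim: "CARD('n) = 2 \<or> CARD('n) = 3"
    and dom: "polyhedral_domain \<Omega>"
    and mesh: "\<And>\<tau>. \<tau> \<in> \<T> \<Longrightarrow> mesh_of \<Omega> \<tau>"
    and reg: "regular_family \<T>"
    and quasi: "CARD('n) = 3 \<Longrightarrow> quasi_uniform_family \<T>"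
    and inv: "inverse_ineq_family \<Omega> s \<T>"
    and lbb: "inf_sup_family \<Omega> s r \<T>"
    and sob: "discrete_sobolev_family \<Omega> s \<T>"
  shows "\<exists>Cst>0. \<forall>m::nat. \<forall>c\<^sub>s>0. \<forall>\<sigma>>0. \<exists>C>0.
    \<forall>\<tau>\<in>\<T>. \<forall>\<mu>>0. \<forall>\<tau>\<^sub>s\<ge>0. \<forall>\<epsilon>>0. \<forall>f. Hminus1 \<Omega> f \<longrightarrow>
      (let Y = Vh \<Omega> s r \<tau>; N = Ynorm \<Omega>; G = picard \<Omega> Y \<mu> \<tau>\<^sub>s \<epsilon> f;
           F = (\<lambda>u. G u - u);
           CG = C_G CARD('n) Cst \<mu> \<tau>\<^sub>s \<epsilon> (mesh_size \<tau>) (dual_norm \<Omega> Y f);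
           ChG = C_hat_G CARD('n) Cst \<mu> \<tau>\<^sub>s \<epsilon> (mesh_size \<tau>) (dual_norm \<Omega> Y f)
       in (\<forall>u\<in>Y. \<forall>z\<in>Y. N (F u - F z) \<ge> \<sigma> * N (u - z)) \<longrightarrow>
          (\<forall>\<beta> x w \<theta>.
             anderson N Y G m \<beta> x w \<longrightarrow>
             (\<forall>k\<ge>1. 0 < \<beta> k \<and> \<beta> k \<le> 1) \<longrightarrow>
             aa_gains N m w \<theta> \<longrightarrow>
             (\<forall>k>m. \<forall>j\<in>{k - aa_depth m k..k-1}. \<forall>i\<in>{1..aa_depth m j}.
                \<bar>direction_sine N (aa_col w j i) (span (aa_col w j ` {1..<i}))\<bar> \<ge> c\<^sub>s) \<longrightarrow>
             (\<exists>H :: nat \<Rightarrow> real.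
                (\<forall>j\<ge>1. H j \<le> C * sqrt (1 - (\<theta> j)\<^sup>2) + \<beta> j * \<theta> j) \<and>
                (\<forall>k>m. N (w (k+1)) \<le> N (w k) *
                   (\<theta> k * (1 - \<beta> k + CG * \<beta> k) +
                    C * ChG * sqrt (1 - (\<theta> k)\<^sup>2) / 2 *
                      (N (w k) * H k
                       + 2 * (\<Sum>n = k - aa_depth m k + 1..k-1. real (k - n) * N (w n) * H n)
                       + real (aa_depth m k) * N (w (k - aa_depth m k)) * H (k - aa_depth m k)))))))"
proof -
have "\<exists>L\<ge>0. \<forall>\<tau>\<in>\<T>. \<forall>v\<in>Xh \<Omega> s \<tau>. AE x in lebesgue_on \<Omega>.
  norm (symgrad \<Omega> v x) \<le> L * sobolev_scale CARD('n) (mesh_size \<tau>) * L2_norm \<Omega> (symgrad \<Omega> v)"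
 by (rule symgrad_family_bound) (fact dim dom mesh reg quasi inv)+
then obtain L where L: "L \<ge> 0" "\<forall>\<tau>\<in>\<T>. \<forall>v\<in>Xh \<Omega> s \<tau>. AE x in lebesgue_on \<Omega>.
  norm (symgrad \<Omega> v x) \<le> L * sobolev_scale CARD('n) (mesh_size \<tau>) * L2_norm \<Omega> (symgrad \<Omega> v)"
 by (elim exE conjE) (rule that)
\<comment> \<open>Of the three summands, 1 gives positivity, \<open>L\<close> serves the linear
  occurrence in \<open>C_hat_G\<close> and \<open>L^2\<close> the quadratic ones. The number
  \<open>L\<close> depends on the domain, the degree and the family only.\<close>
define Cst where "Cst = 1 + L + L\<^sup>2"
have Cst: "Cst > 0" using L(1) by (simp add: Cst_def add_pos_nonneg)
\<comment> \<open>The constant of \<open>A.H\<close> and \<open>A.main\<close> with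
  \<open>C1\<close> written out. It depends on the depth, the sine bound and
  \<open>\<sigma>\<close>, and so can be chosen before the mesh and the data.\<close>
define C where "C m c \<sigma> = 4 * real m * ((1 / c) * (1 + 1/c) ^ m) / \<sigma> + 1" for m and c \<sigma> :: real
have C: "C m c \<sigma> > 0" if "c > 0" "\<sigma> > 0" for m c \<sigma> using that by (simp add: C_def add_nonneg_pos)
have main: "\<exists>H. (\<forall>j\<ge>1. H j \<le> C m c\<^sub>s \<sigma> * sqrt (1 - (\<theta> j)\<^sup>2) + \<beta> j * \<theta> j) \<and>
  (\<forall>k>m. Ynorm \<Omega> (w (k+1)) \<le> Ynorm \<Omega> (w k) *
  (\<theta> k * (1 - \<beta> k + C_G CARD('n) Cst \<mu> \<tau>\<^sub>s \<epsilon> (mesh_size \<tau>) (dual_norm \<Omega> (Vh \<Omega> s r \<tau>) f) * \<beta> k) +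
  C m c\<^sub>s \<sigma> * C_hat_G CARD('n) Cst \<mu> \<tau>\<^sub>s \<epsilon> (mesh_size \<tau>) (dual_norm \<Omega> (Vh \<Omega> s r \<tau>) f) * sqrt (1 - (\<theta> k)\<^sup>2) / 2 *
  (Ynorm \<Omega> (w k) * H k
  + 2 * (\<Sum>n = k - aa_depth m k + 1..k-1. real (k - n) * Ynorm \<Omega> (w n) * H n)
  + real (aa_depth m k) * Ynorm \<Omega> (w (k - aa_depth m k)) * H (k - aa_depth m k))))"
 if c\<^sub>s: "c\<^sub>s > 0" and \<sigma>: "\<sigma> > 0" and \<tau>: "\<tau> \<in> \<T>" and \<mu>: "\<mu> > 0" and \<tau>\<^sub>s: "\<tau>\<^sub>s \<ge> 0" and \<epsilon>: "\<epsilon> > 0" and f: "Hminus1 \<Omega> f"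
  and ex: "\<forall>u\<in>Vh \<Omega> s r \<tau>. \<forall>z\<in>Vh \<Omega> s r \<tau>. \<sigma> * Ynorm \<Omega> (u - z) \<le>
  Ynorm \<Omega> (picard \<Omega> (Vh \<Omega> s r \<tau>) \<mu> \<tau>\<^sub>s \<epsilon> f u - u - (picard \<Omega> (Vh \<Omega> s r \<tau>) \<mu> \<tau>\<^sub>s \<epsilon> f z - z))"
  and run: "anderson (Ynorm \<Omega>) (Vh \<Omega> s r \<tau>) (picard \<Omega> (Vh \<Omega> s r \<tau>) \<mu> \<tau>\<^sub>s \<epsilon> f) m \<beta> x w"
  and damping: "\<forall>k\<ge>1. 0 < \<beta> k \<and> \<beta> k \<le> 1" and gains: "aa_gains (Ynorm \<Omega>) m w \<theta>"
  and sines: "\<forall>k>m. \<forall>j\<in>{k - aa_depth m k..k-1}. \<forall>i\<in>{1..aa_depth m j}.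
  c\<^sub>s \<le> \<bar>direction_sine (Ynorm \<Omega>) (aa_col w j i) (span (aa_col w j ` {1..<i}))\<bar>"
 for m c\<^sub>s \<sigma> \<mu> \<tau>\<^sub>s \<epsilon> \<tau> f \<beta> x w \<theta>
proof -
 define Y where "Y = Vh \<Omega> s r \<tau>"
 define G where "G = picard \<Omega> Y \<mu> \<tau>\<^sub>s \<epsilon> f"
 define h where "h = mesh_size \<tau>"
 define Fd where "Fd = dual_norm \<Omega> Y f"
 define CG where "CG = C_G CARD('n) Cst \<mu> \<tau>\<^sub>s \<epsilon> h Fd"
 define ChG where "ChG = C_hat_G CARD('n) Cst \<mu> \<tau>\<^sub>s \<epsilon> h Fd"
 note defs = Y_def[symmetric] G_def[symmetric] h_def[symmetric] Fd_def[symmetric] CG_def[symmetric] ChG_def[symmetric]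
 note expand = ex[unfolded defs] and run = run[unfolded defs]
 interpret fe_mesh \<Omega> \<tau> by unfold_locales (use dom mesh[OF \<tau>] in auto)
 have h: "h > 0" using mesh_size_pos by (simp add: h_def)
 define S where "S = sobolev_scale CARD('n) h"
 have S: "S > 0" using sobolev_scale_pos[OF h] by (simp add: S_def)
 obtain Bs where Bs: "finite Bs" "Vh \<Omega> s r \<tau> = span Bs" using Vh_finite_dim by blast
 interpret P: picard_space "lebesgue_on \<Omega>" Y "symgrad \<Omega>" "L * S" \<mu> \<tau>\<^sub>s \<epsilon> "sqrt 2 * Fd" f Bs
  unfolding Y_def Fd_def
 proof (rule picard_space_Vh[OF _ _ \<mu> \<tau>\<^sub>s \<epsilon> f Bs])
  show "AE x in lebesgue_on \<Omega>. norm (symgrad \<Omega> v x) \<le> L * S * L2_norm \<Omega> (symgrad \<Omega> v)" if "v \<in> Xh \<Omega> s \<tau>" for v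
  using L(2) \<tau> that by (simp add: S_def h_def)
 qed (use L(1) S in simp)
 have Fd: "Fd \<ge> 0" using P.\<Phi> zero_le_mult_iff[of "sqrt 2" Fd] by auto
 have N: "P.nm = Ynorm \<Omega>" by (simp add: fun_eq_iff P.nm_def P.ip_def Ynorm_def L2_norm_def L2_inner_def)
 have GP: "G = P.G"
  unfolding G_def picard_def is_picard_solution_def P.G_def P.wf_def P.ip_def P.rho_def L2_inner_def by simp
 have CG: "P.CG \<le> CG"
  unfolding P.CG_def unfolding CG_def S_def
  by (rule C_G_dominates[OF h \<mu> \<tau>\<^sub>s \<epsilon>]) (use L(1) in \<open>simp add: Cst_def\<close>)
 have ChG: "P.CH \<le> ChG"
  using C_hat_G_dominates[OF h \<mu> \<tau>\<^sub>s \<epsilon> L(1) Fd Cst_def CG[unfolded CG_def]]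
  unfolding P.CH_def unfolding ChG_def S_def .
 interpret A: anderson_run Y P.ip P.G P.B CG ChG \<sigma> c\<^sub>s m \<beta> \<theta> x w
 proof unfold_locales
  show "P.nm (P.B u v y) \<le> CG * P.nm y" if "u \<in> Y" "v \<in> Y" "y \<in> Y" for u v y
  using P.B_bound[OF that] mult_right_mono[OF CG P.nm_nonneg[OF that(3)]] by linarith
  show "P.nm (P.B u v y - P.B u' v' y) \<le> ChG * (P.nm (u - u') + P.nm (v - v')) * P.nm y"
  if "u \<in> Y" "v \<in> Y" "u' \<in> Y" "v' \<in> Y" "y \<in> Y" for u v u' v' y
  proof -
  have nn: "0 \<le> (P.nm (u - u') + P.nm (v - v')) * P.nm y"
  using P.nm_nonneg that by (intro mult_nonneg_nonneg add_nonneg_nonneg) auto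
  have "P.nm (P.B u v y - P.B u' v' y) \<le> P.CH * ((P.nm (u - u') + P.nm (v - v')) * P.nm y)"
  using P.B_lip[OF that] by (simp add: mult.assoc)
  also have "\<dots> \<le> ChG * ((P.nm (u - u') + P.nm (v - v')) * P.nm y)" by (rule mult_right_mono[OF ChG nn])
  finally show ?thesis by (simp add: mult.assoc)
  qed
  show "CG \<ge> 0" "ChG \<ge> 0" using CG ChG P.CG_nonneg P.CH_nonneg by linarith+
  show "\<sigma> * P.nm (u - v) \<le> P.nm (P.G u - u - (P.G v - v))" if "u \<in> Y" "v \<in> Y" for u v
  using expand that by (simp add: N GP)
  show "anderson P.nm Y P.G m \<beta> x w" using run by (simp add: N GP)
  show "aa_gains P.nm m w \<theta>" using gains by (simp add: N)
  show "c\<^sub>s \<le> direction_sine P.nm (aa_col w j i) (span (aa_col w j ` {1..<i}))"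
  if "k > m" "j \<in> {k - aa_depth m k..k-1}" "i \<in> {1..aa_depth m j}" for k j i
  using sines that direction_sine_nonneg[of \<Omega> "aa_col w j i" "aa_col w j ` {1..<i}"] unfolding N by force
 qed (use P.G P.B P.B_add P.B_scale P.G_diff \<sigma> c\<^sub>s damping in auto)
 have CA: "real (4 * m) * A.C1 / \<sigma> + 1 = C m c\<^sub>s \<sigma>" by (simp add: C_def A.C1_def)
 show ?thesis
  unfolding defs
  by (intro exI[of _ A.H] conjI allI impI) (unfold A.H_def CA, simp, fold A.H_def[unfolded CA], rule A.main[unfolded CA N], simp)
qed
show ?thesis
 unfolding Let_def
 apply (rule exI[of _ Cst])
 apply (intro conjI allI impI Cst)
 subgoal for m c\<^sub>s \<sigma>
  by (rule exI[of _ "C m c\<^sub>s \<sigma>"], intro conjI C ballI allI impI) (assumption | rule main; assumption)+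
 done
qed

end
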